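(* Let $f\in\mathcal C(k)$ with associated Dirichlet series $F(s)=\sum_{n=1}^\infty f(n)n^{-s}$, let $x\ge3$, and let $S_1(x)=\sum_{n\le x}\frac{f(n)}{n}$. Then uniformly for $1+\frac1{\log x}<\sigma\le2$ we have $$S_1(x)\ll_k|F(\sigma)|(\sigma-1)^k(\log x)^{k-1}\left((\sigma-1)^{-4k/\pi}+\log x\right).$$
   Context: Let $k$ be a fixed positive constant. For a multiplicative function $f:\mathbb N\to\mathbb C$ write $$F(s)=\sum_{n=1}^\infty\frac{f(n)}{n^s},\qquad -\frac{F'(s)}{F(s)}=\sum_{n=2}^\infty\frac{\Lambda_f(n)}{n^s},\qquad \log F(s)=\sum_{n=2}^\infty\frac{\Lambda_f(n)}{n^s\log n},$$ and assume that all these Dirichlet series are absolutely convergent for $\Re(s)>1$. The class $\mathcal C(k)$ consists of such multiplicative functions $f$ satisfying $|\Lambda_f(n)|\le k\Lambda(n)$ for all $n\ge2$, where $\Lambda$ is the von Mangoldt function. The notation $\ll_k$ means that the implied constant depends only on $k$. *)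

theory Defs
  imports "HOL-Analysis.Analysis" "HOL-Number_Theory.Prime_Powers"
begin

text \<open>The value at \<open>0\<close> of an arithmetic function is never used: indices start at \<open>1\<close>.\<close>

definition multiplicative :: "(nat \<Rightarrow> complex) \<Rightarrow> bool" where
  "multiplicative f \<longleftrightarrow>
     f 1 = 1 \<and> (\<forall>m\<ge>1. \<forall>n\<ge>1. coprime m n \<longrightarrow> f (m * n) = f m * f n)"

definition dirichlet_series :: "(nat \<Rightarrow> complex) \<Rightarrow> complex \<Rightarrow> complex" where
  "dirichlet_series a s = (\<Sum>\<^sub>\<infinity>n\<in>{1..}. a n / of_nat n powr s)"

definition dirichlet_abs_conv :: "(nat \<Rightarrow> complex) \<Rightarrow> complex \<Rightarrow> bool" where
  "dirichlet_abs_conv a s \<longleftrightarrow> (\<lambda>n. norm (a n / of_nat n powr s)) summable_on {1..}"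

text \<open>
  \<open>is_Lambda_of f L\<close>: for \<open>Re s > 1\<close>, with \<open>F\<close> the Dirichlet series of \<open>f\<close>, the series of \<open>f\<close>,
  of \<open>L\<close> and of \<open>L n / ln n\<close> converge absolutely, and the last two represent \<open>- F' / F\<close> and
  \<open>log F\<close>. By uniqueness of Dirichlet coefficients this determines \<open>L n\<close> for \<open>n \<ge> 2\<close>; these
  are the values written \<open>\<Lambda>\<^sub>f(n)\<close>. Setting \<open>L 1 = 0\<close> makes the sums start at \<open>n = 2\<close>.
  The equation for \<open>log F\<close> is expressed through the exponential, and it entails \<open>F s \<noteq> 0\<close>, so
  that the quotient is a genuine one. Since its series is continuous and has no term at \<open>n = 1\<close>,
  it is the branch of \<open>log F\<close> that tends to \<open>0\<close> as \<open>s\<close> tends to infinity along the reals.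
\<close>

definition is_Lambda_of :: "(nat \<Rightarrow> complex) \<Rightarrow> (nat \<Rightarrow> complex) \<Rightarrow> bool" where
  "is_Lambda_of f L \<longleftrightarrow> L 1 = 0 \<and>
     (\<forall>s. Re s > 1 \<longrightarrow>
        dirichlet_abs_conv f s \<and>
        dirichlet_abs_conv L s \<and>
        dirichlet_abs_conv (\<lambda>n. L n / of_real (ln (real n))) s \<and>
        - deriv (dirichlet_series f) s / dirichlet_series f s = dirichlet_series L s \<and>
        exp (dirichlet_series (\<lambda>n. L n / of_real (ln (real n))) s) = dirichlet_series f s)"

definition class_C :: "real \<Rightarrow> (nat \<Rightarrow> complex) set" where
  "class_C k = {f. multiplicative f \<and>
     (\<exists>L. is_Lambda_of f L \<and> (\<forall>n\<ge>2. norm (L n) \<le> k * mangoldt n))}"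

definition S1 :: "(nat \<Rightarrow> complex) \<Rightarrow> real \<Rightarrow> complex" where
  "S1 f x = (\<Sum>n | 1 \<le> n \<and> real n \<le> x. f n / of_nat n)"

end

theory Submission
  imports Defs "HOL-Complex_Analysis.Complex_Analysis" "HOL-Probability.Probability"
    "HOL-Computational_Algebra.Squarefree" "HOL-Real_Asymp.Real_Asymp"
begin

text \<open>
  Write \<open>T(v) = S\<^sub>1(e\<^sup>v)\<close>. Comparing coefficients in \<open>- F' = F \<cdot> (- F' / F)\<close> gives
  \<open>f \<cdot> log = \<Lambda>\<^sub>f * f\<close>, hence \<open>y |T(y)| \<le> \<Phi>(y) + k (\<Sum>d. \<Lambda>(d) / d |T(y - log d)|)\<close> with
  \<open>\<Phi>(y)\<close> the integral of \<open>|T|\<close> over \<open>[0, y]\<close>. Small \<open>d\<close> are absorbed by induction on \<open>y\<close>; for large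
  \<open>d\<close> the Brun--Titchmarsh inequality, obtained from Selberg's sieve, replaces the sum over primes by
  an integral. This gives Halasz's inequality \<open>y |T(y)| \<lless> 1 + \<Phi>(y)\<close>.

  On \<open>[V, 2 V]\<close> the integral of \<open>|T|\<close> is estimated with \<open>\<alpha> = 1 / V\<close> by Cauchy--Schwarz and Plancherel: the Fourier
  transform of \<open>v T(v) e\<^bsup>-\<alpha>v\<^esup>\<close> is \<open>F(1+s)/s \<cdot> (- F'/F(1+s) + 1/s)\<close> at \<open>s = \<alpha> + it\<close>. The logarithmic derivative
  has small mean square, and the first factor is bounded pointwise: the ratio of \<open>|F(1+s)|\<close> to
  \<open>|F(1+a)|\<close> is controlled by the sum of \<open>k \<Lambda>(n) / (n\<^bsup>1+a\<^esup> log n) |1 - n\<^bsup>-it\<^esup>|\<close>, and expanding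
  \<open>|1 - e\<^bsup>i\<theta>\<^esup>| = 2 |sin(\<theta>/2)|\<close> into its Fourier series, of mean \<open>4 / \<pi>\<close>, reduces this to lower bounds for
  zeta near the line of real part 1. This is where the exponent \<open>4 k / \<pi>\<close> comes from. Summing over dyadic
  \<open>V \<le> log x\<close> finishes the proof.
\<close>

section \<open>Dirichlet series\<close>

text \<open>Two scales compete: \<alpha> = 1/V, dictated by the block [V, 2V], and a = \<sigma> - 1,
  in terms of which the answer is expressed. The twist by n^{-it} is measured at a; moving F from
  1+a to 1+\<alpha> then costs only (a/\<alpha>)^k up to a constant. For V >= 1/a the block bounds
  grow at least like V^k, so the longest block dominates. For V < 1/a the reference point is 1+1/V
  itself, and transferring |F(1+1/V)| to |F(1+a)| leaves a geometric series because 4k/pi > k. The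
  factor v in v T(v) is what brings F'/F into the transform: its mean square over unit windows has
  order 1/\<alpha>, while its square at a real point can have order 1/\<alpha>^2, and this saving
  makes the second moment small enough. The lower bounds for zeta may lose any power of log(2+|t|),
  since it is absorbed into (1+|t|)^{1/4} against the decay of 1/s. The constants are explicit in k
  or are obtained before f is fixed, which makes the uniformity visible.\<close>

definition dirichlet_conv :: "(nat \<Rightarrow> complex) \<Rightarrow> (nat \<Rightarrow> complex) \<Rightarrow> nat \<Rightarrow> complex" where
  "dirichlet_conv a b n = (\<Sum>d | d dvd n. a d * b (n div d))"

lemma norm_dirichlet_term:
  "norm (a n / of_nat n powr s) = norm (a n) / real n powr Re s" for a :: "nat \<Rightarrow> complex"
  using norm_powr_real_powr[of "of_nat n" s] by (simp add: norm_divide)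

lemma dirichlet_abs_conv_iff:
  "dirichlet_abs_conv a s \<longleftrightarrow> summable (\<lambda>n. norm (a n) / real n powr Re s)"
proof -
  \<comment> \<open>The index 0 may be added freely: \<open>0 powr s = 0\<close>, and division by
    zero makes that term vanish.\<close>
  have "dirichlet_abs_conv a s \<longleftrightarrow> (\<lambda>n. norm (a n / of_nat n powr s)) summable_on UNIV"
    unfolding dirichlet_abs_conv_def
    by (rule summable_on_cong_neutral) (auto simp: not_le)
  also have "\<dots> \<longleftrightarrow> summable (\<lambda>n. norm (a n / of_nat n powr s))"
    by (rule summable_on_UNIV_nonneg_real_iff) auto
  finally show ?thesis by (simp only: norm_dirichlet_term)
qed

lemma dirichlet_abs_conv_summable_norm:
  "dirichlet_abs_conv a s \<longleftrightarrow> summable (\<lambda>n. norm (a n / of_nat n powr s))"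
  unfolding dirichlet_abs_conv_iff by (simp only: norm_dirichlet_term)

lemma dirichlet_series_has_sum:
  assumes "dirichlet_abs_conv a s"
  shows "((\<lambda>n. a n / of_nat n powr s) has_sum dirichlet_series a s) {1..}"
  using assms unfolding dirichlet_abs_conv_def dirichlet_series_def
  by (rule has_sum_infsum[OF Infinite_Sum.abs_summable_summable])

lemma dirichlet_series_sums:
  assumes "dirichlet_abs_conv a s"
  shows "(\<lambda>n. a n / of_nat n powr s) sums dirichlet_series a s"
proof -
  have "((\<lambda>n. a n / of_nat n powr s) has_sum dirichlet_series a s) UNIV"
    using dirichlet_series_has_sum[OF assms]
    by (rule has_sum_cong_neutral[THEN iffD1, rotated -1]) (auto simp: not_le)
  thus ?thesis by (rule has_sum_imp_sums)
qed

lemma ln_le_powr: "x \<ge> 1 \<Longrightarrow> e > 0 \<Longrightarrow> ln x \<le> x powr e / e" for x e :: real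
proof -
  assume x: "x \<ge> 1" and e: "e > 0"
  have "e * ln x = ln (x powr e)" using x by (simp add: ln_powr)
  also have "\<dots> \<le> x powr e" using x by (intro ln_bound) auto
  finally show ?thesis using e by (simp add: field_simps)
qed

lemma dirichlet_abs_conv_times_ln:
  assumes "dirichlet_abs_conv a s" "Re s < Re s'"
  shows "dirichlet_abs_conv (\<lambda>n. a n * of_real (ln (real n))) s'"
  unfolding dirichlet_abs_conv_iff
proof (rule summable_comparison_test')
  define e where "e = Re s' - Re s"
  have e: "e > 0" using assms by (simp add: e_def)
  show "summable (\<lambda>n. (1 / e) * (norm (a n) / real n powr Re s))"
    using assms by (intro summable_mult) (simp add: dirichlet_abs_conv_iff)
  fix n :: nat assume n: "n \<ge> 1"
  have "norm (norm (a n * of_real (ln (real n))) / real n powr Re s')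
        = norm (a n) * ln (real n) / (real n powr Re s * real n powr e)"
    using n by (simp add: norm_mult e_def flip: powr_add)
  also have "\<dots> \<le> norm (a n) * (real n powr e / e) / (real n powr Re s * real n powr e)"
    using n e by (intro divide_right_mono mult_left_mono ln_le_powr) auto
  also have "\<dots> = (1 / e) * (norm (a n) / real n powr Re s)"
    using n by (simp add: field_simps)
  finally show "norm (norm (a n * of_real (ln (real n))) / real n powr Re s') \<le> \<dots>" .
qed

lemma dirichlet_abs_conv_times_ln':
  assumes "\<And>s. Re s > 1 \<Longrightarrow> dirichlet_abs_conv a s" "Re s > 1"
  shows "dirichlet_abs_conv (\<lambda>n. a n * of_real (ln (real n))) s"
proof -
  have "Re (of_real ((1 + Re s) / 2)) > 1" "Re (of_real ((1 + Re s) / 2)) < Re s"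
    using assms(2) by auto
  thus ?thesis using assms(1) dirichlet_abs_conv_times_ln by blast
qed

text \<open>Termwise differentiation: near each point the terms are dominated by an absolutely
  convergent series at a real abscissa further left, which makes the convergence locally
  uniform.\<close>

lemma dirichlet_series_has_field_derivative:
  assumes conv: "\<And>s. Re s > 1 \<Longrightarrow> dirichlet_abs_conv a s" and s: "Re s > 1"
  shows "(dirichlet_series a has_field_derivative
           - dirichlet_series (\<lambda>n. a n * of_real (ln (real n))) s) (at s)"
proof -
  define S where "S = {s. Re s > 1}"
  have op: "open S" unfolding S_def by (rule open_halfspace_Re_gt)
  define f where "f n z = a n / of_nat n powr z" for n z
  define f' where "f' n z = - (a n * of_real (ln (real n)) / of_nat n powr z)" for n z
  have der: "(f n has_field_derivative f' n z) (at z)" for n z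
  proof (cases "n = 0")
    case True
    thus ?thesis by (simp add: f_def[abs_def] f'_def)
  next
    case False
    have "((\<lambda>z. a n / of_nat n powr z) has_field_derivative
        (- (a n * (Ln (of_nat n) * of_nat n powr z)) / (of_nat n powr z)\<^sup>2)) (at z)"
      using False by (auto intro!: derivative_eq_intros simp: power2_eq_square)
    moreover have "Ln (of_nat n) = of_real (ln (real n))"
      using False Ln_of_real[of "real n"] by simp
    moreover have "(- (a n * (of_real (ln (real n)) * of_nat n powr z)) / (of_nat n powr z)\<^sup>2) = f' n z"
      using False by (simp add: f'_def power2_eq_square)
    ultimately show ?thesis by (simp add: f_def[abs_def])
  qed
  have "\<exists>g g'. \<forall>x\<in>S. ((\<lambda>n. f n x) sums g x) \<and> ((\<lambda>n. f' n x) sums g' x) \<and>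
          (g has_field_derivative g' x) (at x)"
  proof (rule series_and_derivative_comparison_complex[OF op])
    show "(f n has_field_derivative f' n x) (at x)" for n x by (rule der)
    fix x assume "x \<in> S"
    hence x: "Re x > 1" by (simp add: S_def)
    \<comment> \<open>The midpoint between 1 and \<open>Re x\<close>: the ball of radius
      \<open>Re x - \<sigma>\<close> stays to the right of \<sigma>, so the terms at \<sigma> form
      one majorant for the whole ball.\<close>
    define \<sigma> where "\<sigma> = (1 + Re x) / 2"
    have \<sigma>: "\<sigma> > 1" "\<sigma> < Re x" using x by (auto simp: \<sigma>_def)
    define h where "h n = complex_of_real (norm (a n) / real n powr \<sigma>)" for n
    have "summable (\<lambda>n. norm (a n) / real n powr \<sigma>)"
      using conv[of "of_real \<sigma>"] \<sigma> by (simp add: dirichlet_abs_conv_iff)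
    hence "summable h" unfolding h_def by (simp only: summable_complex_of_real)
    moreover have "range h \<subseteq> \<real>\<^sub>\<ge>\<^sub>0" by (auto simp: h_def)
    moreover have "norm (f n y) \<le> norm (h n)" if "y \<in> ball x (Re x - \<sigma>) \<inter> S" for n y
    proof (cases "n = 0")
      case False
      have "\<bar>Re x - Re y\<bar> < Re x - \<sigma>"
        using that abs_Re_le_cmod[of "x - y"] by (auto simp: dist_norm)
      hence "Re y \<ge> \<sigma>" by linarith
      moreover have "norm (h n) = norm (a n) / real n powr \<sigma>"
        by (simp add: h_def norm_divide)
      ultimately show ?thesis using False unfolding f_def norm_dirichlet_term
        by (simp add: divide_left_mono powr_mono)
    qed (simp add: f_def)
    ultimately show "\<exists>d h. 0 < d \<and> summable h \<and> range h \<subseteq> \<real>\<^sub>\<ge>\<^sub>0 \<and>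
      (\<forall>\<^sub>F n in sequentially. \<forall>y\<in>ball x d \<inter> S. cmod (f n y) \<le> cmod (h n))"
      using \<sigma> by (intro exI[of _ "Re x - \<sigma>"] exI[of _ h]) auto
  qed
  then obtain g g' where g: "\<And>x. x \<in> S \<Longrightarrow> (\<lambda>n. f n x) sums g x"
    "\<And>x. x \<in> S \<Longrightarrow> (\<lambda>n. f' n x) sums g' x"
    "\<And>x. x \<in> S \<Longrightarrow> (g has_field_derivative g' x) (at x)" by blast
  have gD: "g x = dirichlet_series a x" if "x \<in> S" for x
    using g(1)[OF that] dirichlet_series_sums[of a x] conv that sums_unique2
    by (auto simp: f_def S_def)
  have sS: "s \<in> S" using s by (simp add: S_def)
  have "(\<lambda>n. - f' n s) sums dirichlet_series (\<lambda>n. a n * of_real (ln (real n))) s"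
    using dirichlet_series_sums[OF dirichlet_abs_conv_times_ln'[OF conv s]]
    by (simp add: f'_def)
  hence "(\<lambda>n. f' n s) sums - dirichlet_series (\<lambda>n. a n * of_real (ln (real n))) s"
    using sums_minus by fastforce
  hence "g' s = - dirichlet_series (\<lambda>n. a n * of_real (ln (real n))) s"
    using g(2)[OF sS] sums_unique2 by blast
  hence "(g has_field_derivative - dirichlet_series (\<lambda>n. a n * of_real (ln (real n))) s) (at s)"
    using g(3)[OF sS] by simp
  thus ?thesis
    by (rule has_field_derivative_transform_within_open[OF _ op sS]) (simp add: gD)
qed

text \<open>The double series over pairs (d, m) converges absolutely and is regrouped along n = d m;
  the bijection from (d, m) to (d m, d) carries it to pairs of a number and one of its
  divisors.\<close>

lemma dirichlet_series_conv:
  assumes a: "dirichlet_abs_conv a s" and b: "dirichlet_abs_conv b s"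
  shows "dirichlet_abs_conv (dirichlet_conv a b) s"
    and "dirichlet_series (dirichlet_conv a b) s = dirichlet_series a s * dirichlet_series b s"
proof -
  define u where "u n = a n / of_nat n powr s" for n
  define v where "v n = b n / of_nat n powr s" for n
  define A :: "nat set" where "A = {1..}"
  have su: "(\<lambda>n. norm (u n)) summable_on A" and sv: "(\<lambda>n. norm (v n)) summable_on A"
    using a b by (simp_all add: dirichlet_abs_conv_def u_def[abs_def] v_def[abs_def] A_def)
  have hu: "(u has_sum dirichlet_series a s) A" and hv: "(v has_sum dirichlet_series b s) A"
    using dirichlet_series_has_sum[OF a] dirichlet_series_has_sum[OF b]
    by (simp_all add: u_def[abs_def] v_def[abs_def] A_def)
  define P where "P = (\<lambda>(d, m). u d * v m)"
  have sP: "(\<lambda>x. norm (P x)) summable_on A \<times> A"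
    unfolding Infinite_Sum.abs_summable_on_Sigma_iff
  proof (intro conjI ballI)
    show "(\<lambda>y. norm (P (x, y))) summable_on A" if "x \<in> A" for x
      unfolding P_def using summable_on_cmult_right[OF sv, of "norm (u x)"] by (simp add: norm_mult)
    have "(\<lambda>x. norm (u x) * (\<Sum>\<^sub>\<infinity>y\<in>A. norm (v y))) summable_on A"
      by (rule summable_on_cmult_left[OF su])
    hence "(\<lambda>x. \<Sum>\<^sub>\<infinity>y\<in>A. norm (P (x, y))) summable_on A"
      by (simp add: P_def norm_mult infsum_cmult_right')
    thus "(\<lambda>x. norm (\<Sum>\<^sub>\<infinity>y\<in>A. norm (P (x, y)))) summable_on A"
      by (simp add: infsum_nonneg)
  qed
  hence hP: "(P has_sum infsum P (A \<times> A)) (A \<times> A)"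
    by (intro has_sum_infsum) (rule Infinite_Sum.abs_summable_summable)
  have "((\<lambda>x. u x * dirichlet_series b s) has_sum infsum P (A \<times> A)) A"
    by (rule has_sum_SigmaD[OF hP]) (use hv in \<open>auto simp: P_def intro!: has_sum_cmult_right\<close>)
  moreover have "((\<lambda>x. u x * dirichlet_series b s) has_sum dirichlet_series a s * dirichlet_series b s) A"
    using hu by (rule has_sum_cmult_left)
  ultimately have iP: "infsum P (A \<times> A) = dirichlet_series a s * dirichlet_series b s"
    using has_sum_unique by blast
  define Q where "Q = (\<lambda>(n, d). a d * b (n div d) / of_nat n powr s)"
  define B where "B = Sigma A (\<lambda>n. {d. d dvd n})"
  have eq: "Q (d * m, d) = P (d, m)" if "(d, m) \<in> A \<times> A" for d m
    using that powr_times_real_left[of "of_nat d" "of_nat m" s]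
    by (auto simp: Q_def P_def u_def v_def A_def)
  have hQ: "(Q has_sum dirichlet_series a s * dirichlet_series b s) B"
    using hP unfolding iP
    by (subst has_sum_reindex_bij_witness[symmetric, of "A \<times> A" "\<lambda>(n, d). (d, n div d)"
          "\<lambda>(d, m). (d * m, d)" _ _ P "dirichlet_series a s * dirichlet_series b s"])
       (auto simp: eq, auto simp: A_def B_def dvd_def Suc_le_eq)
  have sQ: "(\<lambda>x. norm (Q x)) summable_on B"
    using sP
    by (subst summable_on_reindex_bij_witness[symmetric, of "A \<times> A" "\<lambda>(n, d). (d, n div d)"
          "\<lambda>(d, m). (d * m, d)" _ _ "\<lambda>x. norm (P x)"])
       (auto simp: eq, auto simp: A_def B_def dvd_def Suc_le_eq)
  have fin: "finite {d. d dvd n}" if "n \<in> A" for n :: nat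
    using that by (simp add: A_def)
  have sumQ: "(\<Sum>d | d dvd n. Q (n, d)) = dirichlet_conv a b n / of_nat n powr s" for n
    by (simp add: Q_def dirichlet_conv_def sum_divide_distrib)
  have sQ': "(\<lambda>n. \<Sum>\<^sub>\<infinity>d\<in>{d. d dvd n}. norm (Q (n, d))) summable_on A"
    using sQ unfolding B_def Infinite_Sum.abs_summable_on_Sigma_iff
    by (auto simp: infsum_nonneg)
  show "dirichlet_abs_conv (dirichlet_conv a b) s"
    unfolding dirichlet_abs_conv_def A_def[symmetric]
  proof (rule Infinite_Sum.abs_summable_on_comparison_test'[OF sQ'])
    fix n assume n: "n \<in> A"
    show "norm (dirichlet_conv a b n / of_nat n powr s) \<le> (\<Sum>\<^sub>\<infinity>d\<in>{d. d dvd n}. norm (Q (n, d)))"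
      using fin[OF n] unfolding sumQ[symmetric] by (simp add: norm_sum)
  qed
  moreover have "((\<lambda>n. dirichlet_conv a b n / of_nat n powr s) has_sum
      dirichlet_series a s * dirichlet_series b s) A"
    by (rule has_sum_SigmaD[OF hQ[unfolded B_def]])
       (simp add: sumQ[symmetric] fin has_sum_finite)
  ultimately show "dirichlet_series (dirichlet_conv a b) s = dirichlet_series a s * dirichlet_series b s"
    using dirichlet_series_has_sum has_sum_unique unfolding A_def by blast
qed

text \<open>Uniqueness of coefficients, by induction: once all smaller coefficients vanish, the N-th
  term is minus the tail, and at s = 2 + j the tail is smaller by a factor (N / (N+1))^j. Letting j
  grow kills the coefficient.\<close>

lemma dirichlet_series_eq_0_imp:
  assumes conv: "\<And>s. Re s > 1 \<Longrightarrow> dirichlet_abs_conv a s"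
    and zero: "\<And>s. Re s > 1 \<Longrightarrow> dirichlet_series a s = 0" and "n \<ge> 1"
  shows "a n = 0"
  using \<open>n \<ge> 1\<close>
proof (induction n rule: less_induct)
  case (less N)
  have N: "N \<ge> 1" and IH: "\<And>m. m \<ge> 1 \<Longrightarrow> m < N \<Longrightarrow> a m = 0" using less by auto
  define q where "q = real N / real (Suc N)"
  have q: "0 < q" "q < 1" using N by (auto simp: q_def)
  define K where "K = (\<Sum>n. norm (a n) / real n powr 2) * real N powr 2"
  have sm: "summable (\<lambda>n. norm (a n) / real n powr \<sigma>)" if "\<sigma> > 1" for \<sigma>
    using conv[of "of_real \<sigma>"] that by (simp add: dirichlet_abs_conv_iff)
  have bound: "norm (a N) \<le> q ^ j * K" for j
  proof -
    define \<sigma> where "\<sigma> = 2 + real j"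
    define t where "t n = a n / of_nat n powr complex_of_real \<sigma>" for n
    have t: "t sums 0"
      using dirichlet_series_sums[OF conv, of "of_real \<sigma>"] zero[of "of_real \<sigma>"]
      by (simp add: t_def[abs_def] \<sigma>_def)
    define t' where "t' n = (if n = N then 0 else t n)" for n
    have "(\<lambda>n. if n = N then t n else 0) sums t N"
      by (rule sums_single)
    from sums_diff[OF t this] have t': "t' sums (- t N)"
      by (simp add: t'_def[abs_def] if_distrib cong: if_cong)
    have le: "norm (t' n) \<le> q ^ j * real N powr - real j * (norm (a n) / real n powr 2)" for n
    proof (cases "n \<le> N")
      case True
      thus ?thesis using IH[of n] q by (cases "n = 0") (auto simp: t'_def t_def)
    next
      case False
      have "norm (t' n) = norm (a n) / real n powr 2 * (1 / real n) ^ j"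
        using False unfolding t'_def t_def if_not_P[OF False[unfolded not_le, THEN less_imp_neq, THEN not_sym]] norm_dirichlet_term
        by (simp add: \<sigma>_def powr_add powr_realpow field_simps)
      also have "\<dots> \<le> norm (a n) / real n powr 2 * (1 / real (Suc N)) ^ j"
        using False by (intro mult_left_mono power_mono divide_left_mono) auto
      also have "(1 / real (Suc N)) ^ j = q ^ j * real N powr - real j"
        using N by (simp add: q_def powr_minus powr_realpow field_simps)
      finally show ?thesis by (simp add: mult_ac)
    qed
    have "norm (t N) \<le> (\<Sum>n. q ^ j * real N powr - real j * (norm (a n) / real n powr 2))"
      using norm_suminf_le[OF le summable_mult[OF sm[of 2]]] t' by (simp add: sums_iff)
    also have "\<dots> = q ^ j * real N powr - real j * (\<Sum>n. norm (a n) / real n powr 2)"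
      using sm[of 2] by (intro suminf_mult) auto
    finally have "norm (t N) * real N powr \<sigma> \<le>
        q ^ j * real N powr - real j * (\<Sum>n. norm (a n) / real n powr 2) * real N powr \<sigma>"
      by (rule mult_right_mono) auto
    also have "norm (t N) * real N powr \<sigma> = norm (a N)"
      using N by (simp add: t_def norm_dirichlet_term)
    also have "real N powr \<sigma> = real N powr 2 * real N powr real j"
      by (simp add: \<sigma>_def powr_add)
    finally show ?thesis using N by (simp add: K_def powr_minus field_simps)
  qed
  have "(\<lambda>j. q ^ j * K) \<longlonglongrightarrow> 0 * K"
    using q by (intro tendsto_intros LIMSEQ_power_zero) auto
  hence "norm (a N) \<le> 0 * K"
    using bound by (intro LIMSEQ_le_const) auto
  thus ?case by simp
qed

lemma dirichlet_series_diff: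
  assumes "dirichlet_abs_conv a s" "dirichlet_abs_conv b s"
  shows "dirichlet_abs_conv (\<lambda>n. a n - b n) s"
    and "dirichlet_series (\<lambda>n. a n - b n) s = dirichlet_series a s - dirichlet_series b s"
proof -
  have "summable (\<lambda>n. norm (a n / of_nat n powr s - b n / of_nat n powr s))"
    by (rule summable_comparison_test'[OF summable_add[of
          "\<lambda>n. norm (a n / of_nat n powr s)" "\<lambda>n. norm (b n / of_nat n powr s)"]])
       (use assms in \<open>auto simp: dirichlet_abs_conv_summable_norm intro: norm_triangle_ineq4\<close>)
  thus 1: "dirichlet_abs_conv (\<lambda>n. a n - b n) s"
    by (simp add: dirichlet_abs_conv_summable_norm diff_divide_distrib)
  show "dirichlet_series (\<lambda>n. a n - b n) s = dirichlet_series a s - dirichlet_series b s"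
    using dirichlet_series_sums[OF 1]
      sums_diff[OF dirichlet_series_sums[OF assms(1)] dirichlet_series_sums[OF assms(2)]]
    by (auto simp: diff_divide_distrib dest: sums_unique2)
qed

lemma is_Lambda_of_recurrence:
  assumes L: "is_Lambda_of f L" and n: "n \<ge> 1"
  shows "f n * of_real (ln (real n)) = dirichlet_conv L f n"
proof -
  have f: "dirichlet_abs_conv f s" "dirichlet_abs_conv L s" and nz: "dirichlet_series f s \<noteq> 0"
    and d: "- deriv (dirichlet_series f) s / dirichlet_series f s = dirichlet_series L s"
    if "Re s > 1" for s
  proof -
    note * = L[unfolded is_Lambda_of_def, THEN conjunct2, rule_format, OF that]
    show "dirichlet_abs_conv f s" "dirichlet_abs_conv L s"
      "- deriv (dirichlet_series f) s / dirichlet_series f s = dirichlet_series L s"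
      by (intro *[THEN conjunct1] *[THEN conjunct2, THEN conjunct1]
          *[THEN conjunct2, THEN conjunct2, THEN conjunct2, THEN conjunct1])+
    \<comment> \<open>An exponential never vanishes, so the denominator of -F'/F can be cleared
      below.\<close>
    show "dirichlet_series f s \<noteq> 0" 
      by (subst *[THEN conjunct2, THEN conjunct2, THEN conjunct2, THEN conjunct2, symmetric]) simp
  qed
  define g where "g n = f n * of_real (ln (real n)) - dirichlet_conv L f n" for n
  have fl: "dirichlet_abs_conv (\<lambda>n. f n * of_real (ln (real n))) s" if "Re s > 1" for s
    using dirichlet_abs_conv_times_ln'[of f s] f that by blast
  have "dirichlet_abs_conv g s \<and> dirichlet_series g s = 0" if s: "Re s > 1" for s
  proof -
    have "deriv (dirichlet_series f) s = - dirichlet_series (\<lambda>n. f n * of_real (ln (real n))) s"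
      using dirichlet_series_has_field_derivative[of f s] f s by (intro DERIV_imp_deriv) blast
    hence "dirichlet_series (\<lambda>n. f n * of_real (ln (real n))) s = dirichlet_series L s * dirichlet_series f s"
      using d[OF s] nz[OF s] by (simp add: field_simps)
    note eq = this
    note c = dirichlet_series_conv[OF f(2)[OF s] f(1)[OF s]]
    show ?thesis
      unfolding g_def using dirichlet_series_diff(1)[OF fl[OF s] c(1)]
      by (simp only: dirichlet_series_diff(2)[OF fl[OF s] c(1)] c(2) eq) simp
  qed
  hence "dirichlet_abs_conv g s" "dirichlet_series g s = 0" if "Re s > 1" for s
    using that by blast+
  hence "g n = 0" using n by (rule dirichlet_series_eq_0_imp)
  thus ?thesis by (simp add: g_def)
qed

section \<open>Primes in short intervals by Selberg's sieve\<close>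

text \<open>Square-free numbers up to \<open>z\<close> are encoded as sets of primes, so that the Moebius function is
  a sign depending on the cardinality.\<close>

definition sieve_sets :: "nat \<Rightarrow> nat set set" where
  "sieve_sets z = {A. finite A \<and> (\<forall>p\<in>A. prime p) \<and> \<Prod>A \<le> z}"

definition sieve_mass :: "nat \<Rightarrow> real" where
  "sieve_mass z = (\<Sum>A\<in>sieve_sets z. 1 / real (\<Prod>A))"

lemma prod_primes_dvd_iff:
  fixes A :: "nat set"
  assumes "finite A" "\<forall>p\<in>A. prime p"
  shows "\<Prod>A dvd n \<longleftrightarrow> (\<forall>p\<in>A. p dvd n)"
  using assms
proof (induction A rule: finite_induct)
  case (insert p A)
  have "coprime p (\<Prod>A)"
    using insert by (intro prod_coprime_right) (auto intro!: primes_coprime)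
  hence "p * \<Prod>A dvd n \<longleftrightarrow> p dvd n \<and> \<Prod>A dvd n"
    by (meson divides_mult dvd_mult_left dvd_mult_right)
  thus ?case using insert by simp
qed auto

lemma prime_dvd_prod_primes_iff:
  fixes A :: "nat set"
  assumes "finite A" "\<forall>p\<in>A. prime p" "prime q"
  shows "q dvd \<Prod>A \<longleftrightarrow> q \<in> A"
  using assms primes_dvd_imp_eq[of q] dvd_refl[of q] by (simp only: prime_dvd_prod_iff) blast

lemma prod_primes_pos:
  fixes A :: "nat set"
  assumes "\<forall>p\<in>A. prime p"
  shows "\<Prod>A > 0"
  using assms by (auto intro!: prod_pos simp: prime_gt_0_nat)

lemma sieve_sets_mono:
  assumes "A \<in> sieve_sets z" "B \<subseteq> A"
  shows "B \<in> sieve_sets z"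
proof -
  have "\<Prod>B dvd \<Prod>A" using assms by (intro prod_dvd_prod_subset) (auto simp: sieve_sets_def)
  moreover have "\<Prod>A > 0" using assms by (intro prod_primes_pos) (auto simp: sieve_sets_def)
  ultimately have "\<Prod>B \<le> \<Prod>A" by (intro dvd_imp_le)
  thus ?thesis using assms by (auto simp: sieve_sets_def intro: finite_subset)
qed

lemma inj_on_prod_primes: "inj_on (\<lambda>A. \<Prod>A) {A :: nat set. finite A \<and> (\<forall>p\<in>A. prime p)}"
proof (rule inj_onI, goal_cases)
  case (1 A B)
  have "q \<in> A \<longleftrightarrow> q \<in> B" for q
    using 1 prime_dvd_prod_primes_iff[of A q] prime_dvd_prod_primes_iff[of B q] by auto
  thus ?case by blast
qed

lemma sieve_sets_image: "(\<lambda>A. \<Prod>A) ` sieve_sets z \<subseteq> {1..z}"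
proof clarify
  fix A assume "A \<in> sieve_sets z"
  thus "\<Prod>A \<in> {1..z}" using prod_primes_pos[of A] by (auto simp: sieve_sets_def Suc_le_eq simp del: prod_pos_nat_iff)
qed

lemma inj_on_sieve_sets: "inj_on (\<lambda>A. \<Prod>A) (sieve_sets z)"
  by (rule inj_on_subset[OF inj_on_prod_primes]) (auto simp: sieve_sets_def)

lemma finite_sieve_sets [intro]: "finite (sieve_sets z)"
  by (rule inj_on_finite[OF inj_on_sieve_sets sieve_sets_image]) simp

lemma card_sieve_sets: "card (sieve_sets z) \<le> z"
  using card_inj_on_le[OF inj_on_sieve_sets sieve_sets_image] by simp

text \<open>Moebius inversion on the Boolean lattice: expanding the product of (-1) + 1 over
  \<open>B - G\<close> gives the alternating sum, which vanishes unless \<open>B - G\<close> is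
  empty.\<close>

lemma sum_sign_interval:
  fixes B :: "'a set"
  assumes "finite B" "G \<subseteq> B"
  shows "(\<Sum>A | G \<subseteq> A \<and> A \<subseteq> B. (-1) ^ card A :: real) = (if G = B then (-1) ^ card B else 0)"
proof -
  have fG: "finite G" using assms finite_subset by blast
  have "(\<Sum>A | G \<subseteq> A \<and> A \<subseteq> B. (-1) ^ card A :: real) = (\<Sum>A\<in>Pow (B - G). (-1) ^ card (G \<union> A))"
    by (rule sum.reindex_bij_witness[of _ "\<lambda>A. G \<union> A" "\<lambda>A. A - G"])
       (use assms in \<open>auto simp: Un_absorb1\<close>)
  also have "\<dots> = (\<Sum>A\<in>Pow (B - G). (-1) ^ card G * (\<Prod>x\<in>A. (-1)))"
  proof (rule sum.cong[OF refl])
    fix A assume "A \<in> Pow (B - G)"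
    hence "finite A" "G \<inter> A = {}" using assms finite_subset[of A B] by auto
    thus "(-1) ^ card (G \<union> A) = (-1) ^ card G * (\<Prod>x\<in>A. (-1::real))"
      using fG by (simp add: card_Un_disjoint power_add)
  qed
  also have "\<dots> = (-1) ^ card G * (\<Sum>A\<in>Pow (B - G). (\<Prod>x\<in>A. -1) * (\<Prod>x\<in>(B - G) - A. 1))"
    by (simp add: sum_distrib_left)
  also have "(\<Sum>A\<in>Pow (B - G). (\<Prod>x\<in>A. -1) * (\<Prod>x\<in>(B - G) - A. 1)) = (\<Prod>x\<in>B - G. (-1) + 1 :: real)"
    using assms by (intro prod_add[symmetric]) auto
  also have "\<dots> = (if G = B then 1 else 0)"
    using assms by auto
  finally show ?thesis by simp
qed

text \<open>Gauss's identity n = sum of phi(d) over d dividing n, for square-free n; the product of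
  p - 1 is Euler's totient.\<close>

lemma prod_sub_1_expand:
  fixes C :: "nat set"
  assumes "finite C" "\<forall>p\<in>C. prime p"
  shows "real (\<Prod>C) = (\<Sum>G\<in>Pow C. \<Prod>p\<in>G. real p - 1)"
proof -
  have "real (\<Prod>C) = (\<Prod>p\<in>C. (real p - 1) + 1)" by simp
  also have "\<dots> = (\<Sum>G\<in>Pow C. (\<Prod>p\<in>G. real p - 1) * (\<Prod>p\<in>C - G. 1))"
    by (rule prod_add[OF assms(1)])
  finally show ?thesis by simp
qed

text \<open>The indicator of the sifted set is at most the square of a divisor sum w with
  \<open>l {} = 1\<close>. Expanding the square, the main term is Y times a quadratic form in the
  weights, which their choice makes at most \<open>1 / S\<close>; each of the at most z^2 pairs of
  sets adds an error of at most z^2, because \<open>l\<close> is bounded by z.\<close>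

lemma selberg_sieve:
  fixes I :: "nat set" and Y :: real
  assumes fin: "finite I" and z: "z \<ge> 1"
    and equi: "\<And>q. q \<ge> 1 \<Longrightarrow> \<bar>real (card {n\<in>I. q dvd n}) - Y / real q\<bar> \<le> 1"
    and Y: "Y \<ge> 0"
  shows "real (card {n\<in>I. \<forall>p. prime p \<and> p \<le> z \<longrightarrow> \<not> p dvd n}) \<le> Y / sieve_mass z + real z ^ 4"
proof -
  define D where "D = sieve_sets z"
  define S where "S = sieve_mass z"
  define P where "P A = real (\<Prod>A)" for A :: "nat set"
  have finD: "finite D" unfolding D_def by auto
  have D: "finite A" "\<forall>p\<in>A. prime p" "\<Prod>A \<le> z" "P A > 0" if "A \<in> D" for A
    using that prod_primes_pos[of A] unfolding D_def P_def of_nat_0_less_iff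
    by (simp_all add: sieve_sets_def del: prod_pos_nat_iff)
  have Dsub: "B \<in> D" if "A \<in> D" "B \<subseteq> A" for A B
    using that sieve_sets_mono unfolding D_def by blast
  have e: "{} \<in> D" using z by (simp add: D_def sieve_sets_def)
  have S: "S = (\<Sum>A\<in>D. 1 / P A)" by (simp add: S_def sieve_mass_def D_def P_def)
  have Spos: "S > 0" unfolding S
    using D(4) finD e by (intro sum_pos) auto
  txt \<open>The weights \<open>l A\<close> are those for which the linear forms \<open>y G\<close> below, which diagonalise the
    quadratic form of the sieve, become \<open>(-1) ^ card G / (S * P G)\<close>. The optimal choice has
    \<open>\<Prod>p\<in>G. real p - 1\<close> in place of \<open>P G\<close>; the loss is harmless.\<close>
  define r where "r A = (\<Sum>B | B \<in> D \<and> A \<subseteq> B. 1 / P B)" for A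
  define l where "l A = (-1) ^ card A * P A / S * r A" for A
  have l_empty: "l {} = 1"
    using Spos by (simp add: l_def r_def S P_def)
  have r_bounds: "0 \<le> r A" "r A \<le> S" for A
    unfolding r_def S using D(4) finD less_imp_le[OF D(4)] by (auto intro!: sum_nonneg sum_mono2)
  have l_bound: "\<bar>l A\<bar> \<le> real z" if "A \<in> D" for A
  proof -
    have "\<bar>l A\<bar> = P A * (r A / S)"
      using D(4)[OF that] Spos r_bounds(1)[of A] by (simp add: l_def abs_mult power_abs)
    also have "\<dots> \<le> real z * 1"
      using D(3)[OF that] D(4)[OF that] Spos r_bounds[of A]
      by (intro mult_mono) (auto simp: P_def of_nat_le_iff simp del: of_nat_prod)
    finally show ?thesis by simp
  qed
  define y where "y G = (\<Sum>A | A \<in> D \<and> G \<subseteq> A. l A / P A)" for G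
  \<comment> \<open>Summing first over the sets A between G and B leaves a complete alternating sum,
    which by Moebius inversion survives only for B = G.\<close>
  have y: "y G = (-1) ^ card G / (S * P G)" if G: "G \<in> D" for G
  proof -
    have "y G = (\<Sum>A | A \<in> D \<and> G \<subseteq> A. \<Sum>B | B \<in> D \<and> A \<subseteq> B. (-1) ^ card A / (S * P B))"
      unfolding y_def
    proof (rule sum.cong[OF refl])
      fix A assume "A \<in> {A. A \<in> D \<and> G \<subseteq> A}"
      hence "P A > 0" using D(4) by auto
      hence "l A / P A = (-1) ^ card A / S * r A" by (simp add: l_def)
      thus "l A / P A = (\<Sum>B | B \<in> D \<and> A \<subseteq> B. (-1) ^ card A / (S * P B))"
        by (simp add: r_def sum_distrib_left)
    qed
    also have "\<dots> = (\<Sum>B | B \<in> D. \<Sum>A | A \<in> {A. A \<in> D \<and> G \<subseteq> A} \<and> A \<subseteq> B. (-1) ^ card A / (S * P B))"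
      using finD by (subst sum.swap_restrict) auto
    also have "\<dots> = (\<Sum>B\<in>D. if B = G then (-1) ^ card G / (S * P G) else 0)"
    proof (rule sum.cong, simp)
      fix B assume B: "B \<in> D"
      have "(\<Sum>A | A \<in> {A. A \<in> D \<and> G \<subseteq> A} \<and> A \<subseteq> B. (-1) ^ card A / (S * P B))
          = (\<Sum>A | G \<subseteq> A \<and> A \<subseteq> B. (-1) ^ card A) / (S * P B)"
        unfolding sum_divide_distrib using Dsub[OF B] by (intro sum.cong) auto
      also have "\<dots> = (if B = G then (-1) ^ card G / (S * P G) else 0)"
      proof (cases "G \<subseteq> B")
        case True
        thus ?thesis using sum_sign_interval[OF D(1)[OF B] True] by auto
      next
        case False
        hence "{A. G \<subseteq> A \<and> A \<subseteq> B} = {}" and "B \<noteq> G" by blast+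
        thus ?thesis by (simp only: sum.empty if_False; simp)
      qed
      finally show "(\<Sum>A | A \<in> {A. A \<in> D \<and> G \<subseteq> A} \<and> A \<subseteq> B. (-1) ^ card A / (S * P B)) = \<dots>" .
    qed
    also have "\<dots> = (-1) ^ card G / (S * P G)" using finD G by simp
    finally show ?thesis .
  qed
  \<comment> \<open>\<open>P (A \<union> B)\<close> is a least common multiple. Passing to the
    greatest common divisor \<open>P (A \<inter> B)\<close> and expanding it by Gauss's identity
    turns the form into a sum of squares of the \<open>y G\<close> with nonnegative weights.\<close>
  have main: "(\<Sum>A\<in>D. \<Sum>B\<in>D. l A * l B / P (A \<union> B)) \<le> 1 / S"
  proof -
    have "(\<Sum>A\<in>D. \<Sum>B\<in>D. l A * l B / P (A \<union> B))
        = (\<Sum>A\<in>D. \<Sum>B\<in>D. \<Sum>G | G \<in> D \<and> G \<subseteq> A \<and> G \<subseteq> B. (\<Prod>p\<in>G. real p - 1) * (l A / P A) * (l B / P B))"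
    proof (intro sum.cong refl)
      fix A B assume A: "A \<in> D" and B: "B \<in> D"
      have "P (A \<union> B) * P (A \<inter> B) = P A * P B"
        unfolding P_def using prod.union_inter[of A B "\<lambda>x. x"] D(1)[OF A] D(1)[OF B]
        by (simp only: of_nat_mult[symmetric])
      moreover have "P (A \<inter> B) > 0" using D(4)[OF Dsub[OF A, of "A \<inter> B"]] by auto
      moreover have "P (A \<union> B) > 0" using D(2)[OF A] D(2)[OF B] prod_primes_pos[of "A \<union> B"]
        unfolding P_def of_nat_0_less_iff by blast
      ultimately have "l A * l B / P (A \<union> B) = P (A \<inter> B) * (l A / P A) * (l B / P B)"
        using D(4)[OF A] D(4)[OF B] by (simp add: field_simps)
      also have "P (A \<inter> B) = (\<Sum>G\<in>Pow (A \<inter> B). \<Prod>p\<in>G. real p - 1)"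
        unfolding P_def using D[OF A] by (intro prod_sub_1_expand) auto
      also have "Pow (A \<inter> B) = {G. G \<in> D \<and> G \<subseteq> A \<and> G \<subseteq> B}" using Dsub[OF A] by auto
      finally show "l A * l B / P (A \<union> B) = (\<Sum>G | G \<in> D \<and> G \<subseteq> A \<and> G \<subseteq> B.
          (\<Prod>p\<in>G. real p - 1) * (l A / P A) * (l B / P B))"
        by (simp only: sum_distrib_right)
    qed
    also have "\<dots> = (\<Sum>A\<in>D. \<Sum>B\<in>D. \<Sum>G\<in>D. if G \<subseteq> A \<and> G \<subseteq> B then
        (\<Prod>p\<in>G. real p - 1) * (l A / P A) * (l B / P B) else 0)"
      by (simp only: sum.inter_filter[OF finD])
    also have "\<dots> = (\<Sum>G\<in>D. \<Sum>A\<in>D. \<Sum>B\<in>D. if G \<subseteq> A \<and> G \<subseteq> B then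
        (\<Prod>p\<in>G. real p - 1) * (l A / P A) * (l B / P B) else 0)"
      by (subst (2) sum.swap, subst sum.swap, rule refl)
    also have "\<dots> = (\<Sum>G\<in>D. (\<Prod>p\<in>G. real p - 1) * (y G)\<^sup>2)"
    proof (intro sum.cong refl)
      fix G assume "G \<in> D"
      have yG: "y G = (\<Sum>A\<in>D. if G \<subseteq> A then l A / P A else 0)"
        unfolding y_def using finD by (simp add: sum.inter_filter)
      show "(\<Sum>A\<in>D. \<Sum>B\<in>D. if G \<subseteq> A \<and> G \<subseteq> B then
          (\<Prod>p\<in>G. real p - 1) * (l A / P A) * (l B / P B) else 0) = (\<Prod>p\<in>G. real p - 1) * (y G)\<^sup>2"
        unfolding yG power2_eq_square sum_product unfolding sum_distrib_left
        by (intro sum.cong refl) auto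
    qed
    also have "\<dots> \<le> (\<Sum>G\<in>D. 1 / (S\<^sup>2 * P G))"
    proof (rule sum_mono)
      fix G assume G: "G \<in> D"
      have "(\<Prod>p\<in>G. real p - 1) \<le> P G"
        unfolding P_def of_nat_prod using D(2)[OF G] prime_ge_1_nat
        by (intro prod_mono) (auto simp: of_nat_le_iff Suc_le_eq prime_gt_0_nat)
      moreover have "(y G)\<^sup>2 = 1 / (S * P G)\<^sup>2"
        unfolding y[OF G] by (simp add: power_divide flip: power_mult)
      ultimately have "(\<Prod>p\<in>G. real p - 1) * (y G)\<^sup>2 \<le> P G * (1 / (S * P G)\<^sup>2)"
        by (intro mult_mono) (use D(4)[OF G] in auto)
      also have "\<dots> = 1 / (S\<^sup>2 * P G)"
        using D(4)[OF G] Spos by (simp add: power2_eq_square field_simps)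
      finally show "(\<Prod>p\<in>G. real p - 1) * (y G)\<^sup>2 \<le> 1 / (S\<^sup>2 * P G)" .
    qed
    also have "\<dots> = (1 / S\<^sup>2) * (\<Sum>G\<in>D. 1 / P G)"
      by (simp add: sum_distrib_left)
    also have "\<dots> = 1 / S" unfolding S[symmetric] using Spos by (simp add: power2_eq_square)
    finally show ?thesis .
  qed
  define w where "w n = (\<Sum>A | A \<in> D \<and> \<Prod>A dvd n. l A)" for n
  have "real (card {n\<in>I. \<forall>p. prime p \<and> p \<le> z \<longrightarrow> \<not> p dvd n}) =
      (\<Sum>n | n \<in> I \<and> (\<forall>p. prime p \<and> p \<le> z \<longrightarrow> \<not> p dvd n). (w n)\<^sup>2)"
  proof -
    \<comment> \<open>A nonempty set in D contains a prime p <= z, as the singleton of p again lies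
      in D; so only the empty set contributes to w at a sifted number.\<close>
    have "w n = 1" if n: "\<forall>p. prime p \<and> p \<le> z \<longrightarrow> \<not> p dvd n" for n
    proof -
      have "A = {}" if "A \<in> D" "\<Prod>A dvd n" for A
      proof (rule ccontr)
        assume "A \<noteq> {}"
        then obtain p where p: "p \<in> A" by auto
        have "p \<le> z"
          using Dsub[OF \<open>A \<in> D\<close>, of "{p}"] D(3)[of "{p}"] p by auto
        moreover have "prime p" "p dvd n"
          using p that D prod_primes_dvd_iff[of A n] by auto
        ultimately show False using n by auto
      qed
      hence "{A. A \<in> D \<and> \<Prod>A dvd n} = {{}}" using e by auto
      thus ?thesis by (simp add: w_def l_empty)
    qed
    thus ?thesis by simp
  qed
  also have "\<dots> \<le> (\<Sum>n\<in>I. (w n)\<^sup>2)"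
    using fin by (intro sum_mono2) auto
  also have "\<dots> = (\<Sum>n\<in>I. \<Sum>A\<in>D. \<Sum>B\<in>D. if \<Prod>(A \<union> B) dvd n then l A * l B else 0)"
  proof (intro sum.cong refl)
    fix n
    have "w n = (\<Sum>A\<in>D. if \<Prod>A dvd n then l A else 0)"
      unfolding w_def using finD by (simp add: sum.inter_filter)
    hence "(w n)\<^sup>2 = (\<Sum>A\<in>D. \<Sum>B\<in>D. (if \<Prod>A dvd n then l A else 0) * (if \<Prod>B dvd n then l B else 0))"
      by (simp add: power2_eq_square sum_product)
    also have "\<dots> = (\<Sum>A\<in>D. \<Sum>B\<in>D. if \<Prod>(A \<union> B) dvd n then l A * l B else 0)"
    proof (intro sum.cong refl)
      fix A B assume AB: "A \<in> D" "B \<in> D"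
      have "\<Prod>(A \<union> B) dvd n \<longleftrightarrow> \<Prod>A dvd n \<and> \<Prod>B dvd n"
        using D[OF AB(1)] D[OF AB(2)] prod_primes_dvd_iff[of "A \<union> B" n]
          prod_primes_dvd_iff[of A n] prod_primes_dvd_iff[of B n] by auto
      thus "(if \<Prod>A dvd n then l A else 0) * (if \<Prod>B dvd n then l B else 0)
          = (if \<Prod>(A \<union> B) dvd n then l A * l B else 0)" by simp
    qed
    finally show "(w n)\<^sup>2 = (\<Sum>A\<in>D. \<Sum>B\<in>D. if \<Prod>(A \<union> B) dvd n then l A * l B else 0)" .
  qed
  also have "\<dots> = (\<Sum>A\<in>D. \<Sum>B\<in>D. \<Sum>n\<in>I. if \<Prod>(A \<union> B) dvd n then l A * l B else 0)"
    by (subst sum.swap, subst (2) sum.swap, rule refl)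
  also have "\<dots> = (\<Sum>A\<in>D. \<Sum>B\<in>D. l A * l B * real (card {n\<in>I. \<Prod>(A \<union> B) dvd n}))"
    using fin by (simp add: sum.inter_filter[symmetric] mult_ac)
  also have "\<dots> \<le> (\<Sum>A\<in>D. \<Sum>B\<in>D. Y * (l A * l B / P (A \<union> B)) + real z * real z)"
  proof (intro sum_mono)
    fix A B assume AB: "A \<in> D" "B \<in> D"
    define c where "c = real (card {n\<in>I. \<Prod>(A \<union> B) dvd n})"
    have "\<Prod>(A \<union> B) > 0" using D[OF AB(1)] D[OF AB(2)] by (intro prod_primes_pos) auto
    hence c: "\<bar>c - Y / P (A \<union> B)\<bar> \<le> 1"
      using equi[of "\<Prod>(A \<union> B)"] unfolding c_def P_def by linarith
    have "l A * l B * c - Y * (l A * l B / P (A \<union> B)) = (l A * l B) * (c - Y / P (A \<union> B))"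
      by (simp add: field_simps)
    also have "\<dots> \<le> \<bar>l A\<bar> * \<bar>l B\<bar> * \<bar>c - Y / P (A \<union> B)\<bar>"
      by (metis abs_ge_self abs_mult)
    also have "\<dots> \<le> real z * real z * 1"
      using l_bound[OF AB(1)] l_bound[OF AB(2)] c by (intro mult_mono) auto
    finally show "l A * l B * c \<le> Y * (l A * l B / P (A \<union> B)) + real z * real z" by simp
  qed
  also have "\<dots> = Y * (\<Sum>A\<in>D. \<Sum>B\<in>D. l A * l B / P (A \<union> B)) + real (card D) * real (card D) * (real z * real z)"
    by (simp add: sum.distrib sum_distrib_left)
  also have "\<dots> \<le> Y * (1 / S) + real z * real z * (real z * real z)"
    using card_sieve_sets[of z]
    by (intro add_mono mult_left_mono[OF main Y] mult_mono) (auto simp: D_def)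
  finally show ?thesis by (simp add: S_def power4_eq_xxxx mult_ac)
qed

lemma prod_prime_factors_squarefree:
  fixes n :: nat
  assumes "squarefree n"
  shows "\<Prod>(prime_factors n) = n"
proof -
  have n: "n > 0" using assms by (auto intro!: Nat.gr0I)
  have "multiplicity p n = 1" if "p \<in> prime_factors n" for p
    using assms that squarefree_factorial_semiring''[of n] n
    by (auto simp: prime_factors_multiplicity le_Suc_eq)
  hence "(\<Prod>p\<in>prime_factors n. p ^ multiplicity p n) = \<Prod>(prime_factors n)"
    by (intro prod.cong) auto
  thus ?thesis using n prime_factorization_nat[of n] by simp
qed

text \<open>Each n <= z is a square-free number times a square, so the harmonic sum is at most the
  sieve mass times the sum of 1/m^2, and the latter is at most 2.\<close>

lemma sieve_mass_ge: "ln (real z + 1) / 2 \<le> sieve_mass z"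
proof -
  define D where "D = sieve_sets z"
  have "ln (real z + 1) \<le> harm z" using ln_le_harm[of z] by simp
  also have "harm z = (\<Sum>n\<in>{1..z}. 1 / real n)" by (simp add: harm_def inverse_eq_divide)
  also have "\<dots> = (\<Sum>(A, m)\<in>(\<lambda>n. (prime_factors (squarefree_part n), square_part n)) ` {1..z}.
      1 / real (\<Prod>A) * (1 / real m ^ 2))"
  proof (subst sum.reindex)
    have eq: "\<Prod>(prime_factors (squarefree_part n)) = squarefree_part n" for n :: nat
      by (rule prod_prime_factors_squarefree) auto
    show "inj_on (\<lambda>n. (prime_factors (squarefree_part n), square_part n)) {1..z}"
      by (rule inj_onI) (metis Pair_inject eq squarefree_decompose)
    show "(\<Sum>n\<in>{1..z}. 1 / real n) = sum ((\<lambda>(A, m). 1 / real (\<Prod>A) * (1 / real m ^ 2)) \<circ>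
        (\<lambda>n. (prime_factors (squarefree_part n), square_part n))) {1..z}"
    proof (intro sum.cong refl)
      fix n assume "n \<in> {1..z}"
      have "real n = real (squarefree_part n) * real (square_part n) ^ 2"
        using squarefree_decompose[of n] by (metis of_nat_mult of_nat_power)
      thus "1 / real n = ((\<lambda>(A, m). 1 / real (\<Prod>A) * (1 / real m ^ 2)) \<circ>
          (\<lambda>n. (prime_factors (squarefree_part n), square_part n))) n"
        by (simp only: o_def case_prod_conv eq) simp
    qed
  qed
  also have "\<dots> \<le> (\<Sum>(A, m)\<in>D \<times> {1..z}. 1 / real (\<Prod>A) * (1 / real m ^ 2))"
  proof (rule sum_mono2)
    show "finite (D \<times> {1..z})" by (auto simp: D_def)
    show "(\<lambda>n. (prime_factors (squarefree_part n), square_part n)) ` {1..z} \<subseteq> D \<times> {1..z}"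
    proof clarify
      fix n :: nat assume n: "n \<in> {1..z}"
      have "squarefree_part n dvd n" "square_part n dvd n"
        using squarefree_decompose[of n] by (metis dvd_triv_left, metis dvd_mult dvd_power_same dvd_refl power2_eq_square dvd_triv_left dvd_mult_left square_part_square_dvd)
      hence "squarefree_part n \<le> n" "square_part n \<le> n" using n by (auto intro!: dvd_imp_le)
      moreover have "\<Prod>(prime_factors (squarefree_part n)) = squarefree_part n"
        by (rule prod_prime_factors_squarefree) auto
      moreover have "square_part n > 0" using n by (auto intro!: Nat.gr0I)
      ultimately show "prime_factors (squarefree_part n) \<in> D \<and> square_part n \<in> {1..z}"
        using n by (auto simp: D_def sieve_sets_def)
    qed
  qed (auto simp del: of_nat_prod)
  also have "\<dots> = sieve_mass z * (\<Sum>m\<in>{1..z}. 1 / real m ^ 2)"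
    by (simp add: sum.cartesian_product[symmetric] sum_product sieve_mass_def D_def)
  also have "\<dots> \<le> sieve_mass z * 2"
  proof (rule mult_left_mono)
    have *: "(\<Sum>m\<in>{1..Suc z}. 1 / real m ^ 2) \<le> 2 - 1 / real (Suc z)" for z
    proof (induction z)
      case (Suc z)
      have "1 / real (Suc (Suc z)) ^ 2 \<le> 1 / real (Suc z) - 1 / real (Suc (Suc z))"
        by (simp add: divide_simps power2_eq_square)
      with Suc show ?case by simp
    qed auto
    have "(\<Sum>m\<in>{1..z}. 1 / real m ^ 2) \<le> (\<Sum>m\<in>{1..Suc z}. 1 / real m ^ 2)"
      by (rule sum_mono2) auto
    also have "\<dots> \<le> 2" using *[of z] by (smt (verit) divide_nonneg_nonneg of_nat_0_le_iff)
    finally show "(\<Sum>m\<in>{1..z}. 1 / real m ^ 2) \<le> 2" .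
    show "0 \<le> sieve_mass z" unfolding sieve_mass_def by (intro sum_nonneg) (simp del: of_nat_prod)
  qed
  finally show ?thesis by simp
qed

section \<open>From the sieve to the von Mangoldt function\<close>

lemma card_nat_interval:
  fixes a b :: real
  assumes "0 \<le> a" "a \<le> b"
  shows "\<bar>real (card {m::nat. a < real m \<and> real m \<le> b}) - (b - a)\<bar> \<le> 1"
proof -
  have "{m::nat. a < real m \<and> real m \<le> b} = {nat \<lfloor>a\<rfloor><..nat \<lfloor>b\<rfloor>}"
    using assms by (auto simp: nat_less_iff le_nat_iff le_floor_iff floor_less_iff)
  hence "card {m::nat. a < real m \<and> real m \<le> b} = nat \<lfloor>b\<rfloor> - nat \<lfloor>a\<rfloor>" by simp
  moreover have "\<lfloor>a\<rfloor> \<le> \<lfloor>b\<rfloor>" "0 \<le> \<lfloor>a\<rfloor>" "0 \<le> \<lfloor>b\<rfloor>" using assms by (auto intro: floor_mono)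
  ultimately have "real (card {m::nat. a < real m \<and> real m \<le> b}) = of_int \<lfloor>b\<rfloor> - of_int \<lfloor>a\<rfloor>"
    by (simp add: of_nat_diff nat_mono)
  thus ?thesis by linarith
qed

lemma card_multiples_interval:
  fixes X X' :: real
  assumes "0 \<le> X" "X \<le> X'" "q \<ge> 1"
  shows "\<bar>real (card {n\<in>{n::nat. X < real n \<and> real n \<le> X'}. q dvd n}) - (X' - X) / real q\<bar> \<le> 1"
proof -
  have "{n\<in>{n::nat. X < real n \<and> real n \<le> X'}. q dvd n} =
      (\<lambda>m. q * m) ` {m. X / real q < real m \<and> real m \<le> X' / real q}"
    using assms by (auto simp: field_simps dvd_def)
  moreover have "inj_on (\<lambda>m. q * m) {m. X / real q < real m \<and> real m \<le> X' / real q}"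
    using assms by (auto simp: inj_on_def)
  ultimately have "card {n\<in>{n::nat. X < real n \<and> real n \<le> X'}. q dvd n} =
      card {m::nat. X / real q < real m \<and> real m \<le> X' / real q}"
    by (simp add: card_image)
  thus ?thesis
    using card_nat_interval[of "X / real q" "X' / real q"] assms
    by (simp add: divide_right_mono diff_divide_distrib)
qed

lemma finite_nat_real_le [simp, intro]: "finite {n::nat. P n \<and> real n \<le> x}"
  by (rule finite_subset[of _ "{..nat \<lfloor>x\<rfloor>}"]) (auto simp: le_nat_iff le_floor_iff)

text \<open>Numbers with a prime factor up to z escape the sieve, but the von Mangoldt function sees
  only prime powers among them, and such a power is determined by its base, at most z, and its
  exponent.\<close>

lemma sum_mangoldt_small_prime_le:
  fixes M :: real
  assumes M: "M \<ge> 1" and I: "\<And>d. d \<in> I \<Longrightarrow> d \<ge> 1 \<and> real d \<le> M"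
  shows "(\<Sum>d | d \<in> I \<and> (\<exists>p. prime p \<and> p \<le> z \<and> p dvd d). mangoldt d :: real) \<le> real z * (1 + 2 * ln M) * ln M"
proof -
  define N where "N = {d. (d \<in> I \<and> (\<exists>p. prime p \<and> p \<le> z \<and> p dvd d)) \<and> primepow d}"
  \<comment> \<open>Exponents are at most ln M / ln 2, and ln 2 > 1/2.\<close>
  define K where "K = nat \<lfloor>2 * ln M\<rfloor>"
  have finI: "finite I"
    by (rule finite_subset[of _ "{n. 1 \<le> n \<and> real n \<le> M}"]) (use I in auto)
  have "(\<Sum>d | d \<in> I \<and> (\<exists>p. prime p \<and> p \<le> z \<and> p dvd d). mangoldt d :: real) = (\<Sum>d\<in>N. mangoldt d)"
    using finI by (intro sum.mono_neutral_right) (auto simp: N_def mangoldt_def)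
  also have "\<dots> \<le> (\<Sum>d\<in>N. ln M)"
  proof (rule sum_mono)
    fix d assume "d \<in> N"
    hence d: "d \<ge> 1" "real d \<le> M" using I by (auto simp: N_def)
    hence "(mangoldt d :: real) \<le> ln d" by (intro mangoldt_le) auto
    also have "\<dots> \<le> ln M" using d by simp
    finally show "mangoldt d \<le> ln M" .
  qed
  also have "\<dots> = real (card N) * ln M" by simp
  also have "card N \<le> card ({1..z} \<times> {0..K})"
  proof (rule card_inj_on_le[where f = "\<lambda>d. (aprimedivisor d, multiplicity (aprimedivisor d) d)"])
    show "inj_on (\<lambda>d. (aprimedivisor d, multiplicity (aprimedivisor d) d)) N"
      by (rule inj_onI) (metis (mono_tags, lifting) N_def Pair_inject mem_Collect_eq primepow_decompose)
    show "(\<lambda>d. (aprimedivisor d, multiplicity (aprimedivisor d) d)) ` N \<subseteq> {1..z} \<times> {0..K}"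
    proof clarify
      fix d assume d: "d \<in> N"
      define p where "p = aprimedivisor d"
      have pp: "primepow d" and d1: "d \<ge> 1" "real d \<le> M" using d I by (auto simp: N_def)
      have dec: "p ^ multiplicity p d = d" unfolding p_def by (rule primepow_decompose[OF pp])
      have p: "prime p" unfolding p_def using pp
primepow_gt_Suc_0[OF pp] by (intro prime_aprimedivisor') auto
      obtain r where r: "prime r" "r \<le> z" "r dvd d" using d by (auto simp: N_def)
      have "r dvd p" using r dec prime_dvd_power by metis
      hence "p \<le> z" using r p primes_dvd_imp_eq by metis
      moreover have "multiplicity p d \<le> K"
      proof -
        have "real (multiplicity p d) * ln 2 \<le> real (multiplicity p d) * ln (real p)"
          using prime_ge_2_nat[OF p] by (intro mult_left_mono) auto
        also have "\<dots> = ln (real d)"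
          using prime_gt_0_nat[OF p] by (subst (2) dec[symmetric]) (simp add: ln_realpow)
        also have "\<dots> \<le> ln M" using d1 by simp
        finally have "real (multiplicity p d) * ln 2 \<le> ln M" .
        moreover have "real (multiplicity p d) * (1/2) \<le> real (multiplicity p d) * ln 2"
          using ln2_ge_two_thirds by (intro mult_left_mono) auto
        ultimately have "real (multiplicity p d) \<le> 2 * ln M" by simp
        thus ?thesis unfolding K_def by (simp add: le_nat_iff le_floor_iff)
      qed
      ultimately show "aprimedivisor d \<in> {1..z} \<and> multiplicity (aprimedivisor d) d \<in> {0..K}"
        using prime_gt_0_nat[OF p] by (auto simp: p_def[symmetric] Suc_le_eq)
    qed
  qed simp
  also have "real (card ({1..z} \<times> {0..K})) = real z * (1 + real K)" by (simp add: card_cartesian_product algebra_simps)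
  also have "\<dots> \<le> real z * (1 + 2 * ln M)"
    unfolding K_def using M by (intro mult_left_mono) auto
  finally show ?thesis using M by (simp add: mult_right_mono)
qed

text \<open>Sifting by the primes up to u = X^{1/16} loses only a constant factor against the full
  logarithm, and keeps every error below a constant times u^8 = X^{1/2}, which the lower bound on
  \<delta> makes at most X \<delta>.\<close>

theorem brun_titchmarsh_mangoldt:
  fixes X \<delta> :: real
  assumes X: "X \<ge> 1" and \<delta>: "X powr (-1/2) \<le> \<delta>" "\<delta> \<le> 1"
  shows "(\<Sum>d | X < real d \<and> real d \<le> X * exp \<delta>. mangoldt d / real d) \<le> 2636 * \<delta>"
proof -
  define I where "I = {d::nat. X < real d \<and> real d \<le> X * exp \<delta>}"
  define Y where "Y = X * exp \<delta> - X"
  define u where "u = X powr (1/16)"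
  define z where "z = nat \<lfloor>u\<rfloor>"
  define l where "l = 1 + ln X"
  have \<delta>0: "\<delta> > 0" using \<delta>(1) X by (smt (verit) powr_gt_zero)
  have u: "u \<ge> 1" using X by (simp add: u_def ge_one_powr_ge_zero)
  have z: "z \<ge> 1" "real z \<le> u" "u \<le> real z + 1" using u by (auto simp: z_def le_nat_iff le_floor_iff)
  have l1: "l \<ge> 1" using X by (simp add: l_def)
  \<comment> \<open>A logarithm is traded for one more factor u, paid from the room between the
    error terms and u^8.\<close>
  have lu: "l \<le> 17 * u"
  proof -
    have "ln X = 16 * ln u" using X by (simp add: u_def ln_powr)
    also have "ln u \<le> u - 1" using u by (intro ln_le_minus_one) auto
    finally show ?thesis using u by (simp add: l_def)
  qed
  have e3: "exp \<delta> \<le> 3" using \<delta>(2) exp_le by (smt (verit) exp_le_cancel_iff)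
  have ln3: "ln (3 * X) \<le> 2 * l" 
  proof -
    have "ln (3::real) \<le> 3 - 1" by (rule ln_le_minus_one) simp
    hence "ln 3 \<le> (2::real)" by simp
    moreover have "0 \<le> ln X" using X by simp
    moreover have "ln (3 * X) = ln 3 + ln X" using X by (simp add: ln_mult)
    ultimately show ?thesis unfolding l_def by argo
  qed
  have ln3': "ln (3 * X) \<ge> 0" using X by simp
  have mem: "d \<ge> 1" "real d \<le> 3 * X" if "d \<in> I" for d
  proof -
    have "X * exp \<delta> \<le> X * 3" using e3 X by (intro mult_left_mono) auto
    thus "real d \<le> 3 * X" using that by (auto simp: I_def)
    show "d \<ge> 1" using that X by (auto simp: I_def)
  qed
  have finI: "finite I" unfolding I_def by auto
  have Y: "0 \<le> Y" "Y \<le> 2 * X * \<delta>"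
  proof -
    have "exp \<delta> \<le> 1 + \<delta> + \<delta>\<^sup>2" using \<delta>0 \<delta>(2) exp_bound[of \<delta>] by auto
    also have "\<delta>\<^sup>2 \<le> \<delta>" using \<delta>0 \<delta>(2) by (simp add: power2_eq_square mult_left_le_one_le)
    finally have "X * (exp \<delta> - 1) \<le> X * (2 * \<delta>)" using X by (intro mult_left_mono) auto
    thus "Y \<le> 2 * X * \<delta>" by (simp add: Y_def algebra_simps)
    show "0 \<le> Y" using X \<delta>0 by (simp add: Y_def)
  qed
  define A where "A = {n\<in>I. \<forall>p. prime p \<and> p \<le> z \<longrightarrow> \<not> p dvd n}"
  have cardA: "real (card A) \<le> 64 * Y / l + u ^ 4"
  proof -
    have "real (card A) \<le> Y / sieve_mass z + real z ^ 4"
      unfolding A_def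
    proof (rule selberg_sieve[OF finI z(1) _ Y(1)])
      show "\<bar>real (card {n \<in> I. q dvd n}) - Y / real q\<bar> \<le> 1" if "q \<ge> 1" for q
        unfolding I_def Y_def using X \<delta>0 that by (intro card_multiples_interval) auto
    qed
    \<comment> \<open>The mass is at least ln X / 32 and at least 1/3; together these cover l / 64 =
      (1 + ln X) / 64 also when X is close to 1.\<close>
    also have "Y / sieve_mass z \<le> Y / (l / 64)"
    proof (rule divide_left_mono)
      have "ln X / 16 = ln u" using X by (simp add: u_def ln_powr)
      also have "\<dots> \<le> ln (real z + 1)" using u z by simp
      finally have "ln X / 32 \<le> sieve_mass z" using sieve_mass_ge[of z] by simp
      moreover have "1/3 \<le> sieve_mass z"
      proof -
        have "2/3 \<le> ln (2::real)" by (rule ln2_ge_two_thirds)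
        also have "\<dots> \<le> ln (real z + 1)" using z by simp
        finally show ?thesis using sieve_mass_ge[of z] by simp
      qed
      ultimately show "l / 64 \<le> sieve_mass z" unfolding l_def by argo
      thus "0 < sieve_mass z * (l / 64)" using l1 by (smt (verit) divide_pos_pos mult_pos_pos)
    qed (use Y in auto)
    also have "real z ^ 4 \<le> u ^ 4" using z by (intro power_mono) auto
    finally show ?thesis by (simp add: mult_ac)
  qed
  have "(\<Sum>d\<in>I. mangoldt d :: real) =
      (\<Sum>d\<in>A. mangoldt d) + (\<Sum>d | d \<in> I \<and> (\<exists>p. prime p \<and> p \<le> z \<and> p dvd d). mangoldt d)"
    unfolding A_def using finI by (subst sum.union_disjoint[symmetric]) (auto intro!: sum.cong)
  also have "(\<Sum>d\<in>A. mangoldt d) \<le> (\<Sum>d\<in>A. 2 * l)"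
  proof (rule sum_mono)
    fix d assume "d \<in> A"
    hence d: "d \<ge> 1" "real d \<le> 3 * X" using mem by (auto simp: A_def)
    hence "(mangoldt d :: real) \<le> ln d" by (intro mangoldt_le) auto
    also have "\<dots> \<le> ln (3 * X)" using d by simp
    finally show "mangoldt d \<le> 2 * l" using ln3 by simp
  qed
  also have "\<dots> = real (card A) * (2 * l)" by simp
  also have "\<dots> \<le> (64 * Y / l + u ^ 4) * (2 * l)"
    using cardA l1 by (intro mult_right_mono) auto
  also have "\<dots> = 128 * Y + 2 * l * u ^ 4" using l1 by (simp add: field_simps)
  also have "\<dots> \<le> 128 * (2 * X * \<delta>) + 2 * (17 * u) * u ^ 4"
    using lu l1 Y u by (intro add_mono mult_mono) auto
  also have "(\<Sum>d | d \<in> I \<and> (\<exists>p. prime p \<and> p \<le> z \<and> p dvd d). mangoldt d :: real)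
      \<le> real z * (1 + 2 * ln (3 * X)) * ln (3 * X)"
    using X mem by (intro sum_mangoldt_small_prime_le) auto
  also have "\<dots> \<le> u * (1 + 2 * (2 * (17 * u))) * (2 * (17 * u))"
    using z u lu ln3 ln3' l1 by (intro mult_mono add_mono) auto
  also have "128 * (2 * X * \<delta>) + 2 * (17 * u) * u ^ 4 + u * (1 + 2 * (2 * (17 * u))) * (2 * (17 * u))
      = 256 * X * \<delta> + 34 * u ^ 5 + 34 * u ^ 2 + 2312 * u ^ 3"
    by (simp add: algebra_simps power_numeral_reduce)
  \<comment> \<open>The coefficients 256 + 34 + 34 + 2312 add up to the 2636 of the
    statement.\<close>
  also have "\<dots> \<le> 256 * X * \<delta> + 34 * u ^ 8 + 34 * u ^ 8 + 2312 * u ^ 8"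
    using u X \<delta>0 by (intro add_mono mult_left_mono power_increasing) auto
  also have "u ^ 8 \<le> X * \<delta>"
  proof -
    have "u ^ 8 = X powr (1/2)" using X by (simp add: u_def powr_powr flip: powr_realpow)
    also have "\<dots> = X * X powr (-1/2)" using X by (simp add: powr_mult_base)
    also have "\<dots> \<le> X * \<delta>" using \<delta> X by (intro mult_left_mono) auto
    finally show ?thesis .
  qed
  finally have total: "(\<Sum>d\<in>I. mangoldt d :: real) \<le> X * (2636 * \<delta>)" by simp
  have "(\<Sum>d\<in>I. mangoldt d / real d) \<le> (\<Sum>d\<in>I. mangoldt d / X)"
    using X by (intro sum_mono divide_left_mono mangoldt_nonneg) (auto simp: I_def)
  also have "\<dots> = (\<Sum>d\<in>I. mangoldt d) / X" by (simp add: sum_divide_distrib)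
  also have "\<dots> \<le> 2636 * \<delta>" using total X by (simp add: field_simps)
  finally show ?thesis by (simp add: I_def)
qed

text \<open>The n with a given integer part of ln n carry total weight at most 2637, by the
  preceding theorem with \<delta> = 1. A sum against Lambda(n)/n is thereby compared with a series
  over the integers, in place of partial summation.\<close>

lemma sum_mangoldt_group_le:
  fixes g :: "nat \<Rightarrow> real" and \<gamma> :: "nat \<Rightarrow> real"
  assumes A: "finite A" and \<gamma>: "\<And>j. \<gamma> j \<ge> 0" "summable \<gamma>"
    and g: "\<And>n. n \<in> A \<Longrightarrow> n > 1 \<Longrightarrow> g n \<le> \<gamma> (nat \<lfloor>ln (real n)\<rfloor>)"
  shows "(\<Sum>n\<in>A. mangoldt n / real n * g n) \<le> 2637 * (\<Sum>j. \<gamma> j)"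
proof -
  define J where "J n = nat \<lfloor>ln (real n)\<rfloor>" for n :: nat
  have unit: "(\<Sum>n | n \<in> A \<and> J n = j. mangoldt n / real n) \<le> (2637::real)" for j
  proof -
    define X where "X = exp (real j)"
    have X: "X \<ge> 1" by (simp add: X_def)
    have m: "X \<le> real n \<and> real n \<le> X * exp 1" if "J n = j" "n > 1" for n
    proof -
      have "real j \<le> ln (real n)" "ln (real n) \<le> real j + 1"
        using that by (auto simp: J_def)
      hence "exp (real j) \<le> exp (ln (real n))" "exp (ln (real n)) \<le> exp (real j + 1)"
        by simp_all
      hence "exp (real j) \<le> real n" "real n \<le> exp (real j + 1)"
        using that by simp_all
      thus ?thesis by (simp add: X_def exp_add)
    qed
    \<comment> \<open>The interval of the theorem is open on the left, so the possible point n = X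
      is added separately; it costs the extra 1.\<close>
    have "(\<Sum>n | n \<in> A \<and> J n = j. mangoldt n / real n) \<le>
        (\<Sum>n \<in> {nat \<lfloor>X\<rfloor>} \<union> {n. X < real n \<and> real n \<le> X * exp 1}. mangoldt n / real n :: real)"
    proof -
      have "(\<Sum>n | n \<in> A \<and> J n = j. mangoldt n / real n :: real) = (\<Sum>n | n \<in> A \<and> J n = j \<and> n > 1. mangoldt n / real n)"
        using A by (intro sum.mono_neutral_right) (auto intro!: Suc_lessI Nat.gr0I)
      also have "\<dots> \<le> (\<Sum>n \<in> {nat \<lfloor>X\<rfloor>} \<union> {n. X < real n \<and> real n \<le> X * exp 1}. mangoldt n / real n)"
      proof (rule sum_mono2)
        show "{n. n \<in> A \<and> J n = j \<and> n > 1} \<subseteq> {nat \<lfloor>X\<rfloor>} \<union> {n. X < real n \<and> real n \<le> X * exp 1}"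
        proof
          fix n assume "n \<in> {n. n \<in> A \<and> J n = j \<and> n > 1}"
          hence "X \<le> real n" "real n \<le> X * exp 1" using m by auto
          thus "n \<in> {nat \<lfloor>X\<rfloor>} \<union> {n. X < real n \<and> real n \<le> X * exp 1}"
            by (cases "X = real n") auto
        qed
      qed (auto simp: mangoldt_nonneg)
      finally show ?thesis .
    qed
    also have "\<dots> = (\<Sum>n\<in>{nat \<lfloor>X\<rfloor>}. mangoldt n / real n) + (\<Sum>n | X < real n \<and> real n \<le> X * exp 1. mangoldt n / real n :: real)"
    proof (intro sum.union_disjoint)
      have "real (nat \<lfloor>X\<rfloor>) \<le> X" using X by (intro of_nat_floor) auto
      thus "{nat \<lfloor>X\<rfloor>} \<inter> {n. X < real n \<and> real n \<le> X * exp 1} = {}" by auto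
    qed auto
    also have "(\<Sum>n\<in>{nat \<lfloor>X\<rfloor>}. mangoldt n / real n) \<le> (1::real)"
    proof -
      define n where "n = nat \<lfloor>X\<rfloor>"
      have n: "n > 0" using X by (simp add: n_def)
      have "(mangoldt n :: real) \<le> ln (real n)" by (rule mangoldt_le[OF n])
      also have "\<dots> \<le> real n" using n by (intro ln_bound) auto
      finally show ?thesis using n by (simp add: n_def[symmetric])
    qed
    also have "(\<Sum>n | X < real n \<and> real n \<le> X * exp 1. mangoldt n / real n :: real) \<le> 2636 * 1"
      using X by (intro brun_titchmarsh_mangoldt) (auto simp: powr_minus field_simps ge_one_powr_ge_zero)
    finally show ?thesis by simp
  qed
  have "(\<Sum>n\<in>A. mangoldt n / real n * g n) \<le> (\<Sum>n\<in>A. mangoldt n / real n * \<gamma> (J n))"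
  proof (rule sum_mono)
    fix n assume n: "n \<in> A"
    show "mangoldt n / real n * g n \<le> mangoldt n / real n * \<gamma> (J n)"
    proof (cases "n > 1")
      case True
      thus ?thesis using g[OF n] by (intro mult_left_mono) (auto simp: J_def mangoldt_nonneg)
    qed (auto simp: not_less le_Suc_eq)
  qed
  also have "\<dots> = (\<Sum>j\<in>J ` A. \<Sum>n | n \<in> A \<and> J n = j. mangoldt n / real n * \<gamma> (J n))"
    using A by (intro sum.group[symmetric]) auto
  also have "\<dots> = (\<Sum>j\<in>J ` A. (\<Sum>n | n \<in> A \<and> J n = j. mangoldt n / real n) * \<gamma> j)"
    by (intro sum.cong refl) (simp add: sum_distrib_right)
  also have "\<dots> \<le> (\<Sum>j\<in>J ` A. 2637 * \<gamma> j)"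
    using unit \<gamma> by (intro sum_mono mult_right_mono) auto
  also have "\<dots> = 2637 * (\<Sum>j\<in>J ` A. \<gamma> j)" by (simp add: sum_distrib_left)
  also have "\<dots> \<le> 2637 * (\<Sum>j. \<gamma> j)"
    using A \<gamma> by (intro mult_left_mono sum_le_suminf) auto
  finally show ?thesis .
qed

section \<open>The zeta function near the line of real part 1\<close>

abbreviation zeta :: "complex \<Rightarrow> complex" where "zeta \<equiv> dirichlet_series (\<lambda>_. 1)"

text \<open>The coefficients of log zeta. At n = 1 numerator and denominator are both 0, and so is
  the quotient.\<close>

definition mangoldt_weight :: "nat \<Rightarrow> real" where "mangoldt_weight n = mangoldt n / ln (real n)"

lemma mangoldt_weight_bounds: "0 \<le> mangoldt_weight n" "mangoldt_weight n \<le> 1"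
proof -
  show "0 \<le> mangoldt_weight n"
    by (cases "n = 0") (auto simp: mangoldt_weight_def mangoldt_nonneg)
  have "n > 1 \<Longrightarrow> (mangoldt n :: real) \<le> ln (real n)" by (intro mangoldt_le) auto
  thus "mangoldt_weight n \<le> 1"
    by (cases "n > 1") (auto simp: mangoldt_weight_def not_less le_Suc_eq divide_le_eq)
qed

lemma dirichlet_series_cong:
  assumes "\<And>n. n \<ge> 1 \<Longrightarrow> a n = b n"
  shows "dirichlet_series a s = dirichlet_series b s" "dirichlet_abs_conv a s = dirichlet_abs_conv b s"
  unfolding dirichlet_series_def dirichlet_abs_conv_def
  using assms by (auto intro!: infsum_cong summable_on_cong)

lemma dirichlet_abs_conv_bounded:
  assumes "\<And>n. norm (a n) \<le> 1" "Re s > 1"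
  shows "dirichlet_abs_conv a s"
  unfolding dirichlet_abs_conv_iff
proof (rule summable_comparison_test')
  show "summable (\<lambda>n. real n powr (- Re s))" using assms by (simp add: summable_real_powr_iff)
  show "norm (norm (a n) / real n powr Re s) \<le> real n powr (- Re s)" for n
    using assms(1)[of n] by (simp add: powr_minus divide_right_mono inverse_eq_divide)
qed

lemma dirichlet_abs_conv_zeta: "Re s > 1 \<Longrightarrow> dirichlet_abs_conv (\<lambda>_. 1) s"
  by (rule dirichlet_abs_conv_bounded) auto

lemma dirichlet_abs_conv_mangoldt_weight: "Re s > 1 \<Longrightarrow> dirichlet_abs_conv (\<lambda>n. of_real (mangoldt_weight n)) s"
  using mangoldt_weight_bounds by (intro dirichlet_abs_conv_bounded) auto

lemma dirichlet_abs_conv_mangoldt: "Re s > 1 \<Longrightarrow> dirichlet_abs_conv mangoldt s"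
proof -
  assume s: "Re s > 1"
  have "dirichlet_abs_conv (\<lambda>n. of_real (mangoldt_weight n) * of_real (ln (real n))) s"
    by (intro dirichlet_abs_conv_times_ln' dirichlet_abs_conv_mangoldt_weight s)
  thus ?thesis
    by (subst (asm) dirichlet_series_cong(2)[of _ mangoldt])
       (auto simp: mangoldt_weight_def le_Suc_eq simp flip: of_real_mult of_real_divide)
qed

text \<open>Fixes constants of integration: from one point s = 2 + j to the next, every term but the
  first is damped by a factor of at least 2.\<close>

lemma dirichlet_series_tendsto:
  assumes "\<And>s. Re s > 1 \<Longrightarrow> dirichlet_abs_conv a s"
  shows "(\<lambda>j. dirichlet_series a (of_real (2 + real j))) \<longlonglongrightarrow> a 1"
proof -
  define K where "K = (\<Sum>n. norm (a n) / real n powr 2)"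
  have sm: "summable (\<lambda>n. norm (a n) / real n powr 2)"
    using assms[of "of_real 2"] by (simp add: dirichlet_abs_conv_iff)
  have "norm (dirichlet_series a (of_real (2 + real j)) - a 1) \<le> (1/2) ^ j * K" for j
  proof -
    define s where "s = complex_of_real (2 + real j)"
    define t where "t n = a n / of_nat n powr s" for n
    have t: "t sums dirichlet_series a s"
      using dirichlet_series_sums[OF assms, of s] by (simp add: t_def[abs_def] s_def)
    define t' where "t' n = (if n = 1 then 0 else t n)" for n
    have "(\<lambda>n. if n = 1 then t n else 0) sums t 1" by (rule sums_single)
    from sums_diff[OF t this] have t': "t' sums (dirichlet_series a s - a 1)"
      by (simp add: t'_def[abs_def] t_def if_distrib cong: if_cong)
    have "norm (t' n) \<le> (1/2) ^ j * (norm (a n) / real n powr 2)" for n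
    proof (cases "n \<ge> 2")
      case True
      have "norm (t' n) = norm (a n) / real n powr 2 * (1 / real n) ^ j"
      proof -
        have "norm (t' n) = norm (a n) / real n powr Re s"
          using True norm_dirichlet_term[of a n s] by (auto simp: t'_def t_def)
        thus ?thesis using True by (simp add: s_def powr_add powr_realpow field_simps)
      qed
      also have "\<dots> \<le> norm (a n) / real n powr 2 * (1 / 2) ^ j"
        using True by (intro mult_left_mono power_mono divide_left_mono) auto
      finally show ?thesis by (simp add: mult_ac)
    qed (auto simp: t'_def t_def not_le less_Suc_eq numeral_2_eq_2)
    from norm_suminf_le[OF this summable_mult[OF sm]] show ?thesis
      unfolding K_def suminf_mult[OF sm] using t' by (simp add: sums_iff s_def)
  qed
  moreover have "(\<lambda>j. (1/2) ^ j * K) \<longlonglongrightarrow> 0 * K"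
    by (intro tendsto_intros LIMSEQ_power_zero) auto
  ultimately have "(\<lambda>j. dirichlet_series a (of_real (2 + real j)) - a 1) \<longlonglongrightarrow> 0"
    using Lim_null_comparison[OF always_eventually] by (metis (lifting) mult_zero_left)
  thus ?thesis by (simp add: LIM_zero_iff)
qed

text \<open>The product of zeta and exp(-Z) has derivative zero on the convex half-plane, by Lambda
  * 1 = log, and tends to 1 along the reals. In particular zeta has no zero there.\<close>

lemma exp_dirichlet_mangoldt_weight:
  assumes s: "Re s > 1"
  shows "exp (dirichlet_series (\<lambda>n. of_real (mangoldt_weight n)) s) = zeta s"
proof -
  define S where "S = {s. Re s > 1}"
  define Z where "Z = dirichlet_series (\<lambda>n. of_real (mangoldt_weight n))"
  define h where "h s = zeta s * exp (- Z s)" for s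
  have "(h has_field_derivative 0) (at z within S)" if "z \<in> S" for z
  proof -
    have z: "Re z > 1" using that by (simp add: S_def)
    have 1: "(zeta has_field_derivative - dirichlet_series (\<lambda>n. of_real (ln (real n))) z) (at z)"
      using dirichlet_series_has_field_derivative[of "\<lambda>_. 1" z] z dirichlet_abs_conv_zeta by simp
    have "dirichlet_series (\<lambda>n. of_real (ln (real n))) z = dirichlet_series (dirichlet_conv mangoldt (\<lambda>_. 1)) z"
      by (intro dirichlet_series_cong) (simp add: dirichlet_conv_def mangoldt_sum)
    also have "\<dots> = dirichlet_series mangoldt z * zeta z"
      using z by (intro dirichlet_series_conv dirichlet_abs_conv_mangoldt dirichlet_abs_conv_zeta)
    finally have 2: "dirichlet_series (\<lambda>n. of_real (ln (real n))) z = dirichlet_series mangoldt z * zeta z" .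
    have "(Z has_field_derivative - dirichlet_series (\<lambda>n. of_real (mangoldt_weight n) * of_real (ln (real n))) z) (at z)"
      unfolding Z_def using z by (intro dirichlet_series_has_field_derivative dirichlet_abs_conv_mangoldt_weight)
    also have "dirichlet_series (\<lambda>n. of_real (mangoldt_weight n) * of_real (ln (real n))) z = dirichlet_series mangoldt z"
      by (intro dirichlet_series_cong)
         (auto simp: mangoldt_weight_def le_Suc_eq simp flip: of_real_mult of_real_divide)
    finally have 3: "(Z has_field_derivative - dirichlet_series mangoldt z) (at z)" .
    have "(h has_field_derivative
        (- (dirichlet_series mangoldt z * zeta z)) * exp (- Z z) + zeta z * (exp (- Z z) * dirichlet_series mangoldt z)) (at z)"
      unfolding h_def[abs_def] by (rule derivative_eq_intros 1[unfolded 2] 3 | simp)+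
    thus ?thesis by (simp add: has_field_derivative_at_within)
  qed
  moreover have "convex S" unfolding S_def by (rule convex_halfspace_Re_gt)
  ultimately obtain c where c: "\<And>z. z \<in> S \<Longrightarrow> h z = c"
    using has_field_derivative_zero_constant by metis
  have "(\<lambda>j. zeta (of_real (2 + real j))) \<longlonglongrightarrow> 1"
    using dirichlet_series_tendsto[of "\<lambda>_. 1"] dirichlet_abs_conv_zeta by simp
  moreover have "(\<lambda>j. Z (of_real (2 + real j))) \<longlonglongrightarrow> of_real (mangoldt_weight 1)"
    unfolding Z_def by (intro dirichlet_series_tendsto dirichlet_abs_conv_mangoldt_weight)
  ultimately have "(\<lambda>j. h (of_real (2 + real j))) \<longlonglongrightarrow> 1 * exp (- of_real (mangoldt_weight 1))"
    unfolding h_def by (intro tendsto_intros)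
  moreover have "(\<lambda>j. h (of_real (2 + real j))) \<longlonglongrightarrow> c"
    using c by (simp add: S_def)
  ultimately have "c = 1" using LIMSEQ_unique by (fastforce simp: mangoldt_weight_def)
  hence "zeta s * exp (- Z s) = 1" using c[of s] s by (simp add: h_def S_def)
  thus ?thesis by (simp add: Z_def exp_minus field_simps)
qed

lemma nat_powr_Complex:
  assumes "n \<ge> 1"
  shows "of_nat n powr Complex \<sigma> u = of_real (real n powr \<sigma>) * cis (u * ln (real n))"
proof -
  have "Ln (of_nat n) = of_real (ln (real n))" using assms Ln_of_real[of "real n"] by simp
  hence "of_nat n powr Complex \<sigma> u = exp (Complex \<sigma> u * of_real (ln (real n)))"
    using assms by (simp add: powr_def)
  also have "Complex \<sigma> u * of_real (ln (real n)) = of_real (\<sigma> * ln (real n)) + \<i> * of_real (u * ln (real n))"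
    by (simp add: complex_eq_iff)
  also have "exp \<dots> = of_real (real n powr \<sigma>) * cis (u * ln (real n))"
    using assms by (simp only: exp_add cis_conv_exp exp_of_real) (simp add: powr_def)
  finally show ?thesis .
qed

lemma inverse_nat_powr_Complex:
  assumes "n \<ge> 1"
  shows "1 / of_nat n powr Complex \<sigma> u = of_real (1 / real n powr \<sigma>) * cis (- (u * ln (real n)))"
  unfolding nat_powr_Complex[OF assms]
  by (simp add: cis_inverse[symmetric] field_simps del: cis_inverse)

lemma Re_dirichlet_term:
  "Re (of_real c / of_nat n powr Complex \<sigma> u) = c / real n powr \<sigma> * cos (u * ln (real n))"
proof (cases "n = 0")
  case False
  have "of_real c / of_nat n powr Complex \<sigma> u = of_real c * (1 / of_nat n powr Complex \<sigma> u)" by simp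
  also have "\<dots> = of_real (c / real n powr \<sigma>) * cis (- (u * ln (real n)))"
    using False by (subst inverse_nat_powr_Complex) auto
  finally show ?thesis by simp
qed simp

lemma ln_norm_zeta_sums:
  assumes "\<sigma> > 1"
  shows "(\<lambda>n. mangoldt_weight n / real n powr \<sigma> * cos (u * ln (real n))) sums ln (norm (zeta (Complex \<sigma> u)))"
proof -
  have s: "Re (Complex \<sigma> u) > 1" using assms by simp
  have "ln (norm (zeta (Complex \<sigma> u))) = Re (dirichlet_series (\<lambda>n. of_real (mangoldt_weight n)) (Complex \<sigma> u))"
    by (simp add: exp_dirichlet_mangoldt_weight[OF s, symmetric] norm_exp)
  thus ?thesis
    using sums_Re[OF dirichlet_series_sums[OF dirichlet_abs_conv_mangoldt_weight[OF s]]]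
    by (simp only: Re_dirichlet_term)
qed

lemma zeta_nonzero: "Re s > 1 \<Longrightarrow> zeta s \<noteq> 0"
  using exp_dirichlet_mangoldt_weight[of s] by (metis exp_not_eq_zero)

lemma ln_zeta_sums:
  assumes "\<sigma> > 1"
  shows "(\<lambda>n. mangoldt_weight n / real n powr \<sigma>) sums ln (norm (zeta (of_real \<sigma>)))"
  using ln_norm_zeta_sums[OF assms, of 0] by (simp add: complex_of_real_def)

text \<open>Mertens's inequality: 3 + 4 cos t + cos 2t = 2 (1 + cos t)^2 is nonnegative, and log
  |zeta| is a cosine series with nonnegative coefficients.\<close>

lemma zeta_341:
  assumes "\<sigma> > 1"
  shows "1 \<le> norm (zeta (of_real \<sigma>)) ^ 3 * norm (zeta (Complex \<sigma> u)) ^ 4 * norm (zeta (Complex \<sigma> (2 * u)))"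
proof -
  define x y z where "x = norm (zeta (of_real \<sigma>))" and "y = norm (zeta (Complex \<sigma> u))"
    and "z = norm (zeta (Complex \<sigma> (2 * u)))"
  have pos: "x > 0" "y > 0" "z > 0" using assms zeta_nonzero by (auto simp: x_def y_def z_def)
  have "(\<lambda>n. 3 * (mangoldt_weight n / real n powr \<sigma>) + 4 * (mangoldt_weight n / real n powr \<sigma> * cos (u * ln (real n)))
      + mangoldt_weight n / real n powr \<sigma> * cos (2 * u * ln (real n))) sums (3 * ln x + 4 * ln y + ln z)"
    unfolding x_def y_def z_def
    by (intro sums_add sums_mult ln_zeta_sums ln_norm_zeta_sums assms)
  moreover have "0 \<le> 3 * (mangoldt_weight n / real n powr \<sigma>) + 4 * (mangoldt_weight n / real n powr \<sigma> * cos (u * ln (real n)))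
      + mangoldt_weight n / real n powr \<sigma> * cos (2 * u * ln (real n))" for n
  proof -
    define c where "c = cos (u * ln (real n))"
    have "cos (2 * u * ln (real n)) = 2 * c\<^sup>2 - 1"
      using cos_double_cos[of "u * ln (real n)"] by (simp add: c_def mult_ac)
    hence "3 * (mangoldt_weight n / real n powr \<sigma>) + 4 * (mangoldt_weight n / real n powr \<sigma> * cos (u * ln (real n)))
      + mangoldt_weight n / real n powr \<sigma> * cos (2 * u * ln (real n)) = (mangoldt_weight n / real n powr \<sigma>) * (2 * (c + 1)\<^sup>2)"
      unfolding c_def[symmetric] by (simp only:) (simp add: power2_eq_square algebra_simps add_divide_distrib)
    thus ?thesis using mangoldt_weight_bounds[of n] by simp
  qed
  ultimately have "0 \<le> 3 * ln x + 4 * ln y + ln z" by (rule sums_le[OF _ sums_zero, rotated])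
  also have "\<dots> = ln (x ^ 3 * y ^ 4 * z)" using pos by (simp add: ln_mult ln_realpow)
  finally have "1 \<le> x ^ 3 * y ^ 4 * z" using pos by simp
  thus ?thesis by (simp add: x_def y_def z_def)
qed

section \<open>Approximation of zeta by finite sums\<close>

lemma sum_three_halves_le:
  assumes "N \<ge> 1"
  shows "summable (\<lambda>n. 1 / real (n + N) powr (3/2))"
    and "(\<Sum>n. 1 / real (n + N) powr (3/2)) \<le> 6 / sqrt (real N)"
proof -
  \<comment> \<open>The terms are compared with telescoping differences. The true tail is close to 2
    / sqrt N; the 6 leaves room for the crude comparison y <= 3/2 x of neighbouring roots.\<close>
  define g where "g n = 6 / sqrt (real (n + N))" for n
  have le: "1 / real (n + N) powr (3/2) \<le> g n - g (Suc n)" for n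
  proof -
    define x where "x = sqrt (real (n + N))"
    define y where "y = sqrt (real (n + N) + 1)"
    have x: "x \<ge> 1" and xx: "x\<^sup>2 = real (n + N)" and yy: "y\<^sup>2 = real (n + N) + 1" and y: "y \<ge> 1"
      using assms by (auto simp: x_def y_def)
    have "(3/2 * x)\<^sup>2 = 9/4 * x\<^sup>2" by (simp add: power2_eq_square)
    hence "y\<^sup>2 \<le> (3/2 * x)\<^sup>2" using one_le_power[OF x, of 2] xx yy by argo
    hence y32: "y \<le> 3/2 * x" by (rule power2_le_imp_le) (use x in auto)
    have "(y - x) * (y + x) = y\<^sup>2 - x\<^sup>2" by (simp add: power2_eq_square algebra_simps)
    hence "(y - x) * (y + x) = 1" using xx yy by simp
    hence d: "y - x = 1 / (x + y)" using x y by (simp add: field_simps)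
    have "x * y * (x + y) \<le> x * (3/2 * x) * (x + 3/2 * x)"
      using x y y32 by (intro mult_mono add_mono) auto
    also have "\<dots> \<le> 6 * x ^ 3" using x by (simp add: power3_eq_cube)
    finally have "6 / (6 * x ^ 3) \<le> 6 / (x * y * (x + y))"
      using x y by (intro divide_left_mono) auto
    hence "1 / x ^ 3 \<le> 6 / (x * y * (x + y))" by simp
    also have "\<dots> = 6 / x - 6 / y"
    proof -
      have "6 / x - 6 / y = 6 * (y - x) / (x * y)" using x y by (simp add: field_simps)
      thus ?thesis unfolding d by simp
    qed
    also have "x ^ 3 = real (n + N) powr (3/2)"
    proof -
      have "x = real (n + N) powr (1/2)" by (simp add: x_def powr_half_sqrt)
      thus ?thesis using assms by (simp add: powr_powr flip: powr_realpow)
    qed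
    also have "6 / x - 6 / y = g n - g (Suc n)" by (simp add: g_def x_def y_def add_ac)
    finally show ?thesis .
  qed
  have "filterlim (\<lambda>n. sqrt (real (n + N))) at_top sequentially"
    by (intro filterlim_compose[OF sqrt_at_top] filterlim_compose[OF filterlim_real_sequentially])
       (rule filterlim_add_const_nat_at_top)
  hence "g \<longlonglongrightarrow> 0" unfolding g_def
    by (intro tendsto_divide_0[OF tendsto_const] filterlim_at_top_imp_at_infinity)
  hence sums: "(\<lambda>n. g n - g (Suc n)) sums (g 0 - 0)" by (rule telescope_sums')
  show 1: "summable (\<lambda>n. 1 / real (n + N) powr (3/2))"
    by (rule summable_comparison_test'[OF sums_summable[OF sums], where N = 0]) (use le in auto)
  show "(\<Sum>n. 1 / real (n + N) powr (3/2)) \<le> 6 / sqrt (real N)"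
    using suminf_le[OF le 1 sums_summable[OF sums]] sums_unique[OF sums] by (simp add: g_def)
qed

lemma cpowr_segment:
  assumes n: "n \<ge> 1" and z: "z \<in> closed_segment (of_nat n) (of_nat (Suc n) :: complex)"
  obtains v where "z = of_real v" "real n \<le> v" "v \<le> real n + 1"
proof -
  have "z \<in> closed_segment (of_real (real n)) (of_real (real (Suc n)))" using z by simp
  then obtain v where "z = of_real v" "v \<in> closed_segment (real n) (real (Suc n))"
    unfolding closed_segment_of_real by blast
  thus ?thesis by (intro that) (auto simp: closed_segment_eq_real_ivl)
qed

text \<open>First-order Euler-Maclaurin summation: a term and the integral of \<phi> over the unit
  interval before it differ by at most the supremum of |\<phi>'| there. A primitive \<Psi> takes the
  place of integrals, and general \<phi> allows the application to differences of powers as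
  well.\<close>

lemma sum_minus_primitive_bound:
  fixes \<phi> \<phi>' \<Psi> :: "complex \<Rightarrow> complex" and b :: "nat \<Rightarrow> real"
  assumes N: "N \<ge> 1"
    and \<Psi>: "\<And>v. v \<ge> 1 \<Longrightarrow> (\<Psi> has_field_derivative \<phi> (of_real v)) (at (of_real v))"
    and \<phi>: "\<And>v. v \<ge> 1 \<Longrightarrow> (\<phi> has_field_derivative \<phi>' (of_real v)) (at (of_real v))"
    and b: "\<And>n v. n \<ge> N \<Longrightarrow> real n \<le> v \<Longrightarrow> v \<le> real n + 1 \<Longrightarrow> norm (\<phi>' (of_real v)) \<le> b n"
    and lim: "(\<lambda>n. \<Psi> (of_nat n)) \<longlonglongrightarrow> 0"
    and sm: "summable (\<lambda>n. \<phi> (of_nat (n + N + 1)))" "summable (\<lambda>n. b (n + N))"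
  shows "norm ((\<Sum>n. \<phi> (of_nat (n + N + 1))) + \<Psi> (of_nat N)) \<le> (\<Sum>n. b (n + N))"
proof -
  define e where "e n = \<phi> (of_nat (n + N + 1)) - (\<Psi> (of_nat (n + N + 1)) - \<Psi> (of_nat (n + N)))" for n
  have e: "norm (e n) \<le> b (n + N)" for n
  proof -
    define m where "m = n + N"
    have m: "m \<ge> N" "m \<ge> 1" using N by (auto simp: m_def)
    define S where "S = closed_segment (of_nat m) (of_nat (Suc m) :: complex)"
    have inS: "of_nat m \<in> S" "of_nat (Suc m) \<in> S" by (auto simp: S_def)
    have cS: "convex S" by (simp add: S_def)
    have len: "norm (x - y) \<le> 1" if "x \<in> S" "y \<in> S" for x y
      using that unfolding S_def
      by (elim cpowr_segment[OF m(2)]) (auto simp flip: of_real_diff)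
    have bpos: "0 \<le> b m" using b[of m "real m"] m norm_ge_zero by (meson order.trans le_add_same_cancel1 order_refl zero_le_one)
    have d1: "norm (\<phi> x - \<phi> y) \<le> b m" if "x \<in> S" "y \<in> S" for x y
    proof -
      have "norm (\<phi> x - \<phi> y) \<le> b m * norm (x - y)"
      proof (rule field_differentiable_bound[OF cS _ _ that(1,2)])
        fix z assume "z \<in> S"
        then obtain v where v: "z = of_real v" "real m \<le> v" "v \<le> real m + 1"
          unfolding S_def by (rule cpowr_segment[OF m(2)])
        show "(\<phi> has_field_derivative \<phi>' z) (at z within S)"
          using \<phi>[of v] v m by (auto intro: has_field_derivative_at_within)
        show "norm (\<phi>' z) \<le> b m" using b[OF m(1) v(2,3)] v by simp
      qed
      also have "\<dots> \<le> b m * 1" using len[OF that] bpos by (intro mult_left_mono) auto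
      finally show ?thesis by simp
    qed
    \<comment> \<open>The increment of h is the error \<open>e n\<close>, and its derivative is a
      difference of two values of \<phi>, already estimated by \<open>d1\<close>; the mean value
      inequality thus acts twice.\<close>
    define h where "h z = z * \<phi> (of_nat (Suc m)) - \<Psi> z" for z
    have "norm (h (of_nat (Suc m)) - h (of_nat m)) \<le> b m * norm (of_nat (Suc m) - of_nat m :: complex)"
    proof (rule field_differentiable_bound[OF cS _ _ inS(2,1)])
      fix z assume z: "z \<in> S"
      then obtain v where v: "z = of_real v" "real m \<le> v" "v \<le> real m + 1"
        unfolding S_def by (rule cpowr_segment[OF m(2)])
      have "(h has_field_derivative \<phi> (of_nat (Suc m)) - \<phi> z) (at z)"
        unfolding h_def[abs_def] using \<Psi>[of v] v m by (auto intro!: derivative_eq_intros)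
      thus "(h has_field_derivative \<phi> (of_nat (Suc m)) - \<phi> z) (at z within S)"
        by (rule has_field_derivative_at_within)
      show "norm (\<phi> (of_nat (Suc m)) - \<phi> z) \<le> b m" by (rule d1[OF inS(2) z])
    qed
    also have "h (of_nat (Suc m)) - h (of_nat m) = e n"
      by (simp add: h_def e_def m_def algebra_simps)
    finally show ?thesis by (simp add: m_def)
  qed
  have "(\<lambda>n. \<Psi> (of_nat (n + N))) \<longlonglongrightarrow> 0" by (rule LIMSEQ_ignore_initial_segment[OF lim])
  hence "(\<lambda>n. \<Psi> (of_nat (n + N)) - \<Psi> (of_nat (Suc n + N))) sums (\<Psi> (of_nat (0 + N)) - 0)"
    by (rule telescope_sums')
  from sums_add[OF summable_sums[OF sm(1)] this]
  have "e sums ((\<Sum>n. \<phi> (of_nat (n + N + 1))) + \<Psi> (of_nat N))"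
    by (simp add: e_def[abs_def] algebra_simps)
  thus ?thesis using norm_suminf_le[OF e sm(2)] by (simp add: sums_iff)
qed

lemma norm_of_real_powr: "v > 0 \<Longrightarrow> norm (of_real v powr s) = v powr Re s"
  by (subst norm_powr_real_powr) auto

lemma zeta_split:
  assumes "Re s > 1"
  shows "zeta s = (\<Sum>n=1..N. of_nat n powr (-s)) + (\<Sum>n. of_nat (n + N + 1) powr (-s))"
    and "summable (\<lambda>n. of_nat (n + N + 1) powr (-s) :: complex)"
proof -
  have sums: "(\<lambda>n. of_nat n powr (-s)) sums zeta s"
    using dirichlet_series_sums[OF dirichlet_abs_conv_zeta[OF assms]]
    by (simp add: powr_minus_divide)
  have "(\<lambda>n. of_nat (n + Suc N) powr (-s)) sums (zeta s - (\<Sum>n<Suc N. of_nat n powr (-s)))"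
    by (rule sums_split_initial_segment[OF sums])
  moreover have "(\<Sum>n<Suc N. of_nat n powr (-s)) = (\<Sum>n=1..N. of_nat n powr (-s) :: complex)"
    by (intro sum.mono_neutral_right) (auto simp: not_le)
  ultimately show "zeta s = (\<Sum>n=1..N. of_nat n powr (-s)) + (\<Sum>n. of_nat (n + N + 1) powr (-s))"
    and "summable (\<lambda>n. of_nat (n + N + 1) powr (-s) :: complex)"
    by (simp_all add: sums_iff)
qed

lemma powr_neg_deriv:
  fixes s :: complex
  assumes "v \<ge> 1"
  shows "((\<lambda>z. z powr (-s)) has_field_derivative (-s * of_real v powr (-s-1))) (at (of_real v))"
  using assms by (intro has_field_derivative_powr) (auto simp: complex_nonpos_Reals_iff)

lemma powr_neg_primitive:
  fixes s :: complex
  assumes "v \<ge> 1" "s \<noteq> 1"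
  shows "((\<lambda>z. z powr (1-s) / (1-s)) has_field_derivative (of_real v powr (-s))) (at (of_real v))"
proof -
  have "((\<lambda>z. z powr (1-s)) has_field_derivative ((1-s) * of_real v powr (1-s-1))) (at (of_real v))"
    using assms by (intro has_field_derivative_powr) (auto simp: complex_nonpos_Reals_iff)
  from DERIV_cdivide[OF this, of "1-s"] show ?thesis using assms(2) by simp
qed

lemma powr_primitive_tendsto_0:
  assumes "Re s > 1"
  shows "(\<lambda>n. of_nat n powr (1-s) / (1-s) :: complex) \<longlonglongrightarrow> 0"
proof -
  have "(\<lambda>n. real n powr (1 - Re s)) \<longlonglongrightarrow> 0"
    using assms by (intro tendsto_neg_powr filterlim_real_sequentially) auto
  hence "(\<lambda>n. norm (of_nat n powr (1-s) :: complex)) \<longlonglongrightarrow> 0"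
    by (simp add: norm_powr_real_powr)
  hence "(\<lambda>n. of_nat n powr (1-s) :: complex) \<longlonglongrightarrow> 0" by (rule tendsto_norm_zero_cancel)
  thus ?thesis by (rule tendsto_divide_zero)
qed

lemma powr_minus_2_le:
  assumes "n \<ge> 1" "real n \<le> v" "\<sigma> \<ge> 1"
  shows "v powr (-\<sigma> - 1) \<le> v powr (-2)" "v powr (-2) \<le> 1 / real n powr (3/2)"
    "2 * sqrt v * v powr (-2) \<le> 2 / real n powr (3/2)"
proof -
  show "v powr (-\<sigma> - 1) \<le> v powr (-2)" using assms by (intro powr_mono) auto
  have le: "v powr (-(3/2)) \<le> 1 / real n powr (3/2)"
    using assms by (auto simp: powr_minus_divide intro!: divide_left_mono powr_mono2)
  moreover have "v powr (-2) \<le> v powr (-(3/2))" using assms by (intro powr_mono) auto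
  ultimately show "v powr (-2) \<le> 1 / real n powr (3/2)" by linarith
  have "sqrt v * v powr (-2) = v powr (1/2) * v powr (-2)" using assms by (simp add: powr_half_sqrt)
  also have "\<dots> = v powr (-(3/2))" by (simp flip: powr_add)
  finally show "2 * sqrt v * v powr (-2) \<le> 2 / real n powr (3/2)" using le by simp
qed

text \<open>The summation lemma for z^{-s}. The derivative is bounded by |s| n^{-3/2} and not by its
  true order, because the same exponent then serves the differences below, where a logarithm has to
  be absorbed.\<close>

lemma zeta_approx:
  assumes s: "Re s > 1" and N: "N \<ge> 1"
  shows "norm (zeta s - (\<Sum>n=1..N. of_nat n powr (-s)) + of_nat N powr (1-s) / (1-s))
           \<le> norm s * (6 / sqrt (real N))"
proof -
  have s1: "s \<noteq> 1" using s by auto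
  note sm = sum_three_halves_le[OF N]
  have "norm ((\<Sum>n. of_nat (n + N + 1) powr (-s)) + of_nat N powr (1-s) / (1-s))
      \<le> (\<Sum>n. norm s / real (n + N) powr (3/2))"
  proof (rule sum_minus_primitive_bound[OF N])
    show "summable (\<lambda>n. norm s / real (n + N) powr (3/2))"
      using summable_mult[OF sm(1), of "norm s"] by simp
    fix n v assume nv: "n \<ge> N" "real n \<le> v" "v \<le> real n + 1"
    have "norm (- s * of_real v powr (-s-1)) = norm s * v powr (- Re s - 1)"
      using nv N by (simp add: norm_mult norm_of_real_powr)
    also have "\<dots> \<le> norm s * (1 / real n powr (3/2))"
      using powr_minus_2_le[of n v "Re s"] nv N s by (intro mult_left_mono) auto
    finally show "norm (- s * of_real v powr (-s-1)) \<le> norm s / real n powr (3/2)" by simp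
  qed (rule powr_neg_primitive[OF _ s1] powr_neg_deriv powr_primitive_tendsto_0[OF s] zeta_split(2)[OF s] | assumption)+
  also have "\<dots> = norm s * (\<Sum>n. 1 / real (n + N) powr (3/2))"
    by (subst suminf_mult[OF sm(1), symmetric]) simp
  also have "\<dots> \<le> norm s * (6 / sqrt (real N))" by (intro mult_left_mono sm(2)) auto
  finally show ?thesis using zeta_split(1)[OF s, of N] by simp
qed

lemma norm_powr_diff_le:
  assumes "v \<ge> 1" "\<sigma> \<le> \<sigma>'"
  shows "norm (of_real v powr (- Complex \<sigma> u) - of_real v powr (- Complex \<sigma>' u)) \<le> v powr (-\<sigma>) * ((\<sigma>' - \<sigma>) * ln v)"
proof -
  have "- Complex \<sigma>' u = - Complex \<sigma> u + of_real (-(\<sigma>' - \<sigma>))" by (simp add: complex_eq_iff)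
  hence "of_real v powr (- Complex \<sigma>' u) = of_real v powr (- Complex \<sigma> u) * of_real (v powr (-(\<sigma>' - \<sigma>)))"
    using assms(1) by (simp only: powr_add powr_of_real)
  hence "of_real v powr (- Complex \<sigma> u) - of_real v powr (- Complex \<sigma>' u)
      = of_real v powr (- Complex \<sigma> u) * of_real (1 - v powr (-(\<sigma>' - \<sigma>)))"
    by (simp add: algebra_simps)
  hence "norm (of_real v powr (- Complex \<sigma> u) - of_real v powr (- Complex \<sigma>' u)) = v powr (-\<sigma>) * \<bar>1 - v powr (-(\<sigma>' - \<sigma>))\<bar>"
    using assms(1) by (simp only: norm_mult norm_of_real) (simp add: norm_of_real_powr)
  also have "\<bar>1 - v powr (-(\<sigma>' - \<sigma>))\<bar> \<le> (\<sigma>' - \<sigma>) * ln v"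
  proof -
    have "v powr (-(\<sigma>' - \<sigma>)) \<le> v powr 0" using assms by (intro powr_mono) auto
    moreover have "v powr (-(\<sigma>' - \<sigma>)) = exp (-((\<sigma>' - \<sigma>) * ln v))" using assms(1) by (simp add: powr_def algebra_simps)
    moreover have "1 + -((\<sigma>' - \<sigma>) * ln v) \<le> exp (-((\<sigma>' - \<sigma>) * ln v))" by (rule exp_ge_add_one_self)
    ultimately show ?thesis using assms(1) by (simp only: powr_zero_eq_one split: if_splits)
  qed
  finally show ?thesis by (simp add: mult_left_mono)
qed

text \<open>The same summation for the difference of two powers, so that the error is proportional
  to \<sigma>' - \<sigma>. This takes the place of a bound for the derivative of zeta.\<close>

lemma zeta_diff_approx:
  fixes \<sigma> \<sigma>' u :: real
  defines "s \<equiv> Complex \<sigma> u" and "s' \<equiv> Complex \<sigma>' u"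
  assumes \<sigma>: "1 < \<sigma>" "\<sigma> \<le> \<sigma>'" and N: "N \<ge> 1"
  shows "norm ((zeta s - zeta s') - (\<Sum>n=1..N. of_nat n powr (-s) - of_nat n powr (-s'))
            + (of_nat N powr (1-s) / (1-s) - of_nat N powr (1-s') / (1-s')))
           \<le> (\<sigma>' - \<sigma>) * (1 + 2 * norm s) * (6 / sqrt (real N))"
proof -
  have s: "Re s > 1" "Re s' > 1" using \<sigma> by (auto simp: s_def s'_def)
  hence s1: "s \<noteq> 1" "s' \<noteq> 1" by auto
  note sm = sum_three_halves_le[OF N]
  define c where "c = (\<sigma>' - \<sigma>) * (1 + 2 * norm s)"
  have "norm ((\<Sum>n. of_nat (n + N + 1) powr (-s) - of_nat (n + N + 1) powr (-s'))
        + (of_nat N powr (1-s) / (1-s) - of_nat N powr (1-s') / (1-s')))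
      \<le> (\<Sum>n. c / real (n + N) powr (3/2))"
  proof (rule sum_minus_primitive_bound[OF N])
    show "summable (\<lambda>n. c / real (n + N) powr (3/2))"
      using summable_mult[OF sm(1), of c] by simp
    show "((\<lambda>z. z powr (1-s) / (1-s) - z powr (1-s') / (1-s')) has_field_derivative
        of_real v powr (-s) - of_real v powr (-s')) (at (of_real v))" if "v \<ge> 1" for v
      using that s1 by (intro DERIV_diff powr_neg_primitive)
    show "((\<lambda>z. z powr (-s) - z powr (-s')) has_field_derivative
        (-s * of_real v powr (-s-1)) - (-s' * of_real v powr (-s'-1))) (at (of_real v))" if "v \<ge> 1" for v
      using that by (intro DERIV_diff powr_neg_deriv)
    have "(\<lambda>n. of_nat n powr (1-s) / (1-s) - of_nat n powr (1-s') / (1-s')) \<longlonglongrightarrow> (0::complex) - 0"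
      using s by (intro tendsto_diff powr_primitive_tendsto_0)
    thus "(\<lambda>n. of_nat n powr (1-s) / (1-s) - of_nat n powr (1-s') / (1-s')) \<longlonglongrightarrow> (0::complex)" by simp
    show "summable (\<lambda>n. of_nat (n + N + 1) powr (-s) - of_nat (n + N + 1) powr (-s') :: complex)"
      using s by (intro summable_diff zeta_split(2))
    fix n v assume nv: "n \<ge> N" "real n \<le> v" "v \<le> real n + 1"
    have v: "v \<ge> 1" using nv N by linarith
    \<comment> \<open>Splits the difference into a change of the factor s and a change of the
      power.\<close>
    have eq: "(-s * of_real v powr (-s-1)) - (-s' * of_real v powr (-s'-1))
        = (s' - s) * of_real v powr (-s'-1) - s * (of_real v powr (-s) - of_real v powr (-s')) * of_real v powr (-1)"
      using v by (simp add: powr_diff powr_minus field_simps)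
    have "norm ((-s * of_real v powr (-s-1)) - (-s' * of_real v powr (-s'-1)))
        \<le> norm (s' - s) * v powr (-\<sigma>' - 1) + norm s * norm (of_real v powr (-s) - of_real v powr (-s')) * v powr (-1)"
      unfolding eq using v
      by (intro order.trans[OF norm_triangle_ineq4]) (simp add: norm_mult norm_of_real_powr s'_def)
    also have "norm (s' - s) = \<sigma>' - \<sigma>" using \<sigma> by (simp add: s_def s'_def Complex_eq flip: of_real_diff)
    also have "norm s * norm (of_real v powr (-s) - of_real v powr (-s')) * v powr (-1)
        \<le> norm s * (v powr (-\<sigma>) * ((\<sigma>' - \<sigma>) * ln v)) * v powr (-1)"
      unfolding s_def s'_def using v \<sigma> by (intro mult_right_mono mult_left_mono norm_powr_diff_le) auto
    also have "\<dots> = norm s * (\<sigma>' - \<sigma>) * (ln v * v powr (-\<sigma> - 1))"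
      using v by (simp add: powr_diff powr_minus field_simps)
    also have "\<dots> \<le> norm s * (\<sigma>' - \<sigma>) * ((2 * sqrt v) * v powr (-2))"
    proof (intro mult_left_mono mult_mono)
      have "ln v = 2 * ln (sqrt v)" using v by (simp add: ln_sqrt)
      also have "ln (sqrt v) \<le> sqrt v" using v by (intro ln_bound) auto
      finally show "ln v \<le> 2 * sqrt v" by simp
      show "v powr (-\<sigma> - 1) \<le> v powr (-2)" using v \<sigma> by (intro powr_mono) auto
    qed (use \<sigma> v in auto)
    also have "\<dots> \<le> norm s * (\<sigma>' - \<sigma>) * (2 / real n powr (3/2))"
      using powr_minus_2_le(3)[of n v 1] nv N \<sigma> by (intro mult_left_mono) auto
    also have "(\<sigma>' - \<sigma>) * v powr (-\<sigma>' - 1) \<le> (\<sigma>' - \<sigma>) * (1 / real n powr (3/2))"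
      using powr_minus_2_le[of n v \<sigma>'] nv N \<sigma> by (intro mult_left_mono) auto
    also have "(\<sigma>' - \<sigma>) * (1 / real n powr (3/2)) + norm s * (\<sigma>' - \<sigma>) * (2 / real n powr (3/2)) = c / real n powr (3/2)"
      by (simp add: c_def field_simps flip: add_divide_distrib diff_divide_distrib)
    finally show "norm ((-s * of_real v powr (-s-1)) - (-s' * of_real v powr (-s'-1))) \<le> c / real n powr (3/2)"
      by simp
  qed
  also have "\<dots> = c * (\<Sum>n. 1 / real (n + N) powr (3/2))"
    by (subst suminf_mult[OF sm(1), symmetric]) simp
  also have "\<dots> \<le> c * (6 / sqrt (real N))" using \<sigma> by (intro mult_left_mono sm(2)) (auto simp: c_def)
  finally have *: "norm ((\<Sum>n. of_nat (n + N + 1) powr (-s) - of_nat (n + N + 1) powr (-s'))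
        + (of_nat N powr (1-s) / (1-s) - of_nat N powr (1-s') / (1-s'))) \<le> c * (6 / sqrt (real N))" .
  have "(zeta s - zeta s') - (\<Sum>n=1..N. of_nat n powr (-s) - of_nat n powr (-s')) =
      (\<Sum>n. of_nat (n + N + 1) powr (-s) - of_nat (n + N + 1) powr (-s'))"
    unfolding zeta_split(1)[OF s(1), of N] zeta_split(1)[OF s(2), of N]
    by (subst suminf_diff[symmetric]) (rule zeta_split(2)[OF s(1)] zeta_split(2)[OF s(2)] | simp add: sum_subtractf)+
  thus ?thesis using * unfolding c_def by presburger
qed

lemma harm_le_ln:
  assumes "N \<ge> 1"
  shows "(\<Sum>n=1..N. 1 / real n) \<le> 1 + ln (real N)"
  using assms
proof (induction N rule: dec_induct)
  case (step N)
  have "1 / real (Suc N) = 1 - real N / real (Suc N)" using step by (simp add: field_simps)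
  also have "\<dots> \<le> - ln (real N / real (Suc N))"
    using ln_le_minus_one[of "real N / real (Suc N)"] step by simp
  also have "\<dots> = ln (real (Suc N)) - ln (real N)" using step by (simp add: ln_div)
  finally show ?case using step by simp
qed simp

text \<open>N is about (2 + |u|)^2, which keeps the error |s| / sqrt N bounded while ln N stays of
  the order of ln (2 + |u|).\<close>

lemma cutoff_bounds:
  fixes u :: real
  obtains N :: nat where "N \<ge> 1" "2 + \<bar>u\<bar> \<le> sqrt (real N)" "ln (real N) \<le> 2 * (1 + ln (2 + \<bar>u\<bar>))"
proof
  define U where "U = 2 + \<bar>u\<bar>"
  define N where "N = nat \<lceil>U\<^sup>2\<rceil>"
  have U: "U \<ge> 2" by (simp add: U_def)
  have U2: "U\<^sup>2 \<ge> 4" using power_mono[OF U, of 2] by simp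
  have N: "U\<^sup>2 \<le> real N" "real N \<le> U\<^sup>2 + 1" unfolding N_def using U2 by linarith+
  show "N \<ge> 1" using N U2 by linarith
  show "2 + \<bar>u\<bar> \<le> sqrt (real N)" using N(1) real_le_rsqrt by (simp add: U_def)
  have "real N \<le> 2 * U\<^sup>2" "0 < real N" using N U2 by linarith+
  hence "ln (real N) \<le> ln (2 * U\<^sup>2)" using U by (subst ln_le_cancel_iff) auto
  also have "\<dots> = ln 2 + 2 * ln U" using U by (simp add: ln_mult ln_realpow)
  also have "ln 2 \<le> (1::real)" using ln_2_less_1 by simp
  finally show "ln (real N) \<le> 2 * (1 + ln (2 + \<bar>u\<bar>))" by (simp add: U_def)
qed

lemma norm_nat_powr_neg: "n \<ge> 1 \<Longrightarrow> norm (of_nat n powr (-s) :: complex) = real n powr (- Re s)"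
  using norm_of_real_powr[of "real n" "-s"] by simp

section \<open>Upper and lower bounds for zeta to the right of the line of real part 1\<close>

lemma norm_zeta_upper:
  assumes \<sigma>: "1 < \<sigma>" "\<sigma> \<le> 2"
  shows "norm (zeta (Complex \<sigma> u)) \<le> 9 * (1 + ln (2 + \<bar>u\<bar>)) + 1 / norm (Complex \<sigma> u - 1)"
proof -
  obtain N where N: "N \<ge> 1" "2 + \<bar>u\<bar> \<le> sqrt (real N)" "ln (real N) \<le> 2 * (1 + ln (2 + \<bar>u\<bar>))"
    by (rule cutoff_bounds)
  define s where "s = Complex \<sigma> u"
  have s: "Re s > 1" using \<sigma> by (simp add: s_def)
  have ns: "norm s \<le> 2 + \<bar>u\<bar>" using cmod_le[of s] \<sigma> by (simp add: s_def)
  have "norm s * (6 / sqrt (real N)) \<le> sqrt (real N) * (6 / sqrt (real N))"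
    using ns N by (intro mult_right_mono) auto
  also have "\<dots> = 6" using N by simp
  finally have 1: "norm s * (6 / sqrt (real N)) \<le> 6" .
  have "norm (\<Sum>n=1..N. of_nat n powr (-s)) \<le> (\<Sum>n=1..N. 1 / real n)"
  proof (rule sum_norm_le)
    fix n assume "n \<in> {1..N}"
    hence n: "n \<ge> 1" by simp
    have "real n powr (- Re s) \<le> real n powr (-1)" using n s by (intro powr_mono) auto
    thus "norm (of_nat n powr (-s)) \<le> 1 / real n"
      unfolding norm_nat_powr_neg[OF n] using n by (simp add: powr_minus_divide)
  qed
  also have "\<dots> \<le> 1 + ln (real N)" by (rule harm_le_ln[OF N(1)])
  finally have 2: "norm (\<Sum>n=1..N. of_nat n powr (-s)) \<le> 1 + ln (real N)" .
  have "real N powr (1 - Re s) \<le> real N powr 0" using N s by (intro powr_mono) auto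
  hence 3: "norm (of_nat N powr (1-s) / (1-s)) \<le> 1 / norm (s - 1)"
    using N norm_of_real_powr[of "real N" "1-s"] by (simp add: norm_divide norm_minus_commute divide_right_mono)
  have "norm (zeta s) = norm ((zeta s - (\<Sum>n=1..N. of_nat n powr (-s)) + of_nat N powr (1-s) / (1-s))
      + (\<Sum>n=1..N. of_nat n powr (-s)) - of_nat N powr (1-s) / (1-s))" by simp
  also have "\<dots> \<le> norm (zeta s - (\<Sum>n=1..N. of_nat n powr (-s)) + of_nat N powr (1-s) / (1-s))
      + norm (\<Sum>n=1..N. of_nat n powr (-s)) + norm (of_nat N powr (1-s) / (1-s))"
    by (intro order.trans[OF norm_triangle_ineq4] add_mono norm_triangle_ineq order.refl)
  also have "\<dots> \<le> 6 + (1 + ln (real N)) + 1 / norm (s - 1)"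
    using zeta_approx[OF s N(1)] 1 2 3 by (intro add_mono) auto
  also have "\<dots> \<le> 9 * (1 + ln (2 + \<bar>u\<bar>)) + 1 / norm (s - 1)"
  proof -
    have "0 \<le> ln (2 + \<bar>u\<bar>)" by simp
    thus ?thesis using N(3) by argo
  qed
  finally show ?thesis by (simp add: s_def)
qed

text \<open>A Lipschitz bound in the real direction away from the pole: the finite sum contributes
  the square of the logarithm, and the distance 1/16 from the pole controls the polar term.\<close>

lemma norm_zeta_diff:
  assumes \<sigma>: "1 < \<sigma>" "\<sigma> \<le> \<sigma>'" "\<sigma>' \<le> 2" and r: "1/16 \<le> norm (Complex \<sigma> u - 1)"
  shows "norm (zeta (Complex \<sigma> u) - zeta (Complex \<sigma>' u)) \<le> (\<sigma>' - \<sigma>) * (350 * (1 + ln (2 + \<bar>u\<bar>))\<^sup>2)"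
proof -
  obtain N where N: "N \<ge> 1" "2 + \<bar>u\<bar> \<le> sqrt (real N)" "ln (real N) \<le> 2 * (1 + ln (2 + \<bar>u\<bar>))"
    by (rule cutoff_bounds)
  define B where "B = 1 + ln (2 + \<bar>u\<bar>)"
  have B: "B \<ge> 1" by (simp add: B_def)
  have lnN: "0 \<le> ln (real N)" "ln (real N) \<le> 2 * B" using N by (auto simp: B_def)
  define s where "s = Complex \<sigma> u"
  define s' where "s' = Complex \<sigma>' u"
  have s: "Re s > 1" "Re s' > 1" using \<sigma> by (auto simp: s_def s'_def)
  have ss: "norm (s - s') = \<sigma>' - \<sigma>" using \<sigma> by (simp add: s_def s'_def Complex_eq flip: of_real_diff)
  have r1: "1/16 \<le> norm (1 - s)" using r by (simp add: s_def norm_minus_commute)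
  have "norm (1 - s) \<le> norm (1 - s')"
    unfolding cmod_def s_def s'_def using \<sigma> by (auto intro!: power_mono simp: power2_commute[of 1])
  hence r2: "1/16 \<le> norm (1 - s')" using r1 by simp
  have nz: "1 - s \<noteq> 0" "1 - s' \<noteq> 0" using r1 r2 by auto
  have ns: "norm s \<le> 2 + \<bar>u\<bar>" using cmod_le[of s] \<sigma> by (simp add: s_def)
  have "(1 + 2 * norm s) * (6 / sqrt (real N)) \<le> (3 * sqrt (real N)) * (6 / sqrt (real N))"
    using ns N by (intro mult_right_mono) auto
  also have "\<dots> = 18" using N by simp
  finally have 1: "(1 + 2 * norm s) * (6 / sqrt (real N)) \<le> 18" .
  have pd: "norm (of_nat n powr (-s) - of_nat n powr (-s')) \<le> real n powr (-\<sigma>) * ((\<sigma>' - \<sigma>) * ln (real n))"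
    if "n \<ge> 1" for n :: nat
    using norm_powr_diff_le[of "real n" \<sigma> \<sigma>' u] that \<sigma> by (simp add: s_def s'_def)
  have "norm (\<Sum>n=1..N. of_nat n powr (-s) - of_nat n powr (-s')) \<le> (\<Sum>n=1..N. (\<sigma>' - \<sigma>) * ln (real N) * (1 / real n))"
  proof (rule sum_norm_le)
    fix n assume n: "n \<in> {1..N}"
    have "real n powr (- \<sigma>) \<le> real n powr (-1)" using n \<sigma> by (intro powr_mono) auto
    hence "real n powr (-\<sigma>) * ((\<sigma>' - \<sigma>) * ln (real n)) \<le> real n powr (-1) * ((\<sigma>' - \<sigma>) * ln (real N))"
      using n \<sigma> by (intro mult_mono) auto
    also have "\<dots> = (\<sigma>' - \<sigma>) * ln (real N) * (1 / real n)" using n by (simp add: powr_minus_divide)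
    finally show "norm (of_nat n powr (-s) - of_nat n powr (-s')) \<le> (\<sigma>' - \<sigma>) * ln (real N) * (1 / real n)"
      using pd[of n] n by auto
  qed
  also have "\<dots> = (\<sigma>' - \<sigma>) * ln (real N) * (\<Sum>n=1..N. 1 / real n)" by (simp add: sum_distrib_left)
  also have "\<dots> \<le> (\<sigma>' - \<sigma>) * ln (real N) * (1 + ln (real N))"
    using \<sigma> lnN by (intro mult_left_mono harm_le_ln N) auto
  finally have 2: "norm (\<Sum>n=1..N. of_nat n powr (-s) - of_nat n powr (-s')) \<le> (\<sigma>' - \<sigma>) * (ln (real N) * (1 + ln (real N)))"
    by (simp add: mult_ac)
  define p where "p = (of_nat N powr (1-s) :: complex)"
  define p' where "p' = (of_nat N powr (1-s') :: complex)"
  have p': "norm p' \<le> 1"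
  proof -
    have "real N powr (1 - Re s') \<le> real N powr 0" using N s by (intro powr_mono) auto
    thus ?thesis using N norm_of_real_powr[of "real N" "1-s'"] by (simp add: p'_def)
  qed
  have pp': "norm (p - p') \<le> (\<sigma>' - \<sigma>) * ln (real N)"
  proof -
    have "1 - s = - Complex (\<sigma> - 1) u" "1 - s' = - Complex (\<sigma>' - 1) u"
      by (auto simp: s_def s'_def complex_eq_iff)
    hence "norm (p - p') \<le> real N powr (-(\<sigma> - 1)) * ((\<sigma>' - 1 - (\<sigma> - 1)) * ln (real N))"
      using norm_powr_diff_le[of "real N" "\<sigma> - 1" "\<sigma>' - 1" u] N \<sigma> by (simp add: p_def p'_def)
    also have "\<dots> \<le> real N powr 0 * ((\<sigma>' - 1 - (\<sigma> - 1)) * ln (real N))"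
      using N \<sigma> lnN by (intro mult_right_mono powr_mono) auto
    finally show ?thesis using N by simp
  qed
  have "p / (1-s) - p' / (1-s') = (p - p') / (1-s) + p' * (s - s') / ((1-s) * (1-s'))"
  proof -
    have "1 / (1-s) - 1 / (1-s') = (s - s') / ((1-s) * (1-s'))"
      using nz by (simp add: diff_frac_eq)
    moreover have "p / (1-s) - p' / (1-s') = (p - p') / (1-s) + p' * (1 / (1-s) - 1 / (1-s'))"
      by (simp add: algebra_simps diff_divide_distrib)
    ultimately show ?thesis by (simp only: times_divide_eq_right)
  qed
  hence "norm (p / (1-s) - p' / (1-s')) \<le> norm (p - p') / norm (1-s) + norm p' * norm (s - s') / (norm (1-s) * norm (1-s'))"
    using norm_triangle_ineq[of "(p - p') / (1-s)" "p' * (s - s') / ((1-s) * (1-s'))"]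
    by (simp only: norm_mult norm_divide)
  also have "\<dots> \<le> ((\<sigma>' - \<sigma>) * ln (real N)) / (1/16) + 1 * (\<sigma>' - \<sigma>) / ((1/16) * (1/16))"
    using pp' p' r1 r2 \<sigma> lnN unfolding ss by (intro add_mono frac_le mult_mono) auto
  finally have 3: "norm (p / (1-s) - p' / (1-s')) \<le> (\<sigma>' - \<sigma>) * (16 * ln (real N) + 256)"
    by (simp add: algebra_simps)
  have 4: "norm ((zeta s - zeta s') - (\<Sum>n=1..N. of_nat n powr (-s) - of_nat n powr (-s')) + (p / (1-s) - p' / (1-s')))
       \<le> (\<sigma>' - \<sigma>) * 18"
  proof -
    have "(\<sigma>' - \<sigma>) * (1 + 2 * norm s) * (6 / sqrt (real N)) \<le> (\<sigma>' - \<sigma>) * 18"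
      using 1 \<sigma> by (simp only: mult.assoc) (intro mult_left_mono, auto)
    thus ?thesis using zeta_diff_approx[OF \<sigma>(1,2) N(1), of u] unfolding s_def s'_def p_def p'_def by linarith
  qed
  have tri: "norm (a :: complex) \<le> norm (a - b + c) + norm b + norm c" for a b c
    using norm_triangle_ineq4[of "a - b + c + b" c] norm_triangle_ineq[of "a - b + c" b] by simp
  have "norm (zeta s - zeta s') \<le> (\<sigma>' - \<sigma>) * 18 + (\<sigma>' - \<sigma>) * (ln (real N) * (1 + ln (real N))) + (\<sigma>' - \<sigma>) * (16 * ln (real N) + 256)"
    by (rule order.trans[OF tri[of _ "\<Sum>n=1..N. of_nat n powr (-s) - of_nat n powr (-s')" "p / (1-s) - p' / (1-s')"]])
       (intro add_mono 2 3 4)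
  also have "\<dots> = (\<sigma>' - \<sigma>) * (ln (real N) * (1 + ln (real N)) + 16 * ln (real N) + 274)"
    by (simp add: algebra_simps)
  also have "\<dots> \<le> (\<sigma>' - \<sigma>) * ((2 * B) * (1 + 2 * B) + 16 * (2 * B) + 274)"
    using lnN \<sigma> B by (intro mult_left_mono add_mono mult_mono) auto
  also have "\<dots> \<le> (\<sigma>' - \<sigma>) * (350 * B\<^sup>2)"
  proof (intro mult_left_mono)
    have "B * 1 \<le> B * B" "1 * 1 \<le> B * B" using B by (intro mult_mono; simp)+
    thus "(2 * B) * (1 + 2 * B) + 16 * (2 * B) + 274 \<le> 350 * B\<^sup>2"
      by (simp add: power2_eq_square algebra_simps)
  qed (use \<sigma> in auto)
  finally show ?thesis by (simp add: s_def s'_def B_def)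
qed

text \<open>The approximation with N = 1, where the polar term is already the whole main
  part.\<close>

lemma norm_zeta_near_1:
  assumes "Re s > 1"
  shows "norm (zeta s - 1 / (s - 1)) \<le> 1 + 6 * norm s"
proof -
  have "zeta s - 1 / (s - 1) = (zeta s - (\<Sum>n=1..1. of_nat n powr (-s)) + of_nat 1 powr (1-s) / (1-s)) + 1"
  proof -
    have "1 / (1 - s) = - (1 / (s - 1))" by (metis minus_diff_eq minus_divide_right)
    thus ?thesis by simp
  qed
  also have "norm \<dots> \<le> norm s * (6 / sqrt (real 1)) + norm (1::complex)"
    by (intro order.trans[OF norm_triangle_ineq] add_mono zeta_approx assms) auto
  finally show ?thesis by simp
qed

lemma norm_zeta_real_bounds:
  assumes "0 < a" "a \<le> 1"
  shows "norm (zeta (of_real (1 + a))) \<le> 14 / a" "1 / (26 * a) \<le> norm (zeta (of_real (1 + a)))"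
proof -
  define x where "x = norm (zeta (of_real (1 + a)))"
  have na: "norm (of_real (1 + a) :: complex) = 1 + a" using assms by (simp only: norm_of_real)
  have na': "norm (1 / (of_real (1 + a) - 1) :: complex) = 1 / a" using assms by (simp add: norm_divide)
  have d: "norm (zeta (of_real (1 + a)) - 1 / (of_real (1 + a) - 1)) \<le> 1 + 6 * (1 + a)"
    using norm_zeta_near_1[of "of_real (1 + a)"] assms na by simp
  have d1: "x \<le> 1 / a + (1 + 6 * (1 + a))"
    using norm_triangle_ineq2[of "zeta (of_real (1 + a))" "1 / (of_real (1 + a) - 1)"] d unfolding na' x_def by linarith
  have d2: "1 / a - (1 + 6 * (1 + a)) \<le> x"
    using norm_triangle_ineq3[of "zeta (of_real (1 + a))" "1 / (of_real (1 + a) - 1)"] d unfolding na' x_def by linarith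
  have "1 \<le> 1 / a" using assms by simp
  moreover have "14 / a = 14 * (1 / a)" by simp
  ultimately show "x \<le> 14 / a" using d1 assms by argo
  have x1: "1 \<le> x"
  proof -
    have "0 \<le> ln x"
      using sums_le[OF _ sums_zero ln_zeta_sums[of "1 + a"]] assms mangoldt_weight_bounds by (simp add: x_def)
    thus ?thesis using zeta_nonzero[of "of_real (1 + a)"] assms by (simp add: x_def)
  qed
  show "1 / (26 * a) \<le> x"
  \<comment> \<open>For a <= 1/26 the pole dominates the bounded remainder; for larger a the trivial
    bound zeta >= 1 suffices.\<close>
  proof (cases "a \<le> 1/26")
    case True
    hence "26 \<le> 1 / a" using assms by (simp add: field_simps)
    moreover have "q / 26 \<le> q - (1 + 6 * (1 + a))" if "26 \<le> q" for q
      using that True by argo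
    ultimately have "(1 / a) / 26 \<le> x" using d2 by force
    thus ?thesis by simp
  next
    case False
    hence "1 / (26 * a) \<le> 1" using assms by (simp add: field_simps)
    thus ?thesis using x1 by simp
  qed
qed

text \<open>De la Vallee Poussin's argument: at 1 + b with b >= \<eta> the 3-4-1 inequality and
  upper bounds for its two other factors give a lower bound of order \<eta>^{3/4} up to logarithms.
  For a < \<eta> the point is moved right to 1 + \<eta>, and the variation of zeta is at most half
  of the bound found there. Writing \<eta> = h^4 turns the power 3/4 into h^3.\<close>

lemma norm_zeta_lower_far:
  assumes a: "0 < a" "a \<le> 1" and r: "1/16 \<le> norm (Complex (1 + a) u - 1)"
  shows "1 / (40 * 14000 ^ 3) / (1 + ln (2 + \<bar>u\<bar>)) ^ 10 \<le> norm (zeta (Complex (1 + a) u))"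
proof -
  define B where "B = 1 + ln (2 + \<bar>u\<bar>)"
  have B: "B \<ge> 1" by (simp add: B_def)
  \<comment> \<open>14000 = 40 * 350, where 350 is the constant of \<open>norm_zeta_diff\<close>:
    this makes \<eta> * 350 B^2 equal to h^3 / (40 B), half of the lower bound at 1 +
    \<eta>.\<close>
  define h where "h = 1 / (14000 * B ^ 3)"
  define \<eta> where "\<eta> = h ^ 4" \<comment> \<open>the shift to the right that balances the 3-4-1 bound against the variation of zeta\<close>
  have B3: "1 \<le> 14000 * B ^ 3" using one_le_power[OF B, of 3] by linarith
  have h: "0 < h" using B by (simp add: h_def)
  have "h \<le> 1 / 1" unfolding h_def using B3 B by (intro divide_left_mono) simp_all
  hence "h \<le> 1" by simp
  note h = h this
  have \<eta>: "0 < \<eta>" "\<eta> \<le> 1" using h by (auto simp: \<eta>_def power_le_one)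
  have main: "h ^ 3 / (20 * B) \<le> norm (zeta (Complex (1 + b) u))" if b: "\<eta> \<le> b" "a \<le> b" "b \<le> 1" for b
  proof -
    define x y z where "x = norm (zeta (of_real (1 + b)))" and "y = norm (zeta (Complex (1 + b) u))"
      and "z = norm (zeta (Complex (1 + b) (2 * u)))"
    have b0: "0 < b" using b \<eta> by simp
    have x: "x \<le> 14 / b" unfolding x_def using b0 b by (intro norm_zeta_real_bounds)
    have z: "z \<le> 34 * B"
    proof -
      have "norm (Complex (1 + a) u - 1) \<le> norm (Complex (1 + b) (2 * u) - 1)"
      proof -
        have "a\<^sup>2 + u\<^sup>2 \<le> b\<^sup>2 + 4 * u\<^sup>2"
          using power_mono[OF b(2), of 2] a zero_le_power2[of u] by linarith
        thus ?thesis by (simp add: cmod_def power_mult_distrib)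
      qed
      hence r': "1/16 \<le> norm (Complex (1 + b) (2 * u) - 1)" using r by linarith
      have "z \<le> 9 * (1 + ln (2 + \<bar>2 * u\<bar>)) + 1 / norm (Complex (1 + b) (2 * u) - 1)"
        unfolding z_def using b0 b by (intro norm_zeta_upper) auto
      also have "1 / norm (Complex (1 + b) (2 * u) - 1) \<le> 1 / (1/16)"
        using r' by (intro divide_left_mono) auto
      also have "ln (2 + \<bar>2 * u\<bar>) \<le> ln (2 * (2 + \<bar>u\<bar>))" by simp
      also have "\<dots> = ln 2 + ln (2 + \<bar>u\<bar>)" by (subst ln_mult) auto
      finally have "z \<le> 9 * (ln 2 + B) + 16" by (simp add: B_def)
      moreover have "ln 2 \<le> (1::real)" using ln_2_less_1 by simp
      ultimately show ?thesis using B by argo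
    qed
    have "1 \<le> x ^ 3 * y ^ 4 * z"
      using zeta_341[of "1 + b" u] b0 by (simp add: x_def y_def z_def)
    also have "\<dots> \<le> (14 / b) ^ 3 * y ^ 4 * (34 * B)"
      using x z b0 by (intro mult_mono power_mono mult_nonneg_nonneg zero_le_power) (auto simp: x_def y_def z_def)
    finally have "b ^ 3 \<le> 93296 * (y ^ 4 * B)"
      using b0 by (simp add: power_divide field_simps)
    \<comment> \<open>93296 = 14^3 * 34 is rounded up to 20^4, so that the fourth root is
      rational.\<close>
    also have "\<dots> \<le> 160000 * (y ^ 4 * B)" using B by (intro mult_right_mono) auto
    finally have "b ^ 3 / (20 ^ 4 * B) \<le> y ^ 4" using B by (simp add: field_simps)
    moreover have "(h ^ 3 / (20 * B)) ^ 4 \<le> b ^ 3 / (20 ^ 4 * B)"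
    proof -
      have "(h ^ 3 / (20 * B)) ^ 4 = \<eta> ^ 3 / (20 ^ 4 * B ^ 4)"
        by (simp add: \<eta>_def power_divide power_mult_distrib flip: power_mult)
      also have "\<dots> \<le> b ^ 3 / (20 ^ 4 * B ^ 1)"
        using b \<eta> B by (intro frac_le power_mono mult_left_mono power_increasing) auto
      finally show ?thesis by simp
    qed
    ultimately have "(h ^ 3 / (20 * B)) ^ 4 \<le> y ^ 4" by linarith
    hence "h ^ 3 / (20 * B) \<le> y" by (rule power_le_imp_le_base[of _ 3, simplified]) (auto simp: y_def)
    thus ?thesis by (simp add: y_def)
  qed
  have "h ^ 3 / (40 * B) \<le> norm (zeta (Complex (1 + a) u))"
  proof (cases "\<eta> \<le> a")
    case True
    have "h ^ 3 / (40 * B) \<le> h ^ 3 / (20 * B)" using h B by (intro divide_left_mono) auto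
    thus ?thesis using main[of a] True a by simp
  next
    case False
    have "norm (zeta (Complex (1 + a) u) - zeta (Complex (1 + \<eta>) u)) \<le> ((1 + \<eta>) - (1 + a)) * (350 * B\<^sup>2)"
      unfolding B_def using a r \<eta> False by (intro norm_zeta_diff) auto
    also have "\<dots> \<le> \<eta> * (350 * B\<^sup>2)" using a by (intro mult_right_mono) auto
    also have "\<dots> = h ^ 3 * (350 * B\<^sup>2 * h)" by (simp add: \<eta>_def power_numeral_reduce)
    also have "350 * B\<^sup>2 * h = 1 / (40 * B)" using B by (simp add: h_def power_numeral_reduce)
    finally have "norm (zeta (Complex (1 + a) u) - zeta (Complex (1 + \<eta>) u)) \<le> h ^ 3 / (40 * B)" by simp
    moreover have "h ^ 3 / (20 * B) \<le> norm (zeta (Complex (1 + \<eta>) u))" using main[of \<eta>] \<eta> False by simp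
    moreover have "h ^ 3 / (20 * B) = h ^ 3 / (40 * B) + h ^ 3 / (40 * B)" by simp
    ultimately show ?thesis
      using norm_triangle_ineq3[of "zeta (Complex (1 + a) u)" "zeta (Complex (1 + \<eta>) u)"] by linarith
  qed
  moreover have "h ^ 3 / (40 * B) = 1 / (40 * 14000 ^ 3) / B ^ 10"
    by (simp add: h_def power_divide power_mult_distrib power_numeral_reduce)
  ultimately show ?thesis by (simp add: B_def)
qed

text \<open>Adds the neighbourhood of the pole, where |zeta| is at least half of 1/r with r the
  distance to 1. The factor \<open>min 1 (a + \<bar>u\<bar>)\<close> interpolates between both
  regions; 640 = 16 * 40 reflects the radius 1/16.\<close>

lemma norm_zeta_lower:
  assumes a: "0 < a" "a \<le> 1"
  shows "1 / (640 * 14000 ^ 3) / (min 1 (a + \<bar>u\<bar>) * (1 + ln (2 + \<bar>u\<bar>)) ^ 10) \<le> norm (zeta (Complex (1 + a) u))"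
proof -
  define B where "B = (1 + ln (2 + \<bar>u\<bar>)) ^ 10"
  have B: "B \<ge> 1" unfolding B_def by (intro one_le_power) simp
  define r where "r = norm (Complex (1 + a) u - 1)"
  have rle: "r \<le> a + \<bar>u\<bar>" using cmod_le[of "Complex (1 + a) u - 1"] a by (simp add: r_def)
  define m where "m = min 1 (a + \<bar>u\<bar>)"
  have m: "0 < m" "m \<le> 1" using a by (auto simp: m_def)
  show ?thesis
  proof (cases "1/16 \<le> r")
    case True
    have "1/16 \<le> m" using True rle by (auto simp: m_def)
    hence "1 / (640 * 14000 ^ 3) / (m * B) \<le> 1 / (640 * 14000 ^ 3) / (1/16 * B)"
      using B m by (intro divide_left_mono mult_right_mono) auto
    also have "\<dots> = 1 / (40 * 14000 ^ 3) / B" by simp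
    also have "\<dots> \<le> norm (zeta (Complex (1 + a) u))"
      unfolding B_def using norm_zeta_lower_far[OF a] True by (simp add: r_def)
    finally show ?thesis by (simp add: m_def B_def)
  next
    case False
    have r0: "0 < r" using a by (simp add: r_def complex_eq_iff)
    have "\<bar>u\<bar> \<le> r" "a \<le> r" using abs_Im_le_cmod[of "Complex (1 + a) u - 1"] abs_Re_le_cmod[of "Complex (1 + a) u - 1"] a
      by (auto simp: r_def)
    hence "m = a + \<bar>u\<bar>" using False by (auto simp: m_def)
    hence rm: "r \<le> m" using rle by simp
    have "norm (Complex (1 + a) u) \<le> 1 + r"
      using norm_triangle_ineq[of "Complex (1 + a) u - 1" 1] by (simp add: r_def)
    hence "norm (zeta (Complex (1 + a) u) - 1 / (Complex (1 + a) u - 1)) \<le> 1 + 6 * (1 + r)"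
      using norm_zeta_near_1[of "Complex (1 + a) u"] a by simp
    moreover have "norm (1 / (Complex (1 + a) u - 1)) = 1 / r" by (simp add: r_def norm_divide)
    ultimately have "1 / r - (1 + 6 * (1 + r)) \<le> norm (zeta (Complex (1 + a) u))"
      using norm_triangle_ineq3[of "zeta (Complex (1 + a) u)" "1 / (Complex (1 + a) u - 1)"] by linarith
    moreover have "16 \<le> 1 / r" using False r0 by (simp add: field_simps)
    moreover have "(1 / r) / 2 \<le> q - (1 + 6 * (1 + r))" if "q = 1 / r" "16 \<le> q" for q
      unfolding that(1)[symmetric] using False that(2) by argo
    ultimately have 1: "(1 / r) / 2 \<le> norm (zeta (Complex (1 + a) u))" by force
    have "1 / (640 * 14000 ^ 3) / (m * B) \<le> (1/2) / (r * 1)"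
      using B m rm r0 by (intro frac_le mult_mono) auto
    also have "\<dots> = (1 / r) / 2" by simp
    finally show ?thesis using 1 by (simp add: m_def B_def)
  qed
qed

section \<open>The Fourier series of the absolute value of the sine\<close>

text \<open>|sin x| = 2/pi - (4/pi) times the sum over m of \<open>sin_coeff m\<close> cos (2 (m+1)
  x); the index is shifted to leave out the constant term.\<close>

definition sin_coeff :: "nat \<Rightarrow> real" where "sin_coeff m = 1 / (4 * real (Suc m) ^ 2 - 1)"

lemma sin_coeff_denom: "4 * real (Suc m) ^ 2 - 1 = (2 * real m + 1) * (2 * real m + 3)"
  by (simp add: power2_eq_square algebra_simps)

lemma sin_coeff_pos: "0 < sin_coeff m"
  unfolding sin_coeff_def sin_coeff_denom by simp

lemma sin_coeff_sums: "sin_coeff sums (1/2)"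
proof -
  define g where "g m = 1 / (2 * (2 * real m + 1))" for m
  have "(\<lambda>m. 1 / real (Suc m)) \<longlonglongrightarrow> 0" using LIMSEQ_inverse_real_of_nat by (simp add: inverse_eq_divide)
  hence "g \<longlonglongrightarrow> 0"
  proof (rule Lim_null_comparison[rotated])
    show "eventually (\<lambda>m. norm (g m) \<le> 1 / real (Suc m)) sequentially"
      by (intro always_eventually allI) (simp add: g_def field_simps)
  qed
  hence "(\<lambda>m. g m - g (Suc m)) sums (g 0 - 0)" by (rule telescope_sums')
  moreover have "g m - g (Suc m) = sin_coeff m" for m
    unfolding sin_coeff_def sin_coeff_denom g_def by (simp add: divide_simps) (simp add: algebra_simps)
  ultimately show ?thesis by (simp add: g_def)
qed

lemma artanh_sums:
  fixes w :: complex
  assumes "norm w < 1"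
  shows "(\<lambda>m. w ^ (2 * m + 1) / of_nat (2 * m + 1)) sums ((Ln (1 + w) - Ln (1 - w)) / 2)"
proof -
  have 1: "(\<lambda>n. (-1) ^ Suc n / of_nat n * w ^ n) sums Ln (1 + w)" by (rule Ln_series[OF assms])
  have 2: "(\<lambda>n. (-1) ^ Suc n / of_nat n * (-w) ^ n) sums Ln (1 + (-w))" using assms by (intro Ln_series) auto
  define f where "f n = ((-1) ^ Suc n / of_nat n * w ^ n - (-1) ^ Suc n / of_nat n * (-w) ^ n) / 2" for n
  have "f sums ((Ln (1 + w) - Ln (1 + (-w))) / 2)"
    unfolding f_def by (intro sums_divide sums_diff 1 2)
  moreover have "f n = 0" if "n \<notin> range (\<lambda>m. 2 * m + 1)" for n
  proof -
    have "even n" using that by (metis oddE rangeI)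
    thus ?thesis by (simp add: f_def)
  qed
  moreover have "strict_mono (\<lambda>m::nat. 2 * m + 1)" by (auto simp: strict_mono_def)
  ultimately have "(\<lambda>m. f (2 * m + 1)) sums ((Ln (1 + w) - Ln (1 + (-w))) / 2)"
    by (subst sums_mono_reindex) auto
  moreover have "f n = w ^ n / of_nat n" if "odd n" for n
    using that by (simp add: f_def)
  hence "f (2 * m + 1) = w ^ (2 * m + 1) / of_nat (2 * m + 1)" for m by simp
  ultimately show ?thesis by simp
qed

text \<open>On the unit circle the real part is the cosine series of |sin|. Inside the disc the
  function is elementary, and the circle is reached by continuity.\<close>

definition sin_series :: "complex \<Rightarrow> complex" where
  "sin_series w = (\<Sum>m. of_real (sin_coeff m) * w ^ (2 * m + 2))"

lemma sin_series_summable: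
  fixes w :: complex
  assumes "norm w \<le> 1"
  shows "summable (\<lambda>m. of_real (sin_coeff m) * w ^ (2 * m + 2))"
    "norm (of_real (sin_coeff m) * w ^ (2 * m + 2)) \<le> sin_coeff m"
proof -
  have le: "norm (of_real (sin_coeff m) * w ^ (2 * m + 2)) \<le> sin_coeff m" for m
  proof -
    have "norm w ^ (2 * m + 2) \<le> 1" using assms by (intro power_le_one) auto
    thus ?thesis using sin_coeff_pos[of m] by (simp only: norm_mult norm_power norm_of_real) (simp add: mult_left_le)
  qed
  thus "norm (of_real (sin_coeff m) * w ^ (2 * m + 2)) \<le> sin_coeff m" .
  show "summable (\<lambda>m. of_real (sin_coeff m) * w ^ (2 * m + 2))"
    by (rule summable_comparison_test'[OF sums_summable[OF sin_coeff_sums], where N = 0]) (rule le)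
qed

lemma sin_series_continuous: "continuous_on (cball 0 1) sin_series"
proof -
  have "uniform_limit (cball 0 1) (\<lambda>n w. \<Sum>m<n. of_real (sin_coeff m) * w ^ (2 * m + 2)) sin_series sequentially"
    unfolding sin_series_def
    by (rule Weierstrass_m_test[where M = sin_coeff]) (use sin_series_summable sums_summable[OF sin_coeff_sums] in auto)
  thus ?thesis
    by (rule uniform_limit_theorem[rotated]) (auto intro!: always_eventually continuous_intros)
qed

text \<open>The partial fraction 1 / (4 m^2 - 1) = (1 / (2m-1) - 1 / (2m+1)) / 2 makes the series a
  combination of two shifted artanh series.\<close>

lemma sin_series_closed_form:
  assumes w: "norm w < 1" "w \<noteq> 0"
  shows "sin_series w = 1/2 + (w - 1 / w) / 4 * (Ln (1 + w) - Ln (1 - w))"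
proof -
  define A where "A = (Ln (1 + w) - Ln (1 - w)) / 2"
  have a: "(\<lambda>m. w ^ (2 * m + 1) / of_nat (2 * m + 1)) sums A"
    unfolding A_def by (rule artanh_sums[OF w(1)])
  have b: "(\<lambda>m. w ^ (2 * Suc m + 1) / of_nat (2 * Suc m + 1)) sums (A - w)"
    using a sums_Suc_iff[of "\<lambda>m. w ^ (2 * m + 1) / of_nat (2 * m + 1)" "A - w"] by simp
  have "(\<lambda>m. (1/2) * (w * (w ^ (2 * m + 1) / of_nat (2 * m + 1)) - (w ^ (2 * Suc m + 1) / of_nat (2 * Suc m + 1)) / w))
      sums ((1/2) * (w * A - (A - w) / w))"
    by (intro sums_mult sums_diff sums_divide a b)
  moreover have "(1/2) * (w * (w ^ (2 * m + 1) / of_nat (2 * m + 1)) - (w ^ (2 * Suc m + 1) / of_nat (2 * Suc m + 1)) / w)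
      = of_real (sin_coeff m) * w ^ (2 * m + 2)" for m
  proof -
    have "(1/2) * (w * (w ^ (2 * m + 1) / of_nat (2 * m + 1)) - (w ^ (2 * Suc m + 1) / of_nat (2 * Suc m + 1)) / w)
        = (1/2) * (1 / of_nat (2 * m + 1) - 1 / of_nat (2 * m + 3)) * w ^ (2 * m + 2)"
      using w(2) by (simp add: field_simps del: of_nat_Suc of_nat_add of_nat_mult) (simp add: algebra_simps)?
    also have "(1/2) * (1 / of_nat (2 * m + 1) - 1 / of_nat (2 * m + 3)) = complex_of_real ((1/2) * (1 / (2 * real m + 1) - 1 / (2 * real m + 3)))"
      by simp
    also have "(1/2) * (1 / (2 * real m + 1) - 1 / (2 * real m + 3)) = sin_coeff m"
      unfolding sin_coeff_def sin_coeff_denom by (simp add: divide_simps)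
    finally show ?thesis .
  qed
  ultimately have "sin_series w = (1/2) * (w * A - (A - w) / w)"
    unfolding sin_series_def by (simp add: sums_iff)
  also have "\<dots> = 1/2 + (w - 1 / w) / 4 * (Ln (1 + w) - Ln (1 - w))"
    using w(2) by (simp add: A_def field_simps)
  finally show ?thesis .
qed

text \<open>Abel's method: the series and its closed form are both continuous up to e^{ix}, so
  radial limits carry the identity to the circle. The endpoints are excluded because the logarithms
  are singular at 1 and -1.\<close>

lemma sin_series_unit_circle:
  assumes x: "0 < x" "x < pi"
  shows "Re (sin_series (cis x)) = 1/2 - pi / 4 * sin x"
proof -
  define g where "g w = 1/2 + (w - 1 / w) / 4 * (Ln (1 + w) - Ln (1 - w))" for w :: complex
  define r where "r n = 1 - 1 / real (n + 2)" for n
  have r: "0 < r n" "r n < 1" for n by (auto simp: r_def field_simps)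
  have "r \<longlonglongrightarrow> 1 - 0" unfolding r_def
    by (intro tendsto_diff tendsto_const LIMSEQ_ignore_initial_segment[of "\<lambda>n. 1 / real n", unfolded] lim_1_over_n)
  hence rlim: "(\<lambda>n. of_real (r n) * cis x) \<longlonglongrightarrow> cis x"
    using tendsto_mult[OF tendsto_of_real[of r 1] tendsto_const[of "cis x"]] by simp
  have sx: "sin x > 0" using x by (rule sin_gt_zero)
  have nz: "Im (1 + cis x) \<noteq> 0" "Im (1 - cis x) \<noteq> 0" using sx by auto
  have "isCont g (cis x)"
    unfolding g_def using nz sx
    by (intro continuous_intros) (auto simp: complex_nonpos_Reals_iff)
  hence l1: "(\<lambda>n. g (of_real (r n) * cis x)) \<longlonglongrightarrow> g (cis x)"
    by (rule isCont_tendsto_compose[OF _ rlim])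
  have "(\<lambda>n. sin_series (of_real (r n) * cis x)) \<longlonglongrightarrow> sin_series (cis x)"
    by (rule continuous_on_tendsto_compose[OF sin_series_continuous rlim])
       (use r in \<open>auto simp: norm_mult less_imp_le abs_of_pos intro!: always_eventually\<close>)
  moreover have "sin_series (of_real (r n) * cis x) = g (of_real (r n) * cis x)" for n
    unfolding g_def using r[of n] by (intro sin_series_closed_form) (auto simp: norm_mult)
  ultimately have eq: "sin_series (cis x) = g (cis x)" using l1 LIMSEQ_unique by auto
  have "cis x - 1 / cis x = 2 * \<i> * of_real (sin x)"
    by (simp add: complex_eq_iff divide_inverse cis_inverse)
  hence "Re (g (cis x)) = 1/2 - sin x / 2 * (Im (Ln (1 + cis x)) - Im (Ln (1 - cis x)))"
    unfolding g_def by (simp add: field_simps)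
  \<comment> \<open>1 + e^{ix} and 1 - e^{ix} are perpendicular, with arguments x/2 and x/2 - pi/2;
    the half-angle formulas exhibit them in polar form.\<close>
  also have "Im (Ln (1 + cis x)) - Im (Ln (1 - cis x)) = pi / 2"
  proof -
    define y where "y = x / 2"
    have y: "0 < y" "y < pi / 2" using x by (auto simp: y_def)
    have c: "cos y > 0" and s: "sin y > 0" using y by (auto intro: cos_gt_zero sin_gt_zero)
    have xy: "x = 2 * y" by (simp add: y_def)
    have "1 + cis x = of_real (2 * cos y) * exp (\<i> * of_real y)"
      unfolding xy cis_conv_exp[symmetric] by (simp add: complex_eq_iff cos_double_cos sin_double power2_eq_square)
    also have "\<dots> = exp (of_real (ln (2 * cos y)) + \<i> * of_real y)"
      using c by (simp add: exp_add exp_of_real)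
    finally have "Ln (1 + cis x) = of_real (ln (2 * cos y)) + \<i> * of_real y"
      using y pi_gt_zero by (simp only:) (intro Ln_exp; simp)
    moreover have "1 - cis x = of_real (2 * sin y) * exp (\<i> * of_real (y - pi / 2))"
      unfolding xy cis_conv_exp[symmetric]
      by (simp add: complex_eq_iff cos_double_sin sin_double power2_eq_square cos_diff sin_diff)
    moreover have "\<dots> = exp (of_real (ln (2 * sin y)) + \<i> * of_real (y - pi / 2))"
      using s by (simp only: exp_add exp_of_real) simp
    ultimately have "Ln (1 - cis x) = of_real (ln (2 * sin y)) + \<i> * of_real (y - pi / 2)"
      using y pi_gt_zero by (simp only:) (intro Ln_exp; simp)
    thus ?thesis using \<open>Ln (1 + cis x) = _\<close> by simp
  qed
  finally show ?thesis unfolding eq by simp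
qed

lemma sin_half_eq:
  assumes "0 \<le> x" "x \<le> pi"
  shows "sin x = (4 / pi) * (\<Sum>m. sin_coeff m * (1 - cos (2 * real (Suc m) * x)))"
    and "summable (\<lambda>m. sin_coeff m * (1 - cos (2 * real (Suc m) * x)))"
proof -
  have "(\<lambda>m. of_real (sin_coeff m) * cis x ^ (2 * m + 2)) sums sin_series (cis x)"
    unfolding sin_series_def by (intro summable_sums sin_series_summable) simp
  from sums_Re[OF this] have "(\<lambda>m. sin_coeff m * cos (2 * real (Suc m) * x)) sums Re (sin_series (cis x))"
    by (simp add: Complex.DeMoivre algebra_simps del: power_Suc)
  from sums_diff[OF sin_coeff_sums this]
  have s: "(\<lambda>m. sin_coeff m * (1 - cos (2 * real (Suc m) * x))) sums (1/2 - Re (sin_series (cis x)))"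
    by (simp add: algebra_simps)
  thus "summable (\<lambda>m. sin_coeff m * (1 - cos (2 * real (Suc m) * x)))" by (rule sums_summable)
  show "sin x = (4 / pi) * (\<Sum>m. sin_coeff m * (1 - cos (2 * real (Suc m) * x)))"
  proof (cases "0 < x \<and> x < pi")
    case True
    hence "1/2 - Re (sin_series (cis x)) = pi / 4 * sin x" using sin_series_unit_circle[of x] by simp
    hence "sin x = (4 / pi) * (1/2 - Re (sin_series (cis x)))" by (simp add: field_simps)
    thus ?thesis using sums_unique[OF s] by simp
  next
    case False
    hence "x = 0 \<or> x = pi" using assms by auto
    thus ?thesis
    proof
      assume "x = pi"
      have "cos (2 * real (Suc m) * pi) = 1" for m
        using cos_2npi[of "Suc m"] by (simp add: mult_ac)
      thus ?thesis using \<open>x = pi\<close> by (simp del: of_nat_Suc)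
    qed simp
  qed
qed

text \<open>Stated with 1 - cos in place of cos: every term is then nonnegative, and summation
  against the coefficients of log zeta gives log zeta(1+a) - log |zeta(1+a+imt)|. The coefficients
  sum to 1/2, which against pi/8 is the mean 4/pi of |1 - e^{it}|.\<close>

theorem norm_1_minus_cis_sums:
  "(\<lambda>m. sin_coeff m * (1 - cos (real (Suc m) * t))) sums (pi / 8 * norm (1 - cis t))"
proof -
  \<comment> \<open>t/2 is reduced modulo pi to an x at which the sine is nonnegative, so that the
    norm is 2 sin x without an absolute value.\<close>
  define j where "j = \<lfloor>t / (2 * pi)\<rfloor>"
  define x where "x = t / 2 - pi * of_int j"
  have "of_int j \<le> t / (2 * pi)" "t / (2 * pi) \<le> of_int j + 1" by (auto simp: j_def)
  hence x: "0 \<le> x" "x \<le> pi" by (auto simp: x_def field_simps)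
  have t: "t = 2 * x + 2 * pi * of_int j" by (simp add: x_def)
  have c: "cos (real (Suc m) * t) = cos (2 * real (Suc m) * x)" for m
  proof -
    have "real (Suc m) * t = 2 * real (Suc m) * x + 2 * pi * of_int (int (Suc m) * j)"
      by (simp add: t algebra_simps)
    thus ?thesis by (simp only: cos_add cos_int_2pin sin_int_2pin; simp)
  qed
  have "cis t = cis (2 * x)"
    unfolding t by (simp add: complex_eq_iff cos_add sin_add cos_int_2pin sin_int_2pin)
  hence "norm (1 - cis t) = sqrt ((1 - cos (2 * x))\<^sup>2 + (sin (2 * x))\<^sup>2)"
    by (simp add: cmod_def)
  also have "(1 - cos (2 * x))\<^sup>2 + (sin (2 * x))\<^sup>2 = 2 - 2 * cos (2 * x)"
    using sin_cos_squared_add[of "2 * x"] by (simp add: power2_eq_square algebra_simps)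
  also have "\<dots> = (2 * sin x)\<^sup>2" by (simp add: cos_double_sin power_mult_distrib)
  also have "sqrt \<dots> = 2 * sin x" using sin_ge_zero[OF x] by (intro real_sqrt_unique) auto
  finally have n: "norm (1 - cis t) = 2 * sin x" .
  show ?thesis unfolding n c using sin_half_eq[OF x] by (simp add: sums_iff)
qed

text \<open>The lower bound for zeta at height q t loses a multiple of ln q, so the Fourier
  coefficients must be summable against the logarithm.\<close>

lemma sin_coeff_ln_summable: "summable (\<lambda>m. sin_coeff m * ln (real (Suc m)))"
proof (rule summable_comparison_test')
  show "summable (\<lambda>m. 1 / real (m + 1) powr (3/2))" by (rule sum_three_halves_le) simp
  fix m :: nat
  define x where "x = sqrt (real (Suc m))"
  have x: "x \<ge> 1" "x\<^sup>2 = real (Suc m)" by (auto simp: x_def)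
  have x4: "real (Suc m) ^ 2 = x ^ 4" unfolding x(2)[symmetric] by simp
  have "ln (real (Suc m)) = 2 * ln x" by (simp add: x_def ln_sqrt)
  also have "ln x \<le> x" using x by (intro ln_bound) auto
  finally have l: "ln (real (Suc m)) \<le> 2 * x" by simp
  have "sin_coeff m \<le> 1 / (2 * x ^ 4)"
    unfolding sin_coeff_def x4 using one_le_power[OF x(1), of 4] by (intro divide_left_mono mult_pos_pos) auto
  hence "sin_coeff m * ln (real (Suc m)) \<le> 1 / (2 * x ^ 4) * (2 * x)"
    using l x by (intro mult_mono) auto
  also have "\<dots> = 1 / x ^ 3" using x by (simp add: power_numeral_reduce)
  also have "x ^ 3 = real (m + 1) powr (3/2)"
  proof -
    have "x = real (m + 1) powr (1/2)" by (simp add: x_def powr_half_sqrt)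
    thus ?thesis by (simp add: powr_powr flip: powr_realpow)
  qed
  finally show "norm (sin_coeff m * ln (real (Suc m))) \<le> 1 / real (m + 1) powr (3/2)"
    using sin_coeff_pos[of m] by simp
qed

text \<open>Separates the multiple q from t: passing from q t to t costs ln q once in
  \<open>min 1 (a + \<bar>t\<bar>)\<close> and once in each of the ten logarithmic factors, 11 ln q
  in total.\<close>

lemma ln_norm_zeta_lower:
  assumes a: "0 < a" "a \<le> 1" and q: "q \<ge> 1"
  shows "- ln (norm (zeta (Complex (1 + a) (q * t)))) \<le>
     ln (min 1 (a + \<bar>t\<bar>)) + 10 * ln (1 + ln (2 + \<bar>t\<bar>)) + ln (640 * 14000 ^ 3) + 11 * ln q"
proof -
  define u where "u = q * t"
  define B where "B = 1 + ln (2 + \<bar>u\<bar>)"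
  define m where "m = min 1 (a + \<bar>u\<bar>)"
  define m0 where "m0 = min 1 (a + \<bar>t\<bar>)"
  have B: "B \<ge> 1" and m: "m > 0" and m0: "m0 > 0" using a by (auto simp: B_def m_def m0_def)
  have nz: "zeta (Complex (1 + a) u) \<noteq> 0" using a by (intro zeta_nonzero) auto
  have "1 / (640 * 14000 ^ 3) / (m * B ^ 10) \<le> norm (zeta (Complex (1 + a) u))"
    unfolding m_def B_def by (rule norm_zeta_lower[OF a])
  hence "ln (1 / (640 * 14000 ^ 3) / (m * B ^ 10)) \<le> ln (norm (zeta (Complex (1 + a) u)))"
    using B m nz by (subst ln_le_cancel_iff) auto
  also have "ln (1 / (640 * 14000 ^ 3) / (m * B ^ 10)) = - ln (640 * 14000 ^ 3) - (ln m + 10 * ln B)"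
    using B m by (simp add: ln_div ln_mult ln_realpow)
  finally have 1: "- ln (norm (zeta (Complex (1 + a) u))) \<le> ln (640 * 14000 ^ 3) + ln m + 10 * ln B" by simp
  have "a + \<bar>u\<bar> \<le> q * (a + \<bar>t\<bar>)" using a q mult_right_mono[of 1 q a] by (simp add: u_def abs_mult algebra_simps)
  hence "m \<le> q * m0" using q by (auto simp: m_def m0_def min_def)
  hence "ln m \<le> ln (q * m0)" using m q m0 by (subst ln_le_cancel_iff) auto
  hence 2: "ln m \<le> ln q + ln m0" using q m0 by (simp add: ln_mult)
  have "2 + \<bar>u\<bar> \<le> q * (2 + \<bar>t\<bar>)" using q by (simp add: u_def abs_mult algebra_simps)
  hence "ln B \<le> ln (1 + ln (q * (2 + \<bar>t\<bar>)))"
    unfolding B_def using q by (subst ln_le_cancel_iff) (auto intro!: add_pos_nonneg ln_ge_zero simp: mult_ge1_I)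
  also have "\<dots> \<le> ln (1 + ln (2 + \<bar>t\<bar>)) + ln q"
  proof -
    have lx: "ln q \<ge> 0" and ly: "ln (2 + \<bar>t\<bar>) \<ge> 0" using q by auto
    have "1 + ln (q * (2 + \<bar>t\<bar>)) = (1 + ln (2 + \<bar>t\<bar>)) + ln q" using q by (subst ln_mult) auto
    also have "\<dots> \<le> (1 + ln (2 + \<bar>t\<bar>)) * (1 + ln q)" using lx ly by (simp add: algebra_simps)
    finally have le: "1 + ln (q * (2 + \<bar>t\<bar>)) \<le> (1 + ln (2 + \<bar>t\<bar>)) * (1 + ln q)" .
    have "ln (q * (2 + \<bar>t\<bar>)) = ln q + ln (2 + \<bar>t\<bar>)" using q by (subst ln_mult) auto
    hence "1 + ln (q * (2 + \<bar>t\<bar>)) > 0" using lx ly by linarith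
    hence "ln (1 + ln (q * (2 + \<bar>t\<bar>))) \<le> ln ((1 + ln (2 + \<bar>t\<bar>)) * (1 + ln q))"
      using le by (subst ln_le_cancel_iff) auto
    also have "\<dots> = ln (1 + ln (2 + \<bar>t\<bar>)) + ln (1 + ln q)"
    proof (rule ln_mult_pos)
      show "0 < 1 + ln (2 + \<bar>t\<bar>)" "0 < 1 + ln q" using lx ly by linarith+
    qed
    also have "ln (1 + ln q) \<le> ln q" using lx by (rule ln_add_one_self_le_self)
    finally show ?thesis by simp
  qed
  finally show ?thesis using 1 2 by (simp add: u_def m0_def)
qed

text \<open>22 = 2 * 11: the whole bound comes out halved, because the coefficients
  \<open>sin_coeff\<close> sum to 1/2.\<close>

definition twist_const :: real where "twist_const = ln (640 * 14000 ^ 3) + 22 * (\<Sum>m. sin_coeff m * ln (real (Suc m)))"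

text \<open>The Fourier series of |1 - e^{i\<theta>}| is inserted and the summations are exchanged.
  The frequency m + 1 contributes a difference of logarithms of zeta, to which the lower bound at
  height (m+1) t applies; its loss in m is summable.\<close>

lemma twist_sum_bound:
  fixes a t :: real and N :: nat
  assumes a: "0 < a" "a \<le> 1"
  defines "A \<equiv> ln (norm (zeta (of_real (1 + a)))) + ln (min 1 (a + \<bar>t\<bar>)) + 10 * ln (1 + ln (2 + \<bar>t\<bar>))"
  shows "(\<Sum>n<N. mangoldt_weight n / real n powr (1 + a) * norm (1 - cis (t * ln (real n)))) \<le> (4 / pi) * (A + twist_const)"
proof -
  define x where "x n = mangoldt_weight n / real n powr (1 + a)" for n
  have x: "x n \<ge> 0" for n using mangoldt_weight_bounds[of n] by (simp add: x_def)
  define d where "d m n = x n * (1 - cos (real (Suc m) * t * ln (real n)))" for m n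
  have d: "d m n \<ge> 0" for m n using x[of n] by (simp add: d_def)
  have dsum: "(d m) sums (ln (norm (zeta (of_real (1 + a)))) - ln (norm (zeta (Complex (1 + a) (real (Suc m) * t)))))" for m
    using sums_diff[OF ln_zeta_sums[of "1 + a"] ln_norm_zeta_sums[of "1 + a" "real (Suc m) * t"]] a
    by (simp add: d_def[abs_def] x_def algebra_simps)
  have fs: "(\<lambda>m. sin_coeff m * d m n) sums (pi / 8 * (x n * norm (1 - cis (t * ln (real n)))))" for n
    using sums_mult[OF norm_1_minus_cis_sums[of "t * ln (real n)"], of "x n"]
    by (simp add: d_def mult_ac)
  have "pi / 8 * (\<Sum>n<N. x n * norm (1 - cis (t * ln (real n)))) = (\<Sum>n<N. \<Sum>m. sin_coeff m * d m n)"
    by (simp add: sum_distrib_left sums_unique[OF fs, symmetric])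
  also have "\<dots> = (\<Sum>m. \<Sum>n<N. sin_coeff m * d m n)"
    by (rule suminf_sum[symmetric]) (use fs sums_summable in blast)
  also have "\<dots> \<le> (\<Sum>m. sin_coeff m * (A + ln (640 * 14000 ^ 3)) + 11 * (sin_coeff m * ln (real (Suc m))))"
  proof (rule suminf_le)
    show "summable (\<lambda>m. \<Sum>n<N. sin_coeff m * d m n)" by (rule summable_sum) (use fs sums_summable in blast)
    show "summable (\<lambda>m. sin_coeff m * (A + ln (640 * 14000 ^ 3)) + 11 * (sin_coeff m * ln (real (Suc m))))"
      by (intro summable_add summable_mult summable_mult2 sin_coeff_ln_summable sums_summable[OF sin_coeff_sums])
    fix m
    have "(\<Sum>n<N. d m n) \<le> (\<Sum>n. d m n)"
      using dsum[of m] d by (intro sum_le_suminf) (auto simp: sums_iff)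
    also have "\<dots> = ln (norm (zeta (of_real (1 + a)))) - ln (norm (zeta (Complex (1 + a) (real (Suc m) * t))))"
      using dsum[of m] by (simp only: sums_iff)
    also have "\<dots> \<le> A + ln (640 * 14000 ^ 3) + 11 * ln (real (Suc m))"
      using ln_norm_zeta_lower[OF a, of "real (Suc m)" t] unfolding A_def by simp
    finally have "sin_coeff m * (\<Sum>n<N. d m n) \<le> sin_coeff m * (A + ln (640 * 14000 ^ 3) + 11 * ln (real (Suc m)))"
      using sin_coeff_pos[of m] by (intro mult_left_mono) auto
    thus "(\<Sum>n<N. sin_coeff m * d m n) \<le> sin_coeff m * (A + ln (640 * 14000 ^ 3)) + 11 * (sin_coeff m * ln (real (Suc m)))"
      by (simp add: sum_distrib_left[symmetric] algebra_simps)
  qed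
  also have "\<dots> = (\<Sum>m. sin_coeff m) * (A + ln (640 * 14000 ^ 3)) + 11 * (\<Sum>m. sin_coeff m * ln (real (Suc m)))"
    by (subst suminf_add[symmetric])
       (intro summable_mult summable_mult2 sin_coeff_ln_summable sums_summable[OF sin_coeff_sums]
        | simp only: suminf_mult[OF sin_coeff_ln_summable] suminf_mult2[OF sums_summable[OF sin_coeff_sums]])+
  also have "\<dots> = (A + twist_const) / 2" using sin_coeff_sums by (simp add: sums_iff twist_const_def field_simps)
  finally show ?thesis by (simp add: x_def field_simps)
qed

section \<open>Bounds for the Dirichlet series of a function in the class\<close>

text \<open>With q = 1 / (40 \<kappa>) a logarithm to the power 10 \<kappa> is at most a constant
  times (1+|t|)^{1/4}; the last factor is the one of \<open>twist_factor_bound\<close>.\<close>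

definition F_const :: "real \<Rightarrow> real" where
  "F_const k = (let \<kappa> = 4 * k / pi; q = 1 / (40 * \<kappa>) in
     364 powr k * 14 powr \<kappa> * exp (\<kappa> * twist_const) * (1 + 2 powr q / q) powr (10 * \<kappa>) * (2 * 2 powr \<kappa>))"

text \<open>Three ranges. For |t| <= a the power is at most 2^\<kappa> and 1/\<alpha> remains; for a
  < |t| <= 1 the quotient is about (|t|/a)^\<kappa> / |t|, which is largest at one of the ends; for
  larger |t| it is at most a^{-\<kappa>} / |t|. This is the origin of the two terms 1/\<alpha> and
  a^{-\<kappa>}.\<close>

lemma twist_factor_bound:
  fixes \<alpha> a t \<kappa> :: real
  assumes \<alpha>: "0 < \<alpha>" "\<alpha> \<le> a" "a \<le> 1" and \<kappa>: "\<kappa> > 0"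
  shows "(min 1 (a + \<bar>t\<bar>) / a) powr \<kappa> / norm (Complex \<alpha> t) \<le> 2 * 2 powr \<kappa> * (1 / \<alpha> + a powr (-\<kappa>)) / (1 + \<bar>t\<bar>)"
proof -
  define m where "m = min 1 (a + \<bar>t\<bar>)"
  define r where "r = norm (Complex \<alpha> t)"
  have m: "0 < m" "m \<le> 1" using \<alpha> by (auto simp: m_def)
  have r: "\<alpha> \<le> r" "\<bar>t\<bar> \<le> r" "0 < r"
    using abs_Re_le_cmod[of "Complex \<alpha> t"] abs_Im_le_cmod[of "Complex \<alpha> t"] \<alpha> by (auto simp: r_def)
  have ap: "a powr (-\<kappa>) = 1 / a powr \<kappa>" using \<alpha> by (simp add: powr_minus_divide)
  have a0: "0 < a" using \<alpha> by simp
  have p2: "1 \<le> 2 powr \<kappa>" using \<kappa> by (simp add: ge_one_powr_ge_zero)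
  have "(m / a) powr \<kappa> / r \<le> 2 powr \<kappa> * (1 / \<alpha> + a powr (-\<kappa>)) * (2 / (1 + \<bar>t\<bar>))"
  proof (cases "\<bar>t\<bar> \<ge> 1")
    case True
    have "(m / a) powr \<kappa> / r \<le> (1 / a) powr \<kappa> / \<bar>t\<bar>"
      using m a0 r True \<kappa> by (intro frac_le powr_mono2 divide_right_mono) auto
    also have "\<dots> \<le> a powr (-\<kappa>) * (2 / (1 + \<bar>t\<bar>))"
    proof -
      have "1 / \<bar>t\<bar> \<le> 2 / (1 + \<bar>t\<bar>)" using True by (simp add: field_simps)
      hence "a powr (-\<kappa>) * (1 / \<bar>t\<bar>) \<le> a powr (-\<kappa>) * (2 / (1 + \<bar>t\<bar>))" by (intro mult_left_mono) auto
      thus ?thesis using a0 by (simp add: powr_divide ap)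
    qed
    also have "\<dots> \<le> (2 powr \<kappa> * (1 / \<alpha> + a powr (-\<kappa>))) * (2 / (1 + \<bar>t\<bar>))"
    proof (rule mult_right_mono)
      have "1 * a powr (-\<kappa>) \<le> 2 powr \<kappa> * (1 / \<alpha> + a powr (-\<kappa>))"
        using p2 \<alpha> by (intro mult_mono) auto
      thus "a powr (-\<kappa>) \<le> 2 powr \<kappa> * (1 / \<alpha> + a powr (-\<kappa>))" by simp
    qed auto
    finally show ?thesis .
  next
    case False
    have "(m / a) powr \<kappa> / r \<le> 2 powr \<kappa> * (1 / \<alpha> + a powr (-\<kappa>))"
    proof (cases "\<bar>t\<bar> \<le> a")
      case True
      have "m / a \<le> 2" using True a0 by (simp add: m_def field_simps)
      hence "(m / a) powr \<kappa> / r \<le> 2 powr \<kappa> / \<alpha>"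
        using m a0 r \<alpha> \<kappa> by (intro frac_le powr_mono2) auto
      also have "\<dots> = 2 powr \<kappa> * (1 / \<alpha>)" by simp
      also have "\<dots> \<le> 2 powr \<kappa> * (1 / \<alpha> + a powr (-\<kappa>))" by (intro mult_left_mono) auto
      finally show ?thesis .
    next
      case False
      hence t: "a < \<bar>t\<bar>" "\<bar>t\<bar> \<le> 1" using \<open>\<not> \<bar>t\<bar> \<ge> 1\<close> by auto
      have "m \<le> 2 * \<bar>t\<bar>" using t by (auto simp: m_def)
      hence "(m / a) powr \<kappa> / r \<le> (2 * \<bar>t\<bar> / a) powr \<kappa> / \<bar>t\<bar>"
        using m a0 r t \<kappa> by (intro frac_le powr_mono2) auto
      also have "\<dots> = 2 powr \<kappa> * (a powr (-\<kappa>) * \<bar>t\<bar> powr (\<kappa> - 1))"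
        using t a0 by (simp add: powr_divide powr_mult ap powr_diff)
      also have "\<dots> \<le> 2 powr \<kappa> * (1 / \<alpha> + a powr (-\<kappa>))"
      proof (intro mult_left_mono)
        show "a powr (-\<kappa>) * \<bar>t\<bar> powr (\<kappa> - 1) \<le> 1 / \<alpha> + a powr (-\<kappa>)"
        proof (cases "\<kappa> \<ge> 1")
          case True
          hence "\<bar>t\<bar> powr (\<kappa> - 1) \<le> 1" using t a0 by (intro powr_le1) auto
          hence "a powr (-\<kappa>) * \<bar>t\<bar> powr (\<kappa> - 1) \<le> a powr (-\<kappa>)" by (intro mult_left_le) auto
          moreover have "0 \<le> 1 / \<alpha>" using \<alpha> by simp
          ultimately show ?thesis by linarith
        next
          case False
          hence "\<bar>t\<bar> powr (\<kappa> - 1) \<le> a powr (\<kappa> - 1)" using t a0 by (intro powr_mono2') auto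
          hence "a powr (-\<kappa>) * \<bar>t\<bar> powr (\<kappa> - 1) \<le> a powr (-\<kappa>) * a powr (\<kappa> - 1)" by (intro mult_left_mono) auto
          also have "\<dots> = 1 / a" using a0 by (simp add: powr_diff powr_minus_divide)
          also have "\<dots> \<le> 1 / \<alpha>" using \<alpha> by (intro divide_left_mono) auto
          finally show ?thesis using powr_ge_zero[of a "-\<kappa>"] by linarith
        qed
      qed auto
      finally show ?thesis .
    qed
    also have "\<dots> \<le> 2 powr \<kappa> * (1 / \<alpha> + a powr (-\<kappa>)) * (2 / (1 + \<bar>t\<bar>))"
    proof -
      have "1 \<le> 2 / (1 + \<bar>t\<bar>)" using False by (simp add: field_simps)
      hence "x * 1 \<le> x * (2 / (1 + \<bar>t\<bar>))" if "x \<ge> 0" for x using that by (intro mult_left_mono)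
      from this[of "2 powr \<kappa> * (1 / \<alpha> + a powr (-\<kappa>))"] show ?thesis using \<alpha> by simp
    qed
    finally show ?thesis .
  qed
  moreover have "2 powr \<kappa> * X * (2 / Y) = 2 * 2 powr \<kappa> * X / Y" for X Y :: real by simp
  ultimately show ?thesis unfolding m_def r_def by metis
qed

locale class_C_function =
  fixes k :: real and f L :: "nat \<Rightarrow> complex"
  assumes k: "k > 0" and f1: "f 1 = 1" and Lambda: "is_Lambda_of f L"
    and L_le: "\<And>n. n \<ge> 2 \<Longrightarrow> norm (L n) \<le> k * mangoldt n"
begin

text \<open>Coefficients of log F, with value 0 at n = 1 because \<open>L 1 = 0\<close>.\<close>

definition l :: "nat \<Rightarrow> complex" where "l n = L n / of_real (ln (real n))"

abbreviation F :: "complex \<Rightarrow> complex" where "F \<equiv> dirichlet_series f"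

lemma Lambda_facts:
  assumes "Re s > 1"
  shows "dirichlet_abs_conv f s" "dirichlet_abs_conv L s" "dirichlet_abs_conv l s" "exp (dirichlet_series l s) = F s"
proof -
  note * = Lambda[unfolded is_Lambda_of_def, THEN conjunct2, rule_format, OF assms]
  show "dirichlet_abs_conv f s" "dirichlet_abs_conv L s" by (rule *[THEN conjunct1] *[THEN conjunct2, THEN conjunct1])+
  show "dirichlet_abs_conv l s" "exp (dirichlet_series l s) = F s"
    unfolding l_def by (rule *[THEN conjunct2, THEN conjunct2, THEN conjunct1]
      *[THEN conjunct2, THEN conjunct2, THEN conjunct2, THEN conjunct2])+
qed

lemma norm_L_le: "n \<ge> 1 \<Longrightarrow> norm (L n) \<le> k * mangoldt n"
proof (cases "n = 1")
  case True
  have "L 1 = 0" using Lambda unfolding is_Lambda_of_def by (rule conjunct1)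
  thus ?thesis using True by simp
next
  case False
  assume "n \<ge> 1"
  hence "n \<ge> 2" using False by simp
  thus ?thesis by (rule L_le)
qed

lemma norm_l_le: "n \<ge> 1 \<Longrightarrow> norm (l n) \<le> k * mangoldt_weight n"
  using norm_L_le[of n] by (simp add: l_def mangoldt_weight_def norm_divide divide_right_mono)

lemma F_nonzero: "Re s > 1 \<Longrightarrow> F s \<noteq> 0"
  using Lambda_facts(4)[of s] by (metis exp_not_eq_zero)

text \<open>With x = n^{-1-\<alpha>}, y = n^{-1-a} and w = n^{-it}, each difference of terms is (x -
  y) w - y (1 - w) times a coefficient. The first part sums to the logarithm of a ratio of zeta at
  real points, the second is the twist sum at a. Measuring the twist at a keeps its size independent
  of \<alpha>.\<close>

lemma norm_dirichlet_l_diff: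
  fixes \<alpha> a t :: real
  assumes \<alpha>: "0 < \<alpha>" "\<alpha> \<le> a" "a \<le> 1"
  shows "norm (dirichlet_series l (Complex (1 + \<alpha>) t) - dirichlet_series l (of_real (1 + a))) \<le>
    k * (ln (norm (zeta (of_real (1 + \<alpha>)))) - ln (norm (zeta (of_real (1 + a)))) +
      (4 / pi) * (ln (norm (zeta (of_real (1 + a)))) + ln (min 1 (a + \<bar>t\<bar>)) + 10 * ln (1 + ln (2 + \<bar>t\<bar>)) + twist_const))"
proof -
  define e where "e n = mangoldt_weight n / real n powr (1 + a) * norm (1 - cis (t * ln (real n)))" for n
  define E where "E = (4 / pi) * (ln (norm (zeta (of_real (1 + a)))) + ln (min 1 (a + \<bar>t\<bar>)) + 10 * ln (1 + ln (2 + \<bar>t\<bar>)) + twist_const)"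
  define g where "g n = mangoldt_weight n / real n powr (1 + \<alpha>) - mangoldt_weight n / real n powr (1 + a)" for n
  have e0: "e n \<ge> 0" for n using mangoldt_weight_bounds[of n] by (simp add: e_def)
  have eN: "sum e {..<N} \<le> E" for N
    unfolding e_def E_def using \<alpha> by (intro twist_sum_bound) auto
  have se: "summable e" by (rule summableI_nonneg_bounded[OF e0 eN])
  have gs: "g sums (ln (norm (zeta (of_real (1 + \<alpha>)))) - ln (norm (zeta (of_real (1 + a)))))"
    unfolding g_def using \<alpha> by (intro sums_diff ln_zeta_sums) auto
  define h where "h n = l n / of_nat n powr Complex (1 + \<alpha>) t - l n / of_nat n powr of_real (1 + a)" for n
  have hs: "h sums (dirichlet_series l (Complex (1 + \<alpha>) t) - dirichlet_series l (of_real (1 + a)))"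
    unfolding h_def using \<alpha> by (intro sums_diff dirichlet_series_sums Lambda_facts) auto
  have "norm (h n) \<le> k * (g n + e n)" for n
  proof (cases "n = 0")
    case True
    thus ?thesis by (simp add: h_def g_def e_def)
  next
    case False
    hence n: "n \<ge> 1" by simp
    define x y w where "x = 1 / real n powr (1 + \<alpha>)" and "y = 1 / real n powr (1 + a)"
      and "w = cis (- (t * ln (real n)))"
    have xy: "0 \<le> y" "y \<le> x" using \<alpha> n by (auto simp: x_def y_def intro!: divide_left_mono powr_mono)
    have "h n = l n * (1 / of_nat n powr Complex (1 + \<alpha>) t - 1 / of_nat n powr of_real (1 + a))"
      by (simp add: h_def algebra_simps)
    also have "1 / of_nat n powr Complex (1 + \<alpha>) t = of_real x * w"
      unfolding x_def w_def by (rule inverse_nat_powr_Complex[OF n])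
    also have "1 / of_nat n powr of_real (1 + a) = complex_of_real y"
      using inverse_nat_powr_Complex[OF n, of "1 + a" 0] by (simp add: y_def complex_of_real_def)
    also have "of_real x * w - of_real y = of_real (x - y) * w - of_real y * (1 - w)"
      by (simp add: algebra_simps)
    finally have "norm (h n) = norm (l n) * norm (of_real (x - y) * w - of_real y * (1 - w))"
      by (simp add: norm_mult)
    also have "\<dots> \<le> (k * mangoldt_weight n) * ((x - y) + y * norm (1 - w))"
    proof (intro mult_mono norm_l_le n)
      have "norm (of_real (x - y) * w) = x - y" "norm (of_real y * (1 - w)) = y * norm (1 - w)"
        using xy by (simp_all add: norm_mult w_def flip: of_real_diff)
      thus "norm (of_real (x - y) * w - of_real y * (1 - w)) \<le> (x - y) + y * norm (1 - w)"
        using norm_triangle_ineq4[of "of_real (x - y) * w" "of_real y * (1 - w)"] by simp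
    qed (use k mangoldt_weight_bounds in auto)
    also have "norm (1 - w) = norm (1 - cis (t * ln (real n)))"
    proof -
      have "1 - w = cnj (1 - cis (t * ln (real n)))" by (simp add: w_def cis_cnj)
      thus ?thesis by (simp only: complex_mod_cnj)
    qed
    also have "(k * mangoldt_weight n) * ((x - y) + y * norm (1 - cis (t * ln (real n)))) = k * (g n + e n)"
      by (simp add: g_def e_def x_def y_def algebra_simps)
    finally show ?thesis .
  qed
  hence "norm (suminf h) \<le> (\<Sum>n. k * (g n + e n))"
    by (intro norm_suminf_le summable_mult summable_add se sums_summable[OF gs])
  also have "\<dots> = k * (suminf g + suminf e)"
    by (simp add: suminf_mult summable_add se sums_summable[OF gs] suminf_add)
  also have "suminf e \<le> E" by (rule suminf_le_const[OF se]) (rule eN)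
  finally show ?thesis using hs gs k by (simp add: sums_iff E_def mult_left_mono)
qed

lemma norm_F_ratio:
  assumes \<alpha>: "0 < \<alpha>" "\<alpha> \<le> a" "a \<le> 1"
  defines "\<kappa> \<equiv> 4 * k / pi"
  shows "norm (F (Complex (1 + \<alpha>) t)) \<le> norm (F (of_real (1 + a))) * (364 powr k * (a / \<alpha>) powr k *
     ((14 * min 1 (a + \<bar>t\<bar>) / a) powr \<kappa> * (1 + ln (2 + \<bar>t\<bar>)) powr (10 * \<kappa>) * exp (\<kappa> * twist_const)))"
proof -
  define x y m B where "x = norm (zeta (of_real (1 + \<alpha>)))" and "y = norm (zeta (of_real (1 + a)))"
    and "m = min 1 (a + \<bar>t\<bar>)" and "B = 1 + ln (2 + \<bar>t\<bar>)"
  have pos: "x > 0" "y > 0" "m > 0" "B > 0" "\<kappa> > 0"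
    using \<alpha> zeta_nonzero[of "of_real (1 + \<alpha>)"] zeta_nonzero[of "of_real (1 + a)"] k
    by (auto simp: x_def y_def m_def B_def \<kappa>_def add_pos_nonneg)
  have x: "x \<le> 14 / \<alpha>" unfolding x_def using \<alpha> by (intro norm_zeta_real_bounds) auto
  have y: "y \<le> 14 / a" "1 / (26 * a) \<le> y" unfolding y_def using \<alpha> by (intro norm_zeta_real_bounds; simp)+
  define D where "D = dirichlet_series l (Complex (1 + \<alpha>) t) - dirichlet_series l (of_real (1 + a))"
  have "F (Complex (1 + \<alpha>) t) = F (of_real (1 + a)) * exp D"
    using Lambda_facts(4)[of "Complex (1 + \<alpha>) t"] Lambda_facts(4)[of "of_real (1 + a)"]
      F_nonzero[of "of_real (1 + a)"] \<alpha> by (simp add: D_def exp_diff)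
  hence "norm (F (Complex (1 + \<alpha>) t)) = norm (F (of_real (1 + a))) * exp (Re D)"
    by (simp add: norm_mult norm_exp)
  also have "exp (Re D) \<le> exp (norm D)" by (simp add: complex_Re_le_cmod)
  also have "norm D \<le> k * (ln x - ln y + (4 / pi) * (ln y + ln m + 10 * ln B + twist_const))"
    unfolding D_def x_def y_def m_def B_def by (rule norm_dirichlet_l_diff[OF \<alpha>])
  also have "\<dots> = k * ln (x / y) + \<kappa> * ln (y * m) + 10 * \<kappa> * ln B + \<kappa> * twist_const"
    using pos by (simp add: ln_div ln_mult \<kappa>_def algebra_simps add_divide_distrib)
  also have "exp \<dots> = (x / y) powr k * (y * m) powr \<kappa> * B powr (10 * \<kappa>) * exp (\<kappa> * twist_const)"
    using pos by (simp add: exp_add powr_def)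
  \<comment> \<open>364 = 14 * 26, from the upper bound 14/\<alpha> and the lower bound 1/(26 a) for
    zeta.\<close>
  also have "(x / y) powr k \<le> (364 * (a / \<alpha>)) powr k"
  proof (intro powr_mono2)
    have "x / y \<le> (14 / \<alpha>) / (1 / (26 * a))" using x y pos \<alpha> by (intro frac_le) auto
    thus "x / y \<le> 364 * (a / \<alpha>)" by simp
  qed (use pos k in auto)
  also have "(364 * (a / \<alpha>)) powr k = 364 powr k * (a / \<alpha>) powr k" by (rule powr_mult)
  also have "(y * m) powr \<kappa> \<le> (14 * m / a) powr \<kappa>"
  proof (intro powr_mono2)
    have "y * m \<le> 14 / a * m" using y pos by (intro mult_right_mono) auto
    thus "y * m \<le> 14 * m / a" by simp
  qed (use pos in auto)
  finally show ?thesis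
    by (simp add: m_def B_def mult_ac mult_left_mono mult_right_mono)
qed

text \<open>The power of the logarithm is absorbed by (1+|t|)^{1/4}. What remains is (1+|t|)^{-3/4},
  whose square is integrable, as the second moment requires.\<close>

lemma norm_F_div_le:
  assumes \<alpha>: "0 < \<alpha>" "\<alpha> \<le> a" "a \<le> 1"
  shows "norm (F (Complex (1 + \<alpha>) t) / Complex \<alpha> t) \<le> F_const k * norm (F (of_real (1 + a))) * (a / \<alpha>) powr k *
     (1 / \<alpha> + a powr (- 4 * k / pi)) * (1 + \<bar>t\<bar>) powr (-3/4)"
proof -
  define \<kappa> where "\<kappa> = 4 * k / pi"
  define q where "q = 1 / (40 * \<kappa>)"
  define c where "c = 1 + 2 powr q / q"
  define m B r where "m = min 1 (a + \<bar>t\<bar>)" and "B = 1 + ln (2 + \<bar>t\<bar>)" and "r = norm (Complex \<alpha> t)"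
  have \<kappa>: "\<kappa> > 0" and q: "q > 0" using k by (auto simp: \<kappa>_def q_def)
  have c: "c > 0" using q by (auto simp: c_def intro!: add_pos_nonneg)
  have r: "r > 0" using \<alpha> by (auto simp: r_def complex_eq_iff)
  have m: "m > 0" using \<alpha> by (auto simp: m_def)
  have "B \<le> c * (1 + \<bar>t\<bar>) powr q"
  proof -
    have "ln (2 + \<bar>t\<bar>) \<le> (2 + \<bar>t\<bar>) powr q / q" using q by (intro ln_le_powr) auto
    also have "\<dots> \<le> (2 * (1 + \<bar>t\<bar>)) powr q / q" using q by (intro divide_right_mono powr_mono2) auto
    also have "\<dots> = 2 powr q / q * (1 + \<bar>t\<bar>) powr q" by (subst powr_mult) auto
    finally have "ln (2 + \<bar>t\<bar>) \<le> 2 powr q / q * (1 + \<bar>t\<bar>) powr q" .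
    moreover have "1 \<le> (1 + \<bar>t\<bar>) powr q" using q by (intro ge_one_powr_ge_zero) auto
    ultimately show ?thesis by (simp add: B_def c_def algebra_simps)
  qed
  hence "B powr (10 * \<kappa>) \<le> (c * (1 + \<bar>t\<bar>) powr q) powr (10 * \<kappa>)"
    using \<kappa> by (intro powr_mono2) (auto simp: B_def)
  also have "\<dots> = c powr (10 * \<kappa>) * (1 + \<bar>t\<bar>) powr (1/4)"
    using \<kappa> c by (simp add: powr_mult powr_powr q_def)
  finally have B: "B powr (10 * \<kappa>) \<le> c powr (10 * \<kappa>) * (1 + \<bar>t\<bar>) powr (1/4)" .
  define X where "X = norm (F (of_real (1 + a))) * (364 powr k * (a / \<alpha>) powr k * (14 powr \<kappa> * exp (\<kappa> * twist_const)))"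
  have X: "X \<ge> 0" by (simp add: X_def)
  have "norm (F (Complex (1 + \<alpha>) t)) \<le> norm (F (of_real (1 + a))) * (364 powr k * (a / \<alpha>) powr k *
     ((14 * m / a) powr \<kappa> * B powr (10 * \<kappa>) * exp (\<kappa> * twist_const)))"
    unfolding \<kappa>_def m_def B_def by (rule norm_F_ratio[OF \<alpha>])
  also have "(14 * m / a) powr \<kappa> = 14 powr \<kappa> * (m / a) powr \<kappa>"
    using m \<alpha> by (simp add: powr_mult powr_divide)
  finally have "norm (F (Complex (1 + \<alpha>) t)) \<le> X * ((m / a) powr \<kappa> * B powr (10 * \<kappa>))"
    by (simp add: X_def mult_ac)
  also have "\<dots> \<le> X * ((m / a) powr \<kappa> * (c powr (10 * \<kappa>) * (1 + \<bar>t\<bar>) powr (1/4)))"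
    using X by (intro mult_left_mono B) auto
  finally have "norm (F (Complex (1 + \<alpha>) t)) / r \<le> X * ((m / a) powr \<kappa> * (c powr (10 * \<kappa>) * (1 + \<bar>t\<bar>) powr (1/4))) / r"
    using r by (intro divide_right_mono) auto
  also have "\<dots> = X * c powr (10 * \<kappa>) * (1 + \<bar>t\<bar>) powr (1/4) * ((m / a) powr \<kappa> / r)" by simp
  also have "\<dots> \<le> X * c powr (10 * \<kappa>) * (1 + \<bar>t\<bar>) powr (1/4) * (2 * 2 powr \<kappa> * (1 / \<alpha> + a powr (-\<kappa>)) / (1 + \<bar>t\<bar>))"
    unfolding m_def r_def using X by (intro mult_left_mono twist_factor_bound \<alpha> \<kappa>) auto
  also have "\<dots> = X * c powr (10 * \<kappa>) * (2 * 2 powr \<kappa> * (1 / \<alpha> + a powr (-\<kappa>))) * ((1 + \<bar>t\<bar>) powr (1/4) / (1 + \<bar>t\<bar>))"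
    by simp
  also have "(1 + \<bar>t\<bar>) powr (1/4) / (1 + \<bar>t\<bar>) = (1 + \<bar>t\<bar>) powr (-3/4)"
    using powr_diff[of "1 + \<bar>t\<bar>" "1/4" 1] by simp
  also have "X * c powr (10 * \<kappa>) * (2 * 2 powr \<kappa> * (1 / \<alpha> + a powr (-\<kappa>))) =
      F_const k * norm (F (of_real (1 + a))) * (a / \<alpha>) powr k * (1 / \<alpha> + a powr (-\<kappa>))"
  proof -
    have "F_const k = 364 powr k * 14 powr \<kappa> * exp (\<kappa> * twist_const) * c powr (10 * \<kappa>) * (2 * 2 powr \<kappa>)"
      by (simp only: F_const_def Let_def \<kappa>_def q_def c_def)
    thus ?thesis by (simp add: X_def mult_ac)
  qed
  finally show ?thesis by (simp add: norm_divide r_def \<kappa>_def)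
qed

end

section \<open>Plancherel's inequality and a mean value estimate\<close>

lemma gauss_integrable: "integrable lborel (\<lambda>x::real. exp (- x\<^sup>2 / 2))"
proof -
  have "integrable lborel (\<lambda>x. sqrt (2 * pi) * std_normal_density x)"
    by (intro integrable_mult_right integrable_normal_density) simp
  thus ?thesis by (simp add: std_normal_density_def)
qed

lemma gauss_fourier:
  "(\<integral>x. iexp (t * x) * of_real (exp (- x\<^sup>2 / 2)) \<partial>lborel) = of_real (sqrt (2 * pi) * exp (- t\<^sup>2 / 2))"
proof -
  have "of_real (exp (- t\<^sup>2 / 2)) = char std_normal_distribution t"
    by (simp add: char_std_normal_distribution)
  also have "\<dots> = (\<integral>x. std_normal_density x *\<^sub>R iexp (t * x) \<partial>lborel)"
    unfolding char_def by (subst integral_density) auto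
  also have "\<dots> = (\<integral>x. (1 / sqrt (2 * pi)) *\<^sub>R (iexp (t * x) * of_real (exp (- x\<^sup>2 / 2))) \<partial>lborel)"
    by (intro Bochner_Integration.integral_cong refl) (simp add: std_normal_density_def scaleR_conv_of_real mult_ac)
  also have "\<dots> = (1 / sqrt (2 * pi)) *\<^sub>R (\<integral>x. iexp (t * x) * of_real (exp (- x\<^sup>2 / 2)) \<partial>lborel)"
    by simp
  finally show ?thesis by (simp add: scaleR_conv_of_real field_simps)
qed

lemma gauss_integral: "(\<integral>x. exp (- x\<^sup>2 / 2) \<partial>lborel) = sqrt (2 * pi)"
proof -
  have "complex_of_real (\<integral>x. exp (- x\<^sup>2 / 2) \<partial>lborel) = of_real (sqrt (2 * pi))"
    using gauss_fourier[of 0] by (simp flip: integral_complex_of_real)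
  thus ?thesis by (simp only: of_real_eq_iff)
qed

lemma gauss_scaled_integrable:
  fixes c :: real assumes "c \<noteq> 0" shows "integrable lborel (\<lambda>x. exp (- (c * x)\<^sup>2 / 2))"
  using lborel_integrable_real_affine[OF gauss_integrable assms, of 0] by simp

lemma gauss_shifted_integrable:
  "integrable lborel (\<lambda>x::real. exp (- (x - \<tau>)\<^sup>2 / 2))"
  using lborel_integrable_real_affine[OF gauss_integrable, of 1 "-\<tau>"] by simp

lemma gauss_fourier_scaled:
  fixes d :: real assumes d: "d > 0"
  shows "(\<integral>t. iexp (w * t) * of_real (exp (- (d * t)\<^sup>2 / 2)) \<partial>lborel) = of_real (sqrt (2 * pi) / d * exp (- (w / d)\<^sup>2 / 2))"
proof -
  have "of_real (sqrt (2 * pi) * exp (- (w / d)\<^sup>2 / 2)) = (\<integral>x. iexp ((w / d) * x) * of_real (exp (- x\<^sup>2 / 2)) \<partial>lborel)"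
    by (rule gauss_fourier[symmetric])
  also have "\<dots> = d *\<^sub>R (\<integral>x. iexp ((w / d) * (0 + d * x)) * of_real (exp (- (0 + d * x)\<^sup>2 / 2)) \<partial>lborel)"
    using d by (subst lborel_integral_real_affine[of d _ 0]) auto
  also have "(\<lambda>x. iexp ((w / d) * (0 + d * x)) * of_real (exp (- (0 + d * x)\<^sup>2 / 2)))
      = (\<lambda>t. iexp (w * t) * of_real (exp (- (d * t)\<^sup>2 / 2)))"
    using d by (intro ext) simp
  finally show ?thesis using d by (simp add: scaleR_conv_of_real field_simps)
qed

lemma gauss_fourier_shifted:
  "norm (\<integral>t. iexp (w * t) * of_real (exp (- (t - \<tau>)\<^sup>2 / 2)) \<partial>lborel) = sqrt (2 * pi) * exp (- w\<^sup>2 / 2)"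
proof -
  have "(\<integral>t. iexp (w * t) * of_real (exp (- (t - \<tau>)\<^sup>2 / 2)) \<partial>lborel)
      = (\<integral>t. iexp (w * (\<tau> + 1 * t)) * of_real (exp (- (\<tau> + 1 * t - \<tau>)\<^sup>2 / 2)) \<partial>lborel)"
    by (subst lborel_integral_real_affine[of 1 _ \<tau>]) auto
  also have "\<dots> = (\<integral>t. iexp (w * \<tau>) * (iexp (w * t) * of_real (exp (- t\<^sup>2 / 2))) \<partial>lborel)"
    by (intro Bochner_Integration.integral_cong refl) (simp add: exp_add[symmetric] distrib_left algebra_simps)
  also have "\<dots> = iexp (w * \<tau>) * of_real (sqrt (2 * pi) * exp (- w\<^sup>2 / 2))"
    by (subst integral_mult_right_zero) (simp only: gauss_fourier)
  finally show ?thesis by (simp add: norm_mult)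
qed

text \<open>Domination by a product of two integrable functions is the form in which the exchange of
  integrals occurs in Plancherel's inequality.\<close>

lemma fubini_product_bound:
  fixes f :: "real \<times> real \<Rightarrow> complex"
  assumes f [measurable]: "f \<in> borel_measurable (borel \<Otimes>\<^sub>M borel)"
    and a: "integrable lborel a" and b: "integrable lborel b"
    and le: "\<And>x y. norm (f (x, y)) \<le> a x * b y"
  shows "(\<integral>x. (\<integral>y. f (x, y) \<partial>lborel) \<partial>lborel) = (\<integral>y. (\<integral>x. f (x, y) \<partial>lborel) \<partial>lborel)"
    and "\<And>x. integrable lborel (\<lambda>y. f (x, y))"
proof -
  have [measurable]: "f \<in> borel_measurable (lborel \<Otimes>\<^sub>M lborel)"
    using f by (subst measurable_cong_sets[OF sets_pair_measure_cong[OF sets_lborel sets_lborel] refl])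
  show int: "integrable lborel (\<lambda>y. f (x, y))" for x
    by (rule Bochner_Integration.integrable_bound[OF integrable_mult_right[OF b, of "a x"]])
       (auto intro!: AE_I2 order.trans[OF le])
  have "integrable (lborel \<Otimes>\<^sub>M lborel) f"
  proof (rule lborel_pair.Fubini_integrable)
    show "integrable lborel (\<lambda>x. \<integral>y. norm (f (x, y)) \<partial>lborel)"
    proof (rule Bochner_Integration.integrable_bound[OF integrable_mult_left[OF a, of "\<integral>y. b y \<partial>lborel"]])
      have "(\<integral>y. norm (f (x, y)) \<partial>lborel) \<le> (\<integral>y. a x * b y \<partial>lborel)" for x
        by (intro integral_mono integrable_norm int integrable_mult_right b le)
      thus "AE x in lborel. norm (\<integral>y. norm (f (x, y)) \<partial>lborel) \<le> norm (a x * (\<integral>y. b y \<partial>lborel))"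
        by (intro AE_I2) (simp, smt (verit))
    qed measurable
  qed (use int in auto)
  from lborel_pair.Fubini_integral[of "\<lambda>x y. f (x, y)"] this
  show "(\<integral>x. (\<integral>y. f (x, y) \<partial>lborel) \<partial>lborel) = (\<integral>y. (\<integral>x. f (x, y) \<partial>lborel) \<partial>lborel)"
    by simp
qed

text \<open>Gaussian summation: the integral of |H|^2 against exp(-(\<delta> t)^2 / 2) is at most c,
  and by Fubini it is a correlation of h with Gaussian averages of itself at scale \<delta>. As
  \<delta> tends to 0, dominated convergence yields 2 pi times the integral of |h|^2; boundedness of
  h supplies the majorant, continuity almost everywhere the pointwise limit.\<close>

theorem plancherel_inequality:
  fixes h :: "real \<Rightarrow> complex"
  assumes h: "integrable lborel h" and B: "\<And>u. norm (h u) \<le> B"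
    and cont: "AE u in lborel. isCont h u"
    and c: "(\<integral>\<^sup>+t. ennreal ((norm (\<integral>u. h u * iexp (- (t * u)) \<partial>lborel))\<^sup>2) \<partial>lborel) \<le> ennreal c" "c \<ge> 0"
  shows "integrable lborel (\<lambda>u. (norm (h u))\<^sup>2)" "(\<integral>u. (norm (h u))\<^sup>2 \<partial>lborel) \<le> c / (2 * pi)"
proof -
  have [measurable]: "h \<in> borel_measurable borel" using borel_measurable_integrable[OF h] by simp
  have B0: "B \<ge> 0" using B[of 0] norm_ge_zero order.trans by blast
  show int2: "integrable lborel (\<lambda>u. (norm (h u))\<^sup>2)"
    by (rule Bochner_Integration.integrable_bound[OF integrable_mult_right[OF integrable_norm[OF h], of B]])
       (auto intro!: AE_I2 simp: power2_eq_square abs_mult B0 intro: mult_right_mono B)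
  define H where "H t = (\<integral>u. h u * iexp (- (t * u)) \<partial>lborel)" for t
  have [measurable]: "H \<in> borel_measurable borel" unfolding H_def by measurable
  define I where "I = (\<integral>u. norm (h u) \<partial>lborel)"
  have I0: "I \<ge> 0" unfolding I_def by (rule Bochner_Integration.integral_nonneg) simp
  have HI: "norm (H t) \<le> I" for t
  proof -
    have "norm (H t) \<le> (\<integral>u. norm (h u * iexp (- (t * u))) \<partial>lborel)" unfolding H_def by (rule integral_norm_bound)
    thus ?thesis by (simp add: norm_mult I_def)
  qed
  define g where "g \<delta> t = exp (- (\<delta> * t)\<^sup>2 / 2)" for \<delta> t :: real
  have [measurable]: "g \<delta> \<in> borel_measurable borel" for \<delta> unfolding g_def by measurable
  have g0: "g \<delta> t > 0" for \<delta> t by (simp add: g_def)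
  have cnj_meas: "cnj \<in> borel_measurable borel" by (intro borel_measurable_continuous_onI continuous_intros)
  have [measurable]: "(\<lambda>x. cnj (H (fst x))) \<in> borel_measurable (borel \<Otimes>\<^sub>M borel)"
    by (rule measurable_compose[OF _ cnj_meas]) measurable
  have [measurable]: "(\<lambda>x. cnj (h (snd x))) \<in> borel_measurable (borel \<Otimes>\<^sub>M borel)"
    by (rule measurable_compose[OF _ cnj_meas]) measurable
  have "(\<lambda>x. complex_of_real (g \<delta> x)) \<in> borel_measurable borel" for \<delta>
    unfolding g_def by (intro borel_measurable_continuous_onI continuous_intros) auto
  hence [measurable]: "(\<lambda>x. complex_of_real (g \<delta> (fst x))) \<in> borel_measurable (borel \<Otimes>\<^sub>M borel)" for \<delta>
    by (rule measurable_compose[OF measurable_fst])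
  have [measurable]: "(\<lambda>w. cnj (h (u + \<delta> * w))) \<in> borel_measurable borel" for u \<delta>
    by (rule measurable_compose[OF _ cnj_meas]) measurable
  define A where "A \<delta> = (\<integral>t. (norm (H t))\<^sup>2 * g \<delta> t \<partial>lborel)" for \<delta>
  \<comment> \<open>An unnormalised Gaussian average of the conjugate of h around u; the
    substitution v = u + \<delta> w has moved the scale from the kernel into the argument.\<close>
  define K where "K \<delta> u = (\<integral>w. cnj (h (u + \<delta> * w)) * of_real (g 1 w) \<partial>lborel)" for \<delta> u
  have key: "of_real (A \<delta>) = of_real (sqrt (2 * pi)) * (\<integral>u. h u * K \<delta> u \<partial>lborel)" if \<delta>: "\<delta> > 0" for \<delta>
  proof -
    have gi: "integrable lborel (g \<delta>)" unfolding g_def using \<delta> by (intro gauss_scaled_integrable) auto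
    have "complex_of_real (A \<delta>) = (\<integral>t. complex_of_real ((norm (H t))\<^sup>2 * g \<delta> t) \<partial>lborel)"
      unfolding A_def by (rule integral_complex_of_real[symmetric])
    also have "\<dots> = (\<integral>t. (\<integral>u. h u * iexp (- (t * u)) * (cnj (H t) * of_real (g \<delta> t)) \<partial>lborel) \<partial>lborel)"
    proof (intro Bochner_Integration.integral_cong refl)
      fix t
      have "complex_of_real ((norm (H t))\<^sup>2 * g \<delta> t) = H t * (cnj (H t) * of_real (g \<delta> t))"
        by (simp add: complex_norm_square mult_ac flip: of_real_power)
      also have "H t * (cnj (H t) * of_real (g \<delta> t)) = (\<integral>u. h u * iexp (- (t * u)) * (cnj (H t) * of_real (g \<delta> t)) \<partial>lborel)"
        unfolding H_def by (rule integral_mult_left_zero[symmetric])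
      finally show "complex_of_real ((norm (H t))\<^sup>2 * g \<delta> t) = \<dots>" .
    qed
    also have "\<dots> = (\<integral>u. (\<integral>t. h u * iexp (- (t * u)) * (cnj (H t) * of_real (g \<delta> t)) \<partial>lborel) \<partial>lborel)"
    proof -
      have "norm (h u * iexp (- (t * u)) * (cnj (H t) * of_real (g \<delta> t))) \<le> (I * g \<delta> t) * norm (h u)" for t u
        using HI[of t] g0[of \<delta> t] by (simp add: norm_mult mult_ac mult_right_mono)
      moreover have "(\<lambda>(t, u). h u * iexp (- (t * u)) * (cnj (H t) * of_real (g \<delta> t))) \<in> borel_measurable (borel \<Otimes>\<^sub>M borel)"
        by measurable
      ultimately show ?thesis
        using fubini_product_bound(1)[of "\<lambda>(t, u). h u * iexp (- (t * u)) * (cnj (H t) * of_real (g \<delta> t))"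
            "\<lambda>t. I * g \<delta> t" "\<lambda>u. norm (h u)"] h gi by simp
    qed
    also have "\<dots> = (\<integral>u. h u * (of_real (sqrt (2 * pi)) * K \<delta> u) \<partial>lborel)"
    proof (intro Bochner_Integration.integral_cong refl)
      fix u
      have "(\<integral>t. h u * iexp (- (t * u)) * (cnj (H t) * of_real (g \<delta> t)) \<partial>lborel)
          = h u * (\<integral>t. iexp (- (t * u)) * (cnj (H t) * of_real (g \<delta> t)) \<partial>lborel)"
        by (subst integral_mult_right_zero[symmetric]) (simp only: mult.assoc)
      also have "(\<integral>t. iexp (- (t * u)) * (cnj (H t) * of_real (g \<delta> t)) \<partial>lborel)
          = (\<integral>t. (\<integral>v. cnj (h v) * (iexp ((v - u) * t) * of_real (g \<delta> t)) \<partial>lborel) \<partial>lborel)"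
      proof (intro Bochner_Integration.integral_cong refl)
        fix t
        have "cnj (H t) = (\<integral>v. cnj (h v * iexp (- (t * v))) \<partial>lborel)"
          unfolding H_def by (rule integral_bounded_linear'[OF bounded_linear_cnj bounded_linear_cnj, symmetric]) simp
        also have "\<dots> = (\<integral>v. cnj (h v) * iexp (t * v) \<partial>lborel)"
          by (intro Bochner_Integration.integral_cong refl) (simp add: exp_cnj)
        finally have eq: "cnj (H t) = (\<integral>v. cnj (h v) * iexp (t * v) \<partial>lborel)" .
        have "iexp (- (t * u)) * (cnj (H t) * of_real (g \<delta> t)) = cnj (H t) * (iexp (- (t * u)) * of_real (g \<delta> t))"
          by (simp only: mult_ac)
        also have "\<dots> = (\<integral>v. (cnj (h v) * iexp (t * v)) * (iexp (- (t * u)) * of_real (g \<delta> t)) \<partial>lborel)"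
          unfolding eq by (rule integral_mult_left_zero[symmetric])
        also have "\<dots> = (\<integral>v. cnj (h v) * (iexp ((v - u) * t) * of_real (g \<delta> t)) \<partial>lborel)"
          by (intro Bochner_Integration.integral_cong refl) (simp add: exp_diff exp_minus field_simps)
        finally show "iexp (- (t * u)) * (cnj (H t) * of_real (g \<delta> t)) = \<dots>" .
      qed
      also have "\<dots> = (\<integral>v. (\<integral>t. cnj (h v) * (iexp ((v - u) * t) * of_real (g \<delta> t)) \<partial>lborel) \<partial>lborel)"
      proof -
        have "norm (cnj (h v) * (iexp ((v - u) * t) * of_real (g \<delta> t))) \<le> g \<delta> t * norm (h v)" for t v
          using g0[of \<delta> t] by (simp add: norm_mult mult_ac)
        moreover have "(\<lambda>(t, v). cnj (h v) * (iexp ((v - u) * t) * of_real (g \<delta> t))) \<in> borel_measurable (borel \<Otimes>\<^sub>M borel)"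
          by measurable
        ultimately show ?thesis
          using fubini_product_bound(1)[of "\<lambda>(t, v). cnj (h v) * (iexp ((v - u) * t) * of_real (g \<delta> t))"
            "\<lambda>t. g \<delta> t" "\<lambda>u. norm (h u)"] h gi by simp
      qed
      also have "\<dots> = (\<integral>v. cnj (h v) * of_real (sqrt (2 * pi) / \<delta> * exp (- ((v - u) / \<delta>)\<^sup>2 / 2)) \<partial>lborel)"
        unfolding g_def by (simp only: integral_mult_right_zero gauss_fourier_scaled[OF \<delta>])
      also have "\<dots> = \<delta> *\<^sub>R (\<integral>w. cnj (h (u + \<delta> * w)) * of_real (sqrt (2 * pi) / \<delta> * exp (- ((u + \<delta> * w - u) / \<delta>)\<^sup>2 / 2)) \<partial>lborel)"
        using \<delta> by (subst lborel_integral_real_affine[of \<delta> _ u]) auto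
      also have "\<dots> = \<delta> *\<^sub>R (\<integral>w. of_real (sqrt (2 * pi) / \<delta>) * (cnj (h (u + \<delta> * w)) * of_real (g 1 w)) \<partial>lborel)"
        using \<delta> by (simp add: g_def mult_ac)
      also have "\<dots> = \<delta> *\<^sub>R (of_real (sqrt (2 * pi) / \<delta>) * K \<delta> u)"
        unfolding K_def by (simp only: integral_mult_right_zero)
      also have "\<dots> = of_real (sqrt (2 * pi)) * K \<delta> u" using \<delta> by (simp add: scaleR_conv_of_real)
      finally show "(\<integral>t. h u * iexp (- (t * u)) * (cnj (H t) * of_real (g \<delta> t)) \<partial>lborel) = h u * (of_real (sqrt (2 * pi)) * K \<delta> u)" .
    qed
    also have "\<dots> = (\<integral>u. of_real (sqrt (2 * pi)) * (h u * K \<delta> u) \<partial>lborel)" by (simp only: mult.left_commute)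
    also have "\<dots> = of_real (sqrt (2 * pi)) * (\<integral>u. h u * K \<delta> u \<partial>lborel)" by (rule integral_mult_right_zero)
    finally show ?thesis .
  qed
  have Ac: "A \<delta> \<le> c" if \<delta>: "\<delta> > 0" for \<delta>
  proof -
    have gi: "integrable lborel (g \<delta>)" unfolding g_def using \<delta> by (intro gauss_scaled_integrable) auto
    have "integrable lborel (\<lambda>t. (norm (H t))\<^sup>2 * g \<delta> t)"
      by (rule Bochner_Integration.integrable_bound[OF integrable_mult_right[OF gi, of "I\<^sup>2"]])
         (use HI g0 I0 in \<open>auto intro!: AE_I2 mult_right_mono power_mono simp: less_imp_le abs_mult\<close>)
    hence "ennreal (A \<delta>) = (\<integral>\<^sup>+t. ennreal ((norm (H t))\<^sup>2 * g \<delta> t) \<partial>lborel)"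
      unfolding A_def using g0 by (intro nn_integral_eq_integral[symmetric]) (auto simp: less_imp_le)
    also have "\<dots> \<le> (\<integral>\<^sup>+t. ennreal ((norm (H t))\<^sup>2) \<partial>lborel)"
      by (intro nn_integral_mono ennreal_leI mult_left_le) (auto simp: g_def)
    also have "\<dots> \<le> ennreal c" using c(1) by (simp only: H_def)
    finally show ?thesis using c(2) by (simp add: ennreal_le_iff)
  qed
  define d where "d n = 1 / real (Suc n)" for n
  have d: "d n > 0" for n by (simp add: d_def)
  have dlim: "d \<longlonglongrightarrow> 0" unfolding d_def using LIMSEQ_inverse_real_of_nat by (simp add: inverse_eq_divide)
  have g1: "integrable lborel (g 1)" unfolding g_def by (intro gauss_scaled_integrable) auto
  have Kbound: "norm (K \<delta> u) \<le> B * sqrt (2 * pi)" for \<delta> u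
  proof -
    have "norm (K \<delta> u) \<le> (\<integral>w. norm (cnj (h (u + \<delta> * w)) * of_real (g 1 w)) \<partial>lborel)"
      unfolding K_def by (rule integral_norm_bound)
    also have "\<dots> \<le> (\<integral>w. B * g 1 w \<partial>lborel)"
    proof (rule integral_mono)
      have le: "norm (cnj (h (u + \<delta> * w)) * of_real (g 1 w)) \<le> B * g 1 w" for w
        using g0[of 1 w] B by (simp add: norm_mult mult_right_mono)
      show "integrable lborel (\<lambda>w. B * g 1 w)" using g1 by simp
      show "integrable lborel (\<lambda>w. norm (cnj (h (u + \<delta> * w)) * of_real (g 1 w)))"
        by (rule integrable_norm, rule Bochner_Integration.integrable_bound[OF integrable_mult_right[OF g1, of B]])
           (use le in \<open>auto intro!: AE_I2 intro: order.trans[OF _ abs_ge_self]\<close>)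
      show "norm (cnj (h (u + \<delta> * w)) * of_real (g 1 w)) \<le> B * g 1 w" for w by (rule le)
    qed
    also have "\<dots> = B * sqrt (2 * pi)" using gauss_integral by (simp add: g_def)
    finally show ?thesis .
  qed
  have "(\<lambda>n. \<integral>u. h u * K (d n) u \<partial>lborel) \<longlonglongrightarrow> (\<integral>u. h u * (cnj (h u) * of_real (sqrt (2 * pi))) \<partial>lborel)"
  proof (rule integral_dominated_convergence[where w = "\<lambda>u. norm (h u) * (B * sqrt (2 * pi))"])
    show "integrable lborel (\<lambda>u. norm (h u) * (B * sqrt (2 * pi)))" using h by simp
    show "AE u in lborel. norm (h u * K (d n) u) \<le> norm (h u) * (B * sqrt (2 * pi))" for n
      by (intro AE_I2) (simp only: norm_mult, intro mult_left_mono Kbound norm_ge_zero)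
    show "AE u in lborel. (\<lambda>n. h u * K (d n) u) \<longlonglongrightarrow> h u * (cnj (h u) * of_real (sqrt (2 * pi)))"
      using cont
    proof eventually_elim
      case (elim u)
      have "(\<lambda>n. K (d n) u) \<longlonglongrightarrow> (\<integral>w. cnj (h u) * of_real (g 1 w) \<partial>lborel)"
        unfolding K_def
      proof (rule integral_dominated_convergence[where w = "\<lambda>w. B * g 1 w"])
        show "AE w in lborel. (\<lambda>n. cnj (h (u + d n * w)) * of_real (g 1 w)) \<longlonglongrightarrow> cnj (h u) * of_real (g 1 w)"
        proof (intro AE_I2 tendsto_intros)
          fix w
          have "(\<lambda>n. u + d n * w) \<longlonglongrightarrow> u + 0 * w" by (intro tendsto_intros dlim)
          thus "(\<lambda>n. h (u + d n * w)) \<longlonglongrightarrow> h u" using isCont_tendsto_compose[OF elim] by simp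
        qed
        show "AE w in lborel. norm (cnj (h (u + d n * w)) * of_real (g 1 w)) \<le> B * g 1 w" for n
          using g0[of 1] B by (intro AE_I2) (auto simp: norm_mult mult_right_mono less_imp_le)
        show "(\<lambda>w. cnj (h (u + d n * w)) * of_real (g 1 w)) \<in> borel_measurable lborel" for n
          by measurable
      qed (use g1 in auto)
      also have "(\<integral>w. cnj (h u) * of_real (g 1 w) \<partial>lborel) = cnj (h u) * of_real (sqrt (2 * pi))"
        using gauss_integral by (simp add: g_def)
      finally show ?case by (intro tendsto_intros)
    qed
    show "(\<lambda>u. h u * (cnj (h u) * of_real (sqrt (2 * pi)))) \<in> borel_measurable lborel"
      using measurable_compose[OF \<open>h \<in> borel_measurable borel\<close> cnj_meas]
      by (intro borel_measurable_times) auto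
    show "(\<lambda>u. h u * K (d n) u) \<in> borel_measurable lborel" for n
    proof (intro borel_measurable_times)
      have "(\<lambda>(u, w). cnj (h (u + d n * w)) * of_real (g 1 w)) \<in> borel_measurable (lborel \<Otimes>\<^sub>M lborel)"
      proof -
        have "(\<lambda>x. cnj (h (fst x + d n * snd x))) \<in> borel_measurable (lborel \<Otimes>\<^sub>M lborel)"
          by (rule measurable_compose[OF _ cnj_meas]) measurable
        moreover have "(\<lambda>x. complex_of_real (g 1 (snd x))) \<in> borel_measurable (lborel \<Otimes>\<^sub>M lborel)"
          by measurable
        ultimately show ?thesis unfolding case_prod_beta by (rule borel_measurable_times)
      qed
      thus "K (d n) \<in> borel_measurable lborel"
        unfolding K_def by (rule lborel.borel_measurable_lebesgue_integral)
    qed auto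
  qed
  hence "(\<lambda>n. of_real (sqrt (2 * pi)) * (\<integral>u. h u * K (d n) u \<partial>lborel)) \<longlonglongrightarrow>
      of_real (sqrt (2 * pi)) * (\<integral>u. h u * (cnj (h u) * of_real (sqrt (2 * pi))) \<partial>lborel)"
    by (intro tendsto_intros)
  also have "(\<integral>u. h u * (cnj (h u) * of_real (sqrt (2 * pi))) \<partial>lborel)
      = (\<integral>u. complex_of_real (sqrt (2 * pi) * (norm (h u))\<^sup>2) \<partial>lborel)"
    by (intro Bochner_Integration.integral_cong refl) (simp add: complex_norm_square mult_ac flip: of_real_power)
  also have "\<dots> = of_real (sqrt (2 * pi) * (\<integral>u. (norm (h u))\<^sup>2 \<partial>lborel))"
    by (subst integral_complex_of_real) simp
  also have "of_real (sqrt (2 * pi)) * \<dots> = complex_of_real (2 * pi * (\<integral>u. (norm (h u))\<^sup>2 \<partial>lborel))"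
    by (simp flip: of_real_mult)
  finally have "(\<lambda>n. complex_of_real (A (d n))) \<longlonglongrightarrow> of_real (2 * pi * (\<integral>u. (norm (h u))\<^sup>2 \<partial>lborel))"
    using key[OF d] by simp
  hence "(\<lambda>n. A (d n)) \<longlonglongrightarrow> 2 * pi * (\<integral>u. (norm (h u))\<^sup>2 \<partial>lborel)"
    by (simp only: tendsto_of_real_iff)
  hence "2 * pi * (\<integral>u. (norm (h u))\<^sup>2 \<partial>lborel) \<le> c"
    using Ac[OF d] by (intro LIMSEQ_le_const2) auto
  thus "(\<integral>u. (norm (h u))\<^sup>2 \<partial>lborel) \<le> c / (2 * pi)" by (simp add: field_simps)
qed

text \<open>Expanding the square, each pair of terms meets the Fourier transform of a Gaussian at
  the difference of its frequencies. The centre \<tau> only rotates the phase, so the bound is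
  uniform in it.\<close>

lemma finite_dirichlet_mean_square:
  fixes a :: "nat \<Rightarrow> complex" and v :: "nat \<Rightarrow> real"
  assumes A: "finite A"
  shows "(\<integral>\<^sup>+t. ennreal ((norm (\<Sum>n\<in>A. a n * iexp (- (t * v n))))\<^sup>2 * exp (- (t - \<tau>)\<^sup>2 / 2)) \<partial>lborel)
     \<le> ennreal (sqrt (2 * pi) * (\<Sum>m\<in>A. \<Sum>n\<in>A. norm (a m) * norm (a n) * exp (- (v m - v n)\<^sup>2 / 2)))"
proof -
  define g where "g t = exp (- (t - \<tau>)\<^sup>2 / 2)" for t :: real
  have g: "integrable lborel g" unfolding g_def by (rule gauss_shifted_integrable)
  have [measurable]: "g \<in> borel_measurable borel" unfolding g_def by measurable
  define D where "D t = (\<Sum>n\<in>A. a n * iexp (- (t * v n)))" for t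
  have [measurable]: "D \<in> borel_measurable borel" unfolding D_def by measurable
  have Db: "norm (D t) \<le> (\<Sum>n\<in>A. norm (a n))" for t
    unfolding D_def by (intro sum_norm_le) (simp add: norm_mult)
  have int: "integrable lborel (\<lambda>t. (norm (D t))\<^sup>2 * g t)"
    by (rule Bochner_Integration.integrable_bound[OF integrable_mult_right[OF g, of "(\<Sum>n\<in>A. norm (a n))\<^sup>2"]])
       (use Db in \<open>auto intro!: AE_I2 mult_right_mono power_mono simp: g_def abs_mult\<close>)
  have inte: "integrable lborel (\<lambda>t. iexp (w * t) * of_real (g t))" for w
    by (rule Bochner_Integration.integrable_bound[OF g]) (auto intro!: AE_I2 simp: norm_mult)
  have "complex_of_real (\<integral>t. (norm (D t))\<^sup>2 * g t \<partial>lborel) = (\<integral>t. complex_of_real ((norm (D t))\<^sup>2 * g t) \<partial>lborel)"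
    by (rule integral_complex_of_real[symmetric])
  also have "\<dots> = (\<integral>t. (\<Sum>m\<in>A. \<Sum>n\<in>A. (a m * cnj (a n)) * (iexp ((v n - v m) * t) * of_real (g t))) \<partial>lborel)"
  proof (intro Bochner_Integration.integral_cong refl)
    fix t
    have "of_real ((norm (D t))\<^sup>2 * g t) = D t * cnj (D t) * of_real (g t)"
      by (simp add: complex_norm_square flip: of_real_power)
    also have "\<dots> = (\<Sum>m\<in>A. \<Sum>n\<in>A. (a m * iexp (- (t * v m))) * cnj (a n * iexp (- (t * v n))) * of_real (g t))"
      unfolding D_def cnj_sum sum_product by (simp only: sum_distrib_right)
    also have "\<dots> = (\<Sum>m\<in>A. \<Sum>n\<in>A. (a m * cnj (a n)) * (iexp ((v n - v m) * t) * of_real (g t)))"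
      by (intro sum.cong refl) (simp add: exp_cnj exp_diff exp_minus left_diff_distrib right_diff_distrib field_simps)
    finally show "of_real ((norm (D t))\<^sup>2 * g t) = \<dots>" .
  qed
  also have "\<dots> = (\<Sum>m\<in>A. \<Sum>n\<in>A. (a m * cnj (a n)) * (\<integral>t. iexp ((v n - v m) * t) * of_real (g t) \<partial>lborel))"
    by (subst Bochner_Integration.integral_sum, intro Bochner_Integration.integrable_sum integrable_mult_right inte,
        intro sum.cong refl, subst Bochner_Integration.integral_sum, intro integrable_mult_right inte, simp)
  finally have eq: "complex_of_real (\<integral>t. (norm (D t))\<^sup>2 * g t \<partial>lborel) =
      (\<Sum>m\<in>A. \<Sum>n\<in>A. (a m * cnj (a n)) * (\<integral>t. iexp ((v n - v m) * t) * of_real (g t) \<partial>lborel))" .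
  have "norm (\<integral>t. (norm (D t))\<^sup>2 * g t \<partial>lborel) = norm (complex_of_real (\<integral>t. (norm (D t))\<^sup>2 * g t \<partial>lborel))"
    by (simp only: norm_of_real real_norm_def)
  also have "\<dots> \<le> (\<Sum>m\<in>A. \<Sum>n\<in>A. norm (a m * cnj (a n)) * norm (\<integral>t. iexp ((v n - v m) * t) * of_real (g t) \<partial>lborel))"
    unfolding eq by (intro sum_norm_le) (simp add: norm_mult)
  also have "\<dots> = sqrt (2 * pi) * (\<Sum>m\<in>A. \<Sum>n\<in>A. norm (a m) * norm (a n) * exp (- (v m - v n)\<^sup>2 / 2))"
    unfolding g_def gauss_fourier_shifted
    by (simp add: sum_distrib_left norm_mult mult_ac power2_commute)
  finally have "norm (\<integral>t. (norm (D t))\<^sup>2 * g t \<partial>lborel) \<le>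
      sqrt (2 * pi) * (\<Sum>m\<in>A. \<Sum>n\<in>A. norm (a m) * norm (a n) * exp (- (v m - v n)\<^sup>2 / 2))" .
  hence "(\<integral>t. (norm (D t))\<^sup>2 * g t \<partial>lborel) \<le>
      sqrt (2 * pi) * (\<Sum>m\<in>A. \<Sum>n\<in>A. norm (a m) * norm (a n) * exp (- (v m - v n)\<^sup>2 / 2))"
    using abs_ge_self order.trans unfolding real_norm_def by blast
  moreover have "(\<integral>\<^sup>+t. ennreal ((norm (D t))\<^sup>2 * g t) \<partial>lborel) = ennreal (\<integral>t. (norm (D t))\<^sup>2 * g t \<partial>lborel)"
    by (rule nn_integral_eq_integral[OF int]) (simp add: g_def)
  ultimately show ?thesis unfolding D_def g_def by (simp add: ennreal_leI)
qed

text \<open>Geometric series of ratio 1/e on either side of M, each at most 2; rounding M to an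
  integer costs a factor e, and 12 = 3 * 4.\<close>

lemma sum_exp_minus_abs_le:
  fixes M :: real assumes "M \<ge> 0"
  shows "summable (\<lambda>j. exp (- \<bar>M - real j\<bar>))" "(\<Sum>j. exp (- \<bar>M - real j\<bar>)) \<le> 12"
proof -
  define J where "J = nat \<lfloor>M\<rfloor>"
  have J: "real J \<le> M" "M \<le> real J + 1" using assms by (auto simp: J_def)
  define q where "q = exp (-1 :: real)"
  have q: "0 < q" "q \<le> 1/2"
  proof -
    have "2 \<le> exp (1::real)" using exp_ge_add_one_self[of "1::real"] by simp
    thus "0 < q" "q \<le> 1/2" unfolding q_def exp_minus by (simp_all add: field_simps)
  qed
  have qp: "exp (- real j) = q ^ j" for j by (simp add: q_def flip: exp_of_nat_mult)
  have gs: "summable (\<lambda>j. q ^ j)" "(\<Sum>j. q ^ j) \<le> 2"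
  proof -
    show "summable (\<lambda>j. q ^ j)" using q by (intro summable_geometric) auto
    have "(\<Sum>j. q ^ j) = 1 / (1 - q)" using q by (intro suminf_geometric) auto
    also have "\<dots> \<le> 1 / (1/2)" using q by (intro divide_left_mono) auto
    finally show "(\<Sum>j. q ^ j) \<le> 2" by simp
  qed
  define f where "f j = (if j < J then q ^ (J - j) else q ^ (j - J))" for j
  have le: "exp (- \<bar>M - real j\<bar>) \<le> exp 1 * f j" for j
  proof (cases "j < J")
    case True
    have "- \<bar>M - real j\<bar> \<le> 1 + - real (J - j)" using J True by (simp add: of_nat_diff)
    hence "exp (- \<bar>M - real j\<bar>) \<le> exp (1 + - real (J - j))" by simp
    thus ?thesis using True by (simp only: exp_add qp f_def if_True)
  next
    case False
    have "- \<bar>M - real j\<bar> \<le> 1 + - real (j - J)" using J False by (simp add: of_nat_diff)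
    hence "exp (- \<bar>M - real j\<bar>) \<le> exp (1 + - real (j - J))" by simp
    thus ?thesis using False by (simp only: exp_add qp f_def if_False)
  qed
  have fN: "sum f {..<N} \<le> 4" for N
  proof -
    have "sum f {..<N} \<le> sum f ({..<J} \<union> {J..<J + N})"
      using q by (intro sum_mono2) (auto simp: f_def)
    also have "\<dots> = sum f {..<J} + sum f {J..<J + N}" by (intro sum.union_disjoint) auto
    also have "sum f {..<J} = (\<Sum>i<J. q ^ Suc i)"
      by (rule sum.reindex_bij_witness[of _ "\<lambda>i. J - Suc i" "\<lambda>i. J - Suc i"]) (auto simp: f_def Suc_diff_Suc simp del: power_Suc)
    also have "\<dots> \<le> (\<Sum>i<J. q ^ i)" using q by (intro sum_mono power_decreasing) auto
    also have "\<dots> \<le> 2" using sum_le_suminf[OF gs(1), of "{..<J}"] gs(2) q by auto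
    also have "sum f {J..<J + N} = (\<Sum>i<N. q ^ i)"
      by (rule sum.reindex_bij_witness[of _ "\<lambda>i. i + J" "\<lambda>i. i - J"]) (auto simp: f_def)
    also have "\<dots> \<le> 2" using sum_le_suminf[OF gs(1), of "{..<N}"] gs(2) q by auto
    finally show ?thesis by simp
  qed
  have f0: "f j \<ge> 0" for j using q by (simp add: f_def)
  have sf: "summable f" by (rule summableI_nonneg_bounded[OF f0 fN])
  show 1: "summable (\<lambda>j. exp (- \<bar>M - real j\<bar>))"
    by (rule summable_comparison_test'[OF summable_mult[OF sf, of "exp 1"], where N = 0]) (use le in auto)
  have "(\<Sum>j. exp (- \<bar>M - real j\<bar>)) \<le> (\<Sum>j. exp 1 * f j)" by (rule suminf_le[OF le 1 summable_mult[OF sf]])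
  also have "\<dots> = exp 1 * suminf f" by (rule suminf_mult[OF sf])
  also have "\<dots> \<le> 3 * 4" using suminf_le_const[OF sf fN] exp_le suminf_nonneg[OF sf f0] by (intro mult_mono) auto
  finally show "(\<Sum>j. exp (- \<bar>M - real j\<bar>)) \<le> 12" by simp
qed

text \<open>The Gaussian is dominated by a two-sided exponential, as -d^2/2 <= 1/2 - |d|. Replacing
  ln n by its integer part shifts the exponent by at most 1, and e^{3/2} <= e^2 <= 9.\<close>

lemma mangoldt_gauss_sum_le:
  fixes M :: real assumes "M \<ge> 0" "finite A"
  shows "(\<Sum>n\<in>A. mangoldt n / real n * exp (- (M - ln (real n))\<^sup>2 / 2)) \<le> 2637 * (9 * 12)"
proof -
  have sm: "summable (\<lambda>j. 9 * exp (- \<bar>M - real j\<bar>))" by (intro summable_mult sum_exp_minus_abs_le assms)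
  have "(\<Sum>n\<in>A. mangoldt n / real n * exp (- (M - ln (real n))\<^sup>2 / 2)) \<le> 2637 * (\<Sum>j. 9 * exp (- \<bar>M - real j\<bar>))"
  proof (rule sum_mangoldt_group_le[OF assms(2) _ sm])
    fix n :: nat assume n: "n > 1"
    define x where "x = ln (real n)"
    define j where "j = nat \<lfloor>x\<rfloor>"
    have "x \<ge> 0" using n by (simp add: x_def)
    hence j: "real j \<le> x" "x \<le> real j + 1" by (auto simp: j_def)
    have "0 \<le> (\<bar>M - x\<bar> - 1)\<^sup>2" by simp
    moreover have "(\<bar>M - x\<bar> - 1)\<^sup>2 = (M - x)\<^sup>2 - 2 * \<bar>M - x\<bar> + 1"
      by (simp only: power2_diff[of "\<bar>M - x\<bar>" 1] power2_abs) simp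
    ultimately have "- (M - x)\<^sup>2 / 2 \<le> 1/2 - \<bar>M - x\<bar>" by simp
    also have "\<dots> \<le> 2 + - \<bar>M - real j\<bar>" using j by linarith
    finally have "exp (- (M - x)\<^sup>2 / 2) \<le> exp (1 + 1 + - \<bar>M - real j\<bar>)" by simp
    also have "\<dots> = exp 1 * exp 1 * exp (- \<bar>M - real j\<bar>)" by (simp only: exp_add)
    also have "\<dots> \<le> (3 * 3) * exp (- \<bar>M - real j\<bar>)" using exp_le by (intro mult_right_mono mult_mono) auto
    finally show "exp (- (M - ln (real n))\<^sup>2 / 2) \<le> 9 * exp (- \<bar>M - real (nat \<lfloor>ln (real n)\<rfloor>)\<bar>)"
      by (simp add: x_def j_def)
  qed simp
  also have "(\<Sum>j. 9 * exp (- \<bar>M - real j\<bar>)) = 9 * (\<Sum>j. exp (- \<bar>M - real j\<bar>))"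
    by (rule suminf_mult[OF sum_exp_minus_abs_le(1)[OF assms(1)]])
  also have "\<dots> \<le> 9 * 12" by (intro mult_left_mono sum_exp_minus_abs_le assms) auto
  finally show ?thesis by simp
qed

text \<open>The order of the pole of zeta'/zeta, from the block estimate with a geometric series of
  ratio exp(-\<alpha>); here 1 - exp(-\<alpha>) >= \<alpha>/2.\<close>

lemma mangoldt_powr_sum_le:
  fixes \<alpha> :: real assumes \<alpha>: "0 < \<alpha>" "\<alpha> \<le> 1" "finite A"
  shows "(\<Sum>n\<in>A. mangoldt n / real n powr (1 + \<alpha>)) \<le> 2637 * (2 / \<alpha>)"
proof -
  define q where "q = exp (- \<alpha>)"
  have "q \<le> 1 / (1 + \<alpha>)" unfolding q_def exp_minus using exp_ge_add_one_self[of \<alpha>] \<alpha>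
    by (simp add: field_simps)
  also have "\<dots> \<le> 1 - \<alpha> / 2" using \<alpha> by (simp add: field_simps)
  finally have q: "0 < q" "q \<le> 1 - \<alpha> / 2" by (auto simp: q_def)
  have q1: "q < 1" using q \<alpha> by linarith
  have sm: "summable (\<lambda>j. q ^ j)" using q q1 by (intro summable_geometric) auto
  have "(\<Sum>n\<in>A. mangoldt n / real n powr (1 + \<alpha>)) = (\<Sum>n\<in>A. mangoldt n / real n * real n powr (-\<alpha>))"
    by (intro sum.cong refl) (simp add: powr_add powr_minus field_simps)
  also have "\<dots> \<le> 2637 * (\<Sum>j. q ^ j)"
  proof (rule sum_mangoldt_group_le[OF \<alpha>(3) _ sm])
    fix n :: nat assume n: "n > 1"
    have "real n powr (-\<alpha>) = exp (- \<alpha> * ln (real n))" using n by (simp add: powr_def)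
    also have "\<dots> \<le> exp (- \<alpha> * real (nat \<lfloor>ln (real n)\<rfloor>))"
      using \<alpha> n by (simp add: of_nat_floor)
    also have "\<dots> = q ^ nat \<lfloor>ln (real n)\<rfloor>" by (simp add: q_def mult.commute flip: exp_of_nat_mult)
    finally show "real n powr (-\<alpha>) \<le> q ^ nat \<lfloor>ln (real n)\<rfloor>" .
  qed (use q in auto)
  also have "(\<Sum>j. q ^ j) = 1 / (1 - q)" using q q1 by (intro suminf_geometric) auto
  also have "1 / (1 - q) \<le> 1 / (\<alpha> / 2)" using q q1 \<alpha> by (intro divide_left_mono) auto
  finally show ?thesis by simp
qed

section \<open>The second moment of the logarithmic mean\<close>

text \<open>The exponent is twice the one in \<open>norm_F_div_le\<close>, where \<open>F (1 + \<alpha> + \<i> t) / (\<alpha> + \<i> t)\<close> is bounded.\<close>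

definition wt :: "real \<Rightarrow> real" where "wt t = (1 + \<bar>t\<bar>) powr (-3/2)"

lemma wt_measurable [measurable]: "wt \<in> borel_measurable borel"
  unfolding wt_def by measurable

lemma wt_pos: "0 < wt t" "wt t \<le> 1"
proof -
  have "(1 + \<bar>t\<bar>) powr (-3/2) \<le> (1 + \<bar>t\<bar>) powr 0" by (intro powr_mono) auto
  thus "0 < wt t" "wt t \<le> 1" by (auto simp: wt_def split: if_splits)
qed

section \<open>Weighted integrals over vertical lines\<close>

lemma nn_integral_wt: "(\<integral>\<^sup>+t. ennreal (wt t) \<partial>lborel) \<le> 4"
proof -
  define f where "f x = (1 + x) powr (-3/2)" for x :: real
  have [measurable]: "f \<in> borel_measurable borel" unfolding f_def by measurable
  have half: "(\<integral>\<^sup>+x. ennreal (f x) * indicator {0..} x \<partial>lborel) = 2"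
  proof -
    have "(\<integral>\<^sup>+x. ennreal (f x) * indicator {0..} x \<partial>lborel) = ennreal (0 - (-2 * (1 + 0) powr (-1/2)))"
    proof (rule nn_integral_FTC_atLeast)
      show "((\<lambda>x. -2 * (1 + x) powr (-1/2)) has_real_derivative f x) (at x)" if "0 \<le> x" for x
        using that by (auto intro!: derivative_eq_intros simp: f_def powr_diff field_simps)
      have "((\<lambda>x::real. -2 * (1 + x) powr (-1/2)) \<longlongrightarrow> -2 * 0) at_top"
        by (intro tendsto_mult tendsto_const tendsto_neg_powr filterlim_tendsto_add_at_top[OF tendsto_const] filterlim_ident) auto
      thus "((\<lambda>x::real. -2 * (1 + x) powr (-1/2)) \<longlongrightarrow> 0) at_top" by simp
    qed (auto simp: f_def)
    thus ?thesis by simp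
  qed
  have "(\<integral>\<^sup>+t. ennreal (wt t) \<partial>lborel) \<le> (\<integral>\<^sup>+t. (ennreal (f t) * indicator {0..} t + ennreal (f (- t)) * indicator {0..} (- t)) \<partial>lborel)"
    by (intro nn_integral_mono) (auto simp: wt_def f_def indicator_def)
  also have "\<dots> = 2 + (\<integral>\<^sup>+t. ennreal (f (- t)) * indicator {0..} (- t) \<partial>lborel)"
    by (subst nn_integral_add) (auto simp: half)
  also have "(\<integral>\<^sup>+t. ennreal (f (- t)) * indicator {0..} (- t) \<partial>lborel) = (\<integral>\<^sup>+t. ennreal (f t) * indicator {0..} t \<partial>lborel)"
    by (subst nn_integral_real_affine[of _ "-1" 0]) auto
  finally show ?thesis by (simp add: half)
qed

text \<open>After t = \<alpha> u the integrand is 1 / (1 + u^2) up to scaling, which is at most 2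
  \<open>wt u\<close>.\<close>

lemma nn_integral_wt_div:
  fixes \<alpha> :: real assumes \<alpha>: "\<alpha> > 0"
  shows "(\<integral>\<^sup>+t. ennreal (1 / (norm (Complex \<alpha> t))\<^sup>2) \<partial>lborel) \<le> ennreal (8 / \<alpha>)"
proof -
  have "(\<integral>\<^sup>+t. ennreal (1 / (norm (Complex \<alpha> t))\<^sup>2) \<partial>lborel) = ennreal \<alpha> * (\<integral>\<^sup>+u. ennreal (1 / (norm (Complex \<alpha> (\<alpha> * u)))\<^sup>2) \<partial>lborel)"
    using \<alpha> by (subst nn_integral_real_affine[of _ \<alpha> 0]) (auto simp: cmod_def)
  also have "\<dots> \<le> ennreal \<alpha> * (\<integral>\<^sup>+u. ennreal (2 / \<alpha>\<^sup>2) * ennreal (wt u) \<partial>lborel)"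
  proof (intro mult_left_mono nn_integral_mono)
    fix u :: real
    have eq: "(norm (Complex \<alpha> (\<alpha> * u)))\<^sup>2 = \<alpha>\<^sup>2 * (1 + u\<^sup>2)"
      by (simp add: cmod_def power_mult_distrib algebra_simps)
    have "(1 + \<bar>u\<bar>) powr (3/2) \<le> (1 + \<bar>u\<bar>) powr 2" by (intro powr_mono) auto
    also have "\<dots> = (1 + \<bar>u\<bar>)\<^sup>2" by simp
    also have "\<dots> \<le> 2 * (1 + u\<^sup>2)"
      using zero_le_power2[of "1 - \<bar>u\<bar>"] by (simp add: power2_sum power2_diff)
    finally have le: "(1 + \<bar>u\<bar>) powr (3/2) \<le> 2 * (1 + u\<^sup>2)" .
    have "1 / (1 + u\<^sup>2) \<le> 2 * wt u"
    proof -
      have "wt u = 1 / (1 + \<bar>u\<bar>) powr (3/2)" by (simp add: wt_def powr_minus_divide)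
      also have "\<dots> \<ge> 1 / (2 * (1 + u\<^sup>2))"
      proof (rule divide_left_mono[OF le])
        show "0 < 2 * (1 + u\<^sup>2) * (1 + \<bar>u\<bar>) powr (3/2)" by (intro mult_pos_pos) (auto intro: add_pos_nonneg)
      qed auto
      finally have "1 / (2 * (1 + u\<^sup>2)) \<le> wt u" .
      moreover have "1 / (1 + u\<^sup>2) = 2 * (1 / (2 * (1 + u\<^sup>2)))"
        by (simp add: divide_simps)
      ultimately show ?thesis by (simp only: mult_le_cancel_left_pos zero_less_numeral)
    qed
    hence "1 / \<alpha>\<^sup>2 * (1 / (1 + u\<^sup>2)) \<le> 1 / \<alpha>\<^sup>2 * (2 * wt u)" by (intro mult_left_mono) auto
    hence "1 / (norm (Complex \<alpha> (\<alpha> * u)))\<^sup>2 \<le> 2 / \<alpha>\<^sup>2 * wt u" unfolding eq by simp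
    thus "ennreal (1 / (norm (Complex \<alpha> (\<alpha> * u)))\<^sup>2) \<le> ennreal (2 / \<alpha>\<^sup>2) * ennreal (wt u)"
      by (subst ennreal_mult[symmetric]) (auto simp: wt_pos less_imp_le intro!: ennreal_leI)
  qed auto
  also have "\<dots> = ennreal \<alpha> * (ennreal (2 / \<alpha>\<^sup>2) * (\<integral>\<^sup>+u. ennreal (wt u) \<partial>lborel))"
    by (subst nn_integral_cmult) auto
  also have "\<dots> \<le> ennreal \<alpha> * (ennreal (2 / \<alpha>\<^sup>2) * 4)"
    by (intro mult_left_mono nn_integral_wt) auto
  also have "\<dots> = ennreal (8 / \<alpha>)"
    using \<alpha> by (simp add: power2_eq_square flip: ennreal_mult ennreal_numeral)
  finally show ?thesis .
qed

text \<open>For \<tau> in [t, t + 1] the weight drops by a factor of at most 3 and the Gaussian by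
  at most 2, whence the 6.\<close>

lemma wt_le_average:
  "ennreal (wt t) \<le> 6 * (\<integral>\<^sup>+\<tau>. ennreal (wt \<tau> * exp (- (t - \<tau>)\<^sup>2 / 2)) \<partial>lborel)"
proof -
  have "wt t / 6 \<le> wt \<tau> * exp (- (t - \<tau>)\<^sup>2 / 2)" if \<tau>: "\<tau> \<in> {t..t + 1}" for \<tau>
  proof -
    have "(1 + \<bar>\<tau>\<bar>) powr (3/2) \<le> (2 * (1 + \<bar>t\<bar>)) powr (3/2)" using \<tau> by (intro powr_mono2) auto
    also have "\<dots> = 2 powr (3/2) * (1 + \<bar>t\<bar>) powr (3/2)" by (rule powr_mult)
    also have "2 powr (3/2) \<le> (3::real)"
    proof -
      have "2 powr (3/2) = 2 powr (1 + 1/2 :: real)" by simp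
      also have "\<dots> = 2 * sqrt (2::real)" by (subst powr_add) (simp add: powr_half_sqrt)
      also have "sqrt 2 \<le> (3/2::real)" by (rule real_le_lsqrt) (auto simp: power2_eq_square)
      finally have "2 powr (3/2) \<le> (2::real) * (3/2)" by simp
      also have "\<dots> = 3" by simp
      finally show ?thesis .
    qed
    finally have "(1 + \<bar>\<tau>\<bar>) powr (3/2) \<le> 3 * (1 + \<bar>t\<bar>) powr (3/2)" by (simp add: mult_right_mono)
    hence "1 / (3 * (1 + \<bar>t\<bar>) powr (3/2)) \<le> 1 / (1 + \<bar>\<tau>\<bar>) powr (3/2)"
      by (intro divide_left_mono mult_pos_pos) auto
    hence 1: "wt t / 3 \<le> wt \<tau>" by (simp add: wt_def powr_minus_divide)
    have "(t - \<tau>)\<^sup>2 \<le> 1\<^sup>2" using \<tau> by (intro power2_le_iff_abs_le[THEN iffD2]) auto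
    hence "exp (- 1 / 2) \<le> exp (- (t - \<tau>)\<^sup>2 / 2)" by simp
    moreover have "1 / 2 \<le> exp (- 1 / 2 :: real)" using exp_ge_add_one_self[of "- 1 / 2"] by simp
    ultimately have "1 / 2 \<le> exp (- (t - \<tau>)\<^sup>2 / 2)" by linarith
    hence "(wt t / 3) * (1 / 2) \<le> wt \<tau> * exp (- (t - \<tau>)\<^sup>2 / 2)"
      using 1 wt_pos[of \<tau>] wt_pos[of t] by (intro mult_mono) auto
    thus ?thesis by simp
  qed
  hence "(\<integral>\<^sup>+\<tau>. ennreal (wt t / 6) * indicator {t..t + 1} \<tau> \<partial>lborel) \<le> (\<integral>\<^sup>+\<tau>. ennreal (wt \<tau> * exp (- (t - \<tau>)\<^sup>2 / 2)) \<partial>lborel)"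
    by (intro nn_integral_mono) (auto simp: indicator_def intro!: ennreal_leI)
  hence "ennreal (wt t / 6) \<le> (\<integral>\<^sup>+\<tau>. ennreal (wt \<tau> * exp (- (t - \<tau>)\<^sup>2 / 2)) \<partial>lborel)"
    by (simp add: nn_integral_cmult_indicator)
  hence "6 * ennreal (wt t / 6) \<le> 6 * (\<integral>\<^sup>+\<tau>. ennreal (wt \<tau> * exp (- (t - \<tau>)\<^sup>2 / 2)) \<partial>lborel)"
    by (rule mult_left_mono) auto
  thus ?thesis using wt_pos[of t] by (simp flip: ennreal_mult ennreal_numeral)
qed

text \<open>Local means bounded uniformly in the centre \<tau> give a weighted mean over the whole
  line: the weight is replaced by its Gaussian average and the integrals are exchanged. 24 = 6 * 4,
  with 4 bounding the mass of \<open>wt\<close>.\<close>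

lemma nn_integral_wt_le:
  fixes \<phi> :: "real \<Rightarrow> real"
  assumes [measurable]: "\<phi> \<in> borel_measurable borel" and \<phi>: "\<And>t. \<phi> t \<ge> 0" and "C \<ge> 0"
    and C: "\<And>\<tau>. (\<integral>\<^sup>+t. ennreal (\<phi> t * exp (- (t - \<tau>)\<^sup>2 / 2)) \<partial>lborel) \<le> ennreal C"
  shows "(\<integral>\<^sup>+t. ennreal (wt t * \<phi> t) \<partial>lborel) \<le> ennreal (24 * C)"
proof -
  have "(\<integral>\<^sup>+t. ennreal (wt t * \<phi> t) \<partial>lborel) = (\<integral>\<^sup>+t. ennreal (wt t) * ennreal (\<phi> t) \<partial>lborel)"
    using \<phi> wt_pos by (intro nn_integral_cong) (simp add: ennreal_mult less_imp_le)
  also have "\<dots> \<le> (\<integral>\<^sup>+t. 6 * (\<integral>\<^sup>+\<tau>. ennreal (wt \<tau> * exp (- (t - \<tau>)\<^sup>2 / 2)) \<partial>lborel) * ennreal (\<phi> t) \<partial>lborel)"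
    by (intro nn_integral_mono mult_right_mono wt_le_average) auto
  also have "\<dots> = (\<integral>\<^sup>+t. 6 * (\<integral>\<^sup>+\<tau>. ennreal (wt \<tau>) * ennreal (\<phi> t * exp (- (t - \<tau>)\<^sup>2 / 2)) \<partial>lborel) \<partial>lborel)"
  proof (intro nn_integral_cong)
    fix t
    have "(\<integral>\<^sup>+\<tau>. ennreal (wt \<tau> * exp (- (t - \<tau>)\<^sup>2 / 2)) \<partial>lborel) * ennreal (\<phi> t)
        = (\<integral>\<^sup>+\<tau>. ennreal (wt \<tau> * exp (- (t - \<tau>)\<^sup>2 / 2)) * ennreal (\<phi> t) \<partial>lborel)"
      by (rule nn_integral_multc[symmetric]) measurable
    also have "\<dots> = (\<integral>\<^sup>+\<tau>. ennreal (wt \<tau>) * ennreal (\<phi> t * exp (- (t - \<tau>)\<^sup>2 / 2)) \<partial>lborel)"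
      using \<phi>[of t] wt_pos by (intro nn_integral_cong) (simp add: ennreal_mult[symmetric] less_imp_le mult_ac)
    finally show "6 * (\<integral>\<^sup>+\<tau>. ennreal (wt \<tau> * exp (- (t - \<tau>)\<^sup>2 / 2)) \<partial>lborel) * ennreal (\<phi> t)
        = 6 * (\<integral>\<^sup>+\<tau>. ennreal (wt \<tau>) * ennreal (\<phi> t * exp (- (t - \<tau>)\<^sup>2 / 2)) \<partial>lborel)"
      by (simp add: mult.assoc)
  qed
  also have "\<dots> = 6 * (\<integral>\<^sup>+t. (\<integral>\<^sup>+\<tau>. ennreal (wt \<tau>) * ennreal (\<phi> t * exp (- (t - \<tau>)\<^sup>2 / 2)) \<partial>lborel) \<partial>lborel)"
    by (rule nn_integral_cmult) measurable
  also have "(\<integral>\<^sup>+t. (\<integral>\<^sup>+\<tau>. ennreal (wt \<tau>) * ennreal (\<phi> t * exp (- (t - \<tau>)\<^sup>2 / 2)) \<partial>lborel) \<partial>lborel)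
      = (\<integral>\<^sup>+\<tau>. (\<integral>\<^sup>+t. ennreal (wt \<tau>) * ennreal (\<phi> t * exp (- (t - \<tau>)\<^sup>2 / 2)) \<partial>lborel) \<partial>lborel)"
    by (rule lborel_pair.Fubini') measurable
  also have "\<dots> \<le> (\<integral>\<^sup>+\<tau>. ennreal (wt \<tau>) * ennreal C \<partial>lborel)"
  proof (intro nn_integral_mono)
    fix \<tau>
    have "(\<integral>\<^sup>+t. ennreal (wt \<tau>) * ennreal (\<phi> t * exp (- (t - \<tau>)\<^sup>2 / 2)) \<partial>lborel)
        = ennreal (wt \<tau>) * (\<integral>\<^sup>+t. ennreal (\<phi> t * exp (- (t - \<tau>)\<^sup>2 / 2)) \<partial>lborel)"
      by (rule nn_integral_cmult) measurable
    thus "(\<integral>\<^sup>+t. ennreal (wt \<tau>) * ennreal (\<phi> t * exp (- (t - \<tau>)\<^sup>2 / 2)) \<partial>lborel) \<le> ennreal (wt \<tau>) * ennreal C"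
      using C[of \<tau>] by (simp add: mult_left_mono)
  qed
  also have "\<dots> = (\<integral>\<^sup>+\<tau>. ennreal (wt \<tau>) \<partial>lborel) * ennreal C" by (rule nn_integral_multc) measurable
  also have "\<dots> \<le> 4 * ennreal C" by (intro mult_right_mono nn_integral_wt) auto
  finally have "(\<integral>\<^sup>+t. ennreal (wt t * \<phi> t) \<partial>lborel) \<le> 6 * (4 * ennreal C)" by (simp add: mult_left_mono)
  also have "6 * (4 * ennreal C) = ennreal (24 * C)" using assms(3) by (simp add: mult.assoc[symmetric] ennreal_mult)
  finally show ?thesis .
qed

text \<open>With a = ln n this is the contribution of a single coefficient to the Laplace transform
  of v T(v). The integral of the norm is evaluated too, to justify the summation over n.\<close>

lemma laplace_tail:
  fixes a :: real and s :: complex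
  assumes a: "a \<ge> 0" and s: "Re s > 0"
  defines "p \<equiv> (\<lambda>v::real. indicator {a..} v *\<^sub>R (of_real v * exp (- (s * of_real v))))"
  shows "integrable lborel p" "(\<integral>v. p v \<partial>lborel) = exp (- (s * of_real a)) * (of_real a / s + 1 / s\<^sup>2)"
    "(\<integral>v. norm (p v) \<partial>lborel) = exp (- (Re s * a)) * (a / Re s + 1 / (Re s)\<^sup>2)"
proof -
  define r where "r = Re s"
  have r: "r > 0" using s by (simp add: r_def)
  have [measurable]: "p \<in> borel_measurable borel"
  proof -
    have "(\<lambda>v::real. of_real v * exp (- (s * of_real v))) \<in> borel_measurable borel"
      by (intro borel_measurable_continuous_onI continuous_intros)
    thus ?thesis unfolding p_def by measurable
  qed
  have np: "norm (p v) = (v * exp (- (r * v))) * indicator {a..} v" for v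
    using a by (auto simp: p_def indicator_def norm_mult norm_exp r_def)
  define G where "G v = - (exp (- (r * v)) * (v / r + 1 / r\<^sup>2))" for v
  have "(\<integral>\<^sup>+v. ennreal (v * exp (- (r * v))) * indicator {a..} v \<partial>lborel) = ennreal (0 - G a)"
  proof (rule nn_integral_FTC_atLeast)
    show "(G has_real_derivative v * exp (- (r * v))) (at v)" for v
      unfolding G_def using r by (auto intro!: derivative_eq_intros simp: field_simps power2_eq_square)
    have "((\<lambda>v. - (exp (- (r * v)) * (v / r + 1 / r\<^sup>2))) \<longlongrightarrow> 0) at_top"
      using r by real_asymp
    thus "(G \<longlongrightarrow> 0) at_top" by (simp add: G_def[abs_def])
  qed (use a in auto)
  hence nn: "(\<integral>\<^sup>+v. ennreal (norm (p v)) \<partial>lborel) = ennreal (- G a)"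
    unfolding np by (subst nn_integral_cong[of _ _ "\<lambda>v. ennreal (v * exp (- (r * v))) * indicator {a..} v"]) (auto simp: indicator_def)
  have Ga: "- G a \<ge> 0" using r a by (simp add: G_def)
  show int: "integrable lborel p"
    by (rule integrableI_bounded) (auto simp: nn)
  have "(\<integral>v. norm (p v) \<partial>lborel) = - G a"
    by (rule integral_eq_nn_integral[THEN trans]) (use nn Ga in auto)
  thus "(\<integral>v. norm (p v) \<partial>lborel) = exp (- (Re s * a)) * (a / Re s + 1 / (Re s)\<^sup>2)"
    by (simp add: G_def r_def)
  define H where "H v = - (exp (- (s * of_real v)) * (of_real v / s + 1 / s\<^sup>2))" for v :: real
  have s0: "s \<noteq> 0" using s by auto
  have Hd: "(H has_vector_derivative of_real v * exp (- (s * of_real v))) (at v within S)" for v S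
  proof -
    have "((\<lambda>z. - (exp (- (s * z)) * (z / s + 1 / s\<^sup>2))) has_field_derivative (of_real v * exp (- (s * of_real v)))) (at (of_real v))"
      using s0 by (auto intro!: derivative_eq_intros simp: field_simps power2_eq_square)
    thus ?thesis unfolding H_def by (rule has_vector_derivative_real_field[THEN has_vector_derivative_at_within])
  qed
  have FTC: "(\<integral>v. indicator {..y} v *\<^sub>R p v \<partial>lborel) = H y - H a" if "y \<ge> a" for y
  proof -
    have "(\<integral>v. indicator {..y} v *\<^sub>R p v \<partial>lborel) = (\<integral>v. indicator {a..y} v *\<^sub>R (of_real v * exp (- (s * of_real v))) \<partial>lborel)"
      by (intro Bochner_Integration.integral_cong refl) (auto simp: p_def indicator_def)
    also have "\<dots> = H y - H a"
      using that by (intro integral_FTC_Icc Hd continuous_intros)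
    finally show ?thesis .
  qed
  have "((\<lambda>y. \<integral>v. indicator {..y} v *\<^sub>R p v \<partial>lborel) \<longlongrightarrow> (\<integral>v. p v \<partial>lborel)) at_top"
    by (rule tendsto_integral_at_top[OF _ int]) simp
  moreover have "((\<lambda>y. \<integral>v. indicator {..y} v *\<^sub>R p v \<partial>lborel) \<longlongrightarrow> 0 - H a) at_top"
  proof (rule Lim_transform_eventually)
    have "(H \<longlongrightarrow> 0) at_top"
    proof (rule Lim_null_comparison)
      show "eventually (\<lambda>v. norm (H v) \<le> exp (- (r * v)) * (v / norm s + 1 / (norm s)\<^sup>2)) at_top"
        using eventually_ge_at_top[of 0]
      proof eventually_elim
        case (elim v)
        have "norm (of_real v / s + 1 / s\<^sup>2) \<le> v / norm s + 1 / (norm s)\<^sup>2"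
          using norm_triangle_ineq[of "of_real v / s" "1 / s\<^sup>2"] elim by (simp add: norm_divide norm_power)
        thus ?case unfolding H_def norm_minus_cancel norm_mult norm_exp by (simp add: r_def mult_left_mono)
      qed
      have "norm s > 0" using s0 by simp
      thus "((\<lambda>v. exp (- (r * v)) * (v / norm s + 1 / (norm s)\<^sup>2)) \<longlongrightarrow> 0) at_top"
        using r by real_asymp
    qed
    thus "((\<lambda>y. H y - H a) \<longlongrightarrow> 0 - H a) at_top" by (intro tendsto_intros)
    show "eventually (\<lambda>y. H y - H a = (\<integral>v. indicator {..y} v *\<^sub>R p v \<partial>lborel)) at_top"
      using eventually_ge_at_top[of a] by eventually_elim (simp add: FTC)
  qed
  ultimately have "(\<integral>v. p v \<partial>lborel) = 0 - H a" by (rule tendsto_unique[rotated]) simp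
  thus "(\<integral>v. p v \<partial>lborel) = exp (- (s * of_real a)) * (of_real a / s + 1 / s\<^sup>2)" by (simp add: H_def)
qed

lemma laplace_term_eq:
  "x / y * (1 / z * (w / p + 1 / q)) = x * w / (y * z) * (1 / p) + x / (y * z) * (1 / q)"
  for x :: "'b :: field"
  by (simp add: distrib_left mult.assoc)

lemma ln_le_iff_le_exp: "x > 0 \<Longrightarrow> ln x \<le> y \<longleftrightarrow> x \<le> exp y" for x y :: real
  by (metis exp_le_cancel_iff exp_ln)

section \<open>The Laplace transform of v T(v) and its mean square\<close>

context class_C_function
begin

definition T :: "real \<Rightarrow> complex" where "T v = S1 f (exp v)"

lemma T_sums: "(\<lambda>n. f n / of_nat n * of_bool (real n \<le> exp v)) sums T v"
proof -
  have "(\<lambda>n. f n / of_nat n * of_bool (real n \<le> exp v)) sums (\<Sum>n | 1 \<le> n \<and> real n \<le> exp v. f n / of_nat n * of_bool (real n \<le> exp v))"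
    by (rule sums_finite) (auto simp: not_le)
  thus ?thesis by (simp add: T_def S1_def)
qed

lemma T_neg: "v < 0 \<Longrightarrow> T v = 0"
proof -
  assume "v < 0"
  hence "exp v < 1" by simp
  have "\<not> (1 \<le> n \<and> real n \<le> exp v)" for n
  proof
    assume n: "1 \<le> n \<and> real n \<le> exp v"
    hence "1 \<le> real n" by simp
    thus False using n \<open>exp v < 1\<close> by linarith
  qed
  hence "{n. 1 \<le> n \<and> real n \<le> exp v} = {}" by blast
  thus ?thesis by (simp only: T_def S1_def sum.empty)
qed

lemma T_measurable [measurable]: "T \<in> borel_measurable borel"
proof -
  have "T = (\<lambda>v. \<Sum>n. f n / of_nat n * of_bool (real n \<le> exp v))"
    using T_sums by (simp add: sums_iff fun_eq_iff)
  thus ?thesis by (simp only:) measurable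
qed

text \<open>T jumps only at the points ln n; this supplies the continuity almost everywhere that
  Plancherel's inequality asks for.\<close>

lemma T_locally_constant:
  assumes v: "v \<notin> range (\<lambda>n. ln (real n))"
  shows "eventually (\<lambda>w. T w = T v) (nhds v)"
proof -
  have ne: "real n \<noteq> exp v" for n using v by (metis ln_exp rangeI)
  have cont: "(exp \<longlongrightarrow> exp v) (nhds v)" using isCont_exp[of v] by (simp add: isCont_def tendsto_at_iff_tendsto_nhds)
  have fin: "finite {n::nat. 1 \<le> n \<and> real n \<le> exp (v + 1)}" by simp
  have "eventually (\<lambda>w. (real n \<le> exp w) = (real n \<le> exp v)) (nhds v)" for n
  proof (cases "real n < exp v")
    case True
    from order_tendstoD(1)[OF cont this] show ?thesis by eventually_elim (use True in auto)
  next
    case False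
    hence "exp v < real n" using ne[of n] by simp
    from order_tendstoD(2)[OF cont this] show ?thesis by eventually_elim (use \<open>exp v < real n\<close> in auto)
  qed
  hence "eventually (\<lambda>w. \<forall>n\<in>{n. 1 \<le> n \<and> real n \<le> exp (v + 1)}. (real n \<le> exp w) = (real n \<le> exp v)) (nhds v)"
    using fin by (intro eventually_ball_finite) auto
  moreover have "eventually (\<lambda>w. w < v + 1) (nhds v)"
    by (rule eventually_nhds_in_open[of "{..<v+1}", simplified]) auto
  ultimately show ?thesis
  proof eventually_elim
    case (elim w)
    have "{n. 1 \<le> n \<and> real n \<le> exp w} = {n. 1 \<le> n \<and> real n \<le> exp v}"
    proof (intro Collect_cong conj_cong refl)
      fix n :: nat assume n: "1 \<le> n"
      have "exp w \<le> exp (v + 1)" "exp v \<le> exp (v + 1)" using elim(2) by simp_all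
      show "(real n \<le> exp w) = (real n \<le> exp v)"
      proof (cases "real n \<le> exp (v + 1)")
        case True
        thus ?thesis using elim(1) n by blast
      next
        case False
        hence "\<not> real n \<le> exp w" "\<not> real n \<le> exp v"
          using \<open>exp w \<le> exp (v + 1)\<close> \<open>exp v \<le> exp (v + 1)\<close> by linarith+
        thus ?thesis by blast
      qed
    qed
    thus ?case by (simp add: T_def S1_def)
  qed
qed

lemma F_log_series:
  assumes s: "Re s > 1"
  shows "dirichlet_abs_conv (\<lambda>n. f n * of_real (ln (real n))) s"
    "dirichlet_series (\<lambda>n. f n * of_real (ln (real n))) s = dirichlet_series L s * F s"
proof -
  have eq: "f n * of_real (ln (real n)) = dirichlet_conv L f n" if "n \<ge> 1" for n
    by (rule is_Lambda_of_recurrence[OF Lambda that])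
  note c = dirichlet_series_conv[OF Lambda_facts(2)[OF s] Lambda_facts(1)[OF s]]
  show "dirichlet_abs_conv (\<lambda>n. f n * of_real (ln (real n))) s"
    using c(1) dirichlet_series_cong(2)[of "\<lambda>n. f n * of_real (ln (real n))" "dirichlet_conv L f", OF eq] by simp
  show "dirichlet_series (\<lambda>n. f n * of_real (ln (real n))) s = dirichlet_series L s * F s"
    using c(2) dirichlet_series_cong(1)[of "\<lambda>n. f n * of_real (ln (real n))" "dirichlet_conv L f", OF eq] by simp
qed

definition h :: "real \<Rightarrow> real \<Rightarrow> complex" where "h \<alpha> v = T v * of_real (v * exp (- (\<alpha> * v)))"

lemma isCont_h: "AE v in lborel. isCont (h \<alpha>) v"
proof -
  have "AE v in lborel. v \<notin> range (\<lambda>n. ln (real n))"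
    by (rule AE_not_in) (auto intro!: countable_imp_null_set_lborel)
  thus ?thesis
  proof eventually_elim
    case (elim v)
    from T_locally_constant[OF elim] have "isCont T v"
      by (subst isCont_cong[where g = "\<lambda>_. T v"]) auto
    thus ?case unfolding h_def[abs_def] by (intro continuous_intros)
  qed
qed

text \<open>Rankin's trick: for n <= e^v the factor (e^v / n)^{\<alpha>/2} >= 1 may be inserted,
  which bounds T by a multiple of e^{\<alpha> v/2}; the other half of the damping beats the factor
  v. The bound may depend on f and \<alpha>, since it serves only as a majorant in a limit.\<close>

lemma h_bounded:
  assumes \<alpha>: "\<alpha> > 0"
  shows "\<exists>B. \<forall>v. norm (h \<alpha> v) \<le> B"
proof -
  define A where "A = (\<Sum>n. norm (f n) / real n powr (1 + \<alpha> / 2))"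
  have sm: "summable (\<lambda>n. norm (f n) / real n powr (1 + \<alpha> / 2))"
    using Lambda_facts(1)[of "of_real (1 + \<alpha> / 2)"] \<alpha> by (simp add: dirichlet_abs_conv_iff)
  have A0: "A \<ge> 0" unfolding A_def by (rule suminf_nonneg[OF sm]) auto
  have "norm (h \<alpha> v) \<le> 2 / \<alpha> * A" for v
  proof (cases "v < 0")
    case True
    thus ?thesis using A0 \<alpha> by (simp add: h_def T_neg)
  next
    case False
    have "norm (T v) \<le> (\<Sum>n. exp (\<alpha> / 2 * v) * (norm (f n) / real n powr (1 + \<alpha> / 2)))"
      unfolding sums_unique[OF T_sums]
    proof (rule norm_suminf_le)
      fix n :: nat
      show "norm (f n / of_nat n * of_bool (real n \<le> exp v)) \<le> exp (\<alpha> / 2 * v) * (norm (f n) / real n powr (1 + \<alpha> / 2))"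
      proof (cases "n \<ge> 1 \<and> real n \<le> exp v")
        case True
        have "real n powr (\<alpha> / 2) \<le> exp v powr (\<alpha> / 2)" using True \<alpha> by (intro powr_mono2) auto
        also have "\<dots> = exp (\<alpha> / 2 * v)" by (simp add: powr_def)
        finally have "1 \<le> exp (\<alpha> / 2 * v) / real n powr (\<alpha> / 2)" using True by simp
        hence "norm (f n) / real n * 1 \<le> norm (f n) / real n * (exp (\<alpha> / 2 * v) / real n powr (\<alpha> / 2))"
          by (intro mult_left_mono) auto
        thus ?thesis using True by (simp add: norm_divide powr_add mult_ac)
      next
        case False
        thus ?thesis by (cases "n = 0") auto
      qed
    qed (intro summable_mult sm)
    also have "\<dots> = exp (\<alpha> / 2 * v) * A" unfolding A_def by (rule suminf_mult[OF sm])
    finally have "norm (h \<alpha> v) \<le> exp (\<alpha> / 2 * v) * A * (v * exp (- (\<alpha> * v)))"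
      using False by (simp add: h_def norm_mult mult_right_mono)
    also have "\<dots> = A * (v * exp (- (\<alpha> / 2 * v)))"
      by (simp add: mult_exp_exp algebra_simps)
    also have "\<dots> \<le> A * (2 / \<alpha>)"
    proof (rule mult_left_mono[OF _ A0])
      have "\<alpha> / 2 * v \<le> exp (\<alpha> / 2 * v)" using exp_ge_add_one_self[of "\<alpha> / 2 * v"] by linarith
      thus "v * exp (- (\<alpha> / 2 * v)) \<le> 2 / \<alpha>" using \<alpha> by (simp add: exp_minus field_simps)
    qed
    finally show ?thesis by (simp only: mult.commute)
  qed
  thus ?thesis by blast
qed

text \<open>T is a sum of step functions, and the n-th step contributes f(n) n^{-1-s} (ln n / s +
  1/s^2). The first parts sum to the series of f log, which is the product of the series of L and F,
  the second parts to F / s^2.\<close>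

lemma h_laplace:
  fixes \<alpha> t :: real
  assumes \<alpha>: "\<alpha> > 0"
  defines "s \<equiv> Complex \<alpha> t"
  shows "integrable lborel (h \<alpha>)"
    "(\<integral>v. h \<alpha> v * iexp (- (t * v)) \<partial>lborel) = F (1 + s) / s * (dirichlet_series L (1 + s) + 1 / s)"
proof -
  have s: "Re s > 0" "Re (1 + s) > 1" "s \<noteq> 0" using \<alpha> by (auto simp: s_def complex_eq_iff)
  define p where "p s n v = indicator {ln (real n)..} v *\<^sub>R (of_real v * exp (- (s * of_real v)))" for s :: complex and n v
  define c where "c s n v = (f n / of_nat n) * p s n v" for s n v
  have hsum: "h \<alpha> v * iexp (- (t * v)) = (\<Sum>n. c (Complex \<alpha> t) n v)" and csum: "summable (\<lambda>n. norm (c (Complex \<alpha> t) n v))" for t v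
  proof -
    have "c (Complex \<alpha> t) n v = (f n / of_nat n * of_bool (real n \<le> exp v)) * (of_real v * exp (- (Complex \<alpha> t * of_real v)))" for n
      by (cases "n = 0") (auto simp: c_def p_def indicator_def ln_le_iff_le_exp)
    hence "c (Complex \<alpha> t) n v = (f n / of_nat n * of_bool (real n \<le> exp v)) * (of_real v * exp (- (Complex \<alpha> t * of_real v)))" for n by blast
    hence cs: "(\<lambda>n. c (Complex \<alpha> t) n v) sums (T v * (of_real v * exp (- (Complex \<alpha> t * of_real v))))"
      by (simp only: sums_mult2[OF T_sums])
    have "Complex \<alpha> t * of_real v = of_real (\<alpha> * v) + \<i> * of_real (t * v)" by (simp add: complex_eq_iff)
    hence "exp (- (Complex \<alpha> t * of_real v)) = of_real (exp (- (\<alpha> * v))) * iexp (- (t * v))"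
      by (simp add: exp_of_real exp_add[symmetric] algebra_simps flip: exp_of_real)
    thus "h \<alpha> v * iexp (- (t * v)) = (\<Sum>n. c (Complex \<alpha> t) n v)"
      using cs by (simp add: sums_iff h_def mult_ac)
    show "summable (\<lambda>n. norm (c (Complex \<alpha> t) n v))"
    proof (rule summable_finite[of "{n. 1 \<le> n \<and> real n \<le> exp v}"])
      fix n assume "n \<notin> {n. 1 \<le> n \<and> real n \<le> exp v}"
      thus "norm (c (Complex \<alpha> t) n v) = 0"
        by (cases "n = 0") (auto simp: c_def p_def indicator_def ln_le_iff_le_exp)
    qed simp
  qed
  \<comment> \<open>Absolute convergence of the series of f log makes the integrals of the norms
    summable, which licenses the exchange of sum and integral; t = 0 gives the integrability of
    \<open>h \<alpha>\<close> itself.\<close>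
  have main: "integrable lborel (\<lambda>v. h \<alpha> v * iexp (- (t * v))) \<and>
      (\<integral>v. h \<alpha> v * iexp (- (t * v)) \<partial>lborel) = F (1 + Complex \<alpha> t) / Complex \<alpha> t * (dirichlet_series L (1 + Complex \<alpha> t) + 1 / Complex \<alpha> t)" for t
  proof -
    define s where "s = Complex \<alpha> t"
    have s: "Re s > 0" "Re (1 + s) > 1" "s \<noteq> 0" "Re s = \<alpha>" using \<alpha> by (auto simp: s_def complex_eq_iff)
    have ci: "integrable lborel (c s n)" and
      cv: "(\<integral>v. c s n v \<partial>lborel) = f n * of_real (ln (real n)) / of_nat n powr (1 + s) * (1 / s) + f n / of_nat n powr (1 + s) * (1 / s\<^sup>2)" and
      cn: "(\<integral>v. norm (c s n v) \<partial>lborel) = norm (f n * of_real (ln (real n))) / real n powr (1 + \<alpha>) * (1 / \<alpha>) + norm (f n) / real n powr (1 + \<alpha>) * (1 / \<alpha>\<^sup>2)" for n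
    proof -
      consider "n = 0" | "n \<ge> 1" by linarith
      hence "integrable lborel (c s n) \<and> (\<integral>v. c s n v \<partial>lborel) = f n * of_real (ln (real n)) / of_nat n powr (1 + s) * (1 / s) + f n / of_nat n powr (1 + s) * (1 / s\<^sup>2)
        \<and> (\<integral>v. norm (c s n v) \<partial>lborel) = norm (f n * of_real (ln (real n))) / real n powr (1 + \<alpha>) * (1 / \<alpha>) + norm (f n) / real n powr (1 + \<alpha>) * (1 / \<alpha>\<^sup>2)"
      proof cases
        case 1
        thus ?thesis by (simp add: c_def[abs_def])
      next
        case 2
        have a: "ln (real n) \<ge> 0" using 2 by simp
        note lt = laplace_tail[OF a s(1), folded p_def]
        have Lnn: "Ln (of_nat n) = of_real (ln (real n))" using 2 Ln_of_real[of "real n"] by simp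
        have e: "exp (- (s * of_real (ln (real n)))) = 1 / of_nat n powr s"
          using 2 by (simp add: powr_def Lnn exp_minus inverse_eq_divide)
        have e': "exp (- (Re s * ln (real n))) = 1 / real n powr \<alpha>"
          using 2 s(4) by (simp add: powr_def exp_minus inverse_eq_divide)
        have "integrable lborel (c s n)" unfolding c_def by (intro integrable_mult_right lt(1))
        moreover have "(\<integral>v. c s n v \<partial>lborel) = f n / of_nat n * (1 / of_nat n powr s * (of_real (ln (real n)) / s + 1 / s\<^sup>2))"
          unfolding c_def by (simp only: integral_mult_right_zero lt(2) e)
        moreover have "(\<integral>v. norm (c s n v) \<partial>lborel) = norm (f n / of_nat n) * (1 / real n powr \<alpha> * (ln (real n) / \<alpha> + 1 / \<alpha>\<^sup>2))"
          unfolding c_def norm_mult by (simp only: integral_mult_right_zero lt(3) s(4) e'[unfolded s(4)])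
        moreover have "of_nat n powr (1 + s) = of_nat n * of_nat n powr s" "real n powr (1 + \<alpha>) = real n * real n powr \<alpha>"
          "norm (f n * of_real (ln (real n))) = norm (f n) * ln (real n)" "norm (f n / of_nat n) = norm (f n) / real n"
          using 2 a by (simp_all add: powr_add norm_mult norm_divide)
        ultimately show ?thesis by (simp only: laplace_term_eq simp_thms)
      qed
      thus "integrable lborel (c s n)" "(\<integral>v. c s n v \<partial>lborel) = f n * of_real (ln (real n)) / of_nat n powr (1 + s) * (1 / s) + f n / of_nat n powr (1 + s) * (1 / s\<^sup>2)"
        "(\<integral>v. norm (c s n v) \<partial>lborel) = norm (f n * of_real (ln (real n))) / real n powr (1 + \<alpha>) * (1 / \<alpha>) + norm (f n) / real n powr (1 + \<alpha>) * (1 / \<alpha>\<^sup>2)"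
        by blast+
    qed
    have AEs: "AE v in lborel. summable (\<lambda>n. norm (c s n v))" using csum by (simp add: s_def)
    have sn: "summable (\<lambda>n. \<integral>v. norm (c s n v) \<partial>lborel)"
      unfolding cn
      using F_log_series(1)[OF s(2)] Lambda_facts(1)[OF s(2)] s(4)
      by (intro summable_add summable_mult2) (simp_all add: dirichlet_abs_conv_iff)
    have "(\<lambda>n. f n * of_real (ln (real n)) / of_nat n powr (1 + s) * (1 / s) + f n / of_nat n powr (1 + s) * (1 / s\<^sup>2))
        sums (dirichlet_series L (1 + s) * F (1 + s) * (1 / s) + F (1 + s) * (1 / s\<^sup>2))"
      unfolding F_log_series(2)[OF s(2), symmetric]
      by (intro sums_add sums_mult2 dirichlet_series_sums F_log_series(1) Lambda_facts s)
    also have "dirichlet_series L (1 + s) * F (1 + s) * (1 / s) + F (1 + s) * (1 / s\<^sup>2) = F (1 + s) / s * (dirichlet_series L (1 + s) + 1 / s)"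
      using s(3) by (simp add: field_simps power2_eq_square)
    finally have "(\<integral>v. (\<Sum>n. c s n v) \<partial>lborel) = F (1 + s) / s * (dirichlet_series L (1 + s) + 1 / s)"
      unfolding integral_suminf[OF ci AEs sn] cv by (simp add: sums_iff)
    moreover have "integrable lborel (\<lambda>v. \<Sum>n. c s n v)" by (rule integrable_suminf[OF ci AEs sn])
    ultimately show ?thesis unfolding hsum by (simp only: s_def simp_thms)
  qed
  from main[of 0] show "integrable lborel (h \<alpha>)" by simp
  from main[of t] show "(\<integral>v. h \<alpha> v * iexp (- (t * v)) \<partial>lborel) = F (1 + s) / s * (dirichlet_series L (1 + s) + 1 / s)"
    by (simp add: s_def)
qed

text \<open>After expanding the square, the sum over n close to a given m on the logarithmic scale
  is bounded, and the remaining sum over m is of order 1/\<alpha>. This is smaller by a factor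
  \<alpha> than the square of the pointwise bound. The truncation at N is removed by Fatou's
  lemma.\<close>

lemma L_mean_square:
  assumes \<alpha>: "0 < \<alpha>" "\<alpha> \<le> 1"
  shows "(\<integral>\<^sup>+t. ennreal ((norm (dirichlet_series L (Complex (1 + \<alpha>) t)))\<^sup>2 * exp (- (t - \<tau>)\<^sup>2 / 2)) \<partial>lborel)
     \<le> ennreal (sqrt (2 * pi) * (k\<^sup>2 * (2637\<^sup>2 * 216)) / \<alpha>)"
proof -
  define a where "a n = L n / of_real (real n powr (1 + \<alpha>))" for n
  define D where "D N t = (\<Sum>n\<in>{1..N}. a n * iexp (- (t * ln (real n))))" for N t
  define e where "e t = exp (- (t - \<tau>)\<^sup>2 / 2)" for t
  have [measurable]: "D N \<in> borel_measurable borel" for N unfolding D_def by measurable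
  have [measurable]: "e \<in> borel_measurable borel" unfolding e_def by measurable
  have bound: "(\<integral>\<^sup>+t. ennreal ((norm (D N t))\<^sup>2 * e t) \<partial>lborel) \<le> ennreal (sqrt (2 * pi) * (k\<^sup>2 * (2637\<^sup>2 * 216)) / \<alpha>)" for N
  proof -
    have na: "norm (a n) \<le> k * (mangoldt n / real n powr (1 + \<alpha>))" if "n \<in> {1..N}" for n
      using norm_L_le[of n] that by (simp add: a_def norm_divide divide_right_mono)
    \<comment> \<open>One of the two coefficients keeps its decay n^{-\<alpha>}; the other gives it
      up, its sum being localised by the Gaussian already.\<close>
    have na': "norm (a n) \<le> k * (mangoldt n / real n)" if n: "n \<in> {1..N}" for n
    proof -
      have "real n powr 1 \<le> real n powr (1 + \<alpha>)" using n \<alpha> by (intro powr_mono) auto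
      hence "mangoldt n / real n powr (1 + \<alpha>) \<le> mangoldt n / real n"
        using n by (intro divide_left_mono mangoldt_nonneg) auto
      hence "k * (mangoldt n / real n powr (1 + \<alpha>)) \<le> k * (mangoldt n / real n)" using k by (intro mult_left_mono) auto
      thus ?thesis using na[OF n] by linarith
    qed
    have "(\<Sum>m\<in>{1..N}. \<Sum>n\<in>{1..N}. norm (a m) * norm (a n) * exp (- (ln (real m) - ln (real n))\<^sup>2 / 2))
        \<le> (\<Sum>m\<in>{1..N}. (k * (mangoldt m / real m powr (1 + \<alpha>))) * (k * (2637 * (9 * 12))))"
    proof (rule sum_mono)
      fix m assume m: "m \<in> {1..N}"
      have "(\<Sum>n\<in>{1..N}. norm (a m) * norm (a n) * exp (- (ln (real m) - ln (real n))\<^sup>2 / 2))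
          = norm (a m) * (\<Sum>n\<in>{1..N}. norm (a n) * exp (- (ln (real m) - ln (real n))\<^sup>2 / 2))"
        by (simp only: sum_distrib_left mult.assoc)
      also have "\<dots> \<le> (k * (mangoldt m / real m powr (1 + \<alpha>))) * (k * (2637 * (9 * 12)))"
      proof (intro mult_mono na m)
        have "(\<Sum>n\<in>{1..N}. norm (a n) * exp (- (ln (real m) - ln (real n))\<^sup>2 / 2))
            \<le> (\<Sum>n\<in>{1..N}. k * (mangoldt n / real n) * exp (- (ln (real m) - ln (real n))\<^sup>2 / 2))"
          by (intro sum_mono mult_right_mono na') auto
        also have "\<dots> = k * (\<Sum>n\<in>{1..N}. mangoldt n / real n * exp (- (ln (real m) - ln (real n))\<^sup>2 / 2))"
          by (simp only: sum_distrib_left mult.assoc)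
        also have "\<dots> \<le> k * (2637 * (9 * 12))"
          using k m by (intro mult_left_mono mangoldt_gauss_sum_le) auto
        finally show "(\<Sum>n\<in>{1..N}. norm (a n) * exp (- (ln (real m) - ln (real n))\<^sup>2 / 2)) \<le> k * (2637 * (9 * 12))" .
      qed (use k in \<open>auto intro!: sum_nonneg mult_nonneg_nonneg divide_nonneg_nonneg mangoldt_nonneg\<close>)
      finally show "(\<Sum>n\<in>{1..N}. norm (a m) * norm (a n) * exp (- (ln (real m) - ln (real n))\<^sup>2 / 2))
          \<le> (k * (mangoldt m / real m powr (1 + \<alpha>))) * (k * (2637 * (9 * 12)))" .
    qed
    also have "\<dots> = (\<Sum>m\<in>{1..N}. mangoldt m / real m powr (1 + \<alpha>)) * (k * (k * (2637 * (9 * 12))))"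
      by (simp add: sum_distrib_left sum_distrib_right mult_ac)
    also have "\<dots> \<le> (2637 * (2 / \<alpha>)) * (k * (k * (2637 * (9 * 12))))"
      using k \<alpha> by (intro mult_right_mono mangoldt_powr_sum_le) auto
    also have "\<dots> = (k\<^sup>2 * (2637\<^sup>2 * 216)) / \<alpha>" by (simp add: power2_eq_square)
    finally have "sqrt (2 * pi) * (\<Sum>m\<in>{1..N}. \<Sum>n\<in>{1..N}. norm (a m) * norm (a n) * exp (- (ln (real m) - ln (real n))\<^sup>2 / 2))
        \<le> sqrt (2 * pi) * ((k\<^sup>2 * (2637\<^sup>2 * 216)) / \<alpha>)" by (rule mult_left_mono) simp
    hence le: "sqrt (2 * pi) * (\<Sum>m\<in>{1..N}. \<Sum>n\<in>{1..N}. norm (a m) * norm (a n) * exp (- (ln (real m) - ln (real n))\<^sup>2 / 2))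
        \<le> sqrt (2 * pi) * (k\<^sup>2 * (2637\<^sup>2 * 216)) / \<alpha>" by (simp only: times_divide_eq_right)
    show ?thesis unfolding D_def e_def
      by (rule order.trans[OF finite_dirichlet_mean_square[OF finite_atLeastAtMost] ennreal_leI[OF le]])
  qed
  have lim: "(\<lambda>N. ennreal ((norm (D N t))\<^sup>2 * e t)) \<longlonglongrightarrow> ennreal ((norm (dirichlet_series L (Complex (1 + \<alpha>) t)))\<^sup>2 * e t)" for t
  proof -
    have "(\<lambda>n. L n / of_nat n powr Complex (1 + \<alpha>) t) sums dirichlet_series L (Complex (1 + \<alpha>) t)"
      using \<alpha> by (intro dirichlet_series_sums Lambda_facts) auto
    hence "(\<lambda>N. \<Sum>n<Suc N. L n / of_nat n powr Complex (1 + \<alpha>) t) \<longlonglongrightarrow> dirichlet_series L (Complex (1 + \<alpha>) t)"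
      unfolding sums_def by (rule LIMSEQ_Suc)
    moreover have "(\<Sum>n<Suc N. L n / of_nat n powr Complex (1 + \<alpha>) t) = D N t" for N
    proof -
      have "(\<Sum>n<Suc N. L n / of_nat n powr Complex (1 + \<alpha>) t) = (\<Sum>n\<in>{1..N}. L n / of_nat n powr Complex (1 + \<alpha>) t)"
        by (intro sum.mono_neutral_right) (auto simp: not_le)
      also have "\<dots> = D N t"
        unfolding D_def
      proof (intro sum.cong refl)
        fix n assume n: "n \<in> {1..N}"
        have "L n / of_nat n powr Complex (1 + \<alpha>) t = L n * (1 / of_nat n powr Complex (1 + \<alpha>) t)" by simp
        also have "1 / of_nat n powr Complex (1 + \<alpha>) t = of_real (1 / real n powr (1 + \<alpha>)) * cis (- (t * ln (real n)))"
          using n by (intro inverse_nat_powr_Complex) auto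
        finally show "L n / of_nat n powr Complex (1 + \<alpha>) t = a n * iexp (- (t * ln (real n)))"
          by (simp add: a_def cis_conv_exp)
      qed
      finally show ?thesis .
    qed
    ultimately have "(\<lambda>N. D N t) \<longlonglongrightarrow> dirichlet_series L (Complex (1 + \<alpha>) t)" by simp
    hence "(\<lambda>N. (norm (D N t))\<^sup>2 * e t) \<longlonglongrightarrow> (norm (dirichlet_series L (Complex (1 + \<alpha>) t)))\<^sup>2 * e t"
      by (intro tendsto_intros)
    thus ?thesis by (rule tendsto_ennrealI)
  qed
  have "(\<integral>\<^sup>+t. ennreal ((norm (dirichlet_series L (Complex (1 + \<alpha>) t)))\<^sup>2 * e t) \<partial>lborel)
      = (\<integral>\<^sup>+t. liminf (\<lambda>N. ennreal ((norm (D N t))\<^sup>2 * e t)) \<partial>lborel)"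
    by (intro nn_integral_cong) (rule lim_imp_Liminf[OF _ lim, symmetric], simp)
  also have "\<dots> \<le> liminf (\<lambda>N. (\<integral>\<^sup>+t. ennreal ((norm (D N t))\<^sup>2 * e t) \<partial>lborel))"
    by (rule nn_integral_liminf) measurable
  also have "\<dots> \<le> ennreal (sqrt (2 * pi) * (k\<^sup>2 * (2637\<^sup>2 * 216)) / \<alpha>)"
    by (rule Liminf_le) (use bound in \<open>auto intro!: always_eventually\<close>)
  finally show ?thesis by (simp only: e_def)
qed

lemma L_series_measurable:
  assumes \<alpha>: "0 < \<alpha>"
  shows "(\<lambda>t. dirichlet_series L (Complex (1 + \<alpha>) t)) \<in> borel_measurable borel"
proof -
  have "dirichlet_series L (Complex (1 + \<alpha>) t) = (\<Sum>n. L n * (of_real (1 / real n powr (1 + \<alpha>)) * iexp (- (t * ln (real n)))))" for t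
  proof -
    have "(\<lambda>n. L n / of_nat n powr Complex (1 + \<alpha>) t) sums dirichlet_series L (Complex (1 + \<alpha>) t)"
      using \<alpha> by (intro dirichlet_series_sums Lambda_facts) auto
    moreover have "L n / of_nat n powr Complex (1 + \<alpha>) t = L n * (of_real (1 / real n powr (1 + \<alpha>)) * iexp (- (t * ln (real n))))" for n
    proof (cases "n = 0")
      case False
      have "L n / of_nat n powr Complex (1 + \<alpha>) t = L n * (1 / of_nat n powr Complex (1 + \<alpha>) t)" by simp
      also have "1 / of_nat n powr Complex (1 + \<alpha>) t = of_real (1 / real n powr (1 + \<alpha>)) * cis (- (t * ln (real n)))"
        using False by (intro inverse_nat_powr_Complex) auto
      finally show ?thesis by (simp add: cis_conv_exp)
    qed simp
    ultimately show ?thesis by (simp add: sums_iff)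
  qed
  thus ?thesis by (simp only:) measurable
qed

end

text \<open>The summands with 24 and 8 are the weighted mean squares of the series of L and of 1/s,
  the outer 2 stems from (x + y)^2 <= 2 (x^2 + y^2), and 2 pi from Plancherel.\<close>

definition mean_square_const :: "real \<Rightarrow> real" where
  "mean_square_const k = (2 * (24 * (sqrt (2 * pi) * (k\<^sup>2 * (2637\<^sup>2 * 216))) + 8)) / (2 * pi)"

context class_C_function
begin

text \<open>The square of the transform is at most M^2 \<open>wt t\<close> |L + 1/s|^2, so the mean
  square of the series of L enters with an integrable weight and Plancherel's inequality
  applies.\<close>

theorem T_second_moment:
  assumes \<alpha>: "0 < \<alpha>" "\<alpha> \<le> 1" and M: "M \<ge> 0"
    and F_le: "\<And>t. norm (F (Complex (1 + \<alpha>) t) / Complex \<alpha> t) \<le> M * (1 + \<bar>t\<bar>) powr (-3/4)"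
  shows "integrable lborel (\<lambda>v. (norm (h \<alpha> v))\<^sup>2)" "(\<integral>v. (norm (h \<alpha> v))\<^sup>2 \<partial>lborel) \<le> mean_square_const k * M\<^sup>2 / \<alpha>"
proof -
  define C where "C = sqrt (2 * pi) * (k\<^sup>2 * (2637\<^sup>2 * 216)) / \<alpha>"
  have C: "C \<ge> 0" using \<alpha> by (simp add: C_def)
  define \<phi> where "\<phi> t = (norm (dirichlet_series L (Complex (1 + \<alpha>) t)))\<^sup>2" for t
  have [measurable]: "\<phi> \<in> borel_measurable borel"
    unfolding \<phi>_def using L_series_measurable[OF \<alpha>(1)] by measurable
  have [measurable]: "(\<lambda>t. norm (Complex \<alpha> t)) \<in> borel_measurable borel" unfolding cmod_def by simp
  obtain B where B: "\<And>v. norm (h \<alpha> v) \<le> B" using h_bounded[OF \<alpha>(1)] by blast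
  have le: "(norm (\<integral>v. h \<alpha> v * iexp (- (t * v)) \<partial>lborel))\<^sup>2 \<le> 2 * M\<^sup>2 * (wt t * \<phi> t + 1 / (norm (Complex \<alpha> t))\<^sup>2)" for t
  proof -
    define s where "s = Complex \<alpha> t"
    have s1: "1 + s = Complex (1 + \<alpha>) t" by (simp add: s_def complex_eq_iff)
    define x y where "x = norm (dirichlet_series L (1 + s))" and "y = 1 / norm s"
    have "norm (\<integral>v. h \<alpha> v * iexp (- (t * v)) \<partial>lborel) = norm (F (1 + s) / s) * norm (dirichlet_series L (1 + s) + 1 / s)"
      unfolding h_laplace(2)[OF \<alpha>(1), of t, folded s_def] by (rule norm_mult)
    also have "\<dots> \<le> (M * (1 + \<bar>t\<bar>) powr (-3/4)) * (x + y)"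
    proof (intro mult_mono)
      show "norm (F (1 + s) / s) \<le> M * (1 + \<bar>t\<bar>) powr (-3/4)" unfolding s1 using F_le[of t] by (simp only: s_def)
      show "norm (dirichlet_series L (1 + s) + 1 / s) \<le> x + y"
        using norm_triangle_ineq[of "dirichlet_series L (1 + s)" "1 / s"] by (simp add: x_def y_def norm_divide)
    qed (use M in auto)
    finally have "(norm (\<integral>v. h \<alpha> v * iexp (- (t * v)) \<partial>lborel))\<^sup>2 \<le> ((M * (1 + \<bar>t\<bar>) powr (-3/4)) * (x + y))\<^sup>2"
      by (rule power_mono) simp
    also have "\<dots> = M\<^sup>2 * wt t * (x + y)\<^sup>2"
      by (simp add: power_mult_distrib wt_def powr_powr flip: powr_numeral)
    also have "\<dots> \<le> M\<^sup>2 * wt t * (2 * (x\<^sup>2 + y\<^sup>2))"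
    proof (rule mult_left_mono)
      show "(x + y)\<^sup>2 \<le> 2 * (x\<^sup>2 + y\<^sup>2)" using zero_le_power2[of "x - y"] by (simp add: power2_sum power2_diff)
    qed (use wt_pos[of t] in auto)
    also have "\<dots> = 2 * M\<^sup>2 * (wt t * x\<^sup>2 + wt t * y\<^sup>2)" by (simp add: algebra_simps)
    \<comment> \<open>The weight is dropped from the second term, since 1/|s|^2 already has an
      integral of order 1/\<alpha>.\<close>
    also have "\<dots> \<le> 2 * M\<^sup>2 * (wt t * x\<^sup>2 + 1 * y\<^sup>2)"
      using wt_pos[of t] by (intro mult_left_mono add_left_mono mult_right_mono) auto
    finally show ?thesis by (simp add: x_def y_def \<phi>_def s1 power_divide) (simp add: s_def)?
  qed
  have "(\<integral>\<^sup>+t. ennreal ((norm (\<integral>v. h \<alpha> v * iexp (- (t * v)) \<partial>lborel))\<^sup>2) \<partial>lborel)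
      \<le> (\<integral>\<^sup>+t. ennreal (2 * M\<^sup>2) * (ennreal (wt t * \<phi> t) + ennreal (1 / (norm (Complex \<alpha> t))\<^sup>2)) \<partial>lborel)"
  proof (intro nn_integral_mono)
    fix t
    have "0 \<le> wt t * \<phi> t" using wt_pos[of t] by (simp add: \<phi>_def)
    hence "ennreal (2 * M\<^sup>2) * (ennreal (wt t * \<phi> t) + ennreal (1 / (norm (Complex \<alpha> t))\<^sup>2)) =
        ennreal (2 * M\<^sup>2 * (wt t * \<phi> t + 1 / (norm (Complex \<alpha> t))\<^sup>2))"
      by (simp add: ennreal_mult ennreal_plus[symmetric] del: ennreal_plus)
    thus "ennreal ((norm (\<integral>v. h \<alpha> v * iexp (- (t * v)) \<partial>lborel))\<^sup>2) \<le>
        ennreal (2 * M\<^sup>2) * (ennreal (wt t * \<phi> t) + ennreal (1 / (norm (Complex \<alpha> t))\<^sup>2))"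
      using ennreal_leI[OF le[of t]] by simp
  qed
  also have "\<dots> = ennreal (2 * M\<^sup>2) * ((\<integral>\<^sup>+t. ennreal (wt t * \<phi> t) \<partial>lborel) + (\<integral>\<^sup>+t. ennreal (1 / (norm (Complex \<alpha> t))\<^sup>2) \<partial>lborel))"
  proof -
    have m: "(\<lambda>t. ennreal (wt t * \<phi> t)) \<in> borel_measurable lborel"
      "(\<lambda>t. ennreal (1 / (norm (Complex \<alpha> t))\<^sup>2)) \<in> borel_measurable lborel" by measurable
    show ?thesis by (simp only: nn_integral_cmult[OF borel_measurable_add[OF m]] nn_integral_add[OF m])
  qed
  also have "\<dots> \<le> ennreal (2 * M\<^sup>2) * (ennreal (24 * C) + ennreal (8 / \<alpha>))"
  proof (intro mult_left_mono add_mono)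
    show "(\<integral>\<^sup>+t. ennreal (wt t * \<phi> t) \<partial>lborel) \<le> ennreal (24 * C)"
    proof (rule nn_integral_wt_le)
      show "(\<integral>\<^sup>+t. ennreal (\<phi> t * exp (- (t - \<tau>)\<^sup>2 / 2)) \<partial>lborel) \<le> ennreal C" for \<tau>
        unfolding \<phi>_def C_def by (rule L_mean_square[OF \<alpha>])
      show "\<phi> \<in> borel_measurable borel" by measurable
      show "\<phi> t \<ge> 0" for t by (simp add: \<phi>_def)
    qed (rule C)
    show "(\<integral>\<^sup>+t. ennreal (1 / (norm (Complex \<alpha> t))\<^sup>2) \<partial>lborel) \<le> ennreal (8 / \<alpha>)"
      by (rule nn_integral_wt_div[OF \<alpha>(1)])
  qed auto
  also have "\<dots> = ennreal (2 * M\<^sup>2 * (24 * C + 8 / \<alpha>))"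
  proof -
    have "ennreal (24 * C) + ennreal (8 / \<alpha>) = ennreal (24 * C + 8 / \<alpha>)"
      using C \<alpha> by (intro ennreal_plus[symmetric]) auto
    thus ?thesis using C \<alpha> by (simp only:) (intro ennreal_mult[symmetric], auto)
  qed
  finally have *: "(\<integral>\<^sup>+t. ennreal ((norm (\<integral>v. h \<alpha> v * iexp (- (t * v)) \<partial>lborel))\<^sup>2) \<partial>lborel) \<le> ennreal (2 * M\<^sup>2 * (24 * C + 8 / \<alpha>))" .
  have "2 * M\<^sup>2 * (24 * C + 8 / \<alpha>) \<ge> 0" using C \<alpha> by simp
  note p = plancherel_inequality[OF h_laplace(1)[OF \<alpha>(1)] B isCont_h * this]
  show "integrable lborel (\<lambda>v. (norm (h \<alpha> v))\<^sup>2)" by (rule p(1))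
  have "2 * M\<^sup>2 * (24 * C + 8 / \<alpha>) / (2 * pi) = mean_square_const k * M\<^sup>2 / \<alpha>"
  proof -
    define K where "K = sqrt (2 * pi) * (k\<^sup>2 * (2637\<^sup>2 * 216))"
    have "24 * C + 8 / \<alpha> = (24 * K + 8) / \<alpha>" by (simp add: C_def K_def add_divide_distrib)
    moreover have "mean_square_const k = (2 * (24 * K + 8)) / (2 * pi)" by (simp only: mean_square_const_def K_def)
    moreover have "2 * M\<^sup>2 * (Q / \<alpha>) / (2 * pi) = (2 * Q) / (2 * pi) * M\<^sup>2 / \<alpha>" for Q by (simp add: mult.commute)
    ultimately show ?thesis by (simp only:)
  qed
  thus "(\<integral>v. (norm (h \<alpha> v))\<^sup>2 \<partial>lborel) \<le> mean_square_const k * M\<^sup>2 / \<alpha>" using p(2) by simp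
qed

end

section \<open>A Halasz type inequality for the logarithmic mean\<close>

lemma integrable_indicator_Icc: "integrable lborel (indicator {a..b} :: real \<Rightarrow> real)"
  by (rule integrable_real_indicator) (auto simp: emeasure_lborel_Icc_eq)

lemma sum_divisor_pairs:
  fixes g :: "nat \<Rightarrow> nat \<Rightarrow> 'b :: comm_monoid_add"
  shows "(\<Sum>n\<in>{1..N}. \<Sum>d | d dvd n. g d (n div d)) = (\<Sum>d\<in>{1..N}. \<Sum>m\<in>{1..N div d}. g d m)"
proof -
  have "(\<Sum>n\<in>{1..N}. \<Sum>d | d dvd n. g d (n div d)) = (\<Sum>(n, d)\<in>(SIGMA n:{1..N}. {d. d dvd n}). g d (n div d))"
    by (rule sum.Sigma) auto
  also have "\<dots> = (\<Sum>(d, m)\<in>(SIGMA d:{1..N}. {1..N div d}). g d m)"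
  proof (rule sum.reindex_bij_witness[of _ "\<lambda>(d, m). (d * m, d)" "\<lambda>(n, d). (d, n div d)"])
    fix x assume "x \<in> (SIGMA n:{1..N}. {d. d dvd n})"
    then obtain n d where x: "x = (n, d)" "1 \<le> n" "n \<le> N" "d dvd n" by auto
    then obtain m where n: "n = d * m" by (auto elim: dvdE)
    have "d \<ge> 1" "m \<ge> 1" using x n by (auto simp: Suc_le_eq)
    thus "(case case x of (n, d) \<Rightarrow> (d, n div d) of (d, m) \<Rightarrow> (d * m, d)) = x"
      "(case x of (n, d) \<Rightarrow> (d, n div d)) \<in> (SIGMA d:{1..N}. {1..N div d})"
      "(case case x of (n, d) \<Rightarrow> (d, n div d) of (d, m) \<Rightarrow> g d m) = (case x of (n, d) \<Rightarrow> g d (n div d))"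
      using x n by (auto simp: less_eq_div_iff_mult_less_eq mult.commute intro: order.trans[of d "d * m"])
  next
    fix x assume "x \<in> (SIGMA d:{1..N}. {1..N div d})"
    then obtain d m where x: "x = (d, m)" "1 \<le> d" "1 \<le> m" "m \<le> N div d" by auto
    hence "d * m \<le> N" by (simp add: less_eq_div_iff_mult_less_eq mult.commute)
    thus "(case case x of (d, m) \<Rightarrow> (d * m, d) of (n, d) \<Rightarrow> (d, n div d)) = x"
      "(case x of (d, m) \<Rightarrow> (d * m, d)) \<in> (SIGMA n:{1..N}. {d. d dvd n})"
      using x by auto
  qed
  also have "\<dots> = (\<Sum>d\<in>{1..N}. \<Sum>m\<in>{1..N div d}. g d m)"
    by (rule sum.Sigma[symmetric]) auto
  finally show ?thesis .
qed

lemma real_le_iff_nat_floor: "1 \<le> n \<Longrightarrow> real n \<le> x \<longleftrightarrow> n \<le> nat \<lfloor>x\<rfloor>"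
  using le_nat_floor[of n x] by linarith

lemma nat_le_real_set: "{n. 1 \<le> n \<and> real n \<le> x} = {1..nat \<lfloor>x\<rfloor>}"
  using real_le_iff_nat_floor by auto

context class_C_function
begin

text \<open>A majorant of |T| that also controls the total variation of T; a crude bound for it is
  enough, as it will be multiplied by a small window length.\<close>

definition absS :: "real \<Rightarrow> real" where
  "absS v = (\<Sum>n | 1 \<le> n \<and> real n \<le> exp v. norm (f n) / real n)"

lemma norm_f_ln_le: "n \<ge> 1 \<Longrightarrow> norm (f n) * ln (real n) \<le> (\<Sum>d | d dvd n. k * mangoldt d * norm (f (n div d)))"
proof -
  assume n: "n \<ge> 1"
  have "norm (f n) * ln (real n) = norm (f n * of_real (ln (real n)))" using n by (simp add: norm_mult)
  also have "\<dots> = norm (\<Sum>d | d dvd n. L d * f (n div d))"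
    unfolding is_Lambda_of_recurrence[OF Lambda n] dirichlet_conv_def ..
  also have "\<dots> \<le> (\<Sum>d | d dvd n. k * mangoldt d * norm (f (n div d)))"
  proof (rule sum_norm_le)
    fix d assume "d \<in> {d. d dvd n}"
    hence "d \<ge> 1" using n by (auto intro!: Nat.gr0I simp: Suc_le_eq)
    thus "norm (L d * f (n div d)) \<le> k * mangoldt d * norm (f (n div d))"
      unfolding norm_mult by (intro mult_right_mono norm_L_le) auto
  qed
  finally show ?thesis .
qed

text \<open>A differential inequality in s: by the recurrence for f log, minus the logarithmic
  derivative of P is at most k times minus the derivative of Q, the truncated series of log zeta. So
  ln P - k Q is nondecreasing; it tends to 0 at infinity and is therefore at most 0.\<close>

lemma partial_sum_le_zeta_powr:
  assumes s: "s > 1"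
  shows "(\<Sum>n\<in>{1..N}. norm (f n) * real n powr (-s)) \<le> norm (zeta (of_real s)) powr k"
proof (cases "N \<ge> 1")
  case False
  thus ?thesis by simp
next
  case N: True
  define P where "P s = (\<Sum>n\<in>{1..N}. norm (f n) * real n powr (-s))" for s
  define Q where "Q s = (\<Sum>n\<in>{1..N}. mangoldt_weight n * real n powr (-s))" for s
  have P: "P s > 0" for s
  proof -
    have "norm (f 1) * real 1 powr (-s) \<le> P s"
      unfolding P_def using N by (intro member_le_sum) auto
    thus ?thesis using f1 by simp
  qed
  \<comment> \<open>\<open>P'\<close> is minus the derivative of \<open>P\<close>.\<close>
  define P' where "P' s = (\<Sum>n\<in>{1..N}. norm (f n) * ln (real n) * real n powr (-s))" for s
  have dpow: "((\<lambda>s. real n powr (-s)) has_real_derivative - (ln (real n) * real n powr (-s))) (at s)" if "n \<in> {1..N}" for n s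
    using that unfolding powr_def by (auto intro!: derivative_eq_intros)
  have dP: "(P has_real_derivative - P' s) (at s)" for s
    unfolding P_def[abs_def] P'_def sum_negf[symmetric]
    by (rule DERIV_sum) (rule DERIV_cong[OF DERIV_cmult[OF dpow]], auto)
  have dQ: "(Q has_real_derivative - (\<Sum>n\<in>{1..N}. mangoldt n * real n powr (-s))) (at s)" for s
    unfolding Q_def[abs_def] sum_negf[symmetric]
  proof (rule DERIV_sum)
    fix n assume n: "n \<in> {1..N}"
    have "mangoldt_weight n * ln (real n) = mangoldt n" using n by (cases "n = 1") (auto simp: mangoldt_weight_def)
    thus "((\<lambda>s. mangoldt_weight n * real n powr (-s)) has_real_derivative - (mangoldt n * real n powr (-s))) (at s)"
      by (intro DERIV_cong[OF DERIV_cmult[OF dpow[OF n]]]) (simp add: mult.assoc[symmetric])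
  qed
  have le: "P' s \<le> k * (\<Sum>n\<in>{1..N}. mangoldt n * real n powr (-s)) * P s" for s
  proof -
    define g where "g d m = (k * (mangoldt d * real d powr (-s))) * (norm (f m) * real m powr (-s))" for d m
    have g0: "g d m \<ge> 0" for d m using k by (simp add: g_def mangoldt_nonneg)
    have "P' s \<le> (\<Sum>n\<in>{1..N}. \<Sum>d | d dvd n. g d (n div d))"
      unfolding P'_def
    proof (rule sum_mono)
      fix n assume n: "n \<in> {1..N}"
      have "norm (f n) * ln (real n) * real n powr (-s) \<le> (\<Sum>d | d dvd n. k * mangoldt d * norm (f (n div d))) * real n powr (-s)"
        using n by (intro mult_right_mono norm_f_ln_le) auto
      also have "\<dots> = (\<Sum>d | d dvd n. g d (n div d))"
        unfolding sum_distrib_right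
      proof (intro sum.cong refl)
        fix d assume "d \<in> {d. d dvd n}"
        then obtain m where m: "n = d * m" by (auto elim: dvdE)
        have "d > 0" using n m by (auto intro!: Nat.gr0I)
        thus "k * mangoldt d * norm (f (n div d)) * real n powr (-s) = g d (n div d)"
          by (simp add: m g_def powr_mult mult_ac)
      qed
      finally show "norm (f n) * ln (real n) * real n powr (-s) \<le> (\<Sum>d | d dvd n. g d (n div d))" .
    qed
    also have "\<dots> = (\<Sum>d\<in>{1..N}. \<Sum>m\<in>{1..N div d}. g d m)" by (rule sum_divisor_pairs)
    \<comment> \<open>Extending the hyperbolic region to a square adds nonnegative terms only and
      makes the double sum a product.\<close>
    also have "\<dots> \<le> (\<Sum>d\<in>{1..N}. \<Sum>m\<in>{1..N}. g d m)"
      using g0 by (intro sum_mono sum_mono2) (auto intro: order.trans[OF _ div_le_dividend])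
    also have "\<dots> = k * (\<Sum>n\<in>{1..N}. mangoldt n * real n powr (-s)) * P s"
    proof -
      have "(\<Sum>d\<in>{1..N}. \<Sum>m\<in>{1..N}. g d m) = (\<Sum>d\<in>{1..N}. k * (mangoldt d * real d powr (-s))) * P s"
        by (simp only: g_def P_def sum_product)
      thus ?thesis by (simp only: sum_distrib_left)
    qed
    finally show ?thesis .
  qed
  define \<phi> where "\<phi> s = ln (P s) - k * Q s" for s
  have mono: "\<phi> s \<le> \<phi> s'" if "s \<le> s'" for s s'
  proof (rule DERIV_nonneg_imp_nondecreasing[OF that])
    fix x
    have "(\<phi> has_real_derivative (- P' x / P x - k * - (\<Sum>n\<in>{1..N}. mangoldt n * real n powr (-x)))) (at x)"
      unfolding \<phi>_def[abs_def] using P[of x]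
      by (auto intro!: derivative_eq_intros dP dQ simp: field_simps)
    moreover have "P' x / P x \<le> k * (\<Sum>n\<in>{1..N}. mangoldt n * real n powr (-x))"
      using le[of x] P[of x] by (simp add: divide_le_eq)
    ultimately show "\<exists>y. (\<phi> has_real_derivative y) (at x) \<and> 0 \<le> y"
      by (intro exI[of _ "- P' x / P x - k * - (\<Sum>n\<in>{1..N}. mangoldt n * real n powr (-x))"]) simp
  qed
  have pw: "(\<lambda>j. real n powr (- (s + real j))) \<longlonglongrightarrow> of_bool (n = 1)" if "n \<in> {1..N}" for n
  proof (cases "n = 1")
    case False
    hence n: "real n \<ge> 2" using that by simp
    have "real n powr (- (s + real j)) = real n powr (-s) * (1 / real n) ^ j" for j
      using n by (simp add: powr_diff powr_minus powr_realpow field_simps)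
    moreover have "(\<lambda>j. real n powr (-s) * (1 / real n) ^ j) \<longlonglongrightarrow> real n powr (-s) * 0"
      using n by (intro tendsto_intros LIMSEQ_power_zero) auto
    ultimately show ?thesis using False by simp
  qed simp
  have "(\<lambda>j. P (s + real j)) \<longlonglongrightarrow> (\<Sum>n\<in>{1..N}. norm (f n) * of_bool (n = 1))"
    unfolding P_def by (intro tendsto_intros pw)
  also have "(\<Sum>n\<in>{1..N}. norm (f n) * of_bool (n = 1)) = 1"
    using N f1 by (subst sum.remove[of _ 1]) auto
  finally have limP: "(\<lambda>j. P (s + real j)) \<longlonglongrightarrow> 1" .
  have "(\<lambda>j. Q (s + real j)) \<longlonglongrightarrow> (\<Sum>n\<in>{1..N}. mangoldt_weight n * of_bool (n = 1))"
    unfolding Q_def by (intro tendsto_intros pw)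
  also have "(\<Sum>n\<in>{1..N}. mangoldt_weight n * of_bool (n = 1)) = 0"
    by (intro sum.neutral) (auto simp: mangoldt_weight_def)
  finally have limQ: "(\<lambda>j. Q (s + real j)) \<longlonglongrightarrow> 0" .
  have "(\<lambda>j. \<phi> (s + real j)) \<longlonglongrightarrow> ln 1 - k * 0"
    unfolding \<phi>_def by (intro tendsto_intros limP limQ) auto
  hence "\<phi> s \<le> ln 1 - k * 0"
    by (rule LIMSEQ_le_const) (use mono in \<open>auto intro!: exI[of _ 0]\<close>)
  hence "ln (P s) \<le> k * Q s" by (simp add: \<phi>_def)
  also have "Q s \<le> ln (norm (zeta (of_real s)))"
  proof -
    note z = ln_zeta_sums[OF s]
    have "Q s = (\<Sum>n\<in>{1..N}. mangoldt_weight n / real n powr s)" by (simp add: Q_def powr_minus field_simps)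
    also have "\<dots> \<le> (\<Sum>n. mangoldt_weight n / real n powr s)"
      using mangoldt_weight_bounds by (intro sum_le_suminf sums_summable[OF z]) auto
    finally show ?thesis using z by (simp add: sums_iff)
  qed
  finally have "ln (P s) \<le> k * ln (norm (zeta (of_real s)))" using k by (simp add: mult_left_mono)
  moreover have "norm (zeta (of_real s)) > 0" using zeta_nonzero[of "of_real s"] s by simp
  ultimately have "P s \<le> norm (zeta (of_real s)) powr k"
    using P[of s] by (simp add: powr_def ln_le_iff_le_exp)
  thus ?thesis by (simp add: P_def)
qed

lemma absS_nonneg: "absS v \<ge> 0"
  unfolding absS_def by (intro sum_nonneg) auto

text \<open>Rankin's trick with \<beta> = 1/(1+y): for n <= e^y the factor n^\<beta> is at most e,
  and zeta(1+\<beta>) is of order at most 1 + y.\<close>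

lemma absS_le:
  assumes y: "y \<ge> 0"
  shows "absS y \<le> 3 * (14 * (1 + y)) powr k"
proof -
  define \<beta> where "\<beta> = 1 / (1 + y)"
  have \<beta>: "0 < \<beta>" "\<beta> \<le> 1" "y * \<beta> \<le> 1" using y by (auto simp: \<beta>_def field_simps)
  define N where "N = nat \<lfloor>exp y\<rfloor>"
  have "absS y = (\<Sum>n\<in>{1..N}. norm (f n) / real n)" unfolding absS_def nat_le_real_set N_def ..
  also have "\<dots> \<le> (\<Sum>n\<in>{1..N}. exp 1 * (norm (f n) * real n powr (- (1 + \<beta>))))"
  proof (rule sum_mono)
    fix n assume "n \<in> {1..N}"
    hence n: "n \<ge> 1" "real n \<le> exp y" by (auto simp: N_def le_nat_iff le_floor_iff)
    have "real n powr \<beta> \<le> exp y powr \<beta>" using n \<beta> by (intro powr_mono2) auto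
    also have "\<dots> \<le> exp 1" using \<beta> by (simp add: powr_def mult.commute)
    finally have "1 \<le> exp 1 * real n powr (-\<beta>)" using n by (simp add: powr_minus field_simps)
    hence "norm (f n) / real n * 1 \<le> norm (f n) / real n * (exp 1 * real n powr (-\<beta>))"
      by (intro mult_left_mono) auto
    thus "norm (f n) / real n \<le> exp 1 * (norm (f n) * real n powr (- (1 + \<beta>)))"
      using n by (simp add: powr_diff powr_minus field_simps)
  qed
  also have "\<dots> = exp 1 * (\<Sum>n\<in>{1..N}. norm (f n) * real n powr (- (1 + \<beta>)))" by (simp add: sum_distrib_left)
  also have "\<dots> \<le> 3 * norm (zeta (of_real (1 + \<beta>))) powr k"
    using exp_le \<beta> by (intro mult_mono partial_sum_le_zeta_powr sum_nonneg) auto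
  also have "\<dots> \<le> 3 * (14 / \<beta>) powr k"
    using k \<beta> by (intro mult_left_mono powr_mono2 norm_zeta_real_bounds) auto
  also have "14 / \<beta> = 14 * (1 + y)" by (simp add: \<beta>_def)
  finally show ?thesis .
qed

lemma absS_mono: "v \<le> w \<Longrightarrow> absS v \<le> absS w"
  unfolding absS_def by (intro sum_mono2) (auto intro: order.trans)

lemma norm_T_le_absS: "norm (T v) \<le> absS v"
  unfolding T_def S1_def absS_def by (intro sum_norm_le) (simp add: norm_divide)

lemma norm_T_integrable: "integrable lborel (\<lambda>v. indicator {a..b} v * norm (T v))"
proof (rule Bochner_Integration.integrable_bound)
  show "integrable lborel (\<lambda>v. indicator {a..b} v * absS b)"
    by (intro integrable_mult_left integrable_indicator_Icc)
  show "AE v in lborel. norm (indicator {a..b} v * norm (T v)) \<le> norm (indicator {a..b} v * absS b)"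
    using order.trans[OF norm_T_le_absS absS_mono] absS_nonneg by (intro AE_I2) (auto simp: indicator_def)
qed auto

definition Phi :: "real \<Rightarrow> real" where "Phi y = (\<integral>v. indicator {0..y} v * norm (T v) \<partial>lborel)"

lemma Phi_nonneg: "Phi y \<ge> 0"
  unfolding Phi_def by (rule Bochner_Integration.integral_nonneg) auto

lemma Phi_mono: "y \<le> y' \<Longrightarrow> Phi y \<le> Phi y'"
  unfolding Phi_def by (intro integral_mono norm_T_integrable) (auto simp: indicator_def)

lemma T_shift:
  assumes "d \<ge> 1"
  shows "T (y - ln (real d)) = (\<Sum>m\<in>{1..nat \<lfloor>exp y\<rfloor> div d}. f m / of_nat m)"
proof -
  have "exp (y - ln (real d)) = exp y / real d" using assms by (simp add: exp_diff)
  moreover have "{m. 1 \<le> m \<and> real m \<le> exp y / real d} = {1..nat \<lfloor>exp y\<rfloor> div d}"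
  proof (intro set_eqI)
    fix m :: nat
    have "real m \<le> exp y / real d \<longleftrightarrow> real (m * d) \<le> exp y" using assms by (simp add: field_simps)
    also have "\<dots> \<longleftrightarrow> m * d \<le> nat \<lfloor>exp y\<rfloor>" by (simp add: le_nat_iff le_floor_iff del: of_nat_mult)
    also have "\<dots> \<longleftrightarrow> m \<le> nat \<lfloor>exp y\<rfloor> div d" using assms by (simp add: less_eq_div_iff_mult_less_eq)
    finally show "m \<in> {m. 1 \<le> m \<and> real m \<le> exp y / real d} \<longleftrightarrow> m \<in> {1..nat \<lfloor>exp y\<rfloor> div d}" by auto
  qed
  ultimately show ?thesis by (simp add: T_def S1_def)
qed

text \<open>Each term is weighted by y = ln n + (y - ln n). The part with ln n becomes a sum of T(y
  - ln d) by the recurrence; the other part is the integral of T over [0, y], since n is counted in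
  T(v) for v from ln n to y.\<close>

lemma y_T_le:
  assumes y: "y \<ge> 0"
  shows "y * norm (T y) \<le> Phi y + k * (\<Sum>d\<in>{1..nat \<lfloor>exp y\<rfloor>}. mangoldt d / real d * norm (T (y - ln (real d))))"
proof -
  define N where "N = nat \<lfloor>exp y\<rfloor>"
  have nN: "real n \<le> exp y" "0 \<le> ln (real n)" "ln (real n) \<le> y" if "n \<in> {1..N}" for n
  proof -
    show "real n \<le> exp y" "0 \<le> ln (real n)" using that by (auto simp: N_def le_nat_iff le_floor_iff)
    thus "ln (real n) \<le> y" using that by (subst ln_le_iff_le_exp) auto
  qed
  have Ty: "T y = (\<Sum>n\<in>{1..N}. f n / of_nat n)" unfolding T_def S1_def nat_le_real_set N_def ..
  have "of_real y * T y = (\<Sum>n\<in>{1..N}. f n * of_real (ln (real n)) / of_nat n) + (\<Sum>n\<in>{1..N}. f n / of_nat n * of_real (y - ln (real n)))"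
    unfolding Ty sum_distrib_left sum.distrib[symmetric] by (intro sum.cong refl) (simp add: algebra_simps)
  also have "(\<Sum>n\<in>{1..N}. f n * of_real (ln (real n)) / of_nat n) = (\<Sum>n\<in>{1..N}. \<Sum>d | d dvd n. (L d / of_nat d) * (f (n div d) / of_nat (n div d)))"
  proof (intro sum.cong refl)
    fix n assume n: "n \<in> {1..N}"
    have "f n * of_real (ln (real n)) / of_nat n = (\<Sum>d | d dvd n. L d * f (n div d) / of_nat n)"
      using is_Lambda_of_recurrence[OF Lambda, of n] n by (simp add: dirichlet_conv_def sum_divide_distrib)
    also have "\<dots> = (\<Sum>d | d dvd n. (L d / of_nat d) * (f (n div d) / of_nat (n div d)))"
    proof (intro sum.cong refl)
      fix d assume "d \<in> {d. d dvd n}"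
      then obtain m where "n = d * m" by (auto elim: dvdE)
      thus "L d * f (n div d) / of_nat n = (L d / of_nat d) * (f (n div d) / of_nat (n div d))"
        using n by auto
    qed
    finally show "f n * of_real (ln (real n)) / of_nat n = \<dots>" .
  qed
  also have "\<dots> = (\<Sum>d\<in>{1..N}. L d / of_nat d * T (y - ln (real d)))"
    unfolding sum_divisor_pairs[of "\<lambda>d m. (L d / of_nat d) * (f m / of_nat m)"]
    by (intro sum.cong refl) (simp add: T_shift N_def sum_distrib_left)
  finally have eq: "of_real y * T y = (\<Sum>d\<in>{1..N}. L d / of_nat d * T (y - ln (real d))) + (\<Sum>n\<in>{1..N}. f n / of_nat n * of_real (y - ln (real n)))" .
  have "(\<Sum>n\<in>{1..N}. f n / of_nat n * of_real (y - ln (real n))) = (\<integral>v. indicator {0..y} v *\<^sub>R T v \<partial>lborel)"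
  proof -
    have "(\<integral>v. indicator {0..y} v *\<^sub>R T v \<partial>lborel) = (\<integral>v. (\<Sum>n\<in>{1..N}. f n / of_nat n * of_real (indicator {ln (real n)..y} v)) \<partial>lborel)"
    proof (intro Bochner_Integration.integral_cong refl)
      fix v
      show "indicator {0..y} v *\<^sub>R T v = (\<Sum>n\<in>{1..N}. f n / of_nat n * of_real (indicator {ln (real n)..y} v))"
      proof (cases "v \<in> {0..y}")
        case True
        have "T v = (\<Sum>n\<in>{1..nat \<lfloor>exp v\<rfloor>}. f n / of_nat n)" unfolding T_def S1_def nat_le_real_set ..
        also have "\<dots> = (\<Sum>n\<in>{1..nat \<lfloor>exp v\<rfloor>}. f n / of_nat n * of_real (indicator {ln (real n)..y} v))"
        proof (intro sum.cong refl)
          fix n assume "n \<in> {1..nat \<lfloor>exp v\<rfloor>}"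
          hence "n \<ge> 1" "real n \<le> exp v" by (auto simp: le_nat_iff le_floor_iff)
          hence "ln (real n) \<le> v" by (subst ln_le_iff_le_exp) auto
          thus "f n / of_nat n = f n / of_nat n * of_real (indicator {ln (real n)..y} v)" using True by simp
        qed
        also have "\<dots> = (\<Sum>n\<in>{1..N}. f n / of_nat n * of_real (indicator {ln (real n)..y} v))"
        proof (intro sum.mono_neutral_left ballI)
          show "{1..nat \<lfloor>exp v\<rfloor>} \<subseteq> {1..N}" using True by (auto simp: N_def intro!: nat_mono floor_mono order.trans[of _ "nat \<lfloor>exp v\<rfloor>"])
          fix n assume n: "n \<in> {1..N} - {1..nat \<lfloor>exp v\<rfloor>}"
          hence "\<not> real n \<le> exp v" "n \<ge> 1" by (auto simp: le_nat_iff le_floor_iff)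
          hence "\<not> ln (real n) \<le> v" by (subst ln_le_iff_le_exp) auto
          thus "f n / of_nat n * of_real (indicator {ln (real n)..y} v) = 0" by simp
        qed auto
        finally show ?thesis using True by simp
      next
        case False
        hence "v \<notin> {ln (real n)..y}" if "n \<in> {1..N}" for n using nN(2)[OF that] by auto
        thus ?thesis using False by simp
      qed
    qed
    also have "\<dots> = (\<Sum>n\<in>{1..N}. f n / of_nat n * of_real (y - ln (real n)))"
    proof (subst Bochner_Integration.integral_sum)
      show "integrable lborel (\<lambda>v. f n / of_nat n * of_real (indicator {ln (real n)..y} v))" for n
        by (intro integrable_mult_right integrable_of_real integrable_indicator_Icc)
      show "(\<Sum>n\<in>{1..N}. \<integral>v. f n / of_nat n * of_real (indicator {ln (real n)..y} v) \<partial>lborel) = (\<Sum>n\<in>{1..N}. f n / of_nat n * of_real (y - ln (real n)))"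
        using nN by (intro sum.cong refl) (simp only: integral_mult_right_zero integral_complex_of_real, simp)
    qed
    finally show ?thesis by simp
  qed
  hence "norm (\<Sum>n\<in>{1..N}. f n / of_nat n * of_real (y - ln (real n))) \<le> (\<integral>v. norm (indicator {0..y} v *\<^sub>R T v) \<partial>lborel)"
    by (simp only: integral_norm_bound)
  also have "\<dots> = Phi y" by (simp add: Phi_def)
  finally have 2: "norm (\<Sum>n\<in>{1..N}. f n / of_nat n * of_real (y - ln (real n))) \<le> Phi y" .
  have "norm (\<Sum>d\<in>{1..N}. L d / of_nat d * T (y - ln (real d))) \<le> (\<Sum>d\<in>{1..N}. k * (mangoldt d / real d * norm (T (y - ln (real d)))))"
  proof (rule sum_norm_le)
    fix d assume d: "d \<in> {1..N}"
    have "norm (L d / of_nat d * T (y - ln (real d))) = norm (L d) * (norm (T (y - ln (real d))) / real d)"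
      by (simp add: norm_mult norm_divide)
    also have "\<dots> \<le> (k * mangoldt d) * (norm (T (y - ln (real d))) / real d)"
      using d by (intro mult_right_mono norm_L_le) auto
    finally show "norm (L d / of_nat d * T (y - ln (real d))) \<le> k * (mangoldt d / real d * norm (T (y - ln (real d))))" by simp
  qed
  hence 1: "norm (\<Sum>d\<in>{1..N}. L d / of_nat d * T (y - ln (real d))) \<le> k * (\<Sum>d\<in>{1..N}. mangoldt d / real d * norm (T (y - ln (real d))))"
    by (simp add: sum_distrib_left)
  have "y * norm (T y) = norm (of_real y * T y)" using y by (simp add: norm_mult)
  also have "\<dots> \<le> k * (\<Sum>d\<in>{1..N}. mangoldt d / real d * norm (T (y - ln (real d)))) + Phi y"
    unfolding eq by (intro order.trans[OF norm_triangle_ineq] add_mono 1 2)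
  finally show ?thesis by (simp add: N_def)
qed

section \<open>The recursion behind Halasz's inequality\<close>

lemma short_interval_le:
  assumes A: "finite A" and u: "0 \<le> u" "exp (- u / 2) \<le> \<delta>" "\<delta> \<le> 1"
  shows "(\<Sum>d | d \<in> A \<and> d \<ge> 1 \<and> u < ln (real d) \<and> ln (real d) \<le> u + \<delta>. mangoldt d / real d :: real) \<le> 2636 * \<delta>"
proof -
  have "(\<Sum>d | d \<in> A \<and> d \<ge> 1 \<and> u < ln (real d) \<and> ln (real d) \<le> u + \<delta>. mangoldt d / real d :: real)
      \<le> (\<Sum>d | exp u < real d \<and> real d \<le> exp u * exp \<delta>. mangoldt d / real d)"
  proof (rule sum_mono2)
    show "{d. d \<in> A \<and> d \<ge> 1 \<and> u < ln (real d) \<and> ln (real d) \<le> u + \<delta>} \<subseteq> {d. exp u < real d \<and> real d \<le> exp u * exp \<delta>}"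
    proof clarify
      fix d :: nat assume d: "d \<ge> 1" "u < ln (real d)" "ln (real d) \<le> u + \<delta>"
      have "exp u < exp (ln (real d))" "exp (ln (real d)) \<le> exp (u + \<delta>)"
        unfolding exp_less_cancel_iff exp_le_cancel_iff by (rule d)+
      moreover have "exp (ln (real d)) = real d" using d(1) by simp
      ultimately show "exp u < real d \<and> real d \<le> exp u * exp \<delta>" by (simp only: exp_add)
    qed
  qed (auto simp: mangoldt_nonneg)
  also have "\<dots> \<le> 2636 * \<delta>"
    using u by (intro brun_titchmarsh_mangoldt) (auto simp: powr_def)
  finally show ?thesis .
qed

lemma T_eq_truncated:
  assumes "v \<le> y"
  shows "T v = (\<Sum>n\<in>{1..nat \<lfloor>exp y\<rfloor>}. f n / of_nat n * of_bool (ln (real n) \<le> v))"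
proof -
  have "nat \<lfloor>exp v\<rfloor> \<le> nat \<lfloor>exp y\<rfloor>" using assms by (intro nat_mono floor_mono) simp
  hence "{1..nat \<lfloor>exp v\<rfloor>} \<subseteq> {1..nat \<lfloor>exp y\<rfloor>}" by auto
  moreover have "ln (real n) \<le> v \<longleftrightarrow> n \<in> {1..nat \<lfloor>exp v\<rfloor>}" if "n \<ge> 1" for n
    using that ln_le_iff_le_exp[of "real n" v] real_le_iff_nat_floor[OF that, of "exp v"] by simp
  ultimately show ?thesis unfolding T_def S1_def nat_le_real_set
    by (intro sum.mono_neutral_cong_left) auto
qed

text \<open>The error is the absolute sum over the full window and so does not depend on v, which
  permits integrating the inequality over v.\<close>

lemma T_diff_le:
  assumes "w < v" "v \<le> w + \<delta>" "w + \<delta> \<le> y"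
  shows "norm (T w) \<le> norm (T v) + (\<Sum>n\<in>{1..nat \<lfloor>exp y\<rfloor>}. norm (f n) / real n * of_bool (w < ln (real n) \<and> ln (real n) \<le> w + \<delta>))"
proof -
  have "T v - T w = (\<Sum>n\<in>{1..nat \<lfloor>exp y\<rfloor>}. f n / of_nat n * of_bool (ln (real n) \<le> v) - f n / of_nat n * of_bool (ln (real n) \<le> w))"
    using assms by (subst (1 2) T_eq_truncated[of _ y]) (auto simp: sum_subtractf)
  hence "norm (T v - T w) \<le> (\<Sum>n\<in>{1..nat \<lfloor>exp y\<rfloor>}. norm (f n) / real n * of_bool (w < ln (real n) \<and> ln (real n) \<le> w + \<delta>))"
    using assms by (simp only:) (intro sum_norm_le, auto simp: norm_divide)
  thus ?thesis using norm_triangle_ineq2[of "T w" "T v"] by (simp add: norm_minus_commute)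
qed

text \<open>The sum over d is split at ln d = c y. Below, E bounds the earlier values of T and the
  block estimate gives total weight of order c y + 1; above, averaging over windows of length
  \<delta> turns the sum into \<open>Phi y\<close> plus a variation term of order \<delta>
  \<open>absS y\<close>.\<close>

lemma Halasz_step:
  assumes y: "y \<ge> 1" and c: "0 < c" "c \<le> 1"
    and \<delta>: "\<delta> > 0" "\<delta> \<le> 1" "exp (- (c * y - 1) / 2) \<le> \<delta>" "\<delta> \<le> c * y"
    and E: "E \<ge> 0" "\<And>w. y - c * y \<le> w \<Longrightarrow> w \<le> y - ln 2 \<Longrightarrow> norm (T w) \<le> E"
  shows "y * norm (T y) \<le> Phi y + k * (2637 * (c * y + 1) * E + 2636 * (Phi y + \<delta> * absS y))"
proof -
  define N where "N = nat \<lfloor>exp y\<rfloor>"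
  define a where "a d = (mangoldt d / real d :: real)" for d
  have a0: "a d \<ge> 0" for d by (simp add: a_def mangoldt_nonneg)
  define w where "w d = y - ln (real d)" for d
  have lnd: "0 \<le> ln (real d)" "ln (real d) \<le> y" if "d \<in> {1..N}" for d
  proof -
    have "real d \<le> exp y" using that by (subst real_le_iff_nat_floor) (auto simp: N_def)
    thus "0 \<le> ln (real d)" "ln (real d) \<le> y" using that ln_le_iff_le_exp[of "real d" y] by auto
  qed
  define A1 A2 where "A1 = {d\<in>{1..N}. ln (real d) \<le> c * y}" and "A2 = {d\<in>{1..N}. c * y < ln (real d)}"
  have fin: "finite A1" "finite A2" by (auto simp: A1_def A2_def)
  have split: "(\<Sum>d\<in>{1..N}. a d * norm (T (w d))) = (\<Sum>d\<in>A1. a d * norm (T (w d))) + (\<Sum>d\<in>A2. a d * norm (T (w d)))"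
  proof -
    have "{1..N} = A1 \<union> A2" "A1 \<inter> A2 = {}" by (auto simp: A1_def A2_def)
    thus ?thesis using fin by (simp only: sum.union_disjoint)
  qed
  have part1: "(\<Sum>d\<in>A1. a d * norm (T (w d))) \<le> 2637 * (c * y + 1) * E"
  proof -
    have "(\<Sum>d\<in>A1. a d * norm (T (w d))) \<le> (\<Sum>d\<in>A1. a d * E)"
    proof (rule sum_mono)
      fix d assume d: "d \<in> A1"
      show "a d * norm (T (w d)) \<le> a d * E"
      \<comment> \<open>As Lambda(1) = 0, the value T y itself does not occur on the right. The next
        argument is y - ln 2, and this gap permits the induction.\<close>
      proof (cases "d = 1")
        case True
        thus ?thesis by (simp add: a_def)
      next
        case False
        hence "d \<ge> 2" using d by (auto simp: A1_def)
        hence "ln 2 \<le> ln (real d)" by simp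
        hence "norm (T (w d)) \<le> E" using d by (intro E(2)) (auto simp: w_def A1_def)
        thus ?thesis by (rule mult_left_mono[OF _ a0])
      qed
    qed
    also have "\<dots> = (\<Sum>d\<in>A1. mangoldt d / real d * 1) * E" by (simp add: a_def sum_distrib_right)
    also have "(\<Sum>d\<in>A1. mangoldt d / real d * 1) \<le> 2637 * (\<Sum>j. of_bool (j \<in> {..nat \<lfloor>c * y\<rfloor>}) :: real)"
    proof (rule sum_mangoldt_group_le[OF fin(1)])
      show "summable (\<lambda>j. of_bool (j \<in> {..nat \<lfloor>c * y\<rfloor>}) :: real)" by (rule summable_finite[of "{..nat \<lfloor>c * y\<rfloor>}"]) auto
      fix n assume "n \<in> A1"
      hence "nat \<lfloor>ln (real n)\<rfloor> \<le> nat \<lfloor>c * y\<rfloor>" by (intro nat_mono floor_mono) (auto simp: A1_def)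
      thus "1 \<le> (of_bool (nat \<lfloor>ln (real n)\<rfloor> \<in> {..nat \<lfloor>c * y\<rfloor>}) :: real)" by simp
    qed auto
    also have "(\<Sum>j. of_bool (j \<in> {..nat \<lfloor>c * y\<rfloor>}) :: real) = (\<Sum>j\<in>{..nat \<lfloor>c * y\<rfloor>}. of_bool (j \<in> {..nat \<lfloor>c * y\<rfloor>}))"
      by (rule suminf_finite) auto
    also have "\<dots> = real (nat \<lfloor>c * y\<rfloor>) + 1" by simp
    also have "\<dots> \<le> c * y + 1" using c y by simp
    finally show ?thesis using E(1) by (simp add: mult_right_mono)
  qed
  txt \<open>For large \<open>d\<close> the value \<open>T (w d)\<close> is compared with the mean of \<open>T\<close> over a window of length \<open>\<delta>\<close>;
    each point lies in the windows of few \<open>d\<close> by the Brun--Titchmarsh bound.\<close>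
  define b where "b d v = (of_bool (w d < v \<and> v \<le> w d + \<delta>) :: real)" for d v
  have window: "(\<Sum>d\<in>A2. a d * b d v) \<le> 2636 * \<delta>" if v: "v \<le> y" for v
  proof (cases "\<exists>d\<in>A2. w d < v \<and> v \<le> w d + \<delta>")
    case False
    hence "(\<Sum>d\<in>A2. a d * b d v) = 0" by (intro sum.neutral) (auto simp: b_def)
    thus ?thesis using \<delta> by simp
  next
    case True
    then obtain d where d: "d \<in> A2" "v \<le> w d + \<delta>" by blast
    \<comment> \<open>If v lies in the window of some d with ln d > c y, then y - v exceeds c y - 1,
      so e^{y-v} is large enough for a window of length \<delta> to be admissible in the sieve
      bound.\<close>
    hence u: "c * y - 1 \<le> y - v" using \<delta> by (auto simp: w_def A2_def)
    have "exp (- (y - v) / 2) \<le> exp (- (c * y - 1) / 2)" using u by simp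
    hence u2: "exp (- (y - v) / 2) \<le> \<delta>" using \<delta>(3) by linarith
    have "(\<Sum>d\<in>A2. a d * b d v) = (\<Sum>d | d \<in> A2 \<and> d \<ge> 1 \<and> y - v < ln (real d) \<and> ln (real d) \<le> (y - v) + \<delta>. mangoldt d / real d)"
      using fin by (intro sum.mono_neutral_cong_right) (auto simp: a_def b_def w_def A2_def)
    also have "\<dots> \<le> 2636 * \<delta>" using v u2 \<delta> by (intro short_interval_le fin) auto
    finally show ?thesis .
  qed
  have wy: "0 \<le> w d" "w d + \<delta> \<le> y" if "d \<in> A2" for d
    using that lnd[of d] \<delta> by (auto simp: w_def A2_def)
  \<comment> \<open>Bounds the variation of T over the window of d. In the sum over d the window
    bound is used once more, at v = ln n.\<close>
  define R where "R d = (\<Sum>n\<in>{1..N}. norm (f n) / real n * b d (ln (real n)))" for d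
  have bT: "integrable lborel (\<lambda>v. b d v * norm (T v))" for d
  proof (rule Bochner_Integration.integrable_bound[OF norm_T_integrable[of "w d" "w d + \<delta>"]])
    have [measurable]: "b d \<in> borel_measurable borel" unfolding b_def by measurable
    show "(\<lambda>v. b d v * norm (T v)) \<in> borel_measurable lborel" by measurable
  qed (auto simp: b_def indicator_def intro!: AE_I2)
  have bi: "integrable lborel (b d)" "(\<integral>v. b d v \<partial>lborel) = \<delta>" for d
  proof -
    have eq: "b d = indicator {w d<..w d + \<delta>}" by (auto simp: b_def indicator_def fun_eq_iff)
    show "integrable lborel (b d)" unfolding eq
      by (rule integrable_real_indicator) (use \<delta> in \<open>auto simp: emeasure_lborel_Ioc\<close>)
    show "(\<integral>v. b d v \<partial>lborel) = \<delta>" unfolding eq using \<delta> by simp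
  qed
  have avg: "\<delta> * norm (T (w d)) \<le> (\<integral>v. b d v * norm (T v) \<partial>lborel) + \<delta> * R d" if d: "d \<in> A2" for d
  proof -
    have "\<delta> * norm (T (w d)) = (\<integral>v. b d v * norm (T (w d)) \<partial>lborel)" by (simp add: bi)
    also have "\<dots> \<le> (\<integral>v. b d v * norm (T v) + b d v * R d \<partial>lborel)"
    proof (rule integral_mono)
      show "integrable lborel (\<lambda>v. b d v * norm (T (w d)))" by (intro integrable_mult_left bi)
      show "integrable lborel (\<lambda>v. b d v * norm (T v) + b d v * R d)"
        by (intro Bochner_Integration.integrable_add bT integrable_mult_left bi)
      fix v
      show "b d v * norm (T (w d)) \<le> b d v * norm (T v) + b d v * R d"
      proof (cases "w d < v \<and> v \<le> w d + \<delta>")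
        case True
        have "norm (T (w d)) \<le> norm (T v) + R d"
          using T_diff_le[of "w d" v \<delta> y] True wy[OF d] by (simp add: R_def b_def N_def)
        thus ?thesis by (simp add: b_def)
      next
        case False
        hence "b d v = 0" unfolding b_def by (simp only: of_bool_eq)
        thus ?thesis by simp
      qed
    qed
    also have "\<dots> = (\<integral>v. b d v * norm (T v) \<partial>lborel) + (\<integral>v. b d v * R d \<partial>lborel)"
      by (rule Bochner_Integration.integral_add[OF bT]) (intro integrable_mult_left bi)
    also have "(\<integral>v. b d v * R d \<partial>lborel) = \<delta> * R d" by (simp add: bi)
    finally show ?thesis .
  qed
  have "\<delta> * (\<Sum>d\<in>A2. a d * norm (T (w d))) = (\<Sum>d\<in>A2. a d * (\<delta> * norm (T (w d))))"
    by (simp add: sum_distrib_left mult_ac)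
  also have "\<dots> \<le> (\<Sum>d\<in>A2. a d * ((\<integral>v. b d v * norm (T v) \<partial>lborel) + \<delta> * R d))"
    by (intro sum_mono mult_left_mono avg a0)
  also have "\<dots> = (\<Sum>d\<in>A2. a d * (\<integral>v. b d v * norm (T v) \<partial>lborel)) + \<delta> * (\<Sum>d\<in>A2. a d * R d)"
    by (simp add: distrib_left sum.distrib sum_distrib_left mult_ac)
  also have "(\<Sum>d\<in>A2. a d * (\<integral>v. b d v * norm (T v) \<partial>lborel)) \<le> 2636 * \<delta> * Phi y"
  proof -
    have "(\<Sum>d\<in>A2. a d * (\<integral>v. b d v * norm (T v) \<partial>lborel)) = (\<integral>v. (\<Sum>d\<in>A2. a d * (b d v * norm (T v))) \<partial>lborel)"
      by (subst Bochner_Integration.integral_sum) (auto intro!: integrable_mult_right bT)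
    also have "\<dots> \<le> (\<integral>v. (2636 * \<delta>) * (indicator {0..y} v * norm (T v)) \<partial>lborel)"
    proof (rule integral_mono)
      show "integrable lborel (\<lambda>v. \<Sum>d\<in>A2. a d * (b d v * norm (T v)))"
        by (intro Bochner_Integration.integrable_sum integrable_mult_right bT)
      show "integrable lborel (\<lambda>v. (2636 * \<delta>) * (indicator {0..y} v * norm (T v)))"
        by (intro integrable_mult_right norm_T_integrable)
      fix v
      show "(\<Sum>d\<in>A2. a d * (b d v * norm (T v))) \<le> (2636 * \<delta>) * (indicator {0..y} v * norm (T v))"
      proof (cases "v \<in> {0..y}")
        case True
        have "(\<Sum>d\<in>A2. a d * (b d v * norm (T v))) = (\<Sum>d\<in>A2. a d * b d v) * norm (T v)"
          by (simp only: sum_distrib_right mult.assoc)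
        also have "\<dots> \<le> (2636 * \<delta>) * norm (T v)" using window[of v] True by (intro mult_right_mono) auto
        finally show ?thesis using True by simp
      next
        case False
        have "b d v = 0" if "d \<in> A2" for d using wy[OF that] False by (auto simp: b_def)
        thus ?thesis using False by simp
      qed
    qed
    also have "\<dots> = 2636 * \<delta> * Phi y" by (simp add: Phi_def)
    finally show ?thesis .
  qed
  also have "(\<Sum>d\<in>A2. a d * R d) \<le> 2636 * \<delta> * absS y"
  proof -
    have "(\<Sum>d\<in>A2. a d * R d) = (\<Sum>n\<in>{1..N}. norm (f n) / real n * (\<Sum>d\<in>A2. a d * b d (ln (real n))))"
      unfolding R_def sum_distrib_left by (subst sum.swap) (simp add: mult_ac)
    also have "\<dots> \<le> (\<Sum>n\<in>{1..N}. norm (f n) / real n * (2636 * \<delta>))"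
      using lnd by (intro sum_mono mult_left_mono window) auto
    also have "\<dots> = 2636 * \<delta> * absS y"
      unfolding absS_def nat_le_real_set N_def by (simp add: sum_distrib_left mult_ac)
    finally show ?thesis .
  qed
  finally have "\<delta> * (\<Sum>d\<in>A2. a d * norm (T (w d))) \<le> \<delta> * (2636 * (Phi y + \<delta> * absS y))"
    using \<delta> by (simp add: algebra_simps mult_left_mono)
  hence part2: "(\<Sum>d\<in>A2. a d * norm (T (w d))) \<le> 2636 * (Phi y + \<delta> * absS y)" using \<delta> by simp
  have "y * norm (T y) \<le> Phi y + k * (\<Sum>d\<in>{1..N}. a d * norm (T (w d)))"
    using y_T_le[of y] y by (simp add: N_def a_def w_def)
  also have "\<dots> \<le> Phi y + k * (2637 * (c * y + 1) * E + 2636 * (Phi y + \<delta> * absS y))"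
    unfolding split using part1 part2 k by (intro add_left_mono mult_left_mono add_mono) auto
  finally show ?thesis .
qed

end

text \<open>The window length \<delta> = (1+y)^{-k} cancels the growth of \<open>absS y\<close>. For
  large y it is admissible, since the sieve requires only that \<delta> exceed a negative
  exponential of y.\<close>

theorem Halasz_inequality:
  fixes k :: real
  assumes k: "k > 0"
  obtains C where "C > 0" "\<And>f L y. class_C_function k f L \<Longrightarrow> y \<ge> 0 \<Longrightarrow>
    y * norm (class_C_function.T f y) \<le> C * (1 + class_C_function.Phi f y)"
proof -
  define B where "B = 3 * 14 powr k"
  \<comment> \<open>The contribution of the small d is 4 * 2637 k c + 4 * 2637 k / y times half of
    the target bound; the choice of c makes the first summand at most 1/2, and y >= 8 * 2637 k,
    ensured by \<open>Y0\<close>, the second. The bound c <= 1/2 keeps their arguments w above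
    y/2.\<close>
  define c where "c = min (1/2) (1 / (8 * 2637 * k))"
  have c: "0 < c" "c \<le> 1/2" "4 * 2637 * k * c \<le> 1/2" using k by (auto simp: c_def min_def field_simps)
  have "eventually (\<lambda>y. exp (- (c * y - 1) / 2) \<le> (1 + y) powr (-k)) at_top"
    using c(1) k by real_asymp
  then obtain Y1 where Y1: "\<And>y. y \<ge> Y1 \<Longrightarrow> exp (- (c * y - 1) / 2) \<le> (1 + y) powr (-k)"
    by (auto simp: eventually_at_top_linorder)
  define Y0 where "Y0 = max (max Y1 (8 * 2637 * k)) (1 / c)"
  have Y0: "Y0 \<ge> Y1" "Y0 \<ge> 8 * 2637 * k" "Y0 \<ge> 1 / c" by (auto simp: Y0_def)
  have "1 / c \<ge> 2" using c by (simp add: field_simps)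
  hence Y02: "Y0 \<ge> 2" using Y0 by linarith
  \<comment> \<open>The first entry covers all y <= \<open>Y0\<close> by the trivial estimate; the
    second lets half of \<open>S0\<close> absorb the terms that do not involve earlier values of
    T.\<close>
  define S0 where "S0 = max (Y0 * (B * (1 + Y0) powr k)) (2 * (1 + 2636 * k * (1 + B)))"
  have B0: "B > 0" by (simp add: B_def)
  have S0: "S0 \<ge> Y0 * (B * (1 + Y0) powr k)" "S0 \<ge> 2 * (1 + 2636 * k * (1 + B))" by (auto simp: S0_def)
  have S0pos: "S0 > 0" using S0(2) k B0 by (smt (verit) mult_pos_pos)
  show ?thesis
  proof (rule that[OF S0pos])
    fix f L y
    assume cl: "class_C_function k f L" and y: "(y::real) \<ge> 0"
    interpret class_C_function k f L by (rule cl)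
    have absB: "absS y \<le> B * (1 + y) powr k" if "y \<ge> 0" for y
      using absS_le[OF that] by (simp only: B_def powr_mult mult.assoc)
    txt \<open>The terms with \<open>ln d \<le> c * y\<close> of the recursion involve \<open>T\<close> only at arguments at most
      \<open>y - ln 2\<close>; as \<open>c\<close> is small, they account for at most half of the bound to be shown.\<close>
    have "\<forall>y. 0 \<le> y \<longrightarrow> y \<le> Y0 + real m * ln 2 \<longrightarrow> y * norm (T y) \<le> S0 * (1 + Phi y)" for m
    proof (induction m)
      case 0
      show ?case
      proof (intro allI impI)
        fix y assume y: "0 \<le> y" "y \<le> Y0 + real 0 * ln 2"
        have "norm (T y) \<le> B * (1 + y) powr k" using norm_T_le_absS absB[OF y(1)] by (rule order.trans)
        also have "\<dots> \<le> B * (1 + Y0) powr k" using y k B0 by (intro mult_left_mono powr_mono2) auto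
        finally have "y * norm (T y) \<le> Y0 * (B * (1 + Y0) powr k)" using y by (intro mult_mono) auto
        also have "\<dots> \<le> S0 * 1" using S0(1) by simp
        also have "\<dots> \<le> S0 * (1 + Phi y)" using S0pos Phi_nonneg[of y] by (intro mult_left_mono) auto
        finally show "y * norm (T y) \<le> S0 * (1 + Phi y)" .
      qed
    next
      case (Suc m)
      show ?case
      proof (intro allI impI)
        fix y assume y: "0 \<le> y" "y \<le> Y0 + real (Suc m) * ln 2"
        show "y * norm (T y) \<le> S0 * (1 + Phi y)"
        proof (cases "y \<le> Y0 + real m * ln 2")
          case True
          thus ?thesis using Suc y by blast
        next
          case False
          have "Y0 + 0 \<le> Y0 + real m * ln 2" by (intro add_left_mono) auto
          hence yY: "y > Y0" using False by linarith
          hence y2: "y > 2" using Y02 by linarith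
          define \<delta> where "\<delta> = (1 + y) powr (-k)"
          have "(1 + y) powr (-k) \<le> (1 + y) powr 0" using y2 k by (intro powr_mono) auto
          hence \<delta>1: "\<delta> \<le> 1" using y2 by (simp add: \<delta>_def)
          have "c * (1 / c) \<le> c * y" using Y0(3) yY c by (intro mult_left_mono) auto
          hence cy: "1 \<le> c * y" using c by simp
          \<comment> \<open>The induction hypothesis at w >= y/2 divided by w, with
            \<open>Phi w\<close> replaced by the larger \<open>Phi y\<close>.\<close>
          define E where "E = 2 * S0 * (1 + Phi y) / y"
          have \<Phi>: "Phi y \<ge> 0" by (rule Phi_nonneg)
          have E0: "E \<ge> 0" using S0pos \<Phi> y2 by (simp add: E_def)
          have E: "norm (T w) \<le> E" if w: "y - c * y \<le> w" "w \<le> y - ln 2" for w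
          proof -
            have "c * y \<le> 1/2 * y" using c y by (intro mult_right_mono) auto
            hence w2: "y / 2 \<le> w" using w by linarith
            have "w * norm (T w) \<le> S0 * (1 + Phi w)"
              using Suc.IH w w2 y y2 by (auto simp: algebra_simps)
            also have "w \<le> y" using w ln_gt_zero[of "2::real"] by linarith
            hence "S0 * (1 + Phi w) \<le> S0 * (1 + Phi y)"
              using S0pos by (intro mult_left_mono add_left_mono Phi_mono) auto
            finally have "y / 2 * norm (T w) \<le> S0 * (1 + Phi y)"
              using mult_right_mono[OF w2, of "norm (T w)"] by simp
            thus ?thesis using y2 by (simp add: E_def field_simps)
          qed
          have "y * norm (T y) \<le> Phi y + k * (2637 * (c * y + 1) * E + 2636 * (Phi y + \<delta> * absS y))"
          proof (rule Halasz_step)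
            show "exp (- (c * y - 1) / 2) \<le> \<delta>" unfolding \<delta>_def using yY Y0(1) by (intro Y1) auto
            show "0 < \<delta>" using y2 by (simp add: \<delta>_def)
            show "\<delta> \<le> c * y" using \<delta>1 cy by linarith
          qed (use y2 c \<delta>1 E0 E in auto)
          also have "\<delta> * absS y \<le> B"
          proof -
            have "\<delta> * absS y \<le> \<delta> * (B * (1 + y) powr k)" using absB[OF y(1)] by (intro mult_left_mono) (auto simp: \<delta>_def)
            also have "\<dots> = B" using y2 by (simp add: \<delta>_def powr_minus field_simps)
            finally show ?thesis .
          qed
          also have "k * (2637 * (c * y + 1) * E + 2636 * (Phi y + B)) = (4 * 2637 * k * c + 4 * 2637 * k / y) * (S0 * (1 + Phi y) / 2) + 2636 * k * (Phi y + B)"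
            using y2 by (simp add: E_def field_simps)
          also have "(4 * 2637 * k * c + 4 * 2637 * k / y) * (S0 * (1 + Phi y) / 2) \<le> 1 * (S0 * (1 + Phi y) / 2)"
          proof (rule mult_right_mono)
            have "4 * 2637 * k / y \<le> 1/2" using yY Y0(2) y2 k by (simp add: divide_le_eq)
            thus "4 * 2637 * k * c + 4 * 2637 * k / y \<le> 1" using c(3) by linarith
          qed (use S0pos \<Phi> in auto)
          also have "2636 * k * (Phi y + B) \<le> 2636 * k * ((1 + B) * (1 + Phi y))"
            using k B0 \<Phi> by (intro mult_left_mono) (auto simp: algebra_simps)
          finally have "y * norm (T y) \<le> Phi y + (1 * (S0 * (1 + Phi y) / 2) + 2636 * k * ((1 + B) * (1 + Phi y)))"
            using k by (simp add: mult_left_mono)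
          also have "\<dots> \<le> (1 + 2636 * k * (1 + B)) * (1 + Phi y) + S0 * (1 + Phi y) / 2" by (simp add: algebra_simps)
          also have "(1 + 2636 * k * (1 + B)) * (1 + Phi y) \<le> (S0 / 2) * (1 + Phi y)"
            using S0(2) \<Phi> by (intro mult_right_mono) auto
          finally show ?thesis by simp
        qed
      qed
    qed
    moreover obtain m where "y / ln 2 \<le> real m" using real_arch_simple by blast
    hence "y \<le> Y0 + real m * ln 2" using Y02 by (simp add: field_simps)
    ultimately show "y * norm (T y) \<le> S0 * (1 + Phi y)" using y by blast
  qed
qed

section \<open>The mean value of the logarithmic mean\<close>

text \<open>The largest j dominates: relative to its term the others decay with ratio
  2^{-p}.\<close>

lemma geometric_dyadic_sum_le:
  fixes p Y :: real
  assumes p: "p > 0" and J: "finite J" "\<And>j. j \<in> J \<Longrightarrow> 2 ^ j \<le> Y"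
  shows "(\<Sum>j\<in>J. (2 ^ j / Y) powr p) \<le> 1 / (1 - 2 powr (-p))"
proof (cases "J = {}")
  case True
  have "2 powr (-p) < 2 powr 0" using p by (intro powr_less_mono) auto
  thus ?thesis using True by simp
next
  case False
  define m where "m = Max J"
  define q where "q = 2 powr (-p)"
  have "2 powr (-p) < 2 powr 0" using p by (intro powr_less_mono) auto
  hence q: "0 < q" "q < 1" by (auto simp: q_def)
  have m: "m \<in> J" "\<And>j. j \<in> J \<Longrightarrow> j \<le> m" using J False by (auto simp: m_def)
  have Y: "Y > 0" using J(2)[OF m(1)] by (rule less_le_trans[rotated]) simp
  have "(\<Sum>j\<in>J. (2 ^ j / Y) powr p) \<le> (\<Sum>j\<in>J. q ^ (m - j))"
  proof (rule sum_mono)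
    fix j assume j: "j \<in> J"
    have "2 ^ j / Y \<le> 2 ^ j / 2 ^ m" using J(2)[OF m(1)] Y by (intro divide_left_mono) auto
    also have "\<dots> = 2 powr (- real (m - j))"
    proof -
      have "(2::real) ^ m = 2 ^ j * 2 ^ (m - j)" using m(2)[OF j] by (simp flip: power_add)
      moreover have "(2::real) powr real (m - j) = 2 ^ (m - j)" by (rule powr_realpow) simp
      ultimately show ?thesis by (simp only: powr_minus) (simp add: divide_simps)
    qed
    finally have "(2 ^ j / Y) powr p \<le> (2 powr (- real (m - j))) powr p"
      using p Y by (intro powr_mono2) auto
    also have "\<dots> = q ^ (m - j)" by (simp add: q_def powr_powr mult.commute flip: powr_realpow)
    finally show "(2 ^ j / Y) powr p \<le> q ^ (m - j)" .
  qed
  also have "\<dots> \<le> (\<Sum>j\<in>{..m}. q ^ (m - j))" using m q by (intro sum_mono2) auto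
  also have "\<dots> = (\<Sum>i\<in>{..m}. q ^ i)"
    by (rule sum.reindex_bij_witness[of _ "\<lambda>i. m - i" "\<lambda>i. m - i"]) auto
  also have "\<dots> \<le> (\<Sum>i. q ^ i)" using q by (intro sum_le_suminf summable_geometric) auto
  also have "\<dots> = 1 / (1 - q)" using q by (intro suminf_geometric) auto
  finally show ?thesis by (simp add: q_def)
qed

text \<open>The exponential is the twist bound at t = 0, where
  \<open>min 1 (a + \<bar>t\<bar>)\<close> cancels the pole of zeta.\<close>

definition F_ratio_const :: "real \<Rightarrow> real" where
  "F_ratio_const k = 364 powr k * exp (k * ((4 / pi) * (ln 14 + 10 * ln (1 + ln 2) + twist_const)))"

text \<open>The half sum of 1 and the second-moment constant stems from the arithmetic-geometric
  mean inequality in the block estimate.\<close>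

definition dyadic_const :: "real \<Rightarrow> real" where "dyadic_const k = F_const k * ((1 + exp 4 * mean_square_const k) / 2)"

lemma F_const_pos: "k > 0 \<Longrightarrow> F_const k > 0"
  by (auto simp: F_const_def Let_def intro!: mult_pos_pos) (smt (verit) divide_pos_pos mult_pos_pos pi_gt_zero powr_gt_zero)

lemma mean_square_const_pos: "mean_square_const k > 0"
  unfolding mean_square_const_def by (intro divide_pos_pos mult_pos_pos add_nonneg_pos) auto

text \<open>For blocks with V a <= 1. Moving F from 1 + 1/V to 1 + a loses (V a)^{-k}; what remains
  is (V a)^{\<kappa> - k}, with a positive exponent in the application, so that these blocks sum
  geometrically. The sign of \<kappa> - 1 decides which of 1/a and a^{-\<kappa>} accounts for the
  term V.\<close>

lemma dyadic_weight_le: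
  fixes a V k \<kappa> :: real
  assumes a: "a > 0" and V: "V \<ge> 1" "V * a \<le> 1"
  shows "(1 / V / a) powr k * (V + V powr \<kappa>) \<le> 2 * (1 / a + a powr (-\<kappa>)) * (V * a) powr (\<kappa> - k)"
proof -
  define u where "u = V * a"
  have u: "0 < u" "u \<le> 1" using V a by (auto simp: u_def)
  have V_eq: "V = u / a" using a by (simp add: u_def)
  have "(1 / V / a) powr k * V powr \<kappa> = a powr (-\<kappa>) * u powr (\<kappa> - k)"
    using u a by (simp add: V_eq powr_divide powr_minus powr_diff field_simps)
  moreover have "(1 / V / a) powr k * V \<le> (1 / a + a powr (-\<kappa>)) * u powr (\<kappa> - k)"
  proof (cases "\<kappa> - k \<le> 1 - k")
    case True
    have "(1 / V / a) powr k * V = 1 / a * u powr (1 - k)"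
      using u a by (simp add: V_eq powr_divide powr_diff field_simps)
    also have "\<dots> \<le> 1 / a * u powr (\<kappa> - k)" using u a True by (intro mult_left_mono powr_mono') auto
    also have "\<dots> \<le> (1 / a + a powr (-\<kappa>)) * u powr (\<kappa> - k)" by (intro mult_right_mono) auto
    finally show ?thesis .
  next
    case False
    have "(1 / V / a) powr k * V = a powr (-k) * V powr (1 - k)"
      using V a by (simp add: powr_mult powr_divide powr_diff powr_minus field_simps)
    also have "\<dots> \<le> a powr (-k) * V powr (\<kappa> - k)" using V False by (intro mult_left_mono powr_mono) auto
    also have "\<dots> = a powr (-\<kappa>) * u powr (\<kappa> - k)"
      using V a by (simp add: u_def powr_mult powr_diff powr_minus field_simps)
    also have "\<dots> \<le> (1 / a + a powr (-\<kappa>)) * u powr (\<kappa> - k)" using a by (intro mult_right_mono) auto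
    finally show ?thesis .
  qed
  moreover have "0 \<le> 1 / a * u powr (\<kappa> - k)" using a by simp
  ultimately show ?thesis unfolding u_def[symmetric] by (simp add: algebra_simps)
qed

text \<open>The summands come from the range [0, 1] together with the constant 1, from the blocks
  with V >= 1/a, and from those with V < 1/a.\<close>

definition mean_const :: "real \<Rightarrow> real" where
  "mean_const k = (1 + 3 * 28 powr k) * 14 powr k + dyadic_const k / (1 - 2 powr (-k)) +
    2 * dyadic_const k * F_ratio_const k / (1 - 2 powr (-(4 * k / pi - k)))"

text \<open>The inequality pi < 4 is what makes the blocks shorter than 1/a summable.\<close>

lemma theta_pos: "k > 0 \<Longrightarrow> 4 * k / pi - k > 0" for k :: real
  using pi_less_4 pi_gt_zero by (simp add: field_simps)

lemma mean_const_pos: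
  assumes k: "k > 0"
  shows "mean_const k > 0"
proof -
  have dyadic_const: "dyadic_const k > 0" using F_const_pos[OF k] mean_square_const_pos[of k] by (auto simp: dyadic_const_def intro!: mult_pos_pos add_pos_pos)
  have "1 - 2 powr (-p) > 0" if "p > 0" for p :: real
    using powr_less_mono[of "-p" 0 "2::real"] that by simp
  note * = this[OF k] this[OF theta_pos[OF k]]
  have "(1 + 3 * 28 powr k) * 14 powr k > 0" by (intro mult_pos_pos add_pos_nonneg) auto
  moreover have "dyadic_const k / (1 - 2 powr (-k)) > 0" by (rule divide_pos_pos[OF dyadic_const *(1)])
  moreover have "2 * dyadic_const k * F_ratio_const k / (1 - 2 powr (-(4 * k / pi - k))) > 0"
    by (rule divide_pos_pos[OF _ *(2)]) (use dyadic_const in \<open>simp add: F_ratio_const_def\<close>)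
  ultimately show ?thesis unfolding mean_const_def by linarith
qed

context class_C_function
begin

text \<open>Up to a constant, |F(1+a)| a^{-k} decreases in a. This is
  \<open>norm_dirichlet_l_diff\<close> at t = 0, where the twist term stays bounded because a'
  zeta(1+a') is at most 14.\<close>

lemma norm_F_mono:
  assumes a: "0 < a" "a \<le> a'" "a' \<le> 1"
  shows "norm (F (of_real (1 + a'))) \<le> F_ratio_const k * norm (F (of_real (1 + a))) * (a' / a) powr k"
proof -
  define x y where "x = norm (zeta (of_real (1 + a)))" and "y = norm (zeta (of_real (1 + a')))"
  have pos: "x > 0" "y > 0"
    using a zeta_nonzero[of "of_real (1 + a)"] zeta_nonzero[of "of_real (1 + a')"] by (auto simp: x_def y_def)
  have x: "x \<le> 14 / a" unfolding x_def using a by (intro norm_zeta_real_bounds) auto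
  have y: "y \<le> 14 / a'" "1 / (26 * a') \<le> y" unfolding y_def using a by (intro norm_zeta_real_bounds; simp)+
  define c where "c = (4 / pi) * (ln 14 + 10 * ln (1 + ln 2) + twist_const)"
  define D where "D = dirichlet_series l (of_real (1 + a)) - dirichlet_series l (of_real (1 + a'))"
  have "F (of_real (1 + a')) = F (of_real (1 + a)) * exp (- D)"
    using Lambda_facts(4)[of "of_real (1 + a')"] Lambda_facts(4)[of "of_real (1 + a)"]
      F_nonzero[of "of_real (1 + a)"] a by (simp add: D_def exp_diff)
  hence F_eq: "norm (F (of_real (1 + a'))) = norm (F (of_real (1 + a))) * exp (Re (- D))"
    by (simp only: norm_mult norm_exp_eq_Re)
  have "Re (- D) \<le> norm (- D)" by (rule complex_Re_le_cmod)
  also have "norm (- D) \<le> k * (ln x - ln y + (4 / pi) * (ln y + ln (min 1 (a' + \<bar>0\<bar>)) + 10 * ln (1 + ln (2 + \<bar>0\<bar>)) + twist_const))"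
    unfolding D_def norm_minus_cancel x_def y_def using norm_dirichlet_l_diff[OF a, of 0] by (simp only: complex_of_real_def)
  also have "\<dots> \<le> k * (ln (364 * (a' / a)) + c)"
  proof (intro mult_left_mono add_mono)
    have "x / y \<le> (14 / a) / (1 / (26 * a'))" using x y pos a by (intro frac_le) auto
    hence "x / y \<le> 364 * (a' / a)" by simp
    hence "ln (x / y) \<le> ln (364 * (a' / a))" using pos a by (subst ln_le_cancel_iff) auto
    thus "ln x - ln y \<le> ln (364 * (a' / a))" using pos by (simp add: ln_div)
    have "ln (y * a') \<le> ln 14" using y pos a by (subst ln_le_cancel_iff) (auto simp: field_simps)
    hence "ln y + ln a' \<le> ln 14" using pos a by (simp add: ln_mult)
    moreover have "min 1 (a' + \<bar>0\<bar>) = a'" using a by simp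
    ultimately show "(4 / pi) * (ln y + ln (min 1 (a' + \<bar>0\<bar>)) + 10 * ln (1 + ln (2 + \<bar>0\<bar>)) + twist_const) \<le> c"
      unfolding c_def by (intro mult_left_mono) auto
  qed (use k in auto)
  finally have "norm (F (of_real (1 + a'))) \<le> norm (F (of_real (1 + a))) * exp (k * (ln (364 * (a' / a)) + c))"
    unfolding F_eq by (intro mult_left_mono) auto
  also have "exp (k * (ln (364 * (a' / a)) + c)) = (364 * (a' / a)) powr k * exp (k * c)"
    using a by (simp add: powr_def distrib_left exp_add)
  also have "(364 * (a' / a)) powr k = 364 powr k * (a' / a) powr k" by (rule powr_mult)
  finally show ?thesis by (simp only: F_ratio_const_def c_def mult_ac)
qed

text \<open>Termwise, |log F| is at most k log zeta. The bound serves to absorb the constant 1 and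
  the range [0, 1] into an estimate proportional to |F(1+a)|.\<close>

lemma norm_F_lower:
  assumes a: "0 < a" "a \<le> 1"
  shows "(a / 14) powr k \<le> norm (F (of_real (1 + a)))"
proof -
  define x where "x = norm (zeta (of_real (1 + a)))"
  have x: "x > 0" "x \<le> 14 / a" using a zeta_nonzero[of "of_real (1 + a)"] norm_zeta_real_bounds(1)[OF a] by (auto simp: x_def)
  define D where "D = dirichlet_series l (of_real (1 + a))"
  have ls: "(\<lambda>n. l n / of_nat n powr of_real (1 + a)) sums D"
    unfolding D_def using a by (intro dirichlet_series_sums Lambda_facts) auto
  have zs: "(\<lambda>n. k * (mangoldt_weight n / real n powr (1 + a))) sums (k * ln x)"
    unfolding x_def using a by (intro sums_mult ln_zeta_sums) auto
  have "norm (l n / of_nat n powr of_real (1 + a)) \<le> k * (mangoldt_weight n / real n powr (1 + a))" for n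
  proof (cases "n = 0")
    case False
    thus ?thesis unfolding norm_dirichlet_term using norm_l_le[of n] by (simp add: divide_right_mono)
  qed simp
  hence "norm D \<le> k * ln x"
    using norm_suminf_le[OF _ sums_summable[OF zs], of "\<lambda>n. l n / of_nat n powr of_real (1 + a)"] ls zs by (simp add: sums_iff)
  hence "- (k * ln x) \<le> Re D" using abs_Re_le_cmod[of D] by linarith
  moreover have "exp D = F (of_real (1 + a))" unfolding D_def using a by (intro Lambda_facts(4)) simp
  hence "norm (F (of_real (1 + a))) = exp (Re D)" by (metis norm_exp_eq_Re)
  ultimately have "exp (- (k * ln x)) \<le> norm (F (of_real (1 + a)))" by simp
  moreover have "exp (- (k * ln x)) = (1 / x) powr k" using x by (simp add: powr_def ln_div)
  moreover have "(a / 14) powr k \<le> (1 / x) powr k" using x a k by (intro powr_mono2) (auto simp: field_simps)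
  ultimately show ?thesis by simp
qed

text \<open>Cauchy-Schwarz in the pointwise form 2 M V |T| <= M^2 + V^2 |T|^2, with M the size of
  F(1+s)/s. By the second moment the integral of V^2 |T|^2 over the block is of order M^2 V, which
  balances M^2 times the length V of the block.\<close>

lemma dyadic_T_integral_le:
  assumes V: "V \<ge> 1" and a: "1 / V \<le> a" "a \<le> 1"
  shows "(\<integral>v. indicator {V..2 * V} v * norm (T v) \<partial>lborel) \<le>
    dyadic_const k * norm (F (of_real (1 + a))) * (a * V) powr k * (V + a powr (- 4 * k / pi))"
proof -
  define \<alpha> where "\<alpha> = 1 / V"
  have \<alpha>: "0 < \<alpha>" "\<alpha> \<le> 1" "\<alpha> \<le> a" using V a by (auto simp: \<alpha>_def)
  define M where "M = F_const k * norm (F (of_real (1 + a))) * (a / \<alpha>) powr k * (1 / \<alpha> + a powr (- 4 * k / pi))"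
  have a0: "a > 0" using \<alpha> by linarith
  have M: "M > 0" unfolding M_def using F_const_pos[OF k] F_nonzero[of "of_real (1 + a)"] a0 \<alpha>
    by (intro mult_pos_pos) (auto intro: add_pos_nonneg)
  have F_le: "norm (F (Complex (1 + \<alpha>) t) / Complex \<alpha> t) \<le> M * (1 + \<bar>t\<bar>) powr (-3/4)" for t
    unfolding M_def by (rule norm_F_div_le[OF \<alpha>(1,3) a(2)])
  note m2 = T_second_moment[OF \<alpha>(1,2) less_imp_le[OF M] F_le]
  have le: "indicator {V..2 * V} v * norm (T v) \<le> M / (2 * V) * indicator {V..2 * V} v + exp 4 / (2 * M * V) * (norm (h \<alpha> v))\<^sup>2" for v
  proof (cases "v \<in> {V..2 * V}")
    case False
    thus ?thesis using M V by simp
  next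
    case True
    \<comment> \<open>On the block \<alpha> v <= 2, so the square of the damping exp(-\<alpha> v) is
      at least e^{-4}; hence the factor \<open>exp 4\<close>.\<close>
    have "exp 4 * (norm (h \<alpha> v))\<^sup>2 = (v * norm (T v))\<^sup>2 * (exp 4 * (exp (- (\<alpha> * v)))\<^sup>2)"
      using True V by (simp add: h_def norm_mult power_mult_distrib)
    also have "\<dots> \<ge> (V * norm (T v))\<^sup>2 * 1"
    proof (rule mult_mono)
      show "(V * norm (T v))\<^sup>2 \<le> (v * norm (T v))\<^sup>2" using True V by (intro power_mono mult_right_mono) auto
      have "\<alpha> * v \<le> 2" using True V by (simp add: \<alpha>_def field_simps)
      hence "exp 0 \<le> exp (4 + 2 * (- (\<alpha> * v)))" by simp
      thus "1 \<le> exp 4 * (exp (- (\<alpha> * v)))\<^sup>2" by (simp only: exp_add exp_double exp_zero)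
    qed auto
    finally have hT: "V\<^sup>2 * (norm (T v))\<^sup>2 \<le> exp 4 * (norm (h \<alpha> v))\<^sup>2" by (simp add: power_mult_distrib)
    have "0 \<le> (M - V * norm (T v))\<^sup>2" by simp
    hence "2 * M * V * norm (T v) \<le> M\<^sup>2 + V\<^sup>2 * (norm (T v))\<^sup>2"
      by (simp add: power2_diff power_mult_distrib)
    also have "\<dots> \<le> M\<^sup>2 + exp 4 * (norm (h \<alpha> v))\<^sup>2" using hT by simp
    finally have "norm (T v) \<le> (M\<^sup>2 + exp 4 * (norm (h \<alpha> v))\<^sup>2) / (2 * M * V)"
      using M V by (simp add: pos_le_divide_eq mult_ac)
    also have "\<dots> = M / (2 * V) + exp 4 / (2 * M * V) * (norm (h \<alpha> v))\<^sup>2"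
      using M V by (simp add: add_divide_distrib power2_eq_square)
    finally show ?thesis using True by simp
  qed
  have "(\<integral>v. indicator {V..2 * V} v * norm (T v) \<partial>lborel) \<le>
      (\<integral>v. M / (2 * V) * indicator {V..2 * V} v + exp 4 / (2 * M * V) * (norm (h \<alpha> v))\<^sup>2 \<partial>lborel)"
    by (intro integral_mono norm_T_integrable Bochner_Integration.integrable_add integrable_mult_right integrable_indicator_Icc m2(1) le)
  also have "\<dots> = M / (2 * V) * V + exp 4 / (2 * M * V) * (\<integral>v. (norm (h \<alpha> v))\<^sup>2 \<partial>lborel)"
    using V by (subst Bochner_Integration.integral_add) (auto intro!: integrable_mult_right integrable_indicator_Icc m2(1))
  also have "\<dots> \<le> M / (2 * V) * V + exp 4 / (2 * M * V) * (mean_square_const k * M\<^sup>2 / \<alpha>)"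
    using M V by (intro add_left_mono mult_left_mono m2(2)) auto
  also have "\<dots> = M * ((1 + exp 4 * mean_square_const k) / 2)"
    using M V by (simp add: \<alpha>_def field_simps power2_eq_square)
  also have "\<dots> = dyadic_const k * norm (F (of_real (1 + a))) * (a * V) powr k * (V + a powr (- 4 * k / pi))"
    by (simp add: M_def dyadic_const_def \<alpha>_def)
  finally show ?thesis .
qed

text \<open>The range [0, 1] is estimated trivially, with 28 = 14 * (1 + 1); the last block may
  reach beyond y, which only enlarges the bound.\<close>

lemma Phi_le_dyadic:
  assumes y: "y \<ge> 0" and J: "J = {j. 2 ^ j \<le> y}"
  shows "finite J"
    "Phi y \<le> 3 * 28 powr k + (\<Sum>j\<in>J. \<integral>v. indicator {2 ^ j..2 * 2 ^ j} v * norm (T v) \<partial>lborel)"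
proof -
  obtain m where m: "y < 2 ^ m" using real_arch_pow[of 2 y] by auto
  have "J \<subseteq> {..m}"
  proof
    fix j assume "j \<in> J"
    hence "(2::real) ^ j < 2 ^ m" using m unfolding J by (simp add: le_less_trans)
    hence "j < m" by (rule power_less_imp_less_exp[rotated]) simp
    thus "j \<in> {..m}" by simp
  qed
  thus fin: "finite J" by (rule finite_subset) simp
  have le: "indicator {0..y} v * norm (T v) \<le>
      indicator {0..1} v * norm (T v) + (\<Sum>j\<in>J. indicator {2 ^ j..2 * 2 ^ j} v * norm (T v))" for v
  proof (cases "v \<in> {0..y}")
    case False
    thus ?thesis by (auto intro!: add_nonneg_nonneg sum_nonneg)
  next
    case v: True
    show ?thesis
    proof (cases "v \<le> 1")
      case True
      thus ?thesis using v by (auto intro!: sum_nonneg)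
    next
      case False
      define j where "j = nat \<lfloor>log 2 v\<rfloor>"
      have "log 2 v \<ge> 0" using False by simp
      hence "real j \<le> log 2 v" "log 2 v < real j + 1" unfolding j_def by linarith+
      hence "2 powr real j \<le> v" "v < 2 powr (real j + 1)"
        using False by (simp_all add: le_log_iff log_less_iff)
      hence j: "2 ^ j \<le> v" "v \<le> 2 * 2 ^ j" by (simp_all add: powr_realpow powr_add)
      have "j \<in> J" using j v J by auto
      hence "indicator {2 ^ j..2 * 2 ^ j} v * norm (T v) \<le> (\<Sum>j\<in>J. indicator {2 ^ j..2 * 2 ^ j} v * norm (T v))"
        using fin by (intro member_le_sum) auto
      thus ?thesis using j v False by simp
    qed
  qed
  have int1: "integrable lborel (\<lambda>v. \<Sum>j\<in>J. indicator {2 ^ j..2 * 2 ^ j} v * norm (T v))"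
    by (intro Bochner_Integration.integrable_sum norm_T_integrable)
  have "Phi y \<le> (\<integral>v. indicator {0..1} v * norm (T v) + (\<Sum>j\<in>J. indicator {2 ^ j..2 * 2 ^ j} v * norm (T v)) \<partial>lborel)"
    unfolding Phi_def by (intro integral_mono norm_T_integrable Bochner_Integration.integrable_add int1 le)
  also have "\<dots> = (\<integral>v. indicator {0..1} v * norm (T v) \<partial>lborel) +
      (\<Sum>j\<in>J. \<integral>v. indicator {2 ^ j..2 * 2 ^ j} v * norm (T v) \<partial>lborel)"
    by (subst Bochner_Integration.integral_add[OF norm_T_integrable int1])
      (simp add: Bochner_Integration.integral_sum norm_T_integrable)
  also have "(\<integral>v. indicator {0..1} v * norm (T v) \<partial>lborel) \<le> (\<integral>v. indicator {0..1::real} v * absS 1 \<partial>lborel)"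
  proof (rule integral_mono[OF norm_T_integrable])
    show "integrable lborel (\<lambda>v. indicator {0..1::real} v * absS 1)"
      by (intro integrable_mult_left integrable_indicator_Icc)
    show "indicator {0..1} v * norm (T v) \<le> indicator {0..1} v * absS 1" for v :: real
      using order.trans[OF norm_T_le_absS absS_mono[of v 1]] by (auto simp: indicator_def)
  qed
  also have "\<dots> = absS 1" by simp
  also have "\<dots> \<le> 3 * 28 powr k" using absS_le[of 1] by simp
  finally show "Phi y \<le> 3 * 28 powr k + (\<Sum>j\<in>J. \<integral>v. indicator {2 ^ j..2 * 2 ^ j} v * norm (T v) \<partial>lborel)" by simp
qed

text \<open>R is the asserted bound without its constant. Blocks with V >= 1/a are estimated through
  F at 1 + a, shorter ones through F at 1 + 1/V, which is then transferred to 1 + a. In both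
  families the bounds form part of a geometric progression whose largest term is at most a constant
  times R.\<close>

lemma one_plus_Phi_le:
  assumes a: "0 < a" "a \<le> 1" and ay: "1 \<le> a * y"
  shows "1 + Phi y \<le> mean_const k * (norm (F (of_real (1 + a))) * (a * y) powr k * (y + a powr (- 4 * k / pi)))"
proof -
  define \<kappa> where "\<kappa> = 4 * k / pi"
  have \<kappa>: "\<kappa> - k > 0" "- 4 * k / pi = - \<kappa>" using theta_pos[OF k] by (simp_all add: \<kappa>_def)
  define N where "N = norm (F (of_real (1 + a)))"
  have N0: "N \<ge> 0" by (simp add: N_def)
  define R where "R = N * (a * y) powr k * (y + a powr (-\<kappa>))"
  have y: "y > 0" using a ay by (smt (verit) mult_nonneg_nonpos)
  have ay': "1 / a \<le> y" using a ay by (simp add: field_simps)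
  have ayk: "1 \<le> (a * y) powr k" using ay k by (intro ge_one_powr_ge_zero) auto
  have dyadic_const: "dyadic_const k > 0" using F_const_pos[OF k] mean_square_const_pos[of k] by (auto simp: dyadic_const_def intro!: mult_pos_pos add_pos_pos)
  have F_ratio_const: "F_ratio_const k > 0" by (simp add: F_ratio_const_def)
  define J where "J = {j::nat. 2 ^ j \<le> y}"
  define J1 where "J1 = {j\<in>J. 1 / 2 ^ j \<le> a}"
  define J2 where "J2 = {j\<in>J. \<not> 1 / 2 ^ j \<le> a}"
  note dy = Phi_le_dyadic[OF less_imp_le[OF y] J_def]
  define I where "I j = (\<integral>v. indicator {2 ^ j..2 * 2 ^ j} v * norm (T v) \<partial>lborel)" for j :: nat
  \<comment> \<open>As a <= 1 and \<kappa> > k, a^{-\<kappa>} is at least a^{-k}, which cancels the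
    a^k in the lower bound for F. Constants are thereby bounded by multiples of R.\<close>
  have R1: "1 \<le> 14 powr k * R"
  proof -
    have "1 = 14 powr k * ((a / 14) powr k * 1 * (a powr (-k)))"
      using a by (simp add: powr_divide powr_minus field_simps)
    also have "\<dots> \<le> 14 powr k * (N * (a * y) powr k * (y + a powr (-\<kappa>)))"
    proof (intro mult_left_mono mult_mono)
      show "(a / 14) powr k \<le> N" unfolding N_def by (rule norm_F_lower[OF a])
      have "a powr (-k) \<le> a powr (-\<kappa>)" using a \<kappa> by (intro powr_mono') auto
      thus "a powr (-k) \<le> y + a powr (-\<kappa>)" using y by simp
    qed (use ayk N0 in auto)
    finally show ?thesis by (simp only: R_def)
  qed
  have I1: "I j \<le> dyadic_const k * R * (2 ^ j / y) powr k" if "j \<in> J1" for j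
  proof -
    have "I j \<le> dyadic_const k * N * (a * 2 ^ j) powr k * (2 ^ j + a powr (-\<kappa>))"
      unfolding I_def N_def \<kappa>(2)[symmetric] using that a by (intro dyadic_T_integral_le) (auto simp: J1_def)
    also have "\<dots> \<le> dyadic_const k * N * (a * 2 ^ j) powr k * (y + a powr (-\<kappa>))"
      using that dyadic_const N0 by (intro mult_left_mono) (auto simp: J1_def J_def)
    also have "(a * 2 ^ j) powr k = (a * y) powr k * (2 ^ j / y) powr k"
      using y a by (simp flip: powr_mult)
    finally show ?thesis by (simp add: R_def mult_ac)
  qed
  have I2: "I j \<le> 2 * dyadic_const k * F_ratio_const k * R * (2 ^ j / (1 / a)) powr (\<kappa> - k)" if "j \<in> J2" for j
  proof -
    define V :: real where "V = 2 ^ j"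
    have V: "V \<ge> 1" "a \<le> 1 / V" "V * a \<le> 1" using that by (auto simp: V_def J2_def field_simps)
    have "I j \<le> dyadic_const k * norm (F (of_real (1 + 1 / V))) * (1 / V * V) powr k * (V + (1 / V) powr (-\<kappa>))"
      unfolding I_def V_def[symmetric] \<kappa>(2)[symmetric] using V by (intro dyadic_T_integral_le) auto
    also have "\<dots> = dyadic_const k * norm (F (of_real (1 + 1 / V))) * (V + V powr \<kappa>)"
      using V by (simp add: powr_divide powr_minus)
    also have "\<dots> \<le> dyadic_const k * (F_ratio_const k * N * (1 / V / a) powr k) * (V + V powr \<kappa>)"
      unfolding N_def using V dyadic_const a by (intro mult_right_mono mult_left_mono norm_F_mono) auto
    also have "\<dots> = dyadic_const k * F_ratio_const k * N * ((1 / V / a) powr k * (V + V powr \<kappa>))" by simp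
    also have "\<dots> \<le> dyadic_const k * F_ratio_const k * N * (2 * (1 / a + a powr (-\<kappa>)) * (V * a) powr (\<kappa> - k))"
      using V dyadic_const F_ratio_const N0 a by (intro mult_left_mono dyadic_weight_le) auto
    also have "\<dots> = 2 * dyadic_const k * F_ratio_const k * (N * 1 * (1 / a + a powr (-\<kappa>))) * (V * a) powr (\<kappa> - k)" by simp
    \<comment> \<open>The expression is enlarged to R by (a y)^k >= 1 and y >= 1/a.\<close>
    also have "\<dots> \<le> 2 * dyadic_const k * F_ratio_const k * (N * (a * y) powr k * (y + a powr (-\<kappa>))) * (V * a) powr (\<kappa> - k)"
      using dyadic_const F_ratio_const N0 a ayk ay' by (intro mult_right_mono mult_left_mono mult_mono add_mono) auto
    finally show ?thesis by (simp add: R_def V_def)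
  qed
  have R0: "R \<ge> 0" using y N0 by (simp add: R_def)
  have fin: "finite J1" "finite J2" using dy(1) by (auto simp: J1_def J2_def)
  have "(\<Sum>j\<in>J. I j) = (\<Sum>j\<in>J1. I j) + (\<Sum>j\<in>J2. I j)"
    using fin by (subst sum.union_disjoint[symmetric]) (auto simp: J1_def J2_def intro!: sum.cong)
  also have "(\<Sum>j\<in>J1. I j) \<le> (\<Sum>j\<in>J1. dyadic_const k * R * (2 ^ j / y) powr k)" by (intro sum_mono I1)
  also have "\<dots> = dyadic_const k * R * (\<Sum>j\<in>J1. (2 ^ j / y) powr k)" by (simp only: sum_distrib_left)
  also have "\<dots> \<le> dyadic_const k * R * (1 / (1 - 2 powr (-k)))"
    using dyadic_const R0 fin k by (intro mult_left_mono geometric_dyadic_sum_le) (auto simp: J1_def J_def)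
  also have "(\<Sum>j\<in>J2. I j) \<le> (\<Sum>j\<in>J2. 2 * dyadic_const k * F_ratio_const k * R * (2 ^ j / (1 / a)) powr (\<kappa> - k))" by (intro sum_mono I2)
  also have "\<dots> = 2 * dyadic_const k * F_ratio_const k * R * (\<Sum>j\<in>J2. (2 ^ j / (1 / a)) powr (\<kappa> - k))" by (simp only: sum_distrib_left)
  also have "\<dots> \<le> 2 * dyadic_const k * F_ratio_const k * R * (1 / (1 - 2 powr (-(\<kappa> - k))))"
  proof (intro mult_left_mono geometric_dyadic_sum_le)
    show "2 ^ j \<le> 1 / a" if "j \<in> J2" for j using that a by (auto simp: J2_def field_simps)
  qed (use dyadic_const F_ratio_const R0 fin \<kappa> in auto)
  finally have "(\<Sum>j\<in>J. I j) \<le> dyadic_const k * R * (1 / (1 - 2 powr (-k))) + 2 * dyadic_const k * F_ratio_const k * R * (1 / (1 - 2 powr (-(\<kappa> - k))))" by simp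
  moreover have "Phi y \<le> 3 * 28 powr k + (\<Sum>j\<in>J. I j)" using dy(2) by (simp only: I_def)
  moreover have "(1 + 3 * 28 powr k) * 1 \<le> (1 + 3 * 28 powr k) * (14 powr k * R)"
    using R1 by (rule mult_left_mono) simp
  moreover have "1 + 3 * 28 powr k = (1 + 3 * 28 powr k) * 1" by simp
  ultimately have "1 + Phi y \<le> (1 + 3 * 28 powr k) * (14 powr k * R) +
      (dyadic_const k * R * (1 / (1 - 2 powr (-k))) + 2 * dyadic_const k * F_ratio_const k * R * (1 / (1 - 2 powr (-(\<kappa> - k)))))" by linarith
  also have "\<dots> = mean_const k * R" unfolding mean_const_def \<kappa>_def by (simp add: algebra_simps)
  finally show ?thesis by (simp only: R_def N_def \<kappa>(2))
qed

end

theorem theorem2p4: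
  fixes k :: real
  assumes "k > 0"
  shows "\<exists>C>0. \<forall>f\<in>class_C k. \<forall>x\<ge>3. \<forall>\<sigma>. 1 + 1 / ln x < \<sigma> \<and> \<sigma> \<le> 2 \<longrightarrow>
    norm (S1 f x) \<le> C * (norm (dirichlet_series f (of_real \<sigma>)) * (\<sigma> - 1) powr k *
      (ln x) powr (k - 1) * ((\<sigma> - 1) powr (- 4 * k / pi) + ln x))"
proof -
  obtain C where C: "C > 0" "\<And>f L y. class_C_function k f L \<Longrightarrow> y \<ge> 0 \<Longrightarrow>
    y * norm (class_C_function.T f y) \<le> C * (1 + class_C_function.Phi f y)"
    using Halasz_inequality[OF assms] by blast
  show ?thesis
  proof (intro exI[of _ "C * mean_const k"] conjI ballI allI impI)
    show "0 < C * mean_const k" using C(1) mean_const_pos[OF assms] by simp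
    fix f and x \<sigma> :: real
    assume f: "f \<in> class_C k" and x: "x \<ge> 3" and \<sigma>: "1 + 1 / ln x < \<sigma> \<and> \<sigma> \<le> 2"
    obtain L where L: "is_Lambda_of f L" "\<And>n. n \<ge> 2 \<Longrightarrow> norm (L n) \<le> k * mangoldt n"
      and m: "multiplicative f" using f by (auto simp: class_C_def)
    interpret class_C_function k f L
      by unfold_locales (use assms L m in \<open>auto simp: multiplicative_def\<close>)
    define y a where "y = ln x" and "a = \<sigma> - 1"
    have y: "y > 0" using x by (simp add: y_def)
    have "1 / y < a" using \<sigma> by (simp add: y_def a_def)
    moreover have "0 < 1 / y" using y by simp
    ultimately have "0 < a" by linarith
    moreover have "1 \<le> a * y" using \<open>1 / y < a\<close> y by (simp add: pos_divide_less_eq)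
    moreover have "a \<le> 1" using \<sigma> by (simp add: a_def)
    ultimately have a: "0 < a" "a \<le> 1" "1 \<le> a * y" by auto
    have "y * norm (T y) \<le> C * (1 + Phi y)"
      using y by (intro C(2)[of f L y]) (unfold_locales, auto)
    also have "\<dots> \<le> C * (mean_const k * (norm (F (of_real (1 + a))) * (a * y) powr k * (y + a powr (- 4 * k / pi))))"
      using C(1) by (intro mult_left_mono one_plus_Phi_le a) auto
    \<comment> \<open>One factor y is split off, to be cancelled against the left-hand side of
      Halasz's inequality; this is the source of the exponent k - 1.\<close>
    also have "(a * y) powr k = y * (a powr k * y powr (k - 1))"
      using a y by (simp add: powr_mult powr_diff)
    finally have "y * norm (T y) \<le> y * (C * mean_const k * (norm (F (of_real (1 + a))) * a powr k * y powr (k - 1) * (a powr (- 4 * k / pi) + y)))"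
      by (simp add: mult_ac add_ac)
    hence "norm (T y) \<le> C * mean_const k * (norm (F (of_real (1 + a))) * a powr k * y powr (k - 1) * (a powr (- 4 * k / pi) + y))"
      using y by (rule mult_left_le_imp_le)
    moreover have "T y = S1 f x" using x by (simp add: T_def y_def)
    ultimately show "norm (S1 f x) \<le> C * mean_const k * (norm (F (of_real \<sigma>)) * (\<sigma> - 1) powr k *
      (ln x) powr (k - 1) * ((\<sigma> - 1) powr (- 4 * k / pi) + ln x))"
      by (simp add: y_def a_def)
  qed
qed

end
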